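(* Let $G$ be a discrete group. The simpltotic morphism sets $[\![A,B]\!]$, together with the composition product $[\![A,B]\!]\times[\![B,C]\!]\to[\![A,C]\!]$, are the morphism sets of a category (the \emph{simpltotic category}) whose objects are the ($\mathbb Z_2$-graded $G$-)$C^*$-algebras. Moreover, there is a canonical functor from the homotopy category of $C^*$-algebras (objects the $\mathbb Z_2$-graded $G$-$C^*$-algebras, morphisms homotopy classes of $*$-homomorphisms) into the simpltotic category, which is the identity on objects and assigns to the homotopy class of a $*$-homomorphism $\varphi\colon A\to B$ the morphism $[\![\varphi]\!]$ represented by $A\xrightarrow{\varphi}B\cong\mathfrak S^{\mathfrak o}B$ in $[\![A,B]\!]_{\mathfrak o}$, where $\mathfrak o$ is the one-element directed set.
   Context: Fix a discrete group $G$. All $C^*$-algebras are $\mathbb Z_2$-graded $G$-$C^*$-algebras (ungraded ones carry the trivial grading), and all $*$-homomorphisms are grading-preserving and $G$-equivariant. Generalized asymptotic algebras. For a topological space $X$ equipped with a filter $\mathcal F$ and a $C^*$-algebra $B$, let $C_b(X;B)$ be the $C^*$-algebra of bounded continuous functions $X\to B$, $C_0(X;B)=\{f\in C_b(X;B)\mid\forall\varepsilon>0\ \exists U\in\mathcal F\colon\|f|_U\|<\varepsilon\}$ and $C_a(X;B)=C_b(X;B)/C_0(X;B)$, with grading and $G$-action coming from $B$. Directed sets. Directed sets $\mathfrak m,\mathfrak n,\dots$ are non-empty; $\mathfrak m\triangleright m=\{n\in\mathfrak m\mid n\ge m\}$. A map $\alpha\colon\mathfrak m\to\mathfrak n$ is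 cofinal if for each $n\in\mathfrak n$ there is $m\in\mathfrak m$ with $\alpha(k)\ge n$ for all $k\ge m$. $\Delta^S$ is the full simplicial complex with vertex set $S$ (the same symbol denotes its set of simplices, i.e. the finite non-empty subsets of $S$), and $|\Delta^S|$ is its geometric realization. $|\Delta^{\mathfrak m}|$ carries the filter generated by the subsets $|\Delta^{\mathfrak m\triangleright m}|$, $m\in\mathfrak m$. The $\mathfrak m$-simpltotic algebra is $\mathfrak S^{\mathfrak m}B=C_a(|\Delta^{\mathfrak m}|;B)$. For the one-element directed set $\mathfrak o$, $\mathfrak S^{\mathfrak o}B\cong B$. Morphism sets. For $F$ a finite composition of functors of the form $C_b(X;-)$, $C_0(X;-)$, $C_a(X;-)$ with $X$ a CW-complex whose filter has a basis of subcomplexes, $*$-homomorphisms $\varphi_0,\varphi_1\colon A\to F(B)$ are $F$-homotopic if there is a $*$-homomorphism $\Phi\colon A\to F(C([0,1];B))$ with $F(\mathrm{ev}_i)\circ\Phi=\varphi_i$, $i=0,1$. This is an equivalence relation; $[\![A,B]\!]_F$ is the set of classes $[\![\varphi]\!]$, and $[\![A,B]\!]_{\mathfrak m}=[\![A,B]\!]_{\mathfrak S^{\mathfrak m}}$. A cofinal map $\alpha\colon\mathfrak m\to\mathfrak n$ extends affinely to $|\alpha|\colon|\Delta^{\mathfrak m}|\to|\Delta^{\mathfrak n}|$ and induces $\alpha^*\colon\mathfrak S^{\mathfrak n}B\to\mathfrak S^{\mathfrak m}B$ and $\alpha^*\colon[\![A,B]\!]_{\mathfrak n}\to[\![A,B]\!]_{\mathfrak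 m}$; the latter is independent of the choice of $\alpha$. Let $\mathcal D$ be the category of directed sets with exactly one arrow $\mathfrak m\to\mathfrak n$ if a cofinal map $\mathfrak m\to\mathfrak n$ exists and none otherwise. The simpltotic morphism set is $[\![A,B]\!]=\varinjlim_{\mathfrak m\in\mathcal D^{op}}[\![A,B]\!]_{\mathfrak m}$. Composition product. For directed sets $\mathfrak m,\mathfrak n$ let $\mathfrak m\sharp\mathfrak n=\mathfrak m\times\mathfrak n^{\Delta^{\mathfrak m}}$ with $(m,\xi)\ge(m',\xi')$ iff $m\ge m'$ and $\xi\ge\xi'$ pointwise, and let $\mu\colon\mathfrak m\sharp\mathfrak n\to\mathfrak m$ be the first projection. Choose $\vartheta\colon\Delta^{\mathfrak m\sharp\mathfrak n}\to\mathfrak n$ with $\vartheta(\sigma)\ge\vartheta(\varsigma)$ for $\emptyset\ne\varsigma\subset\sigma$ and $\vartheta(\sigma)\ge\xi(\mu(\sigma))$ for all $\sigma$ and all $(m,\xi)\in\sigma$. Put $X_\vartheta=\bigcup_{\sigma}|\Delta^\sigma|\times|\Delta^{\mathfrak n\triangleright\vartheta(\sigma)}|\subset|\Delta^{\mathfrak m\sharp\mathfrak n}|\times|\Delta^{\mathfrak n}|$. Define $I_\vartheta\colon|\Delta^{\mathfrak m\sharp\mathfrak n}|\to X_\vartheta$ recursively over skeleta: $I_\vartheta(k)=(k,\vartheta(k))$ on vertices; on a simplex $\sigma$ of positive dimension it is the composition of a continuous map $h_\sigma\colon|\Delta^\sigma|\to|\Delta^\sigma|\times\{1\}\cup|\partial\Delta^\sigma|\times[0,1]$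 restricting to $x\mapsto(x,0)$ on the boundary, with the map $(x,t)\mapsto(1-t)I_\vartheta(x)+t(x,\vartheta(\sigma))$ (equal to $(x,\vartheta(\sigma))$ for $t=1$). Let $\Theta=(|\mu|\times\mathrm{id})\circ I_\vartheta$. Pullback along $\Theta$ of elements of $C_b(|\Delta^{\mathfrak m}|;C_b(|\Delta^{\mathfrak n}|;C))\subset C_b(|\Delta^{\mathfrak m}|\times|\Delta^{\mathfrak n}|;C)$ descends to a natural transformation $\Theta^*\colon\mathfrak S^{\mathfrak m}\mathfrak S^{\mathfrak n}C\to\mathfrak S^{\mathfrak m\sharp\mathfrak n}C$, and the induced map $\Theta^*\colon[\![A,C]\!]_{\mathfrak S^{\mathfrak m}\mathfrak S^{\mathfrak n}}\to[\![A,C]\!]_{\mathfrak m\sharp\mathfrak n}$ is independent of all choices. For $[\![\varphi]\!]\in[\![A,B]\!]_{\mathfrak m}$, $[\![\psi]\!]\in[\![B,C]\!]_{\mathfrak n}$ one sets $[\![\psi]\!]\circ[\![\varphi]\!]=\Theta^*[\![\mathfrak S^{\mathfrak m}(\psi)\circ\varphi]\!]\in[\![A,C]\!]_{\mathfrak m\sharp\mathfrak n}$; this passes to the direct limits.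
   Formalization: In I_ϑ the straight path (1−t)I(x)+t(x,ϑ(σ)), which leaves X_ϑ from dimension 2 on, is replaced by a two-step path inside X_ϑ (second coordinate first, then the first). The limit runs over directed sets in an arbitrary sufficiently large type, the algebras over an arbitrary type. *)

theory Defs
  imports "HOL-Analysis.Analysis" "HOL-Algebra.Group"
begin

section \<open>Graded \<open>G\<close>-C*-algebras\<close>

text \<open>
  Algebras are carrier-based, because the asymptotic algebras below are quotients of subsets of
  function spaces. The operations are meaningful on the carrier only.
\<close>

record ('g, 'a) galg = "'a partial_object" +
  cadd :: "'a \<Rightarrow> 'a \<Rightarrow> 'a"
  czero :: 'a
  cscale :: "complex \<Rightarrow> 'a \<Rightarrow> 'a"
  cmult :: "'a \<Rightarrow> 'a \<Rightarrow> 'a"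
  cstar :: "'a \<Rightarrow> 'a"
  cnorm :: "'a \<Rightarrow> real"
  grade :: "'a \<Rightarrow> 'a"
  act :: "'g \<Rightarrow> 'a \<Rightarrow> 'a"

definition cminus :: "('g, 'a) galg \<Rightarrow> 'a \<Rightarrow> 'a \<Rightarrow> 'a" where
  "cminus A x y = cadd A x (cscale A (- 1) y)"

text \<open>
  The value off the carrier is there because \<^locale>\<open>Metric_space\<close> demands non-negativity and
  symmetry of the distance on the whole type.
\<close>

definition cdist :: "('g, 'a) galg \<Rightarrow> 'a \<Rightarrow> 'a \<Rightarrow> real" where
  "cdist A x y = (if x \<in> carrier A \<and> y \<in> carrier A then cnorm A (cminus A x y) else 0)"

definition norm_topology :: "('g, 'a) galg \<Rightarrow> 'a topology" where
  "norm_topology A = Metric_space.mtopology (carrier A) (cdist A)"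

definition star_hom :: "('g, 'a) galg \<Rightarrow> ('g, 'b) galg \<Rightarrow> ('a \<Rightarrow> 'b) \<Rightarrow> bool" where
  "star_hom A B f \<longleftrightarrow>
     f \<in> carrier A \<rightarrow> carrier B \<and>
     (\<forall>x\<in>carrier A. \<forall>y\<in>carrier A. f (cadd A x y) = cadd B (f x) (f y)) \<and>
     (\<forall>c. \<forall>x\<in>carrier A. f (cscale A c x) = cscale B c (f x)) \<and>
     (\<forall>x\<in>carrier A. \<forall>y\<in>carrier A. f (cmult A x y) = cmult B (f x) (f y)) \<and>
     (\<forall>x\<in>carrier A. f (cstar A x) = cstar B (f x))"

locale cstar_algebra =
  fixes A :: "('g, 'a) galg"
  assumes zero_closed: "czero A \<in> carrier A"
    and add_closed: "\<lbrakk>x \<in> carrier A; y \<in> carrier A\<rbrakk> \<Longrightarrow> cadd A x y \<in> carrier A"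
    and scale_closed: "x \<in> carrier A \<Longrightarrow> cscale A c x \<in> carrier A"
    and mult_closed: "\<lbrakk>x \<in> carrier A; y \<in> carrier A\<rbrakk> \<Longrightarrow> cmult A x y \<in> carrier A"
    and star_closed: "x \<in> carrier A \<Longrightarrow> cstar A x \<in> carrier A"
    and add_assoc: "\<lbrakk>x \<in> carrier A; y \<in> carrier A; z \<in> carrier A\<rbrakk>
      \<Longrightarrow> cadd A (cadd A x y) z = cadd A x (cadd A y z)"
    and add_commute: "\<lbrakk>x \<in> carrier A; y \<in> carrier A\<rbrakk> \<Longrightarrow> cadd A x y = cadd A y x"
    and add_zero: "x \<in> carrier A \<Longrightarrow> cadd A x (czero A) = x"
    and minus_self: "x \<in> carrier A \<Longrightarrow> cminus A x x = czero A"
    and scale_one: "x \<in> carrier A \<Longrightarrow> cscale A 1 x = x"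
    and scale_scale: "x \<in> carrier A \<Longrightarrow> cscale A c (cscale A d x) = cscale A (c * d) x"
    and scale_add_right: "\<lbrakk>x \<in> carrier A; y \<in> carrier A\<rbrakk>
      \<Longrightarrow> cscale A c (cadd A x y) = cadd A (cscale A c x) (cscale A c y)"
    and scale_add_left: "x \<in> carrier A
      \<Longrightarrow> cscale A (c + d) x = cadd A (cscale A c x) (cscale A d x)"
    and mult_assoc: "\<lbrakk>x \<in> carrier A; y \<in> carrier A; z \<in> carrier A\<rbrakk>
      \<Longrightarrow> cmult A (cmult A x y) z = cmult A x (cmult A y z)"
    and mult_add_right: "\<lbrakk>x \<in> carrier A; y \<in> carrier A; z \<in> carrier A\<rbrakk>
      \<Longrightarrow> cmult A x (cadd A y z) = cadd A (cmult A x y) (cmult A x z)"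
    and mult_add_left: "\<lbrakk>x \<in> carrier A; y \<in> carrier A; z \<in> carrier A\<rbrakk>
      \<Longrightarrow> cmult A (cadd A x y) z = cadd A (cmult A x z) (cmult A y z)"
    and mult_scale_left: "\<lbrakk>x \<in> carrier A; y \<in> carrier A\<rbrakk>
      \<Longrightarrow> cmult A (cscale A c x) y = cscale A c (cmult A x y)"
    and mult_scale_right: "\<lbrakk>x \<in> carrier A; y \<in> carrier A\<rbrakk>
      \<Longrightarrow> cmult A x (cscale A c y) = cscale A c (cmult A x y)"
    and star_star: "x \<in> carrier A \<Longrightarrow> cstar A (cstar A x) = x"
    and star_add: "\<lbrakk>x \<in> carrier A; y \<in> carrier A\<rbrakk>
      \<Longrightarrow> cstar A (cadd A x y) = cadd A (cstar A x) (cstar A y)"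
    and star_scale: "x \<in> carrier A \<Longrightarrow> cstar A (cscale A c x) = cscale A (cnj c) (cstar A x)"
    and star_mult: "\<lbrakk>x \<in> carrier A; y \<in> carrier A\<rbrakk>
      \<Longrightarrow> cstar A (cmult A x y) = cmult A (cstar A y) (cstar A x)"
    and norm_nonneg: "x \<in> carrier A \<Longrightarrow> 0 \<le> cnorm A x"
    and norm_eq_zero: "x \<in> carrier A \<Longrightarrow> cnorm A x = 0 \<longleftrightarrow> x = czero A"
    and norm_triangle: "\<lbrakk>x \<in> carrier A; y \<in> carrier A\<rbrakk>
      \<Longrightarrow> cnorm A (cadd A x y) \<le> cnorm A x + cnorm A y"
    and norm_scale: "x \<in> carrier A \<Longrightarrow> cnorm A (cscale A c x) = cmod c * cnorm A x"
    and norm_mult: "\<lbrakk>x \<in> carrier A; y \<in> carrier A\<rbrakk>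
      \<Longrightarrow> cnorm A (cmult A x y) \<le> cnorm A x * cnorm A y"
    and norm_star_mult: "x \<in> carrier A \<Longrightarrow> cnorm A (cmult A (cstar A x) x) = (cnorm A x)\<^sup>2"
    and complete: "Metric_space.mcomplete (carrier A) (cdist A)"

text \<open>
  A grading is given by its grading automorphism, an involutive *-automorphism (whose
  eigenspaces for \<open>1\<close> and \<open>-1\<close> are the even and the odd part); \<open>G\<close> acts by grading-preserving
  *-automorphisms. As \<open>G\<close> is discrete, there is no continuity condition on the action.
\<close>

locale graded_G_cstar_algebra = cstar_algebra A
  for G :: "'g monoid" and A :: "('g, 'a) galg" +
  assumes grade_hom: "star_hom A A (grade A)"
    and grade_grade: "x \<in> carrier A \<Longrightarrow> grade A (grade A x) = x"
    and act_hom: "g \<in> carrier G \<Longrightarrow> star_hom A A (act A g)"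
    and act_one: "x \<in> carrier A \<Longrightarrow> act A (one G) x = x"
    and act_mult: "\<lbrakk>g \<in> carrier G; h \<in> carrier G; x \<in> carrier A\<rbrakk>
      \<Longrightarrow> act A (mult G g h) x = act A g (act A h x)"
    and act_grade: "\<lbrakk>g \<in> carrier G; x \<in> carrier A\<rbrakk>
      \<Longrightarrow> act A g (grade A x) = grade A (act A g x)"

definition Mor :: "'g monoid \<Rightarrow> ('g, 'a) galg \<Rightarrow> ('g, 'b) galg \<Rightarrow> ('a \<Rightarrow> 'b) set" where
  "Mor G A B = {f \<in> extensional (carrier A). star_hom A B f \<and>
     (\<forall>x\<in>carrier A. f (grade A x) = grade B (f x)) \<and>
     (\<forall>g\<in>carrier G. \<forall>x\<in>carrier A. f (act A g x) = act B g (f x))}"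


section \<open>Generalized asymptotic algebras\<close>

text \<open>
  A quotient has cosets as elements, and everything on it is induced from representatives by
  taking unions: for a well-defined map the union below is a union of equal cosets.
\<close>

definition coset :: "('g, 'a) galg \<Rightarrow> 'a set \<Rightarrow> 'a \<Rightarrow> 'a set" where
  "coset A J x = {y \<in> carrier A. cminus A y x \<in> J}"

definition quotient_alg :: "('g, 'a) galg \<Rightarrow> 'a set \<Rightarrow> ('g, 'a set) galg" where
  "quotient_alg A J = \<lparr>
     carrier = coset A J ` carrier A,
     cadd = \<lambda>E E'. \<Union>x\<in>E. \<Union>y\<in>E'. coset A J (cadd A x y),
     czero = coset A J (czero A),
     cscale = \<lambda>c E. \<Union>x\<in>E. coset A J (cscale A c x),
     cmult = \<lambda>E E'. \<Union>x\<in>E. \<Union>y\<in>E'. coset A J (cmult A x y),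
     cstar = \<lambda>E. \<Union>x\<in>E. coset A J (cstar A x),
     cnorm = \<lambda>E. INF x\<in>E. cnorm A x,
     grade = \<lambda>E. \<Union>x\<in>E. coset A J (grade A x),
     act = \<lambda>g E. \<Union>x\<in>E. coset A J (act A g x)\<rparr>"

definition Cb :: "'x topology \<Rightarrow> ('g, 'a) galg \<Rightarrow> ('g, 'x \<Rightarrow> 'a) galg" where
  "Cb X B = \<lparr>
     carrier = {f \<in> extensional (topspace X). continuous_map X (norm_topology B) f \<and>
                  (\<exists>K. \<forall>x\<in>topspace X. cnorm B (f x) \<le> K)},
     cadd = \<lambda>f g. \<lambda>x\<in>topspace X. cadd B (f x) (g x),
     czero = \<lambda>x\<in>topspace X. czero B,
     cscale = \<lambda>c f. \<lambda>x\<in>topspace X. cscale B c (f x),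
     cmult = \<lambda>f g. \<lambda>x\<in>topspace X. cmult B (f x) (g x),
     cstar = \<lambda>f. \<lambda>x\<in>topspace X. cstar B (f x),
     cnorm = \<lambda>f. Sup (insert 0 ((\<lambda>x. cnorm B (f x)) ` topspace X)),
     grade = \<lambda>f. \<lambda>x\<in>topspace X. grade B (f x),
     act = \<lambda>g f. \<lambda>x\<in>topspace X. act B g (f x)\<rparr>"

definition C0 :: "'x topology \<Rightarrow> 'x filter \<Rightarrow> ('g, 'a) galg \<Rightarrow> ('x \<Rightarrow> 'a) set" where
  "C0 X F B = {f \<in> carrier (Cb X B). \<forall>\<epsilon>>0. \<forall>\<^sub>F x in F. cnorm B (f x) < \<epsilon>}"

definition Ca :: "'x topology \<Rightarrow> 'x filter \<Rightarrow> ('g, 'a) galg \<Rightarrow> ('g, ('x \<Rightarrow> 'a) set) galg" where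
  "Ca X F B = quotient_alg (Cb X B) (C0 X F B)"

abbreviation Ca_class ::
    "'x topology \<Rightarrow> 'x filter \<Rightarrow> ('g, 'a) galg \<Rightarrow> ('x \<Rightarrow> 'a) \<Rightarrow> ('x \<Rightarrow> 'a) set" where
  "Ca_class X F B \<equiv> coset (Cb X B) (C0 X F B)"

definition Ca_map :: "'x topology \<Rightarrow> 'x filter \<Rightarrow> ('g, 'a) galg \<Rightarrow> ('g, 'b) galg
    \<Rightarrow> ('a \<Rightarrow> 'b) \<Rightarrow> ('x \<Rightarrow> 'a) set \<Rightarrow> ('x \<Rightarrow> 'b) set" where
  "Ca_map X F B C \<psi> =
     (\<lambda>E\<in>carrier (Ca X F B). \<Union>f\<in>E. Ca_class X F C (\<lambda>x\<in>topspace X. \<psi> (f x)))"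

text \<open>\<open>C([0,1]; B)\<close> and its evaluation maps.\<close>

definition cyl :: "('g, 'a) galg \<Rightarrow> ('g, real \<Rightarrow> 'a) galg" where
  "cyl B = Cb (top_of_set {0..1}) B"

definition ev :: "('g, 'a) galg \<Rightarrow> real \<Rightarrow> (real \<Rightarrow> 'a) \<Rightarrow> 'a" where
  "ev B t = (\<lambda>f\<in>carrier (cyl B). f t)"

text \<open>
  \<open>F\<close>-homotopy. HOL cannot quantify over polymorphic functors, so the functor enters through its
  values \<open>FB = F(B)\<close>, \<open>FIB = F(C([0,1]; B))\<close>, \<open>e0 = F(ev\<^sub>0)\<close>, \<open>e1 = F(ev\<^sub>1)\<close>.
\<close>

definition homotopy_rel :: "'g monoid \<Rightarrow> ('g, 'a) galg \<Rightarrow> ('g, 'b) galg \<Rightarrow> ('g, 'c) galg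
    \<Rightarrow> ('c \<Rightarrow> 'b) \<Rightarrow> ('c \<Rightarrow> 'b) \<Rightarrow> (('a \<Rightarrow> 'b) \<times> ('a \<Rightarrow> 'b)) set" where
  "homotopy_rel G A FB FIB e0 e1 = {(\<phi>0, \<phi>1). \<phi>0 \<in> Mor G A FB \<and> \<phi>1 \<in> Mor G A FB \<and>
     (\<exists>\<Phi>\<in>Mor G A FIB. compose (carrier A) e0 \<Phi> = \<phi>0 \<and> compose (carrier A) e1 \<Phi> = \<phi>1)}"


section \<open>Directed sets and simplicial complexes\<close>

text \<open>
  A directed set is its order relation, \<open>(x, y) \<in> r\<close> meaning \<open>x \<le> y\<close>; its underlying set is
  \<open>Field r\<close>, and \<open>r `` {m}\<close> is the set of all elements above \<open>m\<close>.
\<close>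

definition directed_set :: "'i rel \<Rightarrow> bool" where
  "directed_set r \<longleftrightarrow> Field r \<noteq> {} \<and> preorder_on (Field r) r \<and>
     (\<forall>x\<in>Field r. \<forall>y\<in>Field r. \<exists>z. (x, z) \<in> r \<and> (y, z) \<in> r)"

definition cofinal :: "'i rel \<Rightarrow> 'j rel \<Rightarrow> ('i \<Rightarrow> 'j) \<Rightarrow> bool" where
  "cofinal m n \<alpha> \<longleftrightarrow> \<alpha> \<in> Field m \<rightarrow> Field n \<and>
     (\<forall>y\<in>Field n. \<exists>x\<in>Field m. \<forall>k. (x, k) \<in> m \<longrightarrow> (y, \<alpha> k) \<in> n)"

definition simplices :: "'v set \<Rightarrow> 'v set set" where
  "simplices S = {\<sigma>. finite \<sigma> \<and> \<sigma> \<noteq> {} \<and> \<sigma> \<subseteq> S}"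

text \<open>Points of the geometric realization of the full simplex, in barycentric coordinates.\<close>

definition realization :: "'v set \<Rightarrow> ('v \<Rightarrow> real) set" where
  "realization S = {x. (\<forall>v. 0 \<le> x v) \<and> {v. x v \<noteq> 0} \<in> simplices S \<and> (\<Sum>v | x v \<noteq> 0. x v) = 1}"

text \<open>
  The weak (CW) topology. A finite simplex carries the subspace topology of the product
  topology on functions, which is its Euclidean topology.
\<close>

definition realization_topology :: "'v set \<Rightarrow> ('v \<Rightarrow> real) topology" where
  "realization_topology S = topology (\<lambda>U. U \<subseteq> realization S \<and>
     (\<forall>\<sigma>\<in>simplices S. openin (top_of_set (realization \<sigma>)) (U \<inter> realization \<sigma>)))"

lemma openin_realization_topology:
  "openin (realization_topology S) U \<longleftrightarrow> U \<subseteq> realization S \<and>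
     (\<forall>\<sigma>\<in>simplices S. openin (top_of_set (realization \<sigma>)) (U \<inter> realization \<sigma>))"
proof -
  have "istopology (\<lambda>U. U \<subseteq> realization S \<and>
     (\<forall>\<sigma>\<in>simplices S. openin (top_of_set (realization \<sigma>)) (U \<inter> realization \<sigma>)))"
    unfolding istopology_def
  proof (intro conjI allI impI)
    fix U V assume U: "U \<subseteq> realization S \<and>
        (\<forall>\<sigma>\<in>simplices S. openin (top_of_set (realization \<sigma>)) (U \<inter> realization \<sigma>))"
      and V: "V \<subseteq> realization S \<and>
        (\<forall>\<sigma>\<in>simplices S. openin (top_of_set (realization \<sigma>)) (V \<inter> realization \<sigma>))"
    show "U \<inter> V \<subseteq> realization S" using U by blast
    show "\<forall>\<sigma>\<in>simplices S. openin (top_of_set (realization \<sigma>)) (U \<inter> V \<inter> realization \<sigma>)"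
    proof
      fix \<sigma> assume "\<sigma> \<in> simplices S"
      then have "openin (top_of_set (realization \<sigma>)) ((U \<inter> realization \<sigma>) \<inter> (V \<inter> realization \<sigma>))"
        using U V openin_Int by blast
      moreover have "(U \<inter> realization \<sigma>) \<inter> (V \<inter> realization \<sigma>) = U \<inter> V \<inter> realization \<sigma>" by blast
      ultimately show "openin (top_of_set (realization \<sigma>)) (U \<inter> V \<inter> realization \<sigma>)" by simp
    qed
  next
    fix K assume K: "\<forall>U\<in>K. U \<subseteq> realization S \<and>
        (\<forall>\<sigma>\<in>simplices S. openin (top_of_set (realization \<sigma>)) (U \<inter> realization \<sigma>))"
    show "\<Union>K \<subseteq> realization S" using K by blast
    show "\<forall>\<sigma>\<in>simplices S. openin (top_of_set (realization \<sigma>)) (\<Union>K \<inter> realization \<sigma>)"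
    proof
      fix \<sigma> assume "\<sigma> \<in> simplices S"
      then have "openin (top_of_set (realization \<sigma>)) (\<Union>((\<lambda>U. U \<inter> realization \<sigma>) ` K))"
        using K by (intro openin_Union) blast
      moreover have "\<Union>((\<lambda>U. U \<inter> realization \<sigma>) ` K) = \<Union>K \<inter> realization \<sigma>" by blast
      ultimately show "openin (top_of_set (realization \<sigma>)) (\<Union>K \<inter> realization \<sigma>)" by simp
    qed
  qed
  then show ?thesis by (simp add: realization_topology_def topology_inverse')
qed

definition simplex_filter :: "'i rel \<Rightarrow> ('i \<Rightarrow> real) filter" where
  "simplex_filter m = (INF x\<in>Field m. principal (realization (m `` {x})))"

text \<open>The affine extension \<open>|\<alpha>|\<close> of a map of vertex sets.\<close>

definition affine_map :: "('v \<Rightarrow> 'w) \<Rightarrow> ('v \<Rightarrow> real) \<Rightarrow> 'w \<Rightarrow> real" where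
  "affine_map \<alpha> x = (\<lambda>w. \<Sum>v | x v \<noteq> 0 \<and> \<alpha> v = w. x v)"

definition vertex :: "'v \<Rightarrow> 'v \<Rightarrow> real" where
  "vertex v = (\<lambda>w. if w = v then 1 else 0)"

definition segment :: "real \<Rightarrow> ('v \<Rightarrow> real) \<Rightarrow> ('v \<Rightarrow> real) \<Rightarrow> 'v \<Rightarrow> real" where
  "segment t x y = (\<lambda>v. (1 - t) * x v + t * y v)"

definition boundary :: "'v set \<Rightarrow> ('v \<Rightarrow> real) set" where
  "boundary \<sigma> = (\<Union>\<tau>\<in>{\<tau>\<in>simplices \<sigma>. \<tau> \<noteq> \<sigma>}. realization \<tau>)"


section \<open>Simpltotic algebras and morphism sets\<close>

type_synonym ('i, 'a) simpl = "(('i \<Rightarrow> real) \<Rightarrow> 'a) set"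

abbreviation Simpl :: "'i rel \<Rightarrow> ('g, 'a) galg \<Rightarrow> ('g, ('i, 'a) simpl) galg" where
  "Simpl m B \<equiv> Ca (realization_topology (Field m)) (simplex_filter m) B"

abbreviation Simpl_class ::
    "'i rel \<Rightarrow> ('g, 'a) galg \<Rightarrow> (('i \<Rightarrow> real) \<Rightarrow> 'a) \<Rightarrow> ('i, 'a) simpl" where
  "Simpl_class m B \<equiv> Ca_class (realization_topology (Field m)) (simplex_filter m) B"

abbreviation Simpl_map :: "'i rel \<Rightarrow> ('g, 'a) galg \<Rightarrow> ('g, 'b) galg
    \<Rightarrow> ('a \<Rightarrow> 'b) \<Rightarrow> ('i, 'a) simpl \<Rightarrow> ('i, 'b) simpl" where
  "Simpl_map m B C \<equiv> Ca_map (realization_topology (Field m)) (simplex_filter m) B C"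

text \<open>The homomorphism \<open>B \<rightarrow> Simpl m B\<close> given by constant functions; it is the isomorphism
  \<open>B \<cong> Simpl m B\<close> if \<open>m\<close> has only one element.\<close>

definition const_simpl :: "'i rel \<Rightarrow> ('g, 'a) galg \<Rightarrow> 'a \<Rightarrow> ('i, 'a) simpl" where
  "const_simpl m B = (\<lambda>b\<in>carrier B. Simpl_class m B (\<lambda>x\<in>realization (Field m). b))"

definition simpl_homotopy :: "'g monoid \<Rightarrow> ('g, 'a) galg \<Rightarrow> ('g, 'b) galg \<Rightarrow> 'i rel
    \<Rightarrow> (('a \<Rightarrow> ('i, 'b) simpl) \<times> ('a \<Rightarrow> ('i, 'b) simpl)) set" where
  "simpl_homotopy G A B m = homotopy_rel G A (Simpl m B) (Simpl m (cyl B))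
     (Simpl_map m (cyl B) B (ev B 0)) (Simpl_map m (cyl B) B (ev B 1))"

definition simpl_mor :: "'g monoid \<Rightarrow> ('g, 'a) galg \<Rightarrow> ('g, 'b) galg \<Rightarrow> 'i rel
    \<Rightarrow> ('a \<Rightarrow> ('i, 'b) simpl) set set" where
  "simpl_mor G A B m = Mor G A (Simpl m B) // simpl_homotopy G A B m"

abbreviation simpl_mor_class :: "'g monoid \<Rightarrow> ('g, 'a) galg \<Rightarrow> ('g, 'b) galg \<Rightarrow> 'i rel
    \<Rightarrow> ('a \<Rightarrow> ('i, 'b) simpl) \<Rightarrow> ('a \<Rightarrow> ('i, 'b) simpl) set" where
  "simpl_mor_class G A B m \<phi> \<equiv> simpl_homotopy G A B m `` {\<phi>}"

definition pullback :: "'i rel \<Rightarrow> 'j rel \<Rightarrow> ('i \<Rightarrow> 'j) \<Rightarrow> ('g, 'b) galg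
    \<Rightarrow> ('j, 'b) simpl \<Rightarrow> ('i, 'b) simpl" where
  "pullback m n \<alpha> B = (\<lambda>E\<in>carrier (Simpl n B).
     \<Union>f\<in>E. Simpl_class m B (\<lambda>x\<in>realization (Field m). f (affine_map \<alpha> x)))"

definition pullback_mor :: "'g monoid \<Rightarrow> ('g, 'a) galg \<Rightarrow> ('g, 'b) galg \<Rightarrow> 'i rel \<Rightarrow> 'j rel
    \<Rightarrow> ('i \<Rightarrow> 'j) \<Rightarrow> ('a \<Rightarrow> ('j, 'b) simpl) set \<Rightarrow> ('a \<Rightarrow> ('i, 'b) simpl) set" where
  "pullback_mor G A B m n \<alpha> c =
     (\<Union>\<phi>\<in>c. simpl_mor_class G A B m (compose (carrier A) (pullback m n \<alpha> B) \<phi>))"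

text \<open>
  The direct limit over all directed sets. In HOL the directed sets occurring in one set have
  their elements in one type \<open>'i\<close>, whereas \<open>\<sharp>\<close> below leads to a larger type, so elements over
  different types have to be compared: \<open>limit_eq\<close> says that \<open>c\<close> over \<open>m\<close> and \<open>d\<close> over \<open>n\<close>
  represent the same element of the direct limit, where the directed set \<open>k\<close> dominating both is
  taken over the type of \<open>n\<close>, to be used for \<open>'i\<close> not larger than \<open>'j\<close>.

  Nothing is lost if \<open>'i\<close> is infinite and contains copies of \<open>A\<close> and \<open>G\<close>: A *-homomorphism
  into \<open>Simpl n B\<close> is determined by lifts of the images of the elements of \<open>A\<close> subject to at most
  \<open>|'i|\<close> asymptotic conditions. Pulling these back along a map to \<open>n\<close>, from the directed set of
  finite sets of pairs of a condition and an error bound, that sends such a set to an element of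
  \<open>n\<close> beyond which the conditions hold up to the bounds, gives a representative of the same
  element of the limit over a directed set of cardinality at most \<open>|'i|\<close>; homotopies are treated
  in the same way. So the limit over the directed sets in \<open>'i\<close> is the limit over all of them.
\<close>

type_synonym ('i, 'a) germ = "'i rel \<times> ('a \<Rightarrow> ('i, 'a) simpl) set"

definition germs :: "'g monoid \<Rightarrow> ('g, 'a) galg \<Rightarrow> ('g, 'a) galg \<Rightarrow> ('i, 'a) germ set" where
  "germs G A B = {(m, c). directed_set m \<and> c \<in> simpl_mor G A B m}"

definition limit_eq :: "'g monoid \<Rightarrow> ('g, 'a) galg \<Rightarrow> ('g, 'a) galg
    \<Rightarrow> ('i, 'a) germ \<Rightarrow> ('j, 'a) germ \<Rightarrow> bool" where
  "limit_eq G A B = (\<lambda>(m, c) (n, d). \<exists>(k :: 'j rel) \<alpha> \<beta>.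
     directed_set k \<and> cofinal k m \<alpha> \<and> cofinal k n \<beta> \<and>
     pullback_mor G A B k m \<alpha> c = pullback_mor G A B k n \<beta> d)"

definition simpltotic_mor ::
    "'g monoid \<Rightarrow> ('g, 'a) galg \<Rightarrow> ('g, 'a) galg \<Rightarrow> ('i, 'a) germ set set" where
  "simpltotic_mor G A B =
     germs G A B // {(p, q). p \<in> germs G A B \<and> q \<in> germs G A B \<and> limit_eq G A B p q}"


section \<open>The composition product\<close>

definition sharp :: "'i rel \<Rightarrow> 'j rel \<Rightarrow> ('i \<times> ('i set \<Rightarrow> 'j)) rel" (infixr \<open>\<sharp>\<close> 75) where
  "m \<sharp> n = {((x, \<xi>), (x', \<xi>')). (x, x') \<in> m \<and>
     \<xi> \<in> simplices (Field m) \<rightarrow>\<^sub>E Field n \<and> \<xi>' \<in> simplices (Field m) \<rightarrow>\<^sub>E Field n \<and>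
     (\<forall>\<sigma>\<in>simplices (Field m). (\<xi> \<sigma>, \<xi>' \<sigma>) \<in> n)}"

definition theta_choice ::
    "'i rel \<Rightarrow> 'j rel \<Rightarrow> (('i \<times> ('i set \<Rightarrow> 'j)) set \<Rightarrow> 'j) \<Rightarrow> bool" where
  "theta_choice m n \<theta> \<longleftrightarrow> (\<forall>\<sigma>\<in>simplices (Field (m \<sharp> n)).
     \<theta> \<sigma> \<in> Field n \<and>
     (\<forall>\<tau>\<in>simplices \<sigma>. (\<theta> \<tau>, \<theta> \<sigma>) \<in> n) \<and>
     (\<forall>(x, \<xi>)\<in>\<sigma>. (\<xi> (fst ` \<sigma>), \<theta> \<sigma>) \<in> n))"

definition X_theta :: "'i rel \<Rightarrow> 'j rel \<Rightarrow> (('i \<times> ('i set \<Rightarrow> 'j)) set \<Rightarrow> 'j)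
    \<Rightarrow> ((('i \<times> ('i set \<Rightarrow> 'j)) \<Rightarrow> real) \<times> ('j \<Rightarrow> real)) set" where
  "X_theta m n \<theta> =
     (\<Union>\<sigma>\<in>simplices (Field (m \<sharp> n)). realization \<sigma> \<times> realization (n `` {\<theta> \<sigma>}))"

text \<open>
  The path in \<open>X_theta\<close> from \<open>p = (p\<^sub>1, p\<^sub>2)\<close> to \<open>(x, w)\<close> along which the recursion proceeds: \<open>p\<^sub>2\<close>
  is first moved to \<open>w\<close>, then \<open>p\<^sub>1\<close> to \<open>x\<close>. The direct segment \<open>(1 - t) p + t (x, w)\<close> would not do:
  if \<open>\<rho>\<close> is an edge with end point \<open>a\<close> of a 2-simplex \<open>\<sigma>\<close>, then the image of \<open>\<rho>\<close> contains points
  \<open>p\<close> with \<open>p\<^sub>1 = a\<close> over which \<open>p\<^sub>2\<close> has positive weight at \<open>\<theta> {a}\<close>, and their segments to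
  \<open>(x, \<theta> \<sigma>)\<close> leave \<open>X_theta\<close> as soon as \<open>p\<^sub>1\<close> is moved into \<open>\<rho>\<close>, unless \<open>\<theta> {a} \<ge> \<theta> \<rho>\<close>; pulling back along
  the result would not map \<open>C\<^sub>0\<close> to \<open>C\<^sub>0\<close>.
\<close>

definition theta_path :: "('v \<Rightarrow> real) \<times> ('w \<Rightarrow> real) \<Rightarrow> ('v \<Rightarrow> real) \<Rightarrow> ('w \<Rightarrow> real) \<Rightarrow> real
    \<Rightarrow> ('v \<Rightarrow> real) \<times> ('w \<Rightarrow> real)" where
  "theta_path p x w t =
     (if t \<le> 1/2 then (fst p, segment (2 * t) (snd p) w) else (segment (2 * t - 1) (fst p) x, w))"

text \<open>
  The recursion over skeleta determines \<open>I\<close> from the \<open>h \<sigma>\<close>: if \<open>h \<sigma> x = (y, t)\<close> with \<open>t \<noteq> 1\<close>, then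
  \<open>y\<close> is in the boundary, and for \<open>t = 1\<close> the value is \<open>(y, vertex (\<theta> \<sigma>))\<close> whatever \<open>I y\<close> is.
\<close>

definition I_theta :: "'i rel \<Rightarrow> 'j rel \<Rightarrow> (('i \<times> ('i set \<Rightarrow> 'j)) set \<Rightarrow> 'j)
    \<Rightarrow> ((('i \<times> ('i set \<Rightarrow> 'j)) \<Rightarrow> real) \<Rightarrow> (('i \<times> ('i set \<Rightarrow> 'j)) \<Rightarrow> real) \<times> ('j \<Rightarrow> real)) set" where
  "I_theta m n \<theta> = {I \<in> realization (Field (m \<sharp> n)) \<rightarrow> X_theta m n \<theta>.
     (\<forall>k\<in>Field (m \<sharp> n). I (vertex k) = (vertex k, vertex (\<theta> {k}))) \<and>
     (\<exists>h. \<forall>\<sigma>\<in>simplices (Field (m \<sharp> n)). card \<sigma> \<ge> 2 \<longrightarrow>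
        continuous_on (realization \<sigma>) (h \<sigma>) \<and>
        h \<sigma> \<in> realization \<sigma> \<rightarrow> realization \<sigma> \<times> {1} \<union> boundary \<sigma> \<times> {0..1 :: real} \<and>
        (\<forall>x\<in>boundary \<sigma>. h \<sigma> x = (x, 0)) \<and>
        (\<forall>x\<in>realization \<sigma>. case h \<sigma> x of (y, t) \<Rightarrow> I x = theta_path (I y) y (vertex (\<theta> \<sigma>)) t))}"

definition Theta_maps :: "'i rel \<Rightarrow> 'j rel
    \<Rightarrow> ((('i \<times> ('i set \<Rightarrow> 'j)) \<Rightarrow> real) \<Rightarrow> ('i \<Rightarrow> real) \<times> ('j \<Rightarrow> real)) set" where
  "Theta_maps m n = {\<Theta>. \<exists>\<theta> I. theta_choice m n \<theta> \<and> I \<in> I_theta m n \<theta> \<and>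
     \<Theta> = (\<lambda>p. map_prod (affine_map fst) id (I p))}"

text \<open>
  The homomorphism from \<open>Simpl m (Simpl n C)\<close> to \<open>Simpl (m \<sharp> n) C\<close> induced by \<open>\<Theta>\<close>; \<open>F\<close> ranges over
  all lifts of (elements of) \<open>E\<close> to \<open>C\<^sub>b(|\<Delta>\<^sup>m|; C\<^sub>b(|\<Delta>\<^sup>n|; C))\<close>.
\<close>

definition Theta_pullback :: "'i rel \<Rightarrow> 'j rel
    \<Rightarrow> ((('i \<times> ('i set \<Rightarrow> 'j)) \<Rightarrow> real) \<Rightarrow> ('i \<Rightarrow> real) \<times> ('j \<Rightarrow> real)) \<Rightarrow> ('g, 'c) galg
    \<Rightarrow> ('i, ('j, 'c) simpl) simpl \<Rightarrow> ('i \<times> ('i set \<Rightarrow> 'j), 'c) simpl" where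
  "Theta_pullback m n \<Theta> C = (\<lambda>E\<in>carrier (Simpl m (Simpl n C)).
     \<Union>F\<in>{F \<in> carrier (Cb (realization_topology (Field m)) (Cb (realization_topology (Field n)) C)).
           (\<lambda>x\<in>realization (Field m). Simpl_class n C (F x)) \<in> E}.
       Simpl_class (m \<sharp> n) C
         (\<lambda>p\<in>realization (Field (m \<sharp> n)). F (fst (\<Theta> p)) (snd (\<Theta> p))))"

text \<open>
  As above, the union runs over all representatives and all choices of \<open>\<Theta>\<close>; that it is a single
  class, i.e. an element of \<^const>\<open>simpl_mor\<close>, expresses the independence of all choices.
\<close>

definition simpl_comp :: "'g monoid \<Rightarrow> ('g, 'a) galg \<Rightarrow> ('g, 'b) galg \<Rightarrow> ('g, 'c) galg
    \<Rightarrow> 'i rel \<Rightarrow> 'j rel \<Rightarrow> ('b \<Rightarrow> ('j, 'c) simpl) set \<Rightarrow> ('a \<Rightarrow> ('i, 'b) simpl) set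
    \<Rightarrow> ('a \<Rightarrow> ('i \<times> ('i set \<Rightarrow> 'j), 'c) simpl) set" where
  "simpl_comp G A B C m n d c = (\<Union>\<psi>\<in>d. \<Union>\<phi>\<in>c. \<Union>\<Theta>\<in>Theta_maps m n.
     simpl_mor_class G A C (m \<sharp> n) (compose (carrier A) (Theta_pullback m n \<Theta> C)
       (compose (carrier A) (Simpl_map m B (Simpl n C) \<psi>) \<phi>)))"

definition simpltotic_comp :: "'g monoid \<Rightarrow> ('g, 'a) galg \<Rightarrow> ('g, 'a) galg \<Rightarrow> ('g, 'a) galg
    \<Rightarrow> ('i, 'a) germ set \<Rightarrow> ('i, 'a) germ set \<Rightarrow> ('i, 'a) germ set" where
  "simpltotic_comp G A B C Q P = {r \<in> germs G A C. \<exists>(n, d)\<in>Q. \<exists>(m, c)\<in>P.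
     limit_eq G A C r (m \<sharp> n, simpl_comp G A B C m n d c)}"


section \<open>Categories and functors\<close>

record ('o, 'm) cat =
  obj :: "'o set"
  hom_set :: "'o \<Rightarrow> 'o \<Rightarrow> 'm set"
  composition :: "'o \<Rightarrow> 'o \<Rightarrow> 'o \<Rightarrow> 'm \<Rightarrow> 'm \<Rightarrow> 'm"
  ident :: "'o \<Rightarrow> 'm"

text \<open>\<open>composition K A B C g f\<close> is the composition of \<open>f\<close> from \<open>A\<close> to \<open>B\<close> with \<open>g\<close> from \<open>B\<close> to \<open>C\<close>.\<close>

locale category =
  fixes K :: "('o, 'm) cat"
  assumes comp_closed: "\<lbrakk>A \<in> obj K; B \<in> obj K; C \<in> obj K; f \<in> hom_set K A B; g \<in> hom_set K B C\<rbrakk>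
      \<Longrightarrow> composition K A B C g f \<in> hom_set K A C"
    and ident_closed: "A \<in> obj K \<Longrightarrow> ident K A \<in> hom_set K A A"
    and comp_ident_right: "\<lbrakk>A \<in> obj K; B \<in> obj K; f \<in> hom_set K A B\<rbrakk>
      \<Longrightarrow> composition K A A B f (ident K A) = f"
    and comp_ident_left: "\<lbrakk>A \<in> obj K; B \<in> obj K; f \<in> hom_set K A B\<rbrakk>
      \<Longrightarrow> composition K A B B (ident K B) f = f"
    and comp_assoc: "\<lbrakk>A \<in> obj K; B \<in> obj K; C \<in> obj K; D \<in> obj K;
        f \<in> hom_set K A B; g \<in> hom_set K B C; h \<in> hom_set K C D\<rbrakk>
      \<Longrightarrow> composition K A C D h (composition K A B C g f) = composition K A B D (composition K B C D h g) f"

locale cat_functor = source: category K + target: category L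
  for K :: "('o, 'm) cat" and L :: "('p, 'n) cat" +
  fixes Fo :: "'o \<Rightarrow> 'p" and Fm :: "'o \<Rightarrow> 'o \<Rightarrow> 'm \<Rightarrow> 'n"
  assumes obj_closed: "A \<in> obj K \<Longrightarrow> Fo A \<in> obj L"
    and mor_closed: "\<lbrakk>A \<in> obj K; B \<in> obj K; f \<in> hom_set K A B\<rbrakk>
      \<Longrightarrow> Fm A B f \<in> hom_set L (Fo A) (Fo B)"
    and mor_ident: "A \<in> obj K \<Longrightarrow> Fm A A (ident K A) = ident L (Fo A)"
    and mor_comp: "\<lbrakk>A \<in> obj K; B \<in> obj K; C \<in> obj K; f \<in> hom_set K A B; g \<in> hom_set K B C\<rbrakk>
      \<Longrightarrow> Fm A C (composition K A B C g f) = composition L (Fo A) (Fo B) (Fo C) (Fm B C g) (Fm A B f)"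


section \<open>The homotopy category and the simpltotic category\<close>

definition homotopy :: "'g monoid \<Rightarrow> ('g, 'a) galg \<Rightarrow> ('g, 'b) galg
    \<Rightarrow> (('a \<Rightarrow> 'b) \<times> ('a \<Rightarrow> 'b)) set" where
  "homotopy G A B = homotopy_rel G A B (cyl B) (ev B 0) (ev B 1)"

definition homotopy_category :: "'g monoid \<Rightarrow> (('g, 'a) galg, ('a \<Rightarrow> 'a) set) cat" where
  "homotopy_category G = \<lparr>
     obj = {A. graded_G_cstar_algebra G A},
     hom_set = \<lambda>A B. Mor G A B // homotopy G A B,
     composition = \<lambda>A B C d c. \<Union>\<psi>\<in>d. \<Union>\<phi>\<in>c. homotopy G A C `` {compose (carrier A) \<psi> \<phi>},
     ident = \<lambda>A. homotopy G A A `` {\<lambda>x\<in>carrier A. x}\<rparr>"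

text \<open>
  The element of the direct limit represented by \<open>\<phi>\<close> followed by \<open>B \<cong> Simpl o B\<close>, for \<open>\<phi> \<in> c\<close> and
  \<open>o = {(i, i)}\<close> a one-element directed set.
\<close>

definition simpltotic_of :: "'g monoid \<Rightarrow> ('g, 'a) galg \<Rightarrow> ('g, 'a) galg
    \<Rightarrow> ('a \<Rightarrow> 'a) set \<Rightarrow> ('i, 'a) germ set" where
  "simpltotic_of G A B c = {r \<in> germs G A B. \<exists>\<phi>\<in>c. \<exists>i :: 'i.
     limit_eq G A B r
       ({(i, i)}, simpl_mor_class G A B {(i, i)} (compose (carrier A) (const_simpl {(i, i)} B) \<phi>))}"

definition simpltotic_category :: "'g monoid \<Rightarrow> (('g, 'a) galg, ('i, 'a) germ set) cat" where
  "simpltotic_category G = \<lparr>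
     obj = {A. graded_G_cstar_algebra G A},
     hom_set = simpltotic_mor G,
     composition = simpltotic_comp G,
     ident = \<lambda>A. simpltotic_of G A A (homotopy G A A `` {\<lambda>x\<in>carrier A. x})\<rparr>"

text \<open>
  The types of elements of the directed sets in the simpltotic category: an arbitrary type \<open>'j\<close>,
  enlarged so as to be infinite and to contain copies of \<open>G\<close> and of all algebras over \<open>'a\<close>.
\<close>

type_synonym ('g, 'a, 'j) index = "'a \<times> 'g \<times> nat + 'j"

end

theory Submission
 imports Defs
begin

text \<open>
  A homomorphism \<open>A \<rightarrow> Simpl m B\<close> is represented by a lift \<open>f : A \<rightarrow> Cb |m| B\<close> that respects the operations
  up to terms vanishing at infinity, and homotopies are lifted in the same way. As *-homomorphisms are
  contractive, a homomorphism \<open>B \<rightarrow> Simpl n C\<close> has a norm continuous lift \<open>g\<close> (Bartle-Graves), and then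
  \<open>(x, z) \<mapsto> g (f a x) z\<close> respects the operations asymptotically along the filter on \<open>|m| \<times> |n|\<close> in which
  \<open>z\<close> has to be far out depending on the simplex of \<open>x\<close>. The composition product is the pullback of this
  lift along a map into the product that tends to infinity. Since the sets of the filter are contractible
  compatibly with the simplices, any two such maps become homotopic over a common refinement of their
  directed sets. This yields the independence of choices, the unit laws and, comparing two maps into a
  triple product, associativity. Finally, a lift is subject to so few asymptotic conditions that every
  germ has a representative over the index type.
\<close>

text \<open>A mere choice of representatives \<open>g b\<close> would not do for the outer
  homomorphism: \<open>x\<close> runs through simplices, so \<open>g (f a x) z\<close> has to be
  continuous in \<open>x\<close>, and the rate at which \<open>g\<close> becomes compatible with the
  operations has to be uniform for \<open>b\<close> in the compact set of values of
  \<open>f a\<close> on a simplex. Continuity of \<open>g\<close> and compactness give this for one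
  simplex at a time, never for all of them; hence the second variable waits for the simplex of the
  first, and \<open>m ## n\<close> contains a function on simplices. For the same reason
  contractions of the tails first push the second variable far out and only then move the first one,
  whose simplex may change. Homomorphisms must be contractive also for targets such as
  \<open>Ca X F B\<close>; the proof uses completeness of the source alone, so no completeness of
  asymptotic algebras is established. In HOL every refinement and every \<open>##\<close> enlarges
  the index type. Witnesses of equality in the limit therefore have a type of their own, and lifts
  and homotopies with few conditions are shrunk to an infinite type fixed in advance, over which
  equality becomes transitive.\<close>

abbreviation (input) lim_to (infixr "--->" 55) where "f ---> l == tendsto f l"
abbreviation (input) sharp_ascii (infixr "##" 75) where "m ## n == m \<sharp> n"

lemmas sx_def = simplices_def
lemmas cont_prod = continuous_on_Pair continuous_on_fst continuous_on_snd continuous_on_id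

type_synonym 'v pt = "'v=>real"

abbreviation (input) "rl == realization"
abbreviation (input) "spx == simplices"
abbreviation (input) "ntop == norm_topology"
abbreviation (input) "cmap == continuous_map"
abbreviation (input) "con_on == continuous_on"
abbreviation (input) "cA == carrier"
abbreviation (input) "tsp == topspace"
abbreviation (input) "tos == top_of_set"
abbreviation (input) "dset == directed_set"
abbreviation (input) "clA == Ca_class"
abbreviation (input) "cpx == complex_of_real"
abbreviation (input) "rtop == realization_topology"
abbreviation (input) "sfil == simplex_filter"
abbreviation (input) "aff == affine_map"
abbreviation (input) "Fd == Field"
abbreviation (input) "htpy_cat == homotopy_category"
abbreviation (input) "scmp == simpltotic_comp"
abbreviation (input) "bdry == boundary"

abbreviation (input) Iff (infixr "<->" 25) where "A <-> B == A = B"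

section \<open>Normed algebras with the C*-identity\<close>

text \<open>The form in which the axioms of \<open>cstar_algebra\<close> are transferred to
  \<open>Cb X A\<close> and to the quotients \<open>Ca X F A\<close>. Completeness is kept apart; it
  enters only where a limit has to exist, as in \<open>circle_solution\<close> and
  \<open>cont_lift\<close>.\<close>

locale pre_cstar = fixes A::"('g, 'a) galg" assumes zero_closed [simp]: "czero A:cA A" and add_closed [simp]: "[|x:cA A; y:cA A|]==>cadd A x y:cA A"
  and scale_closed [simp]: "x:cA A==>cscale A c x:cA A" and mult_closed [simp]: "[|x:cA A; y:cA A|]==>cmult A x y:cA A"
  and star_closed [simp]: "x:cA A==>cstar A x:cA A" and add_assoc: "[|x:cA A; y:cA A; z:cA A|] ==>cadd A (cadd A x y) z = cadd A x (cadd A y z)"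
  and add_commute: "[|x:cA A; y:cA A|]==>cadd A x y = cadd A y x" and add_zero [simp]: "x:cA A==>cadd A x (czero A) = x"
  and minus_self [simp]: "x:cA A==>cminus A x x = czero A" and scale_one [simp]: "x:cA A==>cscale A 1 x = x"
  and scale_scale [simp]: "x:cA A==>cscale A c (cscale A d x) = cscale A (c * d) x" and scale_add_right: "[|x:cA A; y:cA A|]
  ==>cscale A c (cadd A x y) = cadd A (cscale A c x) (cscale A c y)" and scale_add_left: "x:cA A ==>cscale A (c + d) x = cadd A (cscale A c x) (cscale A d x)"
  and mult_assoc: "[|x:cA A; y:cA A; z:cA A|] ==>cmult A (cmult A x y) z = cmult A x (cmult A y z)" and mult_add_right: "[|x:cA A; y:cA A; z:cA A|]
  ==>cmult A x (cadd A y z) = cadd A (cmult A x y) (cmult A x z)" and mult_add_left: "[|x:cA A; y:cA A; z:cA A|]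
  ==>cmult A (cadd A x y) z = cadd A (cmult A x z) (cmult A y z)" and mult_scale_left: "[|x:cA A; y:cA A|]
  ==>cmult A (cscale A c x) y = cscale A c (cmult A x y)" and mult_scale_right: "[|x:cA A; y:cA A|] ==>cmult A x (cscale A c y) = cscale A c (cmult A x y)"
  and star_star [simp]: "x:cA A==>cstar A (cstar A x) = x" and star_add: "[|x:cA A; y:cA A|] ==>cstar A (cadd A x y) = cadd A (cstar A x) (cstar A y)"
  and star_scale: "x:cA A==>cstar A (cscale A c x) = cscale A (cnj c) (cstar A x)" and star_mult: "[|x:cA A; y:cA A|]
  ==>cstar A (cmult A x y) = cmult A (cstar A y) (cstar A x)" and norm_nonneg [simp]: "x:cA A==>0 <= cnorm A x"
  and norm_eq_zero: "x:cA A==>cnorm A x = 0 <-> x = czero A" and norm_triangle: "[|x:cA A; y:cA A|] ==>cnorm A (cadd A x y) <= cnorm A x + cnorm A y"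
  and norm_scale: "x:cA A==>cnorm A (cscale A c x) = cmod c * cnorm A x" and norm_mult: "[|x:cA A; y:cA A|] ==>cnorm A (cmult A x y) <= cnorm A x * cnorm A y"
  and norm_star_mult: "x:cA A==>cnorm A (cmult A (cstar A x) x) = (cnorm A x)\<^sup>2"

lemma cstar_algebra_pre_cstar: "cstar_algebra A==>pre_cstar A" unfolding cstar_algebra_def pre_cstar_def by(elim conjE; intro conjI; assumption)

lemma cstar_algebra_iff: "cstar_algebra A <-> pre_cstar A & Metric_space.mcomplete (cA A) (cdist A)" unfolding cstar_algebra_def pre_cstar_def
 by(rule iffI; elim conjE; intro conjI; assumption)

context pre_cstar
begin

lemma add_zero_left [simp]: "x:cA A==>cadd A (czero A) x = x" by(simp add: add_commute)

lemma add_left_comm: "[|x:cA A; y:cA A; z:cA A|] ==>cadd A x (cadd A y z) = cadd A y (cadd A x z)" by(metis add_assoc add_commute)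

lemmas add_ac = add_assoc add_commute add_left_comm

lemma sc_zero [simp]: "x:cA A==>cscale A 0 x = czero A" using scale_add_left[of x 1 "-1"] minus_self[of x] by(simp add: cminus_def)

lemma sc_zero_right [simp]: "cscale A c (czero A) = czero A" using scale_scale[of "czero A" c 0] sc_zero[of "czero A"] by simp

lemma add_inverse [simp]: "x:cA A==>cadd A x (cscale A (-1) x) = czero A" using minus_self by(simp add: cminus_def)

lemma add_inverse_left [simp]: "x:cA A==>cadd A (cscale A (-1) x) x = czero A" by(subst add_commute) auto

lemma add_cancel [simp]: "[|x:cA A; y:cA A|]==>cadd A x (cadd A (cscale A (-1) x) y) = y"
 "[|x:cA A; y:cA A|]==>cadd A (cscale A (-1) x) (cadd A x y) = y" by(metis add_assoc add_inverse add_zero_left scale_closed)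
  (metis add_assoc add_inverse_left add_zero_left scale_closed)

lemma mi_closed [simp]: "[|x:cA A; y:cA A|]==>cminus A x y:cA A" by(simp add: cminus_def)

lemma mi_zero [simp]: "x:cA A==>cminus A x (czero A) = x" by(simp add: cminus_def)

lemma mi_swap: "[|x:cA A; y:cA A|]==>cminus A y x = cscale A (-1) (cminus A x y)" by(simp add: cminus_def scale_add_right add_ac)

lemma mi_trans: "[|x:cA A; y:cA A; z:cA A|] ==>cadd A (cminus A x y) (cminus A y z) = cminus A x z" by(simp add: cminus_def add_assoc)

lemma add_mi_cancel [simp]:
 "[|x:cA A; y:cA A|]==>cadd A y (cminus A x y) = x" by(metis add_zero_left cminus_def add_left_comm add_inverse add_zero scale_closed)

lemma mi_eq_zero_iff: "[|x:cA A; y:cA A|]==>cminus A x y = czero A <-> x = y" by(metis add_mi_cancel add_zero minus_self)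

lemma add_mi_add: "[|x:cA A; y:cA A; x':cA A; y':cA A|]
 ==>cminus A (cadd A x y) (cadd A x' y') = cadd A (cminus A x x') (cminus A y y')" by(simp add: cminus_def scale_add_right add_ac)

lemma sc_mi: "[|x:cA A; y:cA A|] ==>cminus A (cscale A c x) (cscale A c y) = cscale A c (cminus A x y)" by(simp add: cminus_def scale_add_right mult.commute)

lemma sc_mi_left: "x:cA A==>cminus A (cscale A c x) (cscale A d x) = cscale A (c - d) x" using scale_add_left[of x c "-d"] by(simp add: cminus_def)

lemma mult_mi: "[|x:cA A; y:cA A; x':cA A; y':cA A|] ==>cminus A (cmult A x y) (cmult A x' y')
  = cadd A (cmult A (cminus A x x') y) (cmult A x' (cminus A y y'))"
 by(simp add: cminus_def mult_add_left mult_add_right mult_scale_left mult_scale_right add_ac)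

lemma star_mi: "[|x:cA A; y:cA A|] ==>cminus A (cstar A x) (cstar A y) = cstar A (cminus A x y)" by(simp add: cminus_def star_add star_scale)

lemma norm_zero [simp]: "cnorm A (czero A) = 0" by(simp add: norm_eq_zero)

lemma norm_star [simp]: assumes x: "x:cA A" shows "cnorm A (cstar A x) = cnorm A x"
proof -
 have le: "cnorm A z <= cnorm A (cstar A z)" if "z:cA A" for z
 proof(cases "cnorm A z = 0")
  case False
  have "cnorm A z * cnorm A z <= cnorm A (cstar A z) * cnorm A z" using norm_star_mult[of z] norm_mult[of "cstar A z" z] that by(simp add: power2_eq_square)
  thus ?thesis using False norm_nonneg[OF that] by simp
 qed (use that in simp)
 show ?thesis using le[of x] le[of "cstar A x"] x by simp
qed

lemma cdist_eq: "[|x:cA A; y:cA A|]==>cdist A x y = cnorm A (cminus A x y)" by(simp add: cdist_def)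

lemma cdist_ge0 [simp]: "0 <= cdist A x y" by(simp add: cdist_def)

lemma cdist_comm: "cdist A x y = cdist A y x" by(auto simp: cdist_def mi_swap[of x y] norm_scale)

lemma cdist_tri: "[|x:cA A; y:cA A; z:cA A|]==>cdist A x z <= cdist A x y + cdist A y z"
 using norm_triangle[of "cminus A x y" "cminus A y z"] by(simp add: cdist_def mi_trans)

lemma cdist_eq_0_iff: "[|x:cA A; y:cA A|]==>cdist A x y = 0 <-> x = y" by(simp add: cdist_def norm_eq_zero mi_eq_zero_iff)

lemma cdist_self [simp]: "cdist A x x = 0" by(simp add: cdist_def)

lemma cdist_zero [simp]: "x:cA A==>cdist A x (czero A) = cnorm A x" by(simp add: cdist_def)

lemma metric: "Metric_space (cA A) (cdist A)" by unfold_locales (auto simp: cdist_tri cdist_eq_0_iff intro: cdist_comm)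

lemma tsp_norm_topology [simp]: "tsp (ntop A) = cA A" by(simp add: norm_topology_def Metric_space.topspace_mtopology[OF metric])

lemma norm_le: "[|x:cA A; y:cA A|]==>cnorm A x <= cnorm A y + cdist A x y" using cdist_tri[of x y "czero A"] by simp

lemma norm_diff: "[|x:cA A; y:cA A|]==>\<bar>cnorm A x - cnorm A y\<bar> <= cdist A x y" using norm_le[of x y] norm_le[of y x] by(simp add: cdist_comm[of y x])

lemma cdist_add: "[|x:cA A; y:cA A; x':cA A; y':cA A|] ==>cdist A (cadd A x y) (cadd A x' y') <= cdist A x x' + cdist A y y'"
 using norm_triangle[of "cminus A x x'" "cminus A y y'"] by(simp add: cdist_def add_mi_add)

text \<open>Adding the correction \<open>b - c\<close> moves an element by at most the distance of
  \<open>b\<close> and \<open>c\<close>. This is what allows two homotopies with merely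
  asymptotically equal ends to be joined in \<open>ahom_trans\<close>.\<close>

lemma cdist_shift: assumes "x:cA A" "b:cA A" "c:cA A" shows "cdist A x (cadd A b (cminus A x c)) <= cdist A b c"
 using cdist_add[of c "cminus A x c" b "cminus A x c"] add_commute[of c "cminus A x c"] assms by(simp add: cdist_comm)

lemma cdist_sc: "[|x:cA A; y:cA A|] ==>cdist A (cscale A c x) (cscale A c y) = cmod c * cdist A x y" by(simp add: cdist_def sc_mi norm_scale)

lemma cdist_sc_left: "x:cA A==>cdist A (cscale A c x) (cscale A d x) = cmod (c - d) * cnorm A x" by(simp add: cdist_def sc_mi_left norm_scale)

lemma cdist_sc2: "[|x:cA A; y:cA A|] ==>cdist A (cscale A c x) (cscale A d y) <= cmod c * cdist A x y + cmod (c - d) * cnorm A y"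
 using cdist_tri[of "cscale A c x" "cscale A c y" "cscale A d y"] by(simp add: cdist_sc cdist_sc_left)

lemma cdist_mult: assumes "x:cA A" "y:cA A" "x':cA A" "y':cA A"
 shows "cdist A (cmult A x y) (cmult A x' y') <= cdist A x x' * cnorm A y + cnorm A x' * cdist A y y'"
proof -
 have "cdist A (cmult A x y) (cmult A x' y')
  <= cnorm A (cmult A (cminus A x x') y) + cnorm A (cmult A x' (cminus A y y'))" using assms by(simp add: cdist_def mult_mi norm_triangle)
 also have "\<dots> <= cdist A x x' * cnorm A y + cnorm A x' * cdist A y y'" using assms by(intro add_mono) (simp_all add: cdist_def norm_mult)
 finally show ?thesis .
qed

lemma cdist_star: "[|x:cA A; y:cA A|]==>cdist A (cstar A x) (cstar A y) = cdist A x y" by(simp add: cdist_def star_mi)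

lemma cmap_ntop: "cmap T (ntop A) f <-> (ALL x:tsp T. f x:cA A) & (ALL x:tsp T. ((%y. cdist A (f y) (f x)) ---> 0) (atin T x))"
proof -
 interpret M: Metric_space "cA A" "cdist A" by(rule metric)
 have *: "limitin M.mtopology f (f x) (atin T x) <->
  f x:cA A & ((%y. cdist A (f y) (f x)) ---> 0) (atin T x)" if "x:tsp T" "ALL x:tsp T. f x:cA A" for x
  using that by(auto simp: M.limitin_metric_dist_null eventually_atin)
 show ?thesis
 proof
  assume c: "cmap T (ntop A) f"
  hence "ALL x:tsp T. f x:cA A" by(auto simp: continuous_map_def Pi_iff)
  thus "(ALL x:tsp T. f x:cA A) & (ALL x:tsp T. ((%y. cdist A (f y) (f x)) ---> 0) (atin T x))" using c * by(simp add: continuous_map_atin norm_topology_def)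
 next
  assume "(ALL x:tsp T. f x:cA A) & (ALL x:tsp T. ((%y. cdist A (f y) (f x)) ---> 0) (atin T x))"
  thus "cmap T (ntop A) f" using * by(simp add: continuous_map_atin norm_topology_def)
 qed
qed

lemma cont_map_norm_topology_open: "cmap T (ntop A) f <-> (ALL x:tsp T. f x:cA A) &
  (ALL x:tsp T. ALL ep>0. EX U. openin T U & x:U & (ALL y:U. cdist A (f y) (f x) < ep))"
proof -
 interpret M: Metric_space "cA A" "cdist A" by(rule metric)
 show ?thesis (is "_ <-> ?C & ?R")
 proof
  assume "cmap T (ntop A) f"
  hence c: "cmap T M.mtopology f" by(simp add: norm_topology_def)
  hence ?C by(auto simp: continuous_map_def Pi_iff)
  moreover have ?R using c unfolding M.continuous_map_to_metric by(metis M.in_mball cdist_comm)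
  ultimately show "?C & ?R" by blast
 next
  assume *: "?C & ?R"
  have "cmap T M.mtopology f" unfolding M.continuous_map_to_metric
  proof(intro ballI allI impI)
  fix x and ep::real assume x: "x:tsp T" "0 < ep"
  then obtain U where U: "openin T U" "x:U" "ALL y:U. cdist A (f y) (f x) < ep" using * by blast
  hence "ALL y:U. f y:M.mball (f x) ep" using * x(1) openin_subset[OF U(1)] by(auto simp: cdist_comm)
  with U show "EX U. openin T U & x:U & (ALL y:U. f y:M.mball (f x) ep)" by blast
  qed
  thus "cmap T (ntop A) f" by(simp add: norm_topology_def)
 qed
qed

lemma cont_map_norm: assumes "cmap T (ntop A) f" shows "cmap T euclideanreal (%x. cnorm A (f x))" unfolding continuous_map_atin
proof
 fix x assume x: "x:tsp T"
 have "((%y. cnorm A (f y) - cnorm A (f x)) ---> 0) (atin T x)"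
 proof(rule Lim_null_comparison)
  show "((%y. cdist A (f y) (f x)) ---> 0) (atin T x)" using assms x by(simp add: cmap_ntop)
  have "f y:cA A" if "y:tsp T" for y using assms that by(simp add: cmap_ntop)
  thus "\<forall>\<^sub>F y in atin T x. norm (cnorm A (f y) - cnorm A (f x)) <= cdist A (f y) (f x)"
  using x norm_diff by(auto simp: eventually_atin intro!: exI[of _ "tsp T"])
 qed
 thus "limitin euclideanreal (%x. cnorm A (f x)) (cnorm A (f x)) (atin T x)" by(simp add: LIM_zero_iff)
qed

end


section \<open>The operations of an algebra\<close>

text \<open>\<open>opn A o x y\<close> ignores \<open>y\<close> if \<open>o\<close> is unary.\<close>

datatype 'g opc = Add | Scale complex | Mult | Star | Grade | Act 'g

fun opn::"('g, 'a) galg=>'g opc=>'a=>'a=>'a" where "opn A Add x y = cadd A x y" | "opn A (Scale c) x y = cscale A c x" | "opn A Mult x y = cmult A x y"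
| "opn A Star x y = cstar A x" | "opn A Grade x y = grade A x" | "opn A (Act g) x y = act A g x"

text \<open>Treating every scalar and every group element as an operation of its own makes a
  morphism just a map that commutes with all \<open>opn\<close>. The zero is covered by
  \<open>Scale 0\<close>.\<close>

definition opcs::"'g monoid=>'g opc set" where "opcs G = {Add, Mult, Star, Grade} Un range Scale Un Act ` cA G"

lemma Mor_iff: "f:Mor G A B <-> f:extensional (cA A) & f:cA A \<rightarrow> cA B &
  (ALL q:opcs G. ALL x:cA A. ALL y:cA A. f (opn A q x y) = opn B q (f x) (f y))" unfolding Mor_def star_hom_def opcs_def by(auto simp: ball_Un)

text \<open>Grading and action are recorded through closure, contractivity and the value at zero,
  all of which pass to \<open>Cb\<close> and \<open>Ca\<close> by pointwise estimates. For a graded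
  \<open>G\<close>-C*-algebra contractivity comes from \<open>sthom_contr\<close>, see
  \<open>graded_calg\<close>.\<close>

locale gpre = pre_cstar A for G::"'g monoid" and A::"('g, 'a) galg" + assumes grade_closed [simp]: "x:cA A==>grade A x:cA A"
  and act_closed [simp]: "[|g:cA G; x:cA A|]==>act A g x:cA A" and cdist_grade: "[|x:cA A; y:cA A|] ==>cdist A (grade A x) (grade A y) <= cdist A x y"
  and cdist_act: "[|g:cA G; x:cA A; y:cA A|] ==>cdist A (act A g x) (act A g y) <= cdist A x y" and grade_zero [simp]: "grade A (czero A) = czero A"
  and act_zero [simp]: "g:cA G==>act A g (czero A) = czero A"
begin

lemma opn_closed [simp]: "[|q:opcs G; x:cA A; y:cA A|]==>opn A q x y:cA A" by(auto simp: opcs_def)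

lemma norm_grade: "x:cA A==>cnorm A (grade A x) <= cnorm A x" using cdist_grade[of x "czero A"] by simp

lemma norm_act: "[|g:cA G; x:cA A|]==>cnorm A (act A g x) <= cnorm A x" using cdist_act[of g x "czero A"] by simp

end

fun opn_const::"'g opc=>real=>real" where "opn_const (Scale c) K = cmod c" | "opn_const Mult K = K" | "opn_const _ K = 1"

context gpre
begin

text \<open>One Lipschitz estimate for all operations. Only multiplication depends on
  \<open>K\<close>; that the bound is on \<open>y\<close> and \<open>x'\<close> comes from
  \<open>x y - x' y' = (x - x') y + x' (y - y')\<close>.\<close>

lemma cdist_opn: assumes q: "q:opcs G" and x: "x:cA A" "y:cA A" "x':cA A" "y':cA A" and K: "cnorm A y <= K" "cnorm A x' <= K"
 shows "cdist A (opn A q x y) (opn A q x' y') <= opn_const q K * (cdist A x x' + cdist A y y')"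
proof(cases q)
 case Mult
 have "cdist A x x' * cnorm A y + cnorm A x' * cdist A y y' <= cdist A x x' * K + K * cdist A y y'"
  using K by(intro add_mono mult_mono) (use x in "auto intro: order_trans[OF norm_nonneg]")
 thus ?thesis using cdist_mult[of x y x' y'] x Mult by(simp add: algebra_simps)
next
 case (Scale c)
 thus ?thesis using x by(simp add: cdist_sc distrib_left)
next
 case Add
 thus ?thesis using cdist_add x by simp
next
 case Star
 thus ?thesis using x by(simp add: cdist_star)
next
 case Grade
 thus ?thesis using cdist_grade[of x x'] x cdist_ge0[of y y'] by(simp add: add_increasing2)
next
 case (Act g)
 hence "g:cA G" using q by(auto simp: opcs_def)
 thus ?thesis using Act cdist_act[of g x x'] x cdist_ge0[of y y'] by(simp add: add_increasing2)
qed

lemma opn_const_ge0: "0 <= K==>0 <= opn_const q K" by(cases q) auto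

lemma norm_opn: assumes q: "q:opcs G" and x: "x:cA A" "y:cA A" and K: "cnorm A y <= K" "0 <= K"
 shows "cnorm A (opn A q x y) <= opn_const q K * (cnorm A x + cnorm A y)"
proof -
 have "opn A q (czero A) (czero A) = czero A" using q mult_scale_left[of "czero A" "czero A" 0] star_scale[of "czero A" 0] by(cases q) (auto simp: opcs_def)
 thus ?thesis using cdist_opn[OF q x, of "czero A" "czero A" K] assms by simp
qed

lemma cont_map_opn: assumes q: "q:opcs G" and f: "cmap T (ntop A) f" and g: "cmap T (ntop A) g"
 shows "cmap T (ntop A) (%x. opn A q (f x) (g x))" unfolding cmap_ntop
proof(intro conjI ballI)
 have car: "f x:cA A" "g x:cA A" if "x:tsp T" for x using f g that by(auto simp: cmap_ntop)
 thus "opn A q (f x) (g x):cA A" if "x:tsp T" for x using that q by simp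
 fix x assume x: "x:tsp T"
 define K where "K = max (cnorm A (f x)) (cnorm A (g x) + 1)"
 have lim: "((%y. cdist A (f y) (f x)) ---> 0) (atin T x)" "((%y. cdist A (g y) (g x)) ---> 0) (atin T x)" using f g x by(auto simp: cmap_ntop)
 have ev: "\<forall>\<^sub>F y in atin T x. y:tsp T" using x by(auto simp: eventually_atin)
 show "((%y. cdist A (opn A q (f y) (g y)) (opn A q (f x) (g x))) ---> 0) (atin T x)"
 proof(rule Lim_null_comparison)
  show "((%y. opn_const q K * (cdist A (f y) (f x) + cdist A (g y) (g x))) ---> 0) (atin T x)" using lim by(auto intro!: tendsto_eq_intros)
  have "\<forall>\<^sub>F y in atin T x. cdist A (g y) (g x) < 1" using order_tendstoD(2)[OF lim(2), of 1] by simp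
  with ev show "\<forall>\<^sub>F y in atin T x. norm (cdist A (opn A q (f y) (g y)) (opn A q (f x) (g x)))
  <= opn_const q K * (cdist A (f y) (f x) + cdist A (g y) (g x))"
  proof eventually_elim
  case (elim y)
  hence "cnorm A (g y) <= K" using norm_le[of "g y" "g x"] car x by(simp add: K_def)
  thus ?case using cdist_opn[OF q, of "f y" "g y" "f x" "g x" K] car x elim by(simp add: K_def)
  qed
 qed
qed

end

section \<open>Bounded continuous functions\<close>

lemma cA_Cb: "f:cA (Cb X B) <-> f:extensional (tsp X) &
  cmap X (ntop B) f & (EX K. ALL x:tsp X. cnorm B (f x) <= K)" by(simp add: Cb_def)

lemma opn_Cb: "opn (Cb X B) q f g = (\<lambda>x\<in>tsp X. opn B q (f x) (g x))" by(cases q) (auto simp: Cb_def)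

lemma czero_Cb: "czero (Cb X B) = (\<lambda>x\<in>tsp X. czero B)" by(simp add: Cb_def)

lemma cnorm_Cb: "cnorm (Cb X B) f = Sup (insert 0 ((%x. cnorm B (f x)) ` tsp X))" by(simp add: Cb_def)

lemma Cb_simps: "cadd (Cb X B) f g = (\<lambda>x\<in>tsp X. cadd B (f x) (g x))" "cscale (Cb X B) c f = (\<lambda>x\<in>tsp X. cscale B c (f x))"
 "cmult (Cb X B) f g = (\<lambda>x\<in>tsp X. cmult B (f x) (g x))" "cstar (Cb X B) f = (\<lambda>x\<in>tsp X. cstar B (f x))"
 "grade (Cb X B) f = (\<lambda>x\<in>tsp X. grade B (f x))" "act (Cb X B) h f = (\<lambda>x\<in>tsp X. act B h (f x))" by(simp_all add: Cb_def)

lemma cmi_Cb: "cminus (Cb X B) f g = (\<lambda>x\<in>tsp X. cminus B (f x) (g x))" by(auto simp: cminus_def Cb_simps)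

lemma Cb_ext: "[|f:cA (Cb X B); g:cA (Cb X B'); !!x. x:tsp X==>f x = g x|]==>f = g" by(auto simp: cA_Cb intro: extensionalityI)

context pre_cstar
begin

lemma Cb_val [simp]: "[|f:cA (Cb X A); x:tsp X|]==>f x:cA A" by(auto simp: cA_Cb cmap_ntop)

lemma Cb_bdd: "f:cA (Cb X A)==>bdd_above (insert 0 ((%x. cnorm A (f x)) ` tsp X))"
proof -
 assume "f:cA (Cb X A)"
 then obtain K where "ALL x:tsp X. cnorm A (f x) <= K" by(auto simp: cA_Cb)
 thus ?thesis unfolding bdd_above_def by(intro exI[of _ "max 0 K"]) (auto simp: le_max_iff_disj)
qed

lemma nval_le: "[|f:cA (Cb X A); x:tsp X|]==>cnorm A (f x) <= cnorm (Cb X A) f" unfolding cnorm_Cb by(rule cSup_upper[OF _ Cb_bdd]) auto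

lemma norm_Cb_ge0: "f:cA (Cb X A)==>0 <= cnorm (Cb X A) f" unfolding cnorm_Cb by(rule cSup_upper[OF _ Cb_bdd]) auto

lemma norm_Cb_le_iff: "[|f:cA (Cb X A); 0 <= K|]==>cnorm (Cb X A) f <= K <-> (ALL x:tsp X. cnorm A (f x) <= K)"
 unfolding cnorm_Cb by(subst cSup_le_iff[OF _ Cb_bdd]) auto

lemma norm_Cb_leI: "[|0 <= K; !!x. x:tsp X==>cnorm A (f x) <= K|]==>cnorm (Cb X A) f <= K" unfolding cnorm_Cb by(rule cSup_least) auto

end

context gpre
begin

lemma Cb_opn_closed: assumes q: "q:opcs G" and f: "f:cA (Cb X A)" and g: "g:cA (Cb X A)" shows "opn (Cb X A) q f g:cA (Cb X A)"
proof -
 obtain K where K: "!!x. x:tsp X==>cnorm A (f x) <= K" using f by(auto simp: cA_Cb)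
 obtain L where L: "!!x. x:tsp X==>cnorm A (g x) <= L" using g by(auto simp: cA_Cb)
 have "cnorm A (opn A q (f x) (g x)) <= opn_const q (max 0 L) * (max 0 K + max 0 L)" if x: "x:tsp X" for x
 proof -
  have "cnorm A (opn A q (f x) (g x)) <= opn_const q (max 0 L) * (cnorm A (f x) + cnorm A (g x))"
  using norm_opn[OF q, of "f x" "g x" "max 0 L"] f g x L[OF x] by simp
  also have "\<dots> <= opn_const q (max 0 L) * (max 0 K + max 0 L)" using K[OF x] L[OF x] by(intro mult_left_mono add_mono opn_const_ge0) auto
  finally show ?thesis .
 qed
 moreover have "cmap X (ntop A) (%x. opn A q (f x) (g x))" using f g by(intro cont_map_opn[OF q]) (auto simp: cA_Cb)
 ultimately show ?thesis unfolding opn_Cb cA_Cb by auto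
qed

lemma Cb_closed: "[|f:cA (Cb X A); g:cA (Cb X A)|]==>cadd (Cb X A) f g:cA (Cb X A)" "f:cA (Cb X A)==>cscale (Cb X A) c f:cA (Cb X A)"
 "[|f:cA (Cb X A); g:cA (Cb X A)|]==>cmult (Cb X A) f g:cA (Cb X A)" "f:cA (Cb X A)==>cstar (Cb X A) f:cA (Cb X A)"
 "f:cA (Cb X A)==>grade (Cb X A) f:cA (Cb X A)" "[|h:cA G; f:cA (Cb X A)|]==>act (Cb X A) h f:cA (Cb X A)"
 using Cb_opn_closed[of Add f X g] Cb_opn_closed[of "Scale c" f X f] Cb_opn_closed[of Mult f X g]
  Cb_opn_closed[of Star f X f] Cb_opn_closed[of Grade f X f] Cb_opn_closed[of "Act h" f X f] by(auto simp: opcs_def)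

lemma Cb_const: "a:cA A==>(\<lambda>x\<in>tsp X. a):cA (Cb X A)" by(auto simp: cA_Cb)

lemma Cb_gpre: "gpre G (Cb X A)"
proof -
 let ?C = "Cb X A"
 have cmem: "cminus ?C f g:cA ?C" if "f:cA ?C" "g:cA ?C" for f g using that by(simp add: cminus_def Cb_closed)
 have zero: "czero ?C:cA ?C" by(simp add: czero_Cb Cb_const)
 have norm0: "cnorm ?C f = 0 <-> f = czero ?C" if f: "f:cA ?C" for f
 proof
  assume "cnorm ?C f = 0"
  hence "ALL x:tsp X. cnorm A (f x) <= 0" using norm_Cb_le_iff[of f X 0] f by simp
  hence "ALL x:tsp X. f x = czero A" using f by(metis Cb_val norm_eq_zero norm_nonneg order_antisym)
  thus "f = czero ?C" using f zero by(intro Cb_ext) (auto simp: czero_Cb)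
 next
  assume "f = czero ?C"
  thus "cnorm ?C f = 0" using norm_Cb_le_iff[of f X 0] norm_Cb_ge0[of f X] f by(auto simp: czero_Cb)
 qed
 have tri: "cnorm ?C (cadd ?C f g) <= cnorm ?C f + cnorm ?C g" if f: "f:cA ?C" "g:cA ?C" for f g
 proof(rule norm_Cb_leI)
  fix x assume x: "x:tsp X"
  thus "cnorm A (cadd ?C f g x) <= cnorm ?C f + cnorm ?C g" using norm_triangle[of "f x" "g x"] f nval_le[OF f(1) x] nval_le[OF f(2) x] by(simp add: Cb_simps)
 qed (use f in "simp add: norm_Cb_ge0")
 have scl: "cnorm ?C (cscale ?C c f) <= cmod c * cnorm ?C f" if f: "f:cA ?C" for f c
 proof(rule norm_Cb_leI)
  fix x assume x: "x:tsp X"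
  thus "cnorm A (cscale ?C c f x) <= cmod c * cnorm ?C f" using f nval_le[OF f(1) x] by(simp add: Cb_simps norm_scale mult_left_mono)
 qed (use f in "simp add: norm_Cb_ge0")
 have sc: "cnorm ?C (cscale ?C c f) = cmod c * cnorm ?C f" if f: "f:cA ?C" for f c
 proof(cases "c = 0")
  case True
  thus ?thesis using scl[OF f, of c] norm_Cb_ge0[of "cscale ?C c f" X] f by(simp add: Cb_closed)
 next
  case False
  \<comment> \<open>The estimate \<open>scl\<close> for the inverse scalar gives the opposite
    inequality.\<close>
  have "cscale ?C (inverse c) (cscale ?C c f) = f" using f False by(intro Cb_ext[of _ X A _ A]) (auto simp: Cb_closed, simp add: Cb_simps)
  hence "cnorm ?C f <= inverse (cmod c) * cnorm ?C (cscale ?C c f)" using scl[of "cscale ?C c f" "inverse c"] f by(simp add: Cb_closed norm_inverse)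
  hence "cmod c * cnorm ?C f <= cmod c * (inverse (cmod c) * cnorm ?C (cscale ?C c f))" by(intro mult_left_mono) auto
  thus ?thesis using scl[OF f, of c] False by(simp flip: mult.assoc)
 qed
 have ml: "cnorm ?C (cmult ?C f g) <= cnorm ?C f * cnorm ?C g" if f: "f:cA ?C" "g:cA ?C" for f g
 proof(rule norm_Cb_leI)
  fix x assume x: "x:tsp X"
  have "cnorm A (f x) * cnorm A (g x) <= cnorm ?C f * cnorm ?C g" using nval_le[OF f(1) x] nval_le[OF f(2) x] f x by(intro mult_mono) (auto simp: norm_Cb_ge0)
  thus "cnorm A (cmult ?C f g x) <= cnorm ?C f * cnorm ?C g" using norm_mult[of "f x" "g x"] f x by(simp add: Cb_simps)
 qed (use f in "simp add: norm_Cb_ge0")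
 have st: "cnorm ?C (cmult ?C (cstar ?C f) f) = (cnorm ?C f)\<^sup>2" if f: "f:cA ?C" for f
 proof(rule order_antisym)
  let ?n = "cnorm ?C (cmult ?C (cstar ?C f) f)"
  have val: "cmult ?C (cstar ?C f) f x = cmult A (cstar A (f x)) (f x)" if "x:tsp X" for x using that by(simp add: Cb_simps)
  have "cnorm A (f x) <= sqrt ?n" if x: "x:tsp X" for x using nval_le[of "cmult ?C (cstar ?C f) f" X x] f x
  by(intro real_le_rsqrt) (simp add: Cb_closed val norm_star_mult)
  hence "cnorm ?C f <= sqrt ?n" using f by(subst norm_Cb_le_iff) (auto simp: norm_Cb_ge0 Cb_closed)
  thus "(cnorm ?C f)\<^sup>2 <= ?n" using f norm_Cb_ge0[OF f] by(metis norm_Cb_ge0 Cb_closed(3,4) power_mono real_sqrt_pow2)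
  show "?n <= (cnorm ?C f)\<^sup>2"
  proof(rule norm_Cb_leI)
  fix x assume x: "x:tsp X"
  thus "cnorm A (cmult ?C (cstar ?C f) f x) <= (cnorm ?C f)\<^sup>2" using f nval_le[OF f x] by(simp add: val norm_star_mult power_mono)
  qed simp
 qed
 have cd: "cdist ?C f g <= K" if "f:cA ?C" "g:cA ?C" "0 <= K"
  "!!x. x:tsp X==>cdist A (f x) (g x) <= K" for f g K using that cmem[of f g] by(auto simp: cdist_def norm_Cb_le_iff cmi_Cb)
 have dc: "cdist A (f x) (g x) <= cdist ?C f g" if "f:cA ?C" "g:cA ?C" "x:tsp X" for f g x using that nval_le[OF cmem, of f g x] by(auto simp: cdist_def cmi_Cb)
 have cd0: "0 <= cdist ?C f g" for f g by(auto simp: cdist_def cmem norm_Cb_ge0)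
 show ?thesis
 proof unfold_locales
  show "cdist ?C (grade ?C f) (grade ?C g) <= cdist ?C f g" if "f:cA ?C" "g:cA ?C" for f g
  using that by(intro cd cd0) (auto simp: Cb_closed Cb_closed[unfolded Cb_simps] Cb_simps
  intro: order_trans[OF cdist_grade dc])
  show "cdist ?C (act ?C h f) (act ?C h g) <= cdist ?C f g" if "h:cA G" "f:cA ?C" "g:cA ?C" for f g h
  using that by(intro cd cd0) (auto simp: Cb_closed Cb_closed[unfolded Cb_simps] Cb_simps
  intro: order_trans[OF cdist_act dc])
 qed (auto simp: Cb_closed norm0 tri sc ml st norm_Cb_ge0 zero cmem
  intro!: Cb_ext[of _ X A _ A],
  auto simp: Cb_simps czero_Cb cmi_Cb add_ac scale_add_right scale_add_left
  mult_assoc mult_add_right mult_add_left mult_scale_left mult_scale_right star_add star_scale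
  star_mult cmem[unfolded cmi_Cb]
  intro!: Cb_const)
qed

lemma cdist_Cb_le_iff: assumes "f:cA (Cb X A)" "g:cA (Cb X A)" "0 <= K" shows "cdist (Cb X A) f g <= K <-> (ALL x:tsp X. cdist A (f x) (g x) <= K)"
proof -
 interpret C: gpre G "Cb X A" by(rule Cb_gpre)
 show ?thesis using assms C.mi_closed[of f g] by(auto simp: cdist_def norm_Cb_le_iff cmi_Cb)
qed

lemma cdist_val_le: assumes "f:cA (Cb X A)" "g:cA (Cb X A)" "x:tsp X" shows "cdist A (f x) (g x) <= cdist (Cb X A) f g"
proof -
 interpret C: gpre G "Cb X A" by(rule Cb_gpre)
 show ?thesis using cdist_Cb_le_iff[OF assms(1,2), of "cdist (Cb X A) f g"] assms(3) by simp
qed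

lemma Cb_complete: assumes "Metric_space.mcomplete (cA A) (cdist A)" shows "Metric_space.mcomplete (cA (Cb X A)) (cdist (Cb X A))"
proof -
 interpret M: Metric_space "cA A" "cdist A" by(rule metric)
 interpret C: gpre G "Cb X A" by(rule Cb_gpre)
 interpret MC: Metric_space "cA (Cb X A)" "cdist (Cb X A)" by(rule C.metric)
 show ?thesis unfolding MC.mcomplete_def
 proof(intro allI impI)
  fix sg assume sg: "MC.MCauchy sg"
  hence mem: "sg n:cA (Cb X A)" for n by(auto simp: MC.MCauchy_def)
  have Cau: "EX N. ALL m n x. N <= m --> N <= n --> x:tsp X --> cdist A (sg m x) (sg n x) < ep" if "0 < ep" for ep
  proof -
  obtain N where "!!m n. N <= m==>N <= n==>cdist (Cb X A) (sg m) (sg n) < ep" using sg \<open>0 < ep\<close> unfolding MC.MCauchy_def by meson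
  thus ?thesis using cdist_val_le[OF mem mem] by(meson le_less_trans)
  qed
  have cont: "\<forall>\<^sub>F n in sequentially. cmap X M.mtopology (sg n)" using mem by(auto simp: cA_Cb norm_topology_def)
  obtain g where g: "cmap X M.mtopology g" "!!ep. 0 < ep==>\<forall>\<^sub>F n in sequentially. ALL x:tsp X. cdist A (sg n x) (g x) < ep"
  using M.continuous_map_uniformly_Cauchy_limit[OF assms cont Cau] by blast
  have gc: "g x:cA A" if "x:tsp X" for x using g(1) that by(auto simp: continuous_map_def Pi_iff)
  obtain n where n: "ALL x:tsp X. cdist A (sg n x) (g x) < 1" using g(2)[of 1] by(auto simp: eventually_sequentially)
  have "cnorm A (g x) <= cnorm (Cb X A) (sg n) + 1" if x: "x:tsp X" for x
  proof -
  have "cnorm A (g x) <= cnorm A (sg n x) + cdist A (g x) (sg n x)" using gc x Cb_val[OF mem x] by(intro norm_le) auto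
  also have "\<dots> <= cnorm (Cb X A) (sg n) + 1" using n x nval_le[OF mem x, of n] by(intro add_mono) (auto simp: cdist_comm less_imp_le)
  finally show ?thesis .
  qed
  hence h: "restrict g (tsp X):cA (Cb X A)" (is "?h:_") using g(1) by(auto simp: cA_Cb norm_topology_def)
  have "limitin MC.mtopology sg ?h sequentially" unfolding MC.limit_metric_sequentially
  proof(intro conjI h allI impI)
  fix ep::real assume ep: "0 < ep"
  obtain N where "ALL n>=N. ALL x:tsp X. cdist A (sg n x) (g x) < ep/2" using g(2)[of "ep/2"] ep by(auto simp: eventually_sequentially)
  hence "ALL n>=N. cdist (Cb X A) (sg n) ?h <= ep/2" using ep mem h by(subst cdist_Cb_le_iff) (auto simp: less_imp_le)
  thus "EX N. ALL n>=N. sg n:cA (Cb X A) & cdist (Cb X A) (sg n) ?h < ep" using ep mem by(intro exI[of _ N]) fastforce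
  qed
  thus "EX x. limitin MC.mtopology sg x sequentially" by blast
 qed
qed

end

section \<open>Asymptotic algebras\<close>

text \<open>Guarantees that the values of functions off the space, such as those produced by
  \<open>restrict\<close>, do not matter along the filter.\<close>

definition fspace::"'x topology=>'x filter=>bool" where "fspace X F <-> (\<forall>\<^sub>F x in F. x:tsp X)"

definition aeq::"'x filter=>('g, 'a) galg=>('x=>'a)=>('x=>'a)=>bool" where "aeq F B u v <-> ((%x. cdist B (u x) (v x)) ---> 0) F"

lemma aeq_cong: "[|\<forall>\<^sub>F x in F. u x = u' x; \<forall>\<^sub>F x in F. v x = v' x|]==>aeq F B u v <-> aeq F B u' v'"
 unfolding aeq_def by(rule tendsto_cong) (auto elim: eventually_elim2)

lemma aeq_comp: "[|aeq F B u v; filterlim h F E|]==>aeq E B (%x. u (h x)) (%x. v (h x))" unfolding aeq_def by(rule filterlim_compose)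

context pre_cstar
begin

lemma aeqI: assumes "!!ep. 0 < ep==>\<forall>\<^sub>F x in F. cdist A (u x) (v x) <= ep" shows "aeq F A u v" unfolding aeq_def
proof(rule tendstoI)
 fix ep::real assume "0 < ep"
 hence "\<forall>\<^sub>F x in F. cdist A (u x) (v x) <= ep / 2" using assms half_gt_zero by blast
 thus "\<forall>\<^sub>F x in F. dist (cdist A (u x) (v x)) 0 < ep"
  by eventually_elim (use \<open>0 < ep\<close> in \<open>simp add: le_less_trans[of _ "ep / 2"]\<close>)
qed

lemma aeqD: "[|aeq F A u v; 0 < ep|]==>\<forall>\<^sub>F x in F. cdist A (u x) (v x) < ep" unfolding aeq_def by(rule order_tendstoD(2))

lemma aeq_refl [simp]: "aeq F A u u" by(simp add: aeq_def)

lemma aeq_sym: "aeq F A u v==>aeq F A v u" by(simp add: aeq_def cdist_comm)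

lemma aeq_bound: assumes "((%x. b x) ---> 0) F" "\<forall>\<^sub>F x in F. cdist A (u x) (v x) <= b x"
 shows "aeq F A u v" unfolding aeq_def by(rule Lim_null_comparison[OF _ assms(1)]) (use assms(2) in "simp")

text \<open>\<open>cdist\<close> vanishes off the carrier, so the triangle inequality is available
  only where all three values lie in the carrier.\<close>

lemma aeq_trans: assumes "aeq F A u v" "aeq F A v w" and "\<forall>\<^sub>F x in F. u x:cA A & v x:cA A & w x:cA A" shows "aeq F A u w"
proof(rule aeq_bound)
 show "((%x. cdist A (u x) (v x) + cdist A (v x) (w x)) ---> 0) F" using assms(1,2) tendsto_add_zero by(auto simp: aeq_def)
 show "\<forall>\<^sub>F x in F. cdist A (u x) (w x) <= cdist A (u x) (v x) + cdist A (v x) (w x)" using assms(3) by eventually_elim (simp add: cdist_tri)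
qed

end

lemma (in gpre) aeq_opn: assumes q: "q:opcs G" and eq: "aeq F A f f'" "aeq F A g g'"
  and car: "\<forall>\<^sub>F x in F. f x:cA A & f' x:cA A & g x:cA A & g' x:cA A"
  and K: "\<forall>\<^sub>F x in F. cnorm A (g x) <= K" "\<forall>\<^sub>F x in F. cnorm A (f' x) <= K"
 shows "aeq F A (%x. opn A q (f x) (g x)) (%x. opn A q (f' x) (g' x))"
proof(rule aeq_bound)
 show "((%x. opn_const q K * (cdist A (f x) (f' x) + cdist A (g x) (g' x))) ---> 0) F" using eq by(auto simp: aeq_def intro!: tendsto_eq_intros)
 show "\<forall>\<^sub>F x in F. cdist A (opn A q (f x) (g x)) (opn A q (f' x) (g' x))
  <= opn_const q K * (cdist A (f x) (f' x) + cdist A (g x) (g' x))" using car K by eventually_elim (intro cdist_opn[OF q]; simp)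
qed

context gpre
begin

lemma in_C0_iff: assumes F: "fspace X F" shows "f:C0 X F A <-> f:cA (Cb X A) & ((%x. cnorm A (f x)) ---> 0) F"
proof -
 have "((%x. cnorm A (f x)) ---> 0) F <-> (ALL ep>0. \<forall>\<^sub>F x in F. cnorm A (f x) < ep)" if f: "f:cA (Cb X A)"
 proof -
  have "\<forall>\<^sub>F x in F. 0 <= cnorm A (f x)" using F[unfolded fspace_def] by eventually_elim (use f in simp)
  hence "(\<forall>\<^sub>F x in F. dist (cnorm A (f x)) 0 < ep) <-> (\<forall>\<^sub>F x in F. cnorm A (f x) < ep)" for ep by(auto elim: eventually_elim2)
  thus ?thesis by(simp add: tendsto_iff)
 qed
 thus ?thesis by(auto simp: C0_def)
qed

lemma in_Ca_class_iff: assumes F: "fspace X F" and f: "f:cA (Cb X A)" shows "g:clA X F A f <-> g:cA (Cb X A) & aeq F A g f"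
proof -
 interpret C: gpre G "Cb X A" by(rule Cb_gpre)
 have "((%x. cnorm A (cminus (Cb X A) g f x)) ---> 0) F <-> aeq F A g f" if g: "g:cA (Cb X A)" unfolding aeq_def
 proof(rule tendsto_cong)
  show "\<forall>\<^sub>F x in F. cnorm A (cminus (Cb X A) g f x) = cdist A (g x) (f x)"
  using F[unfolded fspace_def] by eventually_elim (use f g in "simp add: cmi_Cb cdist_eq")
 qed
 thus ?thesis using C.mi_closed[of g f] f by(auto simp: coset_def in_C0_iff[OF F])
qed

lemma Ca_class_self: "[|fspace X F; f:cA (Cb X A)|]==>f:clA X F A f" by(simp add: in_Ca_class_iff)

lemma ev_Cb_val: "[|fspace X F; f:cA (Cb X A)|]==>\<forall>\<^sub>F x in F. f x:cA A" unfolding fspace_def by(erule eventually_mono) simp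

lemma ev_Cb_norm: "[|fspace X F; f:cA (Cb X A); cnorm (Cb X A) f <= K|]==>\<forall>\<^sub>F x in F. cnorm A (f x) <= K"
 unfolding fspace_def by(erule eventually_mono) (rule order_trans[OF nval_le])

lemma aeq_Cb_trans: assumes F: "fspace X F" and c: "u:cA (Cb X A)" "v:cA (Cb X A)" "w:cA (Cb X A)" and "aeq F A u v" "aeq F A v w"
 shows "aeq F A u w" using assms(5,6) by(rule aeq_trans) (use c[THEN ev_Cb_val[OF F]] in eventually_elim, simp)

lemma Ca_class_eq_iff: assumes F: "fspace X F" and f: "f:cA (Cb X A)" "g:cA (Cb X A)" shows "clA X F A f = clA X F A g <-> aeq F A f g"
proof
 assume "clA X F A f = clA X F A g"
 thus "aeq F A f g" using Ca_class_self[OF F f(1)] in_Ca_class_iff[OF F f(2)] by blast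
next
 assume eq: "aeq F A f g"
 show "clA X F A f = clA X F A g" using aeq_Cb_trans[OF F _ f _ eq] aeq_Cb_trans[OF F _ f(2,1) _ aeq_sym[OF eq]] by(auto simp: in_Ca_class_iff[OF F] f)
qed

text \<open>Evaluates the maps on quotients that are defined as unions over all representatives,
  once the term is known to depend on the class only.\<close>

lemma Ca_class_UN: assumes F: "fspace X F" and f: "f:cA (Cb X A)" and D: "!!g. [|g:cA (Cb X A); aeq F A g f|]==>D g = D f" shows "(UN g:clA X F A f. D g) = D f"
proof(rule UN_constant_eq[OF Ca_class_self[OF F f]], intro ballI)
 fix g assume "g:clA X F A f"
 thus "D g = D f" using D by(simp add: in_Ca_class_iff[OF F f])
qed

lemma cA_Ca: "cA (Ca X F A) = clA X F A ` cA (Cb X A)" by(simp add: Ca_def quotient_alg_def)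

lemma Ca_class_closed [simp]: "f:cA (Cb X A)==>clA X F A f:cA (Ca X F A)" by(simp add: cA_Ca)

lemma aeq_Cb_opn: assumes F: "fspace X F" and q: "q:opcs G" and c: "f:cA (Cb X A)" "g:cA (Cb X A)" "f':cA (Cb X A)" "g':cA (Cb X A)"
  and eq: "aeq F A f f'" "aeq F A g g'" shows "aeq F A (opn (Cb X A) q f g) (opn (Cb X A) q f' g')"
proof -
 have "aeq F A (%x. opn A q (f x) (g x)) (%x. opn A q (f' x) (g' x))"
 proof(rule aeq_opn[OF q eq])
  show "\<forall>\<^sub>F x in F. f x:cA A & f' x:cA A & g x:cA A & g' x:cA A" using c[THEN ev_Cb_val[OF F]] by eventually_elim simp
  show "\<forall>\<^sub>F x in F. cnorm A (g x) <= max (cnorm (Cb X A) g) (cnorm (Cb X A) f')"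
  "\<forall>\<^sub>F x in F. cnorm A (f' x) <= max (cnorm (Cb X A) g) (cnorm (Cb X A) f')" using c by(simp_all add: ev_Cb_norm[OF F])
 qed
 moreover have "\<forall>\<^sub>F x in F. opn (Cb X A) q f g x = opn A q (f x) (g x)"
  "\<forall>\<^sub>F x in F. opn (Cb X A) q f' g' x = opn A q (f' x) (g' x)" using F[unfolded fspace_def] by(eventually_elim, simp add: opn_Cb)+
 note aeq_cong[OF this]
 ultimately show ?thesis by(rule iffD2[rotated])
qed

lemma opn_Ca_UN: assumes "q:opcs G" "E ~= {}" "E' ~= {}"
 shows "opn (Ca X F A) q E E' = (UN f:E. UN g:E'. clA X F A (opn (Cb X A) q f g))" using assms by(cases q) (auto simp: Ca_def quotient_alg_def)

lemma opn_Ca: assumes F: "fspace X F" and q: "q:opcs G" and c: "f:cA (Cb X A)" "g:cA (Cb X A)"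
 shows "opn (Ca X F A) q (clA X F A f) (clA X F A g) = clA X F A (opn (Cb X A) q f g)"
proof -
 have ne: "clA X F A f ~= {}" "clA X F A g ~= {}" using Ca_class_self[OF F] c by blast+
 have eq: "clA X F A (opn (Cb X A) q f' g') = clA X F A (opn (Cb X A) q f g)" if "f':clA X F A f" "g':clA X F A g" for f' g'
 proof -
  have "f':cA (Cb X A)" "g':cA (Cb X A)" "aeq F A f' f" "aeq F A g' g" using that by(simp_all add: in_Ca_class_iff[OF F] c)
  hence "aeq F A (opn (Cb X A) q f' g') (opn (Cb X A) q f g)" using c by(intro aeq_Cb_opn[OF F q])
  thus ?thesis using \<open>f':cA (Cb X A)\<close> \<open>g':cA (Cb X A)\<close> c by(simp add: Ca_class_eq_iff[OF F] Cb_opn_closed[OF q])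
 qed
 show ?thesis unfolding opn_Ca_UN[OF q ne] by(simp add: eq ne)
qed

lemma czero_Ca: "czero (Ca X F A) = clA X F A (czero (Cb X A))" by(simp add: Ca_def quotient_alg_def)

lemma Ca_simps: assumes F: "fspace X F" and c: "f:cA (Cb X A)" shows "g:cA (Cb X A)
 ==>cadd (Ca X F A) (clA X F A f) (clA X F A g) = clA X F A (cadd (Cb X A) f g)" "cscale (Ca X F A) z (clA X F A f) = clA X F A (cscale (Cb X A) z f)"
  "g:cA (Cb X A) ==>cmult (Ca X F A) (clA X F A f) (clA X F A g) = clA X F A (cmult (Cb X A) f g)"
  "cstar (Ca X F A) (clA X F A f) = clA X F A (cstar (Cb X A) f)" "grade (Ca X F A) (clA X F A f) = clA X F A (grade (Cb X A) f)"
  "h:cA G==>act (Ca X F A) h (clA X F A f) = clA X F A (act (Cb X A) h f)"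
 using opn_Ca[OF F, of Add f g] opn_Ca[OF F, of "Scale z" f f] opn_Ca[OF F, of Mult f g]
  opn_Ca[OF F, of Star f f] opn_Ca[OF F, of Grade f f] opn_Ca[OF F, of "Act h" f f] c by(auto simp: opcs_def)

lemma cmi_Ca: assumes F: "fspace X F" and c: "f:cA (Cb X A)" "g:cA (Cb X A)"
 shows "cminus (Ca X F A) (clA X F A f) (clA X F A g) = clA X F A (cminus (Cb X A) f g)" using c by(simp add: cminus_def Ca_simps[OF F] Cb_closed)

lemma cnorm_Ca: "cnorm (Ca X F A) E = (INF f\<in>E. cnorm (Cb X A) f)" by(simp add: Ca_def quotient_alg_def)

text \<open>The radial retraction onto the ball of radius \<open>ep\<close>.\<close>

definition trunc::"real=>'a=>'a" where "trunc ep a = cscale A (cpx (ep / max ep (cnorm A a))) a"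

lemma norm_trunc: "[|a:cA A; 0 < ep|]==>cnorm A (trunc ep a) <= ep" unfolding trunc_def by(simp add: norm_scale norm_divide) (auto simp: field_simps max_def)

lemma trunc_id: "[|a:cA A; 0 < ep; cnorm A a <= ep|]==>trunc ep a = a" unfolding trunc_def by(simp add: max_def)

lemma cont_map_sc: assumes r: "cmap T euclidean r" and f: "cmap T (ntop A) f" shows "cmap T (ntop A) (%x. cscale A (r x) (f x))" unfolding cmap_ntop
proof(intro conjI ballI)
 have car: "f x:cA A" if "x:tsp T" for x using f that by(auto simp: cmap_ntop)
 thus "cscale A (r x) (f x):cA A" if "x:tsp T" for x using that by simp
 fix x assume x: "x:tsp T"
 have lim: "((%y. cdist A (f y) (f x)) ---> 0) (atin T x)" "(r ---> r x) (atin T x)"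
  using f x apply (simp add: cmap_ntop) using r x by(simp add: continuous_map_atin)
 show "((%y. cdist A (cscale A (r y) (f y)) (cscale A (r x) (f x))) ---> 0) (atin T x)"
 proof(rule Lim_null_comparison)
  have "((%y. cmod (r y) * cdist A (f y) (f x) + cmod (r y - r x) * cnorm A (f x))
  ---> cmod (r x) * 0 + cmod (r x - r x) * cnorm A (f x)) (atin T x)" by(intro tendsto_intros lim)
  thus "((%y. cmod (r y) * cdist A (f y) (f x) + cmod (r y - r x) * cnorm A (f x))
  ---> 0) (atin T x)" by simp
  have "\<forall>\<^sub>F y in atin T x. y:tsp T" using x by(auto simp: eventually_atin)
  thus "\<forall>\<^sub>F y in atin T x. norm (cdist A (cscale A (r y) (f y)) (cscale A (r x) (f x)))
  <= cmod (r y) * cdist A (f y) (f x) + cmod (r y - r x) * cnorm A (f x)" by eventually_elim (use car x in "simp add: cdist_sc2")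
 qed
qed

lemma Cb_trunc: assumes f: "f:cA (Cb X A)" and ep: "0 < ep" shows "(\<lambda>x\<in>tsp X. trunc ep (f x)):cA (Cb X A)"
proof -
 have c: "cmap X (ntop A) f" using f by(simp add: cA_Cb)
 have "cmap X (ntop A) (%x. trunc ep (f x))" unfolding trunc_def
 proof(intro cont_map_sc c)
  have "cmap euclideanreal euclidean (%t. cpx (ep / max ep t))" using ep by(auto intro!: continuous_intros)
  from continuous_map_compose[OF cont_map_norm[OF c] this]
  show "cmap X euclidean (%x. cpx (ep / max ep (cnorm A (f x))))" by(simp add: o_def)
 qed
 moreover have "ALL x:tsp X. cnorm A (trunc ep (f x)) <= ep" using norm_trunc[OF _ ep] f by simp
 ultimately show ?thesis by(auto simp: cA_Cb)
qed

text \<open>Retracting the values of \<open>f\<close> to the ball of radius \<open>ep\<close>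
  changes nothing far out, and so gives a representative of the same class whose norm is at most
  \<open>ep\<close>.\<close>

lemma cnorm_Ca_le: assumes F: "fspace X F" and f: "f:cA (Cb X A)" and ep: "0 < ep" and ev: "\<forall>\<^sub>F x in F. cnorm A (f x) <= ep"
 shows "cnorm (Ca X F A) (clA X F A f) <= ep"
proof -
 let ?g = "\<lambda>x\<in>tsp X. trunc ep (f x)"
 have "\<forall>\<^sub>F x in F. ?g x = f x" using F[unfolded fspace_def] ev by eventually_elim (use f ep in "simp add: trunc_id")
 hence "aeq F A ?g f" using aeq_cong[where u = ?g and u' = f and v = f and v' = f and F = F and B = A] by simp
 hence "?g:clA X F A f" using Cb_trunc[OF f ep] by(simp add: in_Ca_class_iff[OF F f])
 moreover have "cnorm (Cb X A) ?g <= ep" using f ep by(intro norm_Cb_leI) (auto simp: norm_trunc)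
 moreover have "bdd_below (cnorm (Cb X A) ` clA X F A f)" by(rule bdd_belowI[of _ 0]) (auto simp: in_Ca_class_iff[OF F f] norm_Cb_ge0)
 ultimately show ?thesis unfolding cnorm_Ca by(meson cINF_lower order_trans)
qed

lemma cnorm_Ca_less: assumes F: "fspace X F" and f: "f:cA (Cb X A)" and less: "cnorm (Ca X F A) (clA X F A f) < ep"
 shows "\<forall>\<^sub>F x in F. cnorm A (f x) < ep"
proof -
 have "clA X F A f ~= {}" using Ca_class_self[OF F f] by blast
 moreover have "bdd_below (cnorm (Cb X A) ` clA X F A f)" by(rule bdd_belowI[of _ 0]) (auto simp: in_Ca_class_iff[OF F f] norm_Cb_ge0)
 ultimately obtain g where g: "g:clA X F A f" "cnorm (Cb X A) g < ep" using less unfolding cnorm_Ca by(auto simp: cINF_less_iff)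
 hence gc: "g:cA (Cb X A)" "aeq F A g f" by(auto simp: in_Ca_class_iff[OF F f])
 have "\<forall>\<^sub>F x in F. cdist A (g x) (f x) < ep - cnorm (Cb X A) g" using aeqD[OF gc(2)] g by simp
 thus ?thesis using F[unfolded fspace_def]
 proof eventually_elim
  case (elim x)
  thus ?case using norm_le[of "f x" "g x"] nval_le[OF gc(1), of x] gc f by(simp add: cdist_comm)
 qed
qed

lemma cnorm_Ca_ge0: assumes F: "fspace X F" and f: "f:cA (Cb X A)" shows "0 <= cnorm (Ca X F A) (clA X F A f)" unfolding cnorm_Ca
proof(rule cINF_greatest)
 show "clA X F A f ~= {}" using Ca_class_self[OF F f] by blast
qed (simp add: in_Ca_class_iff[OF F f] norm_Cb_ge0)

lemma ev_cnorm_Ca: assumes F: "fspace X F" and f: "f:cA (Cb X A)" and ep: "0 < ep"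
 shows "\<forall>\<^sub>F x in F. cnorm A (f x) <= cnorm (Ca X F A) (clA X F A f) + ep"
 using cnorm_Ca_less[OF F f, of "cnorm (Ca X F A) (clA X F A f) + ep"] ep by(auto elim: eventually_mono)

text \<open>Together with \<open>ev_cnorm_Ca\<close> this identifies the quotient norm with the
  limit superior of the pointwise norms along \<open>F\<close>. The norm axioms of the quotient,
  including the C*-identity, are read off from this description.\<close>

lemma cnorm_Ca_le': assumes F: "fspace X F" and f: "f:cA (Cb X A)" and K: "0 <= K" and ev: "!!ep. 0 < ep==>\<forall>\<^sub>F x in F. cnorm A (f x) <= K + ep"
 shows "cnorm (Ca X F A) (clA X F A f) <= K"
proof(rule field_le_epsilon)
 fix ep::real assume "0 < ep"
 thus "cnorm (Ca X F A) (clA X F A f) <= K + ep" using K ev by(intro cnorm_Ca_le[OF F f]) auto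
qed

lemma ev_opn_Cb: "fspace X F==>\<forall>\<^sub>F x in F. opn (Cb X A) q f g x = opn A q (f x) (g x)"
 unfolding fspace_def by(erule eventually_mono) (simp add: opn_Cb)

lemma Ca_norms: assumes F: "fspace X F" and f: "f:cA (Cb X A)" and g: "g:cA (Cb X A)"
 defines "N == %f. cnorm (Ca X F A) (clA X F A f)" shows "N (cadd (Cb X A) f g) <= N f + N g" and "N (cscale (Cb X A) c f) = cmod c * N f"
  and "N (cmult (Cb X A) f g) <= N f * N g" and "N (cmult (Cb X A) (cstar (Cb X A) f) f) = (N f)\<^sup>2"
  and "N f = 0 <-> clA X F A f = clA X F A (czero (Cb X A))" and "N (grade (Cb X A) f) <= N f" and "h:cA G==>N (act (Cb X A) h f) <= N f"
proof -
 interpret C: gpre G "Cb X A" by(rule Cb_gpre)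
 note nn = cnorm_Ca_ge0[OF F]
 note ev = ev_cnorm_Ca[OF F] ev_Cb_val[OF F]
 have N0: "0 <= N f" if "f:cA (Cb X A)" for f unfolding N_def by(rule nn[OF that])
 show "N (cadd (Cb X A) f g) <= N f + N g" unfolding N_def
 proof(rule cnorm_Ca_le'[OF F])
  fix ep::real assume ep: "0 < ep"
  show "\<forall>\<^sub>F x in F. cnorm A (cadd (Cb X A) f g x) <= cnorm (Ca X F A) (clA X F A f) + cnorm (Ca X F A) (clA X F A g) + ep"
  using ev(1)[OF f half_gt_zero[OF ep]] ev(1)[OF g half_gt_zero[OF ep]] ev(2)[OF f] ev(2)[OF g]
  F[unfolded fspace_def]
  proof eventually_elim
  case (elim x)
  thus ?case using norm_triangle[of "f x" "g x"] by(simp add: Cb_simps)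
  qed
 qed (use f g nn in auto)
 have le: "N f' <= N f" if f: "f:cA (Cb X A)" and f': "f':cA (Cb X A)" and l: "!!x. x:tsp X==>cnorm A (f' x) <= cnorm A (f x)" for f f' unfolding N_def
 proof(rule cnorm_Ca_le'[OF F f' nn[OF f]])
  fix ep::real assume ep: "0 < ep"
  show "\<forall>\<^sub>F x in F. cnorm A (f' x) <= cnorm (Ca X F A) (clA X F A f) + ep" using ev(1)[OF f ep] F[unfolded fspace_def]
  proof eventually_elim
  case (elim x)
  thus ?case using l[of x] by simp
  qed
 qed
 have scl: "N (cscale (Cb X A) c f) <= cmod c * N f" if f: "f:cA (Cb X A)" for c f unfolding N_def
 proof(rule cnorm_Ca_le'[OF F])
  fix ep::real assume ep: "0 < ep"
  \<comment> \<open>The summand 1 keeps the denominator positive for \<open>c = 0\<close>.\<close>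
  define de where "de = ep / (cmod c + 1)"
  have d: "0 < de" "cmod c * de <= ep" using ep by(auto simp: de_def field_simps add_pos_nonneg intro!: divide_pos_pos)
  show "\<forall>\<^sub>F x in F. cnorm A (cscale (Cb X A) c f x)
  <= cmod c * cnorm (Ca X F A) (clA X F A f) + ep" using ev(1)[OF f d(1)] ev(2)[OF f] F[unfolded fspace_def]
  proof eventually_elim
  case (elim x)
  thus ?case using mult_left_mono[OF elim(1), of "cmod c"] d by(simp add: Cb_simps norm_scale distrib_left)
  qed
 qed (use f nn in auto)
 show "N (cscale (Cb X A) c f) = cmod c * N f"
 proof(cases "c = 0")
  case True
  thus ?thesis using scl[OF f, of c] N0[of "cscale (Cb X A) c f"] f by simp
 next
  case False
  hence "N f <= inverse (cmod c) * N (cscale (Cb X A) c f)" using scl[of "cscale (Cb X A) c f" "inverse c"] f by(simp add: norm_inverse)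
  hence "cmod c * N f <= cmod c * (inverse (cmod c) * N (cscale (Cb X A) c f))" by(intro mult_left_mono) auto
  thus ?thesis using scl[OF f, of c] False by(simp flip: mult.assoc)
 qed
 have mul: "N (cmult (Cb X A) f g) <= N f * N g" if f: "f:cA (Cb X A)" and g: "g:cA (Cb X A)" for f g
 proof(rule tendsto_lowerbound)
  \<comment> \<open>Each pointwise norm is bounded only up to \<open>ep\<close>; the product of the
    two bounds is taken to the limit as it stands, which avoids estimating mixed terms.\<close>
  have "((%ep. (N f + ep) * (N g + ep)) ---> (N f + 0) * (N g + 0)) (at_right 0)" by(intro tendsto_intros)
  thus "((%ep. (N f + ep) * (N g + ep)) ---> N f * N g) (at_right 0)" by simp
  show "\<forall>\<^sub>F ep in at_right 0. N (cmult (Cb X A) f g) <= (N f + ep) * (N g + ep)" using eventually_at_right_less[of "0::real"]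
  proof eventually_elim
  fix ep::real assume ep: "0 < ep"
  show "N (cmult (Cb X A) f g) <= (N f + ep) * (N g + ep)" unfolding N_def
  proof(rule cnorm_Ca_le[OF F])
  show "\<forall>\<^sub>F x in F. cnorm A (cmult (Cb X A) f g x) <= (cnorm (Ca X F A) (clA X F A f) + ep) * (cnorm (Ca X F A) (clA X F A g) + ep)"
  using ev(1)[OF f ep] ev(1)[OF g ep] ev(2)[OF f] ev(2)[OF g] F[unfolded fspace_def]
  proof eventually_elim
  case (elim x)
  have "cnorm A (cmult A (f x) (g x)) <= cnorm A (f x) * cnorm A (g x)" using elim by(simp add: norm_mult)
  also have "\<dots> <= (cnorm (Ca X F A) (clA X F A f) + ep)
  * (cnorm (Ca X F A) (clA X F A g) + ep)" using elim ep nn f g by(intro mult_mono) auto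
  finally show ?case using elim by(simp add: Cb_simps)
  qed
  qed (use f g ep nn in "auto intro!: mult_pos_pos add_nonneg_pos")
  qed
 qed simp
 show "N (cmult (Cb X A) f g) <= N f * N g" by(rule mul[OF f g])
 show "N (cmult (Cb X A) (cstar (Cb X A) f) f) = (N f)\<^sup>2"
 proof(rule order_antisym)
  have "N (cstar (Cb X A) f) <= N f" using f by(intro le) (auto simp: Cb_simps intro!: Cb_closed[unfolded Cb_simps])
  thus "N (cmult (Cb X A) (cstar (Cb X A) f) f) <= (N f)\<^sup>2"
  using mul[of "cstar (Cb X A) f" f] mult_right_mono[OF _ N0[OF f]] f by(fastforce simp: power2_eq_square)
  show "(N f)\<^sup>2 <= N (cmult (Cb X A) (cstar (Cb X A) f) f)" (is "_ <= ?n")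
  proof(rule field_le_epsilon)
  fix ep::real assume ep: "0 < ep"
  have n: "0 < ?n + ep" using N0[of "cmult (Cb X A) (cstar (Cb X A) f) f"] f ep by simp
  have "\<forall>\<^sub>F x in F. cnorm A (cmult (Cb X A) (cstar (Cb X A) f) f x) <= ?n + ep" unfolding N_def using f ep by(intro ev) auto
  hence "\<forall>\<^sub>F x in F. cnorm A (f x) <= sqrt (?n + ep)" using ev(2)[OF f] F[unfolded fspace_def]
  by eventually_elim (auto simp: Cb_simps norm_star_mult intro!: real_le_rsqrt)
  hence "cnorm (Ca X F A) (clA X F A f) <= sqrt (?n + ep)" using n by(intro cnorm_Ca_le[OF F f]) auto
  hence "N f <= sqrt (?n + ep)" by(simp only: N_def)
  hence "(N f)\<^sup>2 <= (sqrt (?n + ep))\<^sup>2" using N0[OF f] by(rule power_mono)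
  thus "(N f)\<^sup>2 <= ?n + ep" using n by simp
  qed
 qed
 show "N f = 0 <-> clA X F A f = clA X F A (czero (Cb X A))"
 proof
  assume 0: "N f = 0"
  have "aeq F A f (czero (Cb X A))"
  proof(rule aeqI)
  fix ep::real assume ep: "0 < ep"
  show "\<forall>\<^sub>F x in F. cdist A (f x) (czero (Cb X A) x) <= ep" using ev(1)[OF f ep] ev(2)[OF f] F[unfolded fspace_def]
  by eventually_elim (use 0 in "simp add: N_def czero_Cb")
  qed
  thus "clA X F A f = clA X F A (czero (Cb X A))" using f by(subst Ca_class_eq_iff[OF F]) auto
 next
  assume eq: "clA X F A f = clA X F A (czero (Cb X A))"
  have "N (czero (Cb X A)) <= 0" unfolding N_def
  proof(rule cnorm_Ca_le'[OF F])
  show "\<forall>\<^sub>F x in F. cnorm A (czero (Cb X A) x) <= 0 + ep" if "0 < ep" for ep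
  using F[unfolded fspace_def] by eventually_elim (use that in "simp add: czero_Cb")
  qed auto
  thus "N f = 0" using N0[OF f] eq by(simp add: N_def)
 qed
 show "N (grade (Cb X A) f) <= N f" using f by(intro le[OF f]) (auto simp: Cb_simps norm_grade intro!: Cb_closed[unfolded Cb_simps])
 show "N (act (Cb X A) h f) <= N f" if "h:cA G" using f that by(intro le[OF f]) (auto simp: Cb_simps norm_act intro!: Cb_closed[unfolded Cb_simps])
qed

lemma Ca_gpre: assumes F: "fspace X F" shows "gpre G (Ca X F A)"
proof -
 interpret C: gpre G "Cb X A" by(rule Cb_gpre)
 let ?Q = "Ca X F A"
 let ?q = "clA X F A"
 note sm = Ca_simps[OF F] cmi_Ca[OF F] czero_Ca
 have ex: "EX f:cA (Cb X A). E = ?q f" if "E:cA ?Q" for E using that by(auto simp: cA_Ca)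
 have cd: "cdist ?Q E E' = cnorm ?Q (cminus ?Q E E')" if "E:cA ?Q" "E':cA ?Q" for E E' using that by(simp add: cdist_def)
 have gr: "cminus (Cb X A) (grade (Cb X A) f) (grade (Cb X A) g)
  : cA (Cb X A)" if "f:cA (Cb X A)" "g:cA (Cb X A)" for f g using that by simp
 show ?thesis
 proof unfold_locales
  show "cdist ?Q (grade ?Q x) (grade ?Q y) <= cdist ?Q x y" if x: "x:cA ?Q" and y: "y:cA ?Q" for x y
  proof -
  obtain f g where f: "f:cA (Cb X A)" "x = ?q f" "g:cA (Cb X A)" "y = ?q g" using ex[OF x] ex[OF y] by auto
  have "cnorm ?Q (?q (cminus (Cb X A) (grade (Cb X A) f) (grade (Cb X A) g))) <= cnorm ?Q (?q (cminus (Cb X A) f g))"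
  proof(rule cnorm_Ca_le'[OF F])
  fix ep::real assume ep: "0 < ep"
  show "\<forall>\<^sub>F z in F. cnorm A (cminus (Cb X A) (grade (Cb X A) f) (grade (Cb X A) g) z)
  <= cnorm ?Q (?q (cminus (Cb X A) f g)) + ep" using ev_cnorm_Ca[OF F C.mi_closed[OF f(1,3)] ep] F[unfolded fspace_def]
  proof eventually_elim
  case (elim z)
  thus ?case using cdist_grade[of "f z" "g z"] f by(simp add: cdist_def cmi_Cb Cb_simps)
  qed
  qed (use f in "auto intro!: cnorm_Ca_ge0[OF F]")
  thus ?thesis using f by(simp add: cdist_def sm)
  qed
  show "cdist ?Q (act ?Q h x) (act ?Q h y) <= cdist ?Q x y" if h: "h:cA G" and x: "x:cA ?Q" and y: "y:cA ?Q" for x y h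
  proof -
  obtain f g where f: "f:cA (Cb X A)" "x = ?q f" "g:cA (Cb X A)" "y = ?q g" using ex[OF x] ex[OF y] by auto
  have "cnorm ?Q (?q (cminus (Cb X A) (act (Cb X A) h f) (act (Cb X A) h g))) <= cnorm ?Q (?q (cminus (Cb X A) f g))"
  proof(rule cnorm_Ca_le'[OF F])
  fix ep::real assume ep: "0 < ep"
  show "\<forall>\<^sub>F z in F. cnorm A (cminus (Cb X A) (act (Cb X A) h f) (act (Cb X A) h g) z)
  <= cnorm ?Q (?q (cminus (Cb X A) f g)) + ep" using ev_cnorm_Ca[OF F C.mi_closed[OF f(1,3)] ep] F[unfolded fspace_def]
  proof eventually_elim
  case (elim z)
  thus ?case using cdist_act[OF h, of "f z" "g z"] f h by(simp add: cdist_def cmi_Cb Cb_simps)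
  qed
  qed (use f h in "auto intro!: cnorm_Ca_ge0[OF F]")
  thus ?thesis using f h by(simp add: cdist_def sm)
  qed
 qed ((auto dest!: ex simp: sm C.add_assoc C.scale_add_right C.scale_add_left
  C.mult_assoc C.mult_add_right C.mult_add_left C.mult_scale_left C.mult_scale_right C.star_add
  C.star_scale C.star_mult cnorm_Ca_ge0[OF F] Ca_norms[OF F]), (auto simp: C.add_commute)?)
qed

lemma cdist_Ca: assumes F: "fspace X F" and c: "f:cA (Cb X A)" "g:cA (Cb X A)" shows "cdist (Ca X F A) (clA X F A f) (clA X F A g)
  = cnorm (Ca X F A) (clA X F A (cminus (Cb X A) f g))" using c by(simp add: cdist_def cmi_Ca[OF F])

lemma cdist_Ca_le_iff: assumes F: "fspace X F" and c: "f:cA (Cb X A)" "g:cA (Cb X A)" and K: "0 <= K" shows "cdist (Ca X F A) (clA X F A f) (clA X F A g) <= K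
  <-> (ALL ep>0. \<forall>\<^sub>F x in F. cdist A (f x) (g x) <= K + ep)" (is "?d <= K <-> ?R")
proof -
 interpret C: gpre G "Cb X A" by(rule Cb_gpre)
 have m: "cminus (Cb X A) f g:cA (Cb X A)" using c by simp
 have eq: "\<forall>\<^sub>F x in F. cnorm A (cminus (Cb X A) f g x) = cdist A (f x) (g x)"
  using F[unfolded fspace_def] by eventually_elim (use c in "simp add: cmi_Cb cdist_eq")
 show ?thesis unfolding cdist_Ca[OF F c]
 proof safe
  fix ep::real
  assume le: "cnorm (Ca X F A) (clA X F A (cminus (Cb X A) f g)) <= K" and ep: "0 < ep"
  show "\<forall>\<^sub>F x in F. cdist A (f x) (g x) <= K + ep" using ev_cnorm_Ca[OF F m ep] eq by eventually_elim (use le in simp)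
 next
  assume R: ?R
  show "cnorm (Ca X F A) (clA X F A (cminus (Cb X A) f g)) <= K"
  proof(rule cnorm_Ca_le'[OF F m K])
  fix ep::real assume "0 < ep"
  hence "\<forall>\<^sub>F x in F. cdist A (f x) (g x) <= K + ep" using R by blast
  thus "\<forall>\<^sub>F x in F. cnorm A (cminus (Cb X A) f g x) <= K + ep" using eq by eventually_elim simp
  qed
 qed
qed

end

section \<open>Automatic continuity of *-homomorphisms\<close>

context pre_cstar
begin

text \<open>In the product of \<open>(x + z y)\<close> with its adjoint the cross terms are
  \<open>z\<close> and \<open>-z\<close> times the same element, so they cancel. The admissible
  \<open>z\<close> are \<i> and its negative.\<close>

lemma norm_add_sc_commuting: assumes xy: "x:cA A" "y:cA A" and comm: "cmult A (cstar A x) y = cmult A (cstar A y) x" and z: "cnj z = - z" "z * z = - 1"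
 shows "(cnorm A (cadd A x (cscale A z y)))\<^sup>2 = cnorm A (cadd A (cmult A (cstar A x) x) (cmult A (cstar A y) y))"
proof -
 let ?p = "cadd A x (cscale A z y)"
 have "cmult A (cstar A ?p) ?p = cadd A (cmult A (cstar A x) x) (cadd A (cscale A z (cmult A (cstar A x) y))
  (cadd A (cscale A (- z) (cmult A (cstar A x) y)) (cmult A (cstar A y) y)))"
  using xy z by(simp add: star_add star_scale mult_add_left mult_add_right mult_scale_left
  mult_scale_right scale_add_right comm add_ac)
 also have "\<dots> = cadd A (cmult A (cstar A x) x) (cmult A (cstar A y) y)"
  using add_cancel(1)[of "cscale A z (cmult A (cstar A x) y)" "cmult A (cstar A y) y"] xy by simp
 finally show ?thesis using norm_star_mult[of ?p] xy by simp
qed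

text \<open>Informally, \<open>a\<^sup>2 + (1 - c)\<^sup>2 = 1\<close>, so that \<open>a\<close> is the real part of the unitary \<open>a + \<i> (1 - c)\<close>.\<close>

lemma norm_real_part_unitary: assumes car: "a:cA A" "c:cA A" "d:cA A" and sa: "cstar A a = a" "cstar A c = c" and comm: "cmult A a c = cmult A c a"
  and circle: "cadd A c c = cadd A (cmult A a a) (cmult A c c)" shows "cnorm A (cmult A a d) <= cnorm A d"
proof -
 define x where "x = cmult A a d"
 \<comment> \<open>\<open>y\<close> is \<open>(1 - c) d\<close>, written without a unit. Thus
   \<open>x + \<i> y\<close> and \<open>x - \<i> y\<close> are the unitary and its adjoint applied
   to \<open>d\<close>; both have the norm of \<open>d\<close>, and their sum is
   \<open>2 a d\<close>.\<close>
 define y where "y = cminus A d (cmult A c d)"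
 have xy [simp]: "x:cA A" "y:cA A" using car by(auto simp: x_def y_def)
 have sx: "cstar A x = cmult A (cstar A d) a" and sy: "cstar A y = cminus A (cstar A d) (cmult A (cstar A d) c)"
  using car sa by(auto simp: x_def y_def star_mult cminus_def star_add star_scale)
 have ac: "cmult A a (cmult A c d) = cmult A c (cmult A a d)" using car comm by(metis mult_assoc)
 have comm': "cmult A (cstar A x) y = cmult A (cstar A y) x" unfolding sx sy using car
  by(simp add: x_def y_def cminus_def mult_add_left mult_add_right mult_scale_left
  mult_scale_right mult_assoc ac)
 have "cadd A (cmult A (cstar A x) x) (cmult A (cstar A y) y) = cmult A (cstar A d) (cadd A (cmult A (cmult A a a) d) (cadd A d (cadd A
  (cscale A (-1) (cmult A (cadd A c c) d)) (cmult A (cmult A c c) d))))" unfolding sx sy using car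
  by(simp add: x_def y_def cminus_def mult_add_left mult_add_right mult_scale_left
  mult_scale_right mult_assoc scale_add_right add_ac)
 also have "cadd A (cmult A (cmult A a a) d) (cadd A d (cadd A (cscale A (-1) (cmult A (cadd A c c) d)) (cmult A (cmult A c c) d)))
  = cadd A d (cadd A (cscale A (-1) (cmult A (cadd A c c) d)) (cmult A (cadd A (cmult A a a) (cmult A c c)) d))" using car by(simp add: mult_add_left add_ac)
 also have "\<dots> = d" using car by(simp flip: circle)
 finally have eq: "cadd A (cmult A (cstar A x) x) (cmult A (cstar A y) y) = cmult A (cstar A d) d" .
 have "(cnorm A (cadd A x (cscale A z y)))\<^sup>2 = (cnorm A d)\<^sup>2" if "cnj z = - z" "z * z = - 1" for z
  using norm_add_sc_commuting[OF xy comm' that] norm_star_mult[of d] car by(simp add: eq)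
 hence nz: "cnorm A (cadd A x (cscale A z y)) = cnorm A d" if "cnj z = - z" "z * z = - 1" for z using that car by(simp add: power2_eq_iff_nonneg)
 have "cadd A (cadd A x (cscale A \<i> y)) (cadd A x (cscale A (- \<i>) y))
  = cadd A x (cadd A x (cadd A (cscale A \<i> y) (cscale A (-1) (cscale A \<i> y))))" by(simp add: add_ac)
 also have "\<dots> = cscale A 2 x" using scale_add_left[of x 1 1] by(simp del: scale_scale)
 finally have "cnorm A (cscale A 2 x) <= cnorm A d + cnorm A d" using norm_triangle[of "cadd A x (cscale A \<i> y)" "cadd A x (cscale A (- \<i>) y)"]
  by(simp add: nz)
 thus ?thesis by(simp add: norm_scale x_def[symmetric])
qed

text \<open>The preceding estimate is applied to \<open>d = a\<close>: it turns the C*-identity into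
  the statement that the square of the norm of \<open>a\<close> is at most the norm.\<close>

lemma norm_le_1_unitary: assumes car: "a:cA A" "c:cA A" and sa: "cstar A a = a" "cstar A c = c" and comm: "cmult A a c = cmult A c a"
  and circle: "cadd A c c = cadd A (cmult A a a) (cmult A c c)" shows "cnorm A a <= 1"
proof -
 have "(cnorm A a)\<^sup>2 = cnorm A (cmult A a a)" using norm_star_mult[of a] sa car by simp
 also have "\<dots> <= cnorm A a" using norm_real_part_unitary[OF car car(1) sa comm circle] .
 finally have "cnorm A a * (1 - cnorm A a) >= 0" by(simp add: power2_eq_square algebra_simps)
 thus ?thesis using norm_nonneg[OF car(1)] by(simp add: zero_le_mult_iff) linarith
qed

text \<open>The solution is \<open>1 - sqrt (1 - y\<^sup>2)\<close>, found without functional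
  calculus as the fixed point of \<open>v \<mapsto> (y\<^sup>2 + v\<^sup>2) / 2\<close>. On the
  self-adjoint elements that commute with \<open>y\<close> and have norm at most
  \<open>rh = cnorm A y\<close>, this map has Lipschitz constant \<open>rh < 1\<close>, and these
  elements form a closed set.\<close>

lemma circle_solution: assumes compl: "Metric_space.mcomplete (cA A) (cdist A)" and y: "y:cA A" "cstar A y = y" "cnorm A y < 1"
 obtains v where "v:cA A" "cstar A v = v" "cmult A y v = cmult A v y" "cadd A v v = cadd A (cmult A y y) (cmult A v v)"
proof -
 interpret M: Metric_space "cA A" "cdist A" by(rule metric)
 define rh where "rh = cnorm A y"
 have rh: "0 <= rh" "rh < 1" using y by(auto simp: rh_def)
 define S where "S = {v:cA A. cstar A v = v & cmult A y v = cmult A v y & cnorm A v <= rh}"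
 interpret S: Submetric "cA A" "cdist A" S by unfold_locales (auto simp: S_def)
 define f where "f = (%v. cscale A (1/2) (cadd A (cmult A y y) (cmult A v v)))"
 have "closedin M.mtopology S" unfolding M.metric_closedin_iff_sequentially_closed
 proof(intro conjI allI impI)
  fix sg::"nat=>'a" and l
  assume *: "range sg <= S & limitin M.mtopology sg l sequentially"
  hence sg: "sg k:cA A" "cstar A (sg k) = sg k" "cmult A y (sg k) = cmult A (sg k) y" "cnorm A (sg k) <= rh" for k by(auto simp: S_def)
  have l: "l:cA A" "(%k. cdist A (sg k) l) \<longlonglongrightarrow> 0" using * by(auto simp: M.limitin_metric_dist_null)
  \<comment> \<open>Passage to the limit: an inequality valid up to a multiple of the distance of
    \<open>sg k\<close> from \<open>l\<close> is valid exactly.\<close>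
  have small: "r <= s" if "!!k. r <= s + C * cdist A (sg k) l" for C r s
  proof(rule LIMSEQ_le_const)
  show "(%k. s + C * cdist A (sg k) l) \<longlonglongrightarrow> s" using tendsto_add[OF tendsto_const tendsto_mult[OF tendsto_const l(2)], of s C] by simp
  qed (use that in auto)
  have "cdist A (cstar A l) l <= 0 + 2 * cdist A (sg k) l" for k using cdist_tri[of "cstar A l" "cstar A (sg k)" l] sg[of k] l
  by(simp add: cdist_star cdist_comm[of l]) (simp add: cdist_star[of l "sg k", simplified sg(2)] cdist_comm[of l])
  hence "cstar A l = l" using small[of "cdist A (cstar A l) l" 0 2] cdist_eq_0_iff[of "cstar A l" l] l by(simp add: order_antisym)
  moreover have "cdist A (cmult A y l) (cmult A l y) <= 0 + (2 * rh) * cdist A (sg k) l" for k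
  proof -
  have "cdist A (cmult A y l) (cmult A l y) <= cdist A (cmult A y l) (cmult A y (sg k)) + cdist A (cmult A (sg k) y) (cmult A l y)"
  using cdist_tri[of "cmult A y l" "cmult A y (sg k)" "cmult A l y"] y l sg[of k] by simp
  also have "\<dots> <= rh * cdist A (sg k) l + cdist A (sg k) l * rh" using cdist_mult[of y l y "sg k"] cdist_mult[of "sg k" y l y] y(1) l(1) sg(1)[of k]
  unfolding rh_def by(intro add_mono) (simp_all add: cdist_comm[of l] sg(3))
  finally show ?thesis by(simp add: algebra_simps)
  qed
  hence "cmult A y l = cmult A l y" using small[of "cdist A (cmult A y l) (cmult A l y)" 0 "2 * rh"]
  cdist_eq_0_iff[of "cmult A y l" "cmult A l y"] l y by(simp add: order_antisym)
  moreover have "cnorm A l <= rh + 1 * cdist A (sg k) l" for k using norm_le[of l "sg k"] sg[of k] l by(simp add: cdist_comm[of l])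
  hence "cnorm A l <= rh" by(rule small)
  ultimately show "l:S" using l by(simp add: S_def)
 qed (auto simp: S_def)
 hence "S.sub.mcomplete" using compl by(rule S.closedin_mcomplete_imp_mcomplete)
 moreover have "S ~= {}" using y rh mult_scale_left[of y y 0] mult_scale_right[of y y 0] star_scale[of y 0] by(auto simp: S_def intro!: exI[of _ "czero A"])
 moreover have "f:S \<rightarrow> S"
 proof
  fix v assume v: "v:S"
  hence vc: "v:cA A" and comm: "cmult A y v = cmult A v y" by(auto simp: S_def)
  have "cmult A y (cmult A v v) = cmult A v (cmult A v y)" using vc y comm by(metis mult_assoc)
  hence "cmult A y (f v) = cmult A (f v) y" using vc y by(simp add: f_def mult_scale_left mult_scale_right mult_add_left mult_add_right mult_assoc)
  moreover have "cnorm A (f v) <= rh"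
  proof -
  have "cnorm A (f v) <= (cnorm A (cmult A y y) + cnorm A (cmult A v v)) / 2"
  using norm_triangle[of "cmult A y y" "cmult A v v"] y vc by(simp add: f_def norm_scale)
  also have "\<dots> <= (rh * rh + rh * rh) / 2" using norm_mult[of y y] norm_mult[of v v] v y mult_mono[of "cnorm A v" rh "cnorm A v" rh] rh
  by(simp add: rh_def S_def)
  also have "\<dots> <= rh" using rh mult_left_le_one_le[of rh rh] by simp
  finally show ?thesis .
  qed
  ultimately show "f v:S" using v y by(simp add: S_def f_def star_scale star_add star_mult)
 qed
 moreover have "cdist A (f v) (f w) <= rh * cdist A v w" if "v:S" "w:S" for v w
 proof -
  have vw: "v:cA A" "w:cA A" "cnorm A v <= rh" "cnorm A w <= rh" using that by(auto simp: S_def)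
  have "cdist A (f v) (f w) <= cdist A (cmult A v v) (cmult A w w) / 2"
  using cdist_add[of "cmult A y y" "cmult A v v" "cmult A y y" "cmult A w w"] vw y by(simp add: f_def cdist_sc)
  also have "\<dots> <= (cdist A v w * cnorm A v + cnorm A w * cdist A v w) / 2" using cdist_mult[of v v w w] vw by simp
  also have "\<dots> <= (cdist A v w * rh + rh * cdist A v w) / 2" using vw rh by(intro divide_right_mono add_mono mult_mono) auto
  finally show ?thesis by simp
 qed
 ultimately obtain v where v: "v:S" "f v = v" using S.sub.Banach_fixedpoint_thm[of f rh] rh by blast
 show thesis
 proof(rule that)
  show vc: "v:cA A" and "cstar A v = v" "cmult A y v = cmult A v y" using v by(auto simp: S_def)
  have "cadd A v v = cscale A 2 (f v)" using scale_add_left[of v 1 1] vc v by simp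
  thus "cadd A v v = cadd A (cmult A y y) (cmult A v v)" using vc y by(simp add: f_def)
 qed
qed

end

text \<open>No spectrum is involved. For self-adjoint \<open>y\<close> of norm below 1 the circle
  equation is solved in the complete algebra \<open>B\<close>; \<open>ps\<close> carries the
  solution to \<open>D\<close>, where it bounds \<open>ps y\<close> by 1 even if \<open>D\<close> is
  incomplete. Scaling extends this to all self-adjoint elements, and the C*-identity to all
  elements.\<close>

theorem sthom_contr: assumes "cstar_algebra B" "pre_cstar D" and hom: "star_hom B D ps" and x: "x:cA B" shows "cnorm D (ps x) <= cnorm B x"
proof -
 interpret B: pre_cstar B using assms(1) by(rule cstar_algebra_pre_cstar)
 interpret D: pre_cstar D by(rule assms)
 have compl: "Metric_space.mcomplete (cA B) (cdist B)" using assms(1) by(simp add: cstar_algebra_iff)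
 have ps: "!!x. x:cA B==>ps x:cA D" "!!x y. [|x:cA B; y:cA B|]==>ps (cadd B x y) = cadd D (ps x) (ps y)" "!!c x. x:cA B==>ps (cscale B c x) = cscale D c (ps x)"
  "!!x y. [|x:cA B; y:cA B|]==>ps (cmult B x y) = cmult D (ps x) (ps y)"
  "!!x. x:cA B==>ps (cstar B x) = cstar D (ps x)" using hom by(auto simp: star_hom_def Pi_iff)
 have 1: "cnorm D (ps y) <= 1" if y: "y:cA B" "cstar B y = y" "cnorm B y < 1" for y
 proof -
  obtain v where "v:cA B" "cstar B v = v" "cmult B y v = cmult B v y"
  "cadd B v v = cadd B (cmult B y y) (cmult B v v)" using B.circle_solution[OF compl y] by blast
  note v = this
  have "cmult D (ps y) (ps v) = cmult D (ps v) (ps y)" using v y ps(4)[of y v] ps(4)[of v y] by simp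
  moreover have "cadd D (ps v) (ps v) = cadd D (cmult D (ps y) (ps y)) (cmult D (ps v) (ps v))"
  using v y ps(2)[of v v] ps(2)[of "cmult B y y" "cmult B v v"] by(simp add: ps(4))
  moreover have "cstar D (ps y) = ps y" "cstar D (ps v) = ps v" using v y ps(5)[of y] ps(5)[of v] by simp_all
  ultimately show ?thesis using v y by(intro D.norm_le_1_unitary[of "ps y" "ps v"]) (simp_all add: ps(1))
 qed
 have sa: "cnorm D (ps y) <= cnorm B y" if y: "y:cA B" "cstar B y = y" for y
 proof(rule field_le_epsilon)
  fix ep::real assume ep: "0 < ep"
  define r where "r = cnorm B y + ep"
  have r: "0 < r" "cnorm B y < r" using ep add_nonneg_pos[OF B.norm_nonneg[OF y(1)]] by(auto simp: r_def)
  let ?z = "cscale B (cpx (inverse r)) y"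
  have "cnorm B ?z < 1" using r y by(simp add: B.norm_scale norm_inverse) (simp add: field_simps)
  hence "cnorm D (ps ?z) <= 1" using y by(intro 1) (auto simp: B.star_scale)
  hence "inverse r * cnorm D (ps y) <= 1" using y r by(simp add: ps D.norm_scale norm_inverse)
  thus "cnorm D (ps y) <= cnorm B y + ep" using r by(simp add: r_def field_simps)
 qed
 have "(cnorm D (ps x))\<^sup>2 = cnorm D (ps (cmult B (cstar B x) x))" using x by(simp add: ps D.norm_star_mult)
 also have "\<dots> <= cnorm B (cmult B (cstar B x) x)" using x by(intro sa) (auto simp: B.star_mult)
 also have "\<dots> = (cnorm B x)\<^sup>2" using x by(simp add: B.norm_star_mult)
 finally show ?thesis using x by(simp add: power2_le_iff_abs_le)
qed

lemma sthom_cdist: assumes "cstar_algebra B" "pre_cstar D" and hom: "star_hom B D ps" and x: "x:cA B" "y:cA B" shows "cdist D (ps x) (ps y) <= cdist B x y"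
proof -
 interpret B: pre_cstar B using assms(1) by(rule cstar_algebra_pre_cstar)
 have "ps x:cA D" "ps y:cA D" "cminus D (ps x) (ps y) = ps (cminus B x y)" using hom x by(auto simp: star_hom_def cminus_def Pi_iff)
 thus ?thesis using sthom_contr[OF assms(1,2) hom, of "cminus B x y"] x by(simp add: cdist_def)
qed

lemma Mor_sthom: "ps:Mor G B D==>star_hom B D ps" by(simp add: Mor_def)

text \<open>The properties of an object that the lifting arguments use. They pass to
  \<open>Cb X B\<close>, so algebras of paths are treated in the same way as the objects
  themselves.\<close>

definition calg::"'g monoid=>('g, 'a) galg=>bool" where "calg G B <-> gpre G B & cstar_algebra B"

lemma calg_gpre: "calg G B==>gpre G B" by(simp add: calg_def)

lemma gpre_pre_cstar: "gpre G B==>pre_cstar B" by(simp add: gpre_def)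

lemma graded_calg: assumes "graded_G_cstar_algebra G B" shows "calg G B"
proof -
 interpret B: graded_G_cstar_algebra G B by(rule assms)
 have B: "cstar_algebra B" by unfold_locales
 interpret P: pre_cstar B using B by(rule cstar_algebra_pre_cstar)
 have zero: "ps (czero B) = czero B" if h: "star_hom B B ps" for ps
 proof -
  have "ps (cscale B 0 (czero B)) = cscale B 0 (ps (czero B))" "ps (czero B):cA B" using h P.zero_closed unfolding star_hom_def Pi_iff by blast+
  thus ?thesis by simp
 qed
 have "gpre G B"
 proof unfold_locales
  show "grade B x:cA B" if "x:cA B" for x using B.grade_hom that by(auto simp: star_hom_def)
  show "act B g x:cA B" if "g:cA G" "x:cA B" for x g using B.act_hom[OF that(1)] that by(auto simp: star_hom_def)
  show "cdist B (grade B x) (grade B y) <= cdist B x y" if "x:cA B" "y:cA B" for x y using sthom_cdist[OF B P.pre_cstar_axioms B.grade_hom that] .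
  show "cdist B (act B g x) (act B g y) <= cdist B x y" if "g:cA G" "x:cA B" "y:cA B" for x y g
  using sthom_cdist[OF B P.pre_cstar_axioms B.act_hom[OF that(1)] that(2,3)] .
  show "grade B (czero B) = czero B" using zero[OF B.grade_hom] .
  show "act B g (czero B) = czero B" if "g:cA G" for g using zero[OF B.act_hom[OF that]] .
 qed
 with B show ?thesis by(simp add: calg_def)
qed

lemma calg_Cb: "calg G B==>calg G (Cb X B)" unfolding calg_def cstar_algebra_iff by(auto intro: gpre.Cb_gpre gpre.Cb_complete gpre_pre_cstar)

lemma calg_cyl: "calg G B==>calg G (cyl B)" unfolding cyl_def by(rule calg_Cb)

lemma Mor_cdist: assumes B: "calg G B" and D: "gpre G D" and ps: "ps:Mor G B D" and x: "x:cA B" "y:cA B"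
 shows "cdist D (ps x) (ps y) <= cdist B x y" using sthom_cdist[OF _ gpre_pre_cstar[OF D] Mor_sthom[OF ps] x] B by(simp add: calg_def)

lemma Mor_norm: assumes B: "calg G B" and D: "gpre G D" and ps: "ps:Mor G B D" and x: "x:cA B"
 shows "cnorm D (ps x) <= cnorm B x" using sthom_contr[OF _ gpre_pre_cstar[OF D] Mor_sthom[OF ps] x] B by(simp add: calg_def)

lemma Mor_closed: "[|ps:Mor G B D; x:cA B|]==>ps x:cA D" by(auto simp: Mor_iff)

lemma Mor_opn: "[|ps:Mor G B D; q:opcs G; x:cA B; y:cA B|] ==>ps (opn B q x y) = opn D q (ps x) (ps y)" by(auto simp: Mor_iff)

lemma Mor_comp:  "[|ph:Mor G A B; ps:Mor G B D; gpre G A|]==>compose (cA A) ps ph:Mor G A D" unfolding Mor_iff by(auto simp: compose_def gpre.opn_closed Pi_iff)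

lemma cmap_contr: assumes "pre_cstar B" "pre_cstar D" and le: "!!x y. [|x:cA B; y:cA B|]==>cdist D (ps x) (ps y) <= cdist B x y"
  and cl: "!!x. x:cA B==>ps x:cA D" and f: "cmap T (ntop B) f" shows "cmap T (ntop D) (%x. ps (f x))"
proof -
 interpret B: pre_cstar B by fact
 interpret D: pre_cstar D by fact
 show ?thesis unfolding D.cmap_ntop
 proof(intro conjI ballI)
  have car: "f x:cA B" if "x:tsp T" for x using f that by(auto simp: B.cmap_ntop)
  thus "ps (f x):cA D" if "x:tsp T" for x using cl that by blast
  fix x assume x: "x:tsp T"
  have ev: "\<forall>\<^sub>F y in atin T x. y:tsp T" using x by(auto simp: eventually_atin)
  show "((%y. cdist D (ps (f y)) (ps (f x))) ---> 0) (atin T x)"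
  proof(rule Lim_null_comparison)
  show "((%y. cdist B (f y) (f x)) ---> 0) (atin T x)" using f x by(auto simp: B.cmap_ntop)
  show "\<forall>\<^sub>F y in atin T x. norm (cdist D (ps (f y)) (ps (f x))) <= cdist B (f y) (f x)" using ev by eventually_elim (use le car x in simp)
  qed
 qed
qed

lemma Mor_cont: assumes B: "calg G B" and D: "gpre G D" and ps: "ps:Mor G B D" and f: "cmap T (ntop B) f"
 shows "cmap T (ntop D) (%x. ps (f x))" by(rule cmap_contr[OF gpre_pre_cstar[OF calg_gpre[OF B]] gpre_pre_cstar[OF D]
  Mor_cdist[OF B D ps] Mor_closed[OF ps] f])

section \<open>Asymptotic morphisms\<close>

text \<open>Lifts of homomorphisms into asymptotic algebras to functions into \<open>Cb X B\<close>.\<close>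

definition amor::"'g monoid=>('g, 'a) galg=>('g, 'b) galg=>'x topology=>'x filter =>('a=>'x=>'b)=>bool" where
 "amor G A B X F f <-> (ALL a:cA A. f a:cA (Cb X B)) & (ALL q:opcs G. ALL x:cA A. ALL y:cA A.
  aeq F B (f (opn A q x y)) (%p. opn B q (f x p) (f y p)))"

definition mor_of::"'x topology=>'x filter=>('g, 'a) galg=>('g, 'b) galg =>('a=>'x=>'b)=>'a=>('x=>'b) set" where
 "mor_of X F A B f = (\<lambda>a\<in>cA A. clA X F B (f a))"

lemma amorD: "[|amor G A B X F f; a:cA A|]==>f a:cA (Cb X B)" "[|amor G A B X F f; q:opcs G; x:cA A; y:cA A|]
 ==>aeq F B (f (opn A q x y)) (%p. opn B q (f x p) (f y p))" by(auto simp: amor_def)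

lemma amor_iff_Mor: assumes A: "gpre G A" and B: "gpre G B" and F: "fspace X F" and f: "!!a. a:cA A==>f a:cA (Cb X B)"
 shows "amor G A B X F f <-> mor_of X F A B f:Mor G A (Ca X F B)"
proof -
 interpret A: gpre G A by(rule A)
 interpret B: gpre G B by(rule B)
 have "aeq F B (f (opn A q x y)) (%p. opn B q (f x p) (f y p)) <->
  clA X F B (f (opn A q x y)) = opn (Ca X F B) q (clA X F B (f x)) (clA X F B (f y))" if q: "q:opcs G" and xy: "x:cA A" "y:cA A" for q x y
 proof -
  have "aeq F B (f (opn A q x y)) (%p. opn B q (f x p) (f y p))
  <-> aeq F B (f (opn A q x y)) (opn (Cb X B) q (f x) (f y))" using B.ev_opn_Cb[OF F, of q "f x" "f y"] by(intro aeq_cong) (auto elim: eventually_mono)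
  also have "\<dots> <-> clA X F B (f (opn A q x y)) = clA X F B (opn (Cb X B) q (f x) (f y))"
  using q xy f by(intro B.Ca_class_eq_iff[OF F, symmetric] B.Cb_opn_closed) auto
  finally show ?thesis using q xy f by(simp add: B.opn_Ca[OF F])
 qed
 thus ?thesis using f by(auto simp: amor_def Mor_iff mor_of_def)
qed

lemma mor_of_Mor: "[|amor G A B X F f; gpre G A; gpre G B; fspace X F|]==>mor_of X F A B f:Mor G A (Ca X F B)"
 using amor_iff_Mor[of G A B X F f] amorD(1)[of G A B X F f] by simp

lemma Mor_lift: assumes A: "gpre G A" and B: "gpre G B" and F: "fspace X F" and ph: "ph:Mor G A (Ca X F B)"
 obtains f where "amor G A B X F f" "ph = mor_of X F A B f"
proof -
 have "ALL a:cA A. EX f:cA (Cb X B). ph a = clA X F B f" using Mor_closed[OF ph] by(auto simp: gpre.cA_Ca[OF B])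
 then obtain f where f: "!!a. a:cA A==>f a:cA (Cb X B)" "!!a. a:cA A==>ph a = clA X F B (f a)" by metis
 hence eq: "ph = mor_of X F A B f" using ph by(intro extensionalityI[of _ "cA A"]) (auto simp: Mor_iff mor_of_def)
 hence "amor G A B X F f" using ph amor_iff_Mor[OF A B F f(1)] by simp
 thus thesis using that eq by blast
qed

lemma restr_eq_iff: "restrict f S = restrict g S <-> (ALL x:S. f x = g x)"
proof
 assume eq: "restrict f S = restrict g S"
 show "ALL x:S. f x = g x" using fun_cong[OF eq] by(metis restrict_apply')
qed (auto intro: restrict_ext)

lemma mor_of_eq_iff: assumes B: "gpre G B" and F: "fspace X F" and f: "!!a. a:cA A==>f a:cA (Cb X B)" "!!a. a:cA A==>f' a:cA (Cb X B)"
 shows "mor_of X F A B f = mor_of X F A B f' <-> (ALL a:cA A. aeq F B (f a) (f' a))"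
proof -
 interpret B: gpre G B by(rule B)
 have "mor_of X F A B f = mor_of X F A B f' <-> (ALL a:cA A. clA X F B (f a) = clA X F B (f' a))" unfolding mor_of_def by(rule restr_eq_iff)
 thus ?thesis using f by(simp add: B.Ca_class_eq_iff[OF F])
qed

section \<open>Continuous lifts\<close>

primrec csum::"('g, 'a) galg=>(nat=>'a)=>nat=>'a" where "csum A f 0 = czero A" | "csum A f (Suc n) = cadd A (csum A f n) (f n)"

context pre_cstar
begin

lemma csum_closed: "(!!i. i < n==>f i:cA A)==>csum A f n:cA A" by(induction n) auto

lemma csum_extend: assumes "m <= n" "!!i. i < m==>f i:cA A" "!!i. [|m <= i; i < n|]==>f i = czero A" shows "csum A f n = csum A f m" using assms
proof(induction n rule: dec_induct)
 case (step n)
 thus ?case by(simp add: csum_closed[of n] less_Suc_eq) (metis csum_closed add_zero linorder_not_le zero_closed)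
qed simp

lemma limitin_norm: "limitin (ntop A) f l L <->
  l:cA A & (\<forall>\<^sub>F y in L. f y:cA A) & ((%y. cdist A (f y) l) ---> 0) L"
 unfolding norm_topology_def by(rule Metric_space.limitin_metric_dist_null[OF metric])

lemma limitin_add: assumes "limitin (ntop A) f l L" "limitin (ntop A) g m L" shows "limitin (ntop A) (%y. cadd A (f y) (g y)) (cadd A l m) L"
proof -
 have ev: "\<forall>\<^sub>F y in L. f y:cA A" "\<forall>\<^sub>F y in L. g y:cA A" and lm: "l:cA A" "m:cA A"
  and lim: "((%y. cdist A (f y) l) ---> 0) L" "((%y. cdist A (g y) m) ---> 0) L" using assms by(auto simp: limitin_norm)
 show ?thesis unfolding limitin_norm
 proof(intro conjI)
  show "\<forall>\<^sub>F y in L. cadd A (f y) (g y):cA A" using ev by eventually_elim simp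
  show "((%y. cdist A (cadd A (f y) (g y)) (cadd A l m)) ---> 0) L"
  proof(rule Lim_null_comparison[OF _ tendsto_add_zero[OF lim]])
  show "\<forall>\<^sub>F y in L. norm (cdist A (cadd A (f y) (g y)) (cadd A l m)) <= cdist A (f y) l + cdist A (g y) m"
  using ev by eventually_elim (use lm in "simp add: cdist_add")
  qed
 qed (use lm in simp)
qed

lemma limitin_sc: assumes r: "(r ---> r0) L" and f: "limitin (ntop A) f l L" shows "limitin (ntop A) (%y. cscale A (cpx (r y)) (f y)) (cscale A (cpx r0) l) L"
proof -
 have ev: "\<forall>\<^sub>F y in L. f y:cA A" and l: "l:cA A" and lim: "((%y. cdist A (f y) l) ---> 0) L" using f by(auto simp: limitin_norm)
 show ?thesis unfolding limitin_norm
 proof(intro conjI)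
  show "\<forall>\<^sub>F y in L. cscale A (cpx (r y)) (f y):cA A" using ev by eventually_elim simp
  have "((%y. \<bar>r y\<bar> * cdist A (f y) l + \<bar>r y - r0\<bar> * cnorm A l)
  ---> \<bar>r0\<bar> * 0 + \<bar>r0 - r0\<bar> * cnorm A l) L" by(intro tendsto_intros lim r)
  hence "((%y. \<bar>r y\<bar> * cdist A (f y) l + \<bar>r y - r0\<bar> * cnorm A l) ---> 0) L" by simp
  thus "((%y. cdist A (cscale A (cpx (r y)) (f y)) (cscale A (cpx r0) l)) ---> 0) L"
  proof(rule Lim_null_comparison[rotated])
  show "\<forall>\<^sub>F y in L. norm (cdist A (cscale A (cpx (r y)) (f y)) (cscale A (cpx r0) l))
  <= \<bar>r y\<bar> * cdist A (f y) l + \<bar>r y - r0\<bar> * cnorm A l" using ev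
  proof eventually_elim
  case (elim y)
  thus ?case using cdist_sc2[of "f y" l "cpx (r y)" "cpx r0"] l by(simp flip: of_real_diff)
  qed
  qed
 qed (use l in simp)
qed

lemma limitin_csum: "(!!i. i < n==>limitin (ntop A) (%y. f y i) (l i) L)
 ==>limitin (ntop A) (%y. csum A (f y) n) (csum A l n) L" by(induction n) (auto intro: limitin_add)

end

lemma (in Metric_space) atin_mtopology: assumes "x0:M" shows "((%y. d y x0) ---> 0) (atin mtopology x0)"
  and "0 < r==>\<forall>\<^sub>F y in atin mtopology x0. y:M & d y x0 < r"
proof -
 have "limitin mtopology (%y. y) x0 (atin mtopology x0)" using continuous_map_atin[of mtopology mtopology "%y. y"] assms by simp
 thus "((%y. d y x0) ---> 0) (atin mtopology x0)"
  and "0 < r==>\<forall>\<^sub>F y in atin mtopology x0. y:M & d y x0 < r" by(simp add: limitin_metric_dist_null, simp add: limitin_metric)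
qed

text \<open>
 The weights \<open>h\<close> come from the standard proof of the paracompactness of metric spaces: at
 level \<open>n\<close> the sets \<open>{x. h al n x > 0}\<close> have distance at least \<open>de n\<close> from each other.
 Subtracting multiples of the previous levels makes the partition of unity locally finite.
\<close>

theorem (in Metric_space) cont_sel: fixes E::"('g, 'e) galg" and S::"'a=>'e set" assumes E: "pre_cstar E" and sub: "!!x. x:M==>S x <= cA E"
  and conv: "!!x a b t. [|x:M; a:S x; b:S x; 0 <= t; t <= 1|] ==>cadd E (cscale E (cpx t) a) (cscale E (cpx (1 - t)) b):S x"
  and loc: "!!al. al:M==>EX a r. 0 < r & (ALL x:M. d x al < r --> a:S x)"
 obtains u where "cmap mtopology (ntop E) u" "!!x. x:M==>u x:S x"
proof -
 interpret E: pre_cstar E by(rule E)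
 obtain a r0 where r0: "!!al. al:M==>0 < r0 al" and a0: "!!al x. [|al:M; x:M; d x al < r0 al|]==>a al:S x" using loc by metis
 \<comment> \<open>Cutting the radii off at 1 bounds all the weights \<open>f al\<close> by 1, so
   that the suprema \<open>F\<close> below are finite.\<close>
 define r where "r = (%al. min 1 (r0 al))"
 have r: "!!al. al:M==>0 < r al" "!!al. r al <= 1" and a: "!!al x. [|al:M; x:M; d x al < r al|]==>a al:S x" using r0 a0 by(auto simp: r_def)
 obtain W::"'a rel" where W: "well_order_on UNIV W" using well_order_on by blast
 define lt where "lt = (%be al. (be, al):W - Id)"
 have wf: "wf (W - Id)" and tot: "!!al be. al ~= be==>lt al be \<or> lt be al" using W by(auto simp: well_order_on_def linear_order_on_def total_on_def lt_def)
 define f where "f = (%al x. max 0 (r al - d x al))"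
 have f01: "0 <= f al x" "f al x <= 1" for al x using r(2)[of al] nonneg[of x al] by(auto simp: f_def intro: order_trans[of _ "r al"])
 have flip: "f al x <= f al y + d x y" if "al:M" "x:M" "y:M" for al x y
  using triangle[of y x al] that nonneg[of x y] by(auto simp: f_def max_def commute[of y x])
 have fpos: "a al:S x" if "0 < f al x" "al:M" "x:M" for al x using a[OF that(2,3)] that by(auto simp: f_def)
 define FF where "FF = (%al x. insert 0 {f be x |be. be:M & lt be al})"
 define F where "F = (%al x. Sup (FF al x))"
 have FFb: "bdd_above (FF al x)" for al x using f01 by(auto simp: FF_def bdd_above_def intro!: exI[of _ 1])
 have Fge: "f be x <= F al x" if "be:M" "lt be al" for al be x unfolding F_def by(rule cSup_upper[OF _ FFb]) (use that in "auto simp: FF_def")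
 have F0: "0 <= F al x" for al x unfolding F_def by(rule cSup_upper[OF _ FFb]) (auto simp: FF_def)
 have Flip: "F al x <= F al y + d x y" if "x:M" "y:M" for al x y
 proof -
  have "z <= F al y + d x y" if z: "z:FF al x" for z
  using z flip[OF _ \<open>x:M\<close> \<open>y:M\<close>] Fge[of _ al y] F0[of al y] nonneg[of x y] by(fastforce simp: FF_def)
  hence "Sup (FF al x) <= F al y + d x y" by(intro cSup_least) (auto simp: FF_def)
  thus ?thesis by(simp add: F_def)
 qed
 define de where "de = (%n. (1/2::real) ^ n)"
 have de: "0 < de n" "de n <= 1" for n by(auto simp: de_def power_le_one)
 \<comment> \<open>Positivity of \<open>h n al x\<close> says that \<open>f al x > 3 * de n\<close>
   while all earlier weights at \<open>x\<close> are below \<open>2 * de n\<close>. As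
   \<open>f\<close> is 1-Lipschitz, the gap \<open>de n\<close> between the two thresholds separates
   the supports for different indices, which is \<open>sep\<close>.\<close>
 define h where "h = (%n al x. max 0 (min (f al x - 3 * de n) (2 * de n - F al x)))"
 have hlip: "\<bar>h n al x - h n al y\<bar> <= d x y" if "al:M" "x:M" "y:M" for n al x y
  using flip[of al x y] flip[of al y x] Flip[of x y al] Flip[of y x al] that unfolding h_def commute[of y x] by linarith
 have h01: "0 <= h n al x" "h n al x <= 1" for n al x using f01(2)[of al x] de(1)[of n] unfolding h_def by linarith+
 have sep: "de n < d x y" if "al:M" "be:M" "x:M" "y:M" "0 < h n al x" "0 < h n be y" "al ~= be" for n al be x y
 proof -
  have *: "de n < d x y" if "lt al be" "al:M" "x:M" "y:M" "0 < h n al x" "0 < h n be y" for al be x y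
  using Fge[OF \<open>al:M\<close> \<open>lt al be\<close>, of y] flip[OF \<open>al:M\<close> \<open>x:M\<close> \<open>y:M\<close>] that
  by(auto simp: h_def max_def split: if_splits)
  show ?thesis using tot[OF \<open>al ~= be\<close>] *[of al be x y] *[of be al y x] that commute[of x y] by metis
 qed
 define sel where "sel = (%n x. SOME al. al:M & 0 < h n al x)"
 define H where "H = (%n x. if EX al:M. 0 < h n al x then h n (sel n x) x else 0)"
 have H01: "0 <= H n x" "H n x <= 1" for n x by(auto simp: H_def h01)
 have Hpos: "sel n x:M & 0 < h n (sel n x) x" if "0 < H n x" for n x using that unfolding H_def sel_def by(auto split: if_splits intro: someI2)
 \<comment> \<open>Half the separation distance: in such a ball at most one index is active at level
   \<open>n\<close>, so \<open>H n\<close> coincides with a single \<open>h n al\<close> and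
   \<open>sel n\<close> is constant where \<open>H n\<close> is positive.\<close>
 have local: "EX al:M. ALL x:M. d x x0 < de n / 2 --> H n x = h n al x & (0 < H n x --> sel n x = al)" if x0: "x0:M" for n x0
 proof(cases "EX x:M. d x x0 < de n / 2 & (EX al:M. 0 < h n al x)")
  case True
  then obtain x al where x: "x:M" "d x x0 < de n / 2" "al:M" "0 < h n al x" by blast
  have uniq: "be = al" if "y:M" "d y x0 < de n / 2" "be:M" "0 < h n be y" for y be
  using sep[of be al y x n] triangle'[of y x0 x] x x0 that by(fastforce simp: commute)
  have "H n y = h n al y & (0 < H n y --> sel n y = al)" if y: "y:M" "d y x0 < de n / 2" for y
  proof(cases "EX be:M. 0 < h n be y")
  case True
  hence "sel n y:M & 0 < h n (sel n y) y" unfolding sel_def by(metis (mono_tags, lifting) someI)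
  hence "sel n y = al" using uniq[OF y] by blast
  thus ?thesis using True by(simp add: H_def)
  next
  case False
  hence "h n al y = 0" using h01(1)[of n al y] x(3) by force
  thus ?thesis using False by(simp add: H_def)
  qed
  thus ?thesis using x(3) by blast
 next
  case False
  hence "h n x0 x = 0 & H n x = 0" if "x:M" "d x x0 < de n / 2" for x using that x0 h01(1)[of n x0 x] by(force simp: H_def)
  thus ?thesis using x0 by force
 qed
 have Hlim: "(H n ---> H n x0) (atin mtopology x0)" if x0: "x0:M" for n x0
 proof -
  obtain al where al: "al:M" "!!x. [|x:M; d x x0 < de n / 2|]==>H n x = h n al x" using local[OF x0] by blast
  have "((%y. H n y - H n x0) ---> 0) (atin mtopology x0)"
  proof(rule Lim_null_comparison[OF _ atin_mtopology(1)[OF x0]])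
  show "\<forall>\<^sub>F y in atin mtopology x0. norm (H n y - H n x0) <= d y x0"
  using atin_mtopology(2)[OF x0, of "de n / 2"] de(1)[of n] al hlip x0 by(auto elim!: eventually_mono)
  qed
  thus ?thesis by(simp add: LIM_zero_iff)
 qed
 have Hex: "EX n. 0 < H n x" if x: "x:M" for x
 proof -
  have "f x x > 0" using x r(1)[OF x] by(simp add: f_def)
  hence "x:{al:M. 0 < f al x}" using x by simp
  \<comment> \<open>For the least index \<open>al\<close> with \<open>f al x > 0\<close> the earlier
    weights vanish at \<open>x\<close>. Hence \<open>F al x = 0\<close>, and \<open>h n al x\<close>
    is positive as soon as \<open>3 * de n < f al x\<close>.\<close>
  then obtain al where "al:{al:M. 0 < f al x}" "!!be. (be, al):W - Id==>be ~: {al:M. 0 < f al x}" by(rule wfE_min[OF wf]) blast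
  hence al: "al:M" "0 < f al x" and least: "!!be. lt be al==>~ (be:M & 0 < f be x)" by(auto simp only: lt_def mem_Collect_eq)
  have "f be x = 0" if "be:M" "lt be al" for be using least[OF that(2)] that f01(1)[of be x] by auto
  hence "FF al x = {0}" by(auto simp: FF_def)
  hence "F al x = 0" by(simp add: F_def)
  moreover have "(%n. 3 * de n) \<longlonglongrightarrow> 3 * 0" unfolding de_def by(intro tendsto_intros LIMSEQ_power_zero) auto
  hence "\<forall>\<^sub>F n in sequentially. 3 * de n < f al x" using al(2) order_tendstoD(2)[of "%n. 3 * de n" 0] by simp
  then obtain n where "3 * de n < f al x" by(auto simp: eventually_sequentially)
  ultimately have "0 < h n al x" using de(1)[of n] by(simp add: h_def)
  hence "EX al:M. 0 < h n al x" using al(1) by blast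
  hence "0 < h n (sel n x) x" unfolding sel_def by(metis (mono_tags, lifting) someI)
  hence "0 < H n x" using \<open>EX al:M. 0 < h n al x\<close> by(simp add: H_def)
  thus ?thesis ..
 qed
 \<comment> \<open>At the first level with \<open>H n x > 0\<close> nothing is subtracted, so some
   \<open>k n x\<close> is positive. Near a point with \<open>H m x0 > 0\<close> the subtracted term
   exceeds 1 for all large \<open>n\<close>, so almost all \<open>k n\<close> vanish on a
   neighbourhood.\<close>
 define k where "k = (%n x. max 0 (H n x - real n * (\<Sum>i<n. H i x)))"
 have k0: "0 <= k n x" for n x by(simp add: k_def)
 have klim: "(k n ---> k n x0) (atin mtopology x0)" if x0: "x0:M" for n x0 unfolding k_def by(intro tendsto_intros Hlim x0)
 have kpos: "0 < H n x" if "0 < k n x" for n x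
 proof -
  have "0 <= real n * (\<Sum>i<n. H i x)" using H01(1) by(intro mult_nonneg_nonneg sum_nonneg) auto
  thus ?thesis using that unfolding k_def by linarith
 qed
 have kex: "EX n. 0 < k n x" if x: "x:M" for x
 proof -
  define n where "n = (LEAST n. 0 < H n x)"
  have n: "0 < H n x" "!!i. i < n==>~ 0 < H i x" using LeastI_ex[OF Hex[OF x]] not_less_Least unfolding n_def by blast+
  hence "H i x = 0" if "i < n" for i using that H01(1)[of i x] by fastforce
  hence "k n x = H n x" using n(1) by(simp add: k_def)
  thus ?thesis using n(1) by metis
 qed
 have kfin: "EX N. (ALL n>=N. k n x0 = 0) & (\<forall>\<^sub>F x in atin mtopology x0. ALL n>=N. k n x = 0)" if x0: "x0:M" for x0
 proof -
  obtain m where m: "0 < H m x0" using Hex[OF x0] by blast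
  obtain q::nat where q: "2 / H m x0 < real q" using reals_Archimedean2 by blast
  define N where "N = max (Suc m) q"
  have zero: "k n x = 0" if H: "H m x0 / 2 < H m x" and n: "N <= n" for n x
  proof -
  have "real q * (H m x0 / 2) > 1" using q m by(simp add: field_simps)
  also have "real q * (H m x0 / 2) <= real n * (\<Sum>i<n. H i x)"
  proof(rule mult_mono)
  have "H m x <= (\<Sum>i<n. H i x)" using n by(intro member_le_sum) (auto simp: N_def H01)
  thus "H m x0 / 2 <= (\<Sum>i<n. H i x)" using H by simp
  qed (use n m in "auto simp: N_def")
  finally show ?thesis using H01(2)[of n x] by(simp add: k_def)
  qed
  have "\<forall>\<^sub>F x in atin mtopology x0. H m x0 / 2 < H m x" using m by(intro order_tendstoD(1)[OF Hlim[OF x0]]) simp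
  hence "\<forall>\<^sub>F x in atin mtopology x0. ALL n>=N. k n x = 0" by eventually_elim (use zero in auto)
  moreover have "ALL n>=N. k n x0 = 0" using zero[of x0] m by auto
  ultimately show ?thesis by blast
 qed
 define tm where "tm = (%x n. if 0 < k n x then cscale E (cpx (k n x)) (a (sel n x)) else czero E)"
 have selS: "a (sel n x):S x" if "0 < k n x" "x:M" for n x
 proof -
  have "sel n x:M" "0 < h n (sel n x) x" using Hpos[OF kpos[OF that(1)]] by auto
  thus ?thesis using that(2) de(1)[of n] by(intro fpos) (auto simp: h_def max_def split: if_splits)
 qed
 have tmc: "tm x n:cA E" if "x:M" for x n using selS sub that by(force simp: tm_def)
 define T where "T = (%x N. \<Sum>n<N. k n x)"
 have T0: "0 <= T x N" for x N by(simp add: T_def sum_nonneg k0)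
 \<comment> \<open>The normalized partial sum for \<open>Suc N\<close> is the convex combination,
   with weight \<open>T x N / T x (Suc N)\<close>, of the previous one and the new element
   \<open>a (sel N x)\<close>; so binary convexity of \<open>S x\<close> suffices.\<close>
 have inS: "(0 < T x N --> cscale E (cpx (1 / T x N)) (csum E (tm x) N):S x) & (T x N = 0 --> csum E (tm x) N = czero E)" if x: "x:M" for x N
 proof(induction N)
  case 0
  thus ?case by(simp add: T_def)
 next
  case (Suc N)
  have TS: "T x (Suc N) = T x N + k N x" by(simp add: T_def)
  have cc: "csum E (tm x) N:cA E" using tmc[OF x] by(intro E.csum_closed)
  show ?case
  proof(cases "0 < k N x")
  case False
  hence "k N x = 0" using k0[of N x] by linarith
  thus ?thesis using Suc cc by(simp add: TS tm_def)
  next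
  case pos: True
  have aS: "a (sel N x):S x" by(rule selS[OF pos x])
  hence ac: "a (sel N x):cA E" using sub[OF x] by blast
  have "cscale E (cpx (1 / T x (Suc N))) (csum E (tm x) (Suc N)):S x"
  proof(cases "0 < T x N")
  case False
  hence "T x N = 0" using T0[of x N] by linarith
  thus ?thesis using Suc pos aS ac by(simp add: TS tm_def)
  next
  case True
  define t where "t = T x N / (T x N + k N x)"
  have t: "0 <= t" "t <= 1" "1 - t = k N x / (T x N + k N x)" using True pos by(auto simp: t_def field_simps)
  have "cadd E (cscale E (cpx t) (cscale E (cpx (1 / T x N)) (csum E (tm x) N)))
  (cscale E (cpx (1 - t)) (a (sel N x))):S x" using Suc True aS by(intro conv[OF x _ _ t(1,2)]) auto
  moreover have "cpx t * cpx (1 / T x N) = cpx (1 / (T x N + k N x))" using True by(simp add: t_def flip: of_real_mult)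
  ultimately show ?thesis using pos cc ac by(simp add: TS tm_def E.scale_add_right t(3))
  qed
  thus ?thesis using T0[of x N] pos by(simp add: TS)
  qed
 qed
 define N where "N = (%x. LEAST N. ALL n>=N. k n x = 0)"
 define u where "u = (%x. cscale E (cpx (1 / T x (N x))) (csum E (tm x) (N x)))"
 have Nx: "k n x = 0" if x: "x:M" and n: "N x <= n" for n x
 proof -
  have "EX N. ALL n>=N. k n x = 0" using kfin[OF x] by blast
  hence "ALL n>=N x. k n x = 0" unfolding N_def by(rule LeastI_ex)
  thus ?thesis using n by blast
 qed
 have u_eq: "u x = cscale E (cpx (1 / T x N')) (csum E (tm x) N')" and Tpos: "0 < T x N'" if x: "x:M" and N': "!!n. N' <= n==>k n x = 0" for x N'
 proof -
  have le: "N x <= N'" unfolding N_def by(rule Least_le) (use N' in blast)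
  have "T x N' = T x (N x)" unfolding T_def using le Nx[OF x] by(intro sum.mono_neutral_right) auto
  moreover have "csum E (tm x) N' = csum E (tm x) (N x)" using le Nx[OF x] tmc[OF x] by(intro E.csum_extend) (auto simp: tm_def)
  ultimately show "u x = cscale E (cpx (1 / T x N')) (csum E (tm x) N')" by(simp add: u_def)
  obtain n where n: "0 < k n x" using kex[OF x] by blast
  hence "n < N'" using N' by(metis less_irrefl linorder_not_le)
  hence "k n x <= T x N'" unfolding T_def by(intro member_le_sum) (auto simp: k0)
  thus "0 < T x N'" using n by linarith
 qed
 show thesis
 proof(rule that)
  show uS: "u x:S x" if "x:M" for x using inS[OF that, of "N x"] Tpos[OF that Nx[OF that]] by(simp add: u_def)
  show "cmap mtopology (ntop E) u" unfolding continuous_map_atin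
  proof
  fix x0 assume "x0:tsp mtopology"
  hence x0: "x0:M" by simp
  obtain N' where N': "\<forall>\<^sub>F x in atin mtopology x0. ALL n>=N'. k n x = 0" using kfin[OF x0] by blast
  define N2 where "N2 = max N' (N x0)"
  have N2: "k n x0 = 0" if "N2 <= n" for n using Nx[OF x0] that by(simp add: N2_def)
  have tmlim: "limitin (ntop E) (%x. tm x n) (tm x0 n) (atin mtopology x0)" for n
  proof -
  obtain al where al: "al:M" "!!x. [|x:M; d x x0 < de n / 2; 0 < H n x|]==>sel n x = al" using local[OF x0] by blast
  have ac: "a al:cA E" using a[OF al(1,1)] sub[OF al(1)] r(1)[OF al(1)] al(1) by auto
  have eq: "tm x n = cscale E (cpx (k n x)) (a al)" if "x:M" "d x x0 < de n / 2" for x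
  proof(cases "0 < k n x")
  case True
  thus ?thesis using al(2)[OF that kpos] by(simp add: tm_def)
  next
  case False
  hence "k n x = 0" using k0[of n x] by linarith
  thus ?thesis using ac by(simp add: tm_def)
  qed
  have "limitin (ntop E) (%x. a al) (a al) (atin mtopology x0)" using ac by(simp add: E.limitin_norm)
  from E.limitin_sc[OF klim[OF x0] this]
  have "limitin (ntop E) (%x. cscale E (cpx (k n x)) (a al)) (cscale E (cpx (k n x0)) (a al)) (atin mtopology x0)" .
  moreover have "\<forall>\<^sub>F x in atin mtopology x0. cscale E (cpx (k n x)) (a al) = tm x n"
  using atin_mtopology(2)[OF x0, of "de n / 2"] de(1)[of n] eq by(auto elim: eventually_mono)
  moreover have "tm x0 n = cscale E (cpx (k n x0)) (a al)" using eq[OF x0] x0 de(1)[of n] by simp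
  ultimately show ?thesis by(simp add: limitin_transform_eventually)
  qed
  have Tlim: "((%x. T x N2) ---> T x0 N2) (atin mtopology x0)" unfolding T_def by(intro tendsto_intros klim x0)
  have "limitin (ntop E) (%x. cscale E (cpx (1 / T x N2)) (csum E (tm x) N2))
  (cscale E (cpx (1 / T x0 N2)) (csum E (tm x0) N2)) (atin mtopology x0)" using Tpos[OF x0, of N2] N2
  by(intro E.limitin_sc E.limitin_csum tmlim tendsto_intros Tlim) auto
  moreover have "u x0 = cscale E (cpx (1 / T x0 N2)) (csum E (tm x0) N2)" by(rule u_eq[OF x0 N2])
  moreover have "\<forall>\<^sub>F x in atin mtopology x0. cscale E (cpx (1 / T x N2)) (csum E (tm x) N2) = u x"
  using N' atin_mtopology(2)[OF x0, of 1, simplified]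
  proof eventually_elim
  case (elim x)
  thus ?case by(intro u_eq(1)[symmetric]) (auto simp: N2_def)
  qed
  ultimately show "limitin (ntop E) u (u x0) (atin mtopology x0)" by(simp add: limitin_transform_eventually)
  qed
 qed
qed

lemma Ca_class_mi_le: assumes C: "gpre G C" and F: "fspace X F" and f: "f:cA (Cb X C)" "g:cA (Cb X C)"
 shows "cdist (Ca X F C) (clA X F C f) (clA X F C g) <= cdist (Cb X C) f g"
proof -
 interpret C: gpre G C by(rule C)
 interpret E: gpre G "Cb X C" by(rule C.Cb_gpre)
 show ?thesis unfolding C.cdist_Ca_le_iff[OF F f E.cdist_ge0]
 proof(intro allI impI)
  fix ep::real assume "0 < ep"
  show "\<forall>\<^sub>F x in F. cdist C (f x) (g x) <= cdist (Cb X C) f g + ep" using F[unfolded fspace_def]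
  proof eventually_elim
  case (elim x)
  thus ?case using C.cdist_val_le[OF f elim] \<open>0 < ep\<close> by simp
  qed
 qed
qed

context gpre
begin

lemma cdist_convex: assumes car: "a:cA A" "b:cA A" "z:cA A" and t: "0 <= t" "t <= 1" and a: "cdist A a z <= ep" and b: "cdist A b z <= ep"
 shows "cdist A (cadd A (cscale A (cpx t) a) (cscale A (cpx (1 - t)) b)) z <= ep"
proof -
 have "z = cadd A (cscale A (cpx t) z) (cscale A (cpx (1 - t)) z)" using car scale_add_left[of z "cpx t" "cpx (1 - t)"] by simp
 hence "cdist A (cadd A (cscale A (cpx t) a) (cscale A (cpx (1 - t)) b)) z <= cdist A (cscale A (cpx t) a) (cscale A (cpx t) z)
  + cdist A (cscale A (cpx (1 - t)) b) (cscale A (cpx (1 - t)) z)" using cdist_add[of "cscale A (cpx t) a" "cscale A (cpx (1 - t)) b"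
  "cscale A (cpx t) z" "cscale A (cpx (1 - t)) z"] car by simp
 also have "\<dots> = t * cdist A a z + (1 - t) * cdist A b z" using car t norm_of_real[of "1 - t", where ?'a = complex]
  by(simp add: cdist_sc del: of_real_diff)
 also have "\<dots> <= t * ep + (1 - t) * ep" using a b t by(intro add_mono mult_left_mono) auto
 finally show ?thesis by(simp add: algebra_simps)
qed

text \<open>The theorem of Bartle and Graves, for the quotient map from \<open>Cb X A\<close> to \<open>Ca X F A\<close>.\<close>

lemma approximate_lift: assumes M: "Metric_space M d" and F: "fspace X F" and ep: "0 < ep" and ga: "cmap (Metric_space.mtopology M d) (ntop (Ca X F A)) ga"
 obtains u where "cmap (Metric_space.mtopology M d) (ntop (Cb X A)) u" "!!x. x:M==>cdist (Ca X F A) (clA X F A (u x)) (ga x) <= ep"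
  "!!x. x:M==>cnorm (Cb X A) (u x) <= cnorm (Ca X F A) (ga x) + 2 * ep"
proof -
 interpret M: Metric_space M d by(rule M)
 interpret E: gpre G "Cb X A" by(rule Cb_gpre)
 interpret Q: gpre G "Ca X F A" by(rule Ca_gpre[OF F])
 let ?q = "clA X F A"
 have gac: "ga x:cA (Ca X F A)" if "x:M" for x using ga that by(auto simp: Q.cmap_ntop)
 \<comment> \<open>A nearly norm-minimal representative at \<open>al\<close> exceeds the quotient
   norm by less than \<open>ep\<close>. The second \<open>ep\<close> in the norm bound absorbs the
   variation of \<open>ga\<close> around \<open>al\<close>, so that this one representative is
   admissible on a whole ball.\<close>
 define S where "S = (%x. {a:cA (Cb X A). cdist (Ca X F A) (?q a) (ga x) <= ep & cnorm (Cb X A) a <= cnorm (Ca X F A) (ga x) + 2 * ep})"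
 obtain u where u: "cmap M.mtopology (ntop (Cb X A)) u" "!!x. x:M==>u x:S x"
 proof(rule M.cont_sel[OF E.pre_cstar_axioms, of S])
  fix x a b and t::real assume *: "x:M" "a:S x" "b:S x" "0 <= t" "t <= 1"
  let ?c = "cadd (Cb X A) (cscale (Cb X A) (cpx t) a) (cscale (Cb X A) (cpx (1 - t)) b)"
  have ab: "a:cA (Cb X A)" "b:cA (Cb X A)" using * by(auto simp: S_def)
  have q: "?q ?c = cadd (Ca X F A) (cscale (Ca X F A) (cpx t) (?q a)) (cscale (Ca X F A) (cpx (1 - t)) (?q b))" using ab by(simp add: Ca_simps[OF F])
  have "cdist (Ca X F A) (?q ?c) (ga x) <= ep" unfolding q using * ab by(intro Q.cdist_convex gac) (auto simp: S_def)
  moreover have "cdist (Cb X A) ?c (czero (Cb X A)) <= cnorm (Ca X F A) (ga x) + 2 * ep" using * ab by(intro E.cdist_convex) (auto simp: S_def)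
  ultimately show "?c:S x" using ab by(simp add: S_def)
 next
  fix al assume al: "al:M"
  obtain a where a: "a:cA (Cb X A)" "?q a = ga al" "cnorm (Cb X A) a < cnorm (Ca X F A) (ga al) + ep"
  proof -
  obtain f where f: "f:cA (Cb X A)" "ga al = ?q f" using gac[OF al] by(auto simp: cA_Ca)
  have "?q f ~= {}" using Ca_class_self[OF F f(1)] by blast
  moreover have "bdd_below (cnorm (Cb X A) ` ?q f)" by(rule bdd_belowI[of _ 0]) (auto simp: in_Ca_class_iff[OF F f(1)] norm_Cb_ge0)
  moreover have "(INF f\<in>?q f. cnorm (Cb X A) f) < cnorm (Ca X F A) (ga al) + ep" using ep f by(simp add: cnorm_Ca)
  ultimately obtain a where a: "a : ?q f" "cnorm (Cb X A) a < cnorm (Ca X F A) (ga al) + ep" by(auto simp: cINF_less_iff)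
  hence "a:cA (Cb X A)" "aeq F A a f" by(simp_all add: in_Ca_class_iff[OF F f(1)])
  thus thesis using that[of a] a f by(simp add: Ca_class_eq_iff[OF F])
  qed
  obtain U where U: "openin M.mtopology U" "al:U" "!!x. x:U==>cdist (Ca X F A) (ga x) (ga al) < ep"
  using ga al ep unfolding Q.cont_map_norm_topology_open by force
  obtain r where r: "0 < r" "M.mball al r <= U" using U by(auto simp: M.openin_mtopology)
  have "a:S x" if x: "x:M" "d x al < r" for x
  proof -
  have "x:U" using r x al by(auto simp: M.commute)
  hence d: "cdist (Ca X F A) (ga x) (ga al) < ep" by(rule U(3))
  hence "cnorm (Ca X F A) (ga al) <= cnorm (Ca X F A) (ga x) + ep" using Q.norm_le[of "ga al" "ga x"] gac al x by(simp add: Q.cdist_comm)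
  thus ?thesis using a d by(simp add: S_def Q.cdist_comm)
  qed
  thus "EX a r. 0 < r & (ALL x:M. d x al < r --> a:S x)" using r(1) by blast
 qed (auto simp: S_def intro: that)
 thus thesis by(intro that[of u]) (auto simp: S_def)
qed

lemma geometric_Cauchy: assumes s: "!!n. s n:cA A" and step: "!!n. cdist A (s (Suc n)) (s n) <= 2 * (1/2) ^ n"
 shows "m <= n==>cdist A (s n) (s m) <= 4 * (1/2) ^ m - 4 * (1/2) ^ n"
proof(induction n rule: dec_induct)
 case (step n)
 thus ?case using cdist_tri[of "s (Suc n)" "s n" "s m"] s assms(2)[of n] by simp
qed simp

text \<open>Each step lifts the remaining error, which is at most \<open>(1/2) ^ n\<close>, so the
  corrections form a convergent series. The constant 7 is 2 from the first approximate lift, 4 from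
  the sum of the corrections and 1 from the approximation of the limit.\<close>

theorem cont_lift: assumes M: "Metric_space M d" and F: "fspace X F" and compl: "Metric_space.mcomplete (cA A) (cdist A)"
  and ga: "cmap (Metric_space.mtopology M d) (ntop (Ca X F A)) ga"
 obtains u where "cmap (Metric_space.mtopology M d) (ntop (Cb X A)) u" "!!x. x:M==>clA X F A (u x) = ga x"
  "!!x. x:M==>cnorm (Cb X A) (u x) <= cnorm (Ca X F A) (ga x) + 7"
proof -
 interpret M: Metric_space M d by(rule M)
 interpret E: gpre G "Cb X A" by(rule Cb_gpre)
 interpret ME: Metric_space "cA (Cb X A)" "cdist (Cb X A)" by(rule E.metric)
 interpret Q: gpre G "Ca X F A" by(rule Ca_gpre[OF F])
 let ?q = "clA X F A"
 let ?T = "M.mtopology"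
 have gac: "ga x:cA (Ca X F A)" if "x:M" for x using ga that by(auto simp: Q.cmap_ntop)
 define P where "P = (%n s. cmap ?T (ntop (Cb X A)) s & (ALL x:M. cdist (Ca X F A) (?q (s x)) (ga x) <= (1/2) ^ n)
  & (n = 0 --> (ALL x:M. cnorm (Cb X A) (s x) <= cnorm (Ca X F A) (ga x) + 2)))"
 obtain s0 where "cmap ?T (ntop (Cb X A)) s0" "!!x. x:M==>cdist (Ca X F A) (?q (s0 x)) (ga x) <= 1"
  "!!x. x:M==>cnorm (Cb X A) (s0 x) <= cnorm (Ca X F A) (ga x) + 2 * 1" by(rule approximate_lift[OF M F zero_less_one ga]) blast
 hence base: "EX s. P 0 s" by(auto simp: P_def)
 have step: "EX s'. P (Suc n) s' & (ALL x:M. cdist (Cb X A) (s' x) (s x) <= 2 * (1/2) ^ n)" if s: "P n s" for n s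
 proof -
  have sc: "cmap ?T (ntop (Cb X A)) s" and sx: "!!x. x:M==>s x:cA (Cb X A)"
  and sd: "!!x. x:M==>cdist (Ca X F A) (?q (s x)) (ga x) <= (1/2) ^ n" using s by(auto simp: P_def E.cmap_ntop)
  have qs: "cmap ?T (ntop (Ca X F A)) (%x. ?q (s x))" by(rule cmap_contr[OF E.pre_cstar_axioms Q.pre_cstar_axioms
  Ca_class_mi_le[OF gpre_axioms F] Ca_class_closed sc])
  have pos: "0 < (1/2::real) ^ Suc n" by simp
  have "cmap ?T (ntop (Ca X F A))
  (%x. opn (Ca X F A) Add (ga x) (opn (Ca X F A) (Scale (-1)) (?q (s x)) (?q (s x))))" by(intro Q.cont_map_opn ga qs) (auto simp: opcs_def)
  hence "cmap ?T (ntop (Ca X F A)) (%x. cminus (Ca X F A) (ga x) (?q (s x)))" by(simp add: cminus_def)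
  then obtain v where v: "cmap ?T (ntop (Cb X A)) v" "!!x. x:M==>cdist (Ca X F A) (?q (v x)) (cminus (Ca X F A) (ga x) (?q (s x))) <= (1/2) ^ Suc n"
  "!!x. x:M==>cnorm (Cb X A) (v x) <= cnorm (Ca X F A) (cminus (Ca X F A) (ga x) (?q (s x))) + 2 * (1/2) ^ Suc n" by(rule approximate_lift[OF M F pos]) blast
  have vx: "v x:cA (Cb X A)" if "x:M" for x using v(1) that by(auto simp: E.cmap_ntop)
  let ?s' = "%x. cadd (Cb X A) (s x) (v x)"
  have "cmap ?T (ntop (Cb X A)) (%x. opn (Cb X A) Add (s x) (v x))" by(intro E.cont_map_opn sc v) (auto simp: opcs_def)
  hence "cmap ?T (ntop (Cb X A)) ?s'" by simp
  moreover have "cdist (Ca X F A) (?q (?s' x)) (ga x) <= (1/2) ^ Suc n" if x: "x:M" for x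
  proof -
  have "ga x = cadd (Ca X F A) (?q (s x)) (cminus (Ca X F A) (ga x) (?q (s x)))" using sx[OF x] gac[OF x] by simp
  hence "cdist (Ca X F A) (?q (?s' x)) (ga x) <= cdist (Ca X F A) (?q (s x)) (?q (s x))
  + cdist (Ca X F A) (?q (v x)) (cminus (Ca X F A) (ga x) (?q (s x)))"
  using Q.cdist_add[of "?q (s x)" "?q (v x)" "?q (s x)" "cminus (Ca X F A) (ga x) (?q (s x))"]
  sx[OF x] vx[OF x] gac[OF x] by(simp add: Ca_simps[OF F])
  thus ?thesis using v(2)[OF x] by simp
  qed
  moreover have "cdist (Cb X A) (?s' x) (s x) <= 2 * (1/2) ^ n" if x: "x:M" for x
  proof -
  have "cdist (Cb X A) (?s' x) (s x) <= cnorm (Cb X A) (v x)" using E.cdist_add[of "s x" "v x" "s x" "czero (Cb X A)"] sx[OF x] vx[OF x] by simp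
  also have "\<dots> <= cdist (Ca X F A) (ga x) (?q (s x)) + 2 * (1/2) ^ Suc n" using v(3)[OF x] sx[OF x] gac[OF x] by(simp add: cdist_def)
  also have "\<dots> <= 2 * (1/2) ^ n" using sd[OF x] by(simp add: Q.cdist_comm)
  finally show ?thesis .
  qed
  ultimately show ?thesis by(intro exI[of _ ?s']) (auto simp: P_def)
 qed
 obtain s where s: "!!n. P n (s n)" and sd: "!!n x. x:M==>cdist (Cb X A) (s (Suc n) x) (s n x) <= 2 * (1/2) ^ n"
  using dependent_nat_choice[of P "%n s s'. ALL x:M. cdist (Cb X A) (s' x) (s x) <= 2 * (1/2) ^ n"]
  base step by metis
 have sc: "cmap ?T (ntop (Cb X A)) (s n)" for n using s[of n] by(simp add: P_def)
 hence sx: "s n x:cA (Cb X A)" if "x:M" for n x using that by(simp add: E.cmap_ntop)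
 have sq: "cdist (Ca X F A) (?q (s n x)) (ga x) <= (1/2) ^ n" if "x:M" for n x using s[of n] that by(simp add: P_def)
 have cau: "cdist (Cb X A) (s n x) (s m x) <= 4 * (1/2) ^ m" if "m <= n" "x:M" for m n x
  using E.geometric_Cauchy[of "%n. s n x", OF sx[OF that(2)] sd[OF that(2)] that(1)] by(rule order_trans) simp
 have small: "EX N. 4 * (1/2) ^ N < ep" if "0 < ep" for ep::real using real_arch_pow_inv[of "ep/4" "1/2"] that by(auto simp: field_simps)
 obtain u where u: "cmap ?T ME.mtopology u" "!!ep. 0 < ep==>\<forall>\<^sub>F n in sequentially. ALL x:tsp ?T. cdist (Cb X A) (s n x) (u x) < ep"
 proof(rule ME.continuous_map_uniformly_Cauchy_limit[OF Cb_complete[OF compl]])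
  show "\<forall>\<^sub>F n in sequentially. cmap ?T ME.mtopology (s n)" using sc by(simp add: norm_topology_def)
  fix ep::real assume "0 < ep"
  then obtain N where N: "4 * (1/2) ^ N < ep / 2" using small[of "ep/2"] by auto
  have "cdist (Cb X A) (s m x) (s n x) < ep" if "N <= m" "N <= n" "x:M" for m n x
  using E.cdist_tri[of "s m x" "s N x" "s n x"] cau[OF that(1,3)] cau[OF that(2,3)] N sx[OF that(3)] by(simp add: E.cdist_comm[of "s N x"])
  thus "EX N. ALL m n x. N <= m --> N <= n --> x:tsp ?T --> cdist (Cb X A) (s m x) (s n x) < ep" by auto
 qed blast
 have uc: "cmap ?T (ntop (Cb X A)) u" using u(1) by(simp add: norm_topology_def)
 hence ux: "u x:cA (Cb X A)" if "x:M" for x using that by(simp add: E.cmap_ntop)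
 show thesis
 proof(rule that[OF uc])
  fix x assume x: "x:M"
  have near: "EX N. ALL n>=N. cdist (Cb X A) (s n x) (u x) < ep" if "0 < ep" for ep using u(2)[OF that] x by(auto simp: eventually_sequentially)
  have "cdist (Ca X F A) (?q (u x)) (ga x) <= 0"
  proof(rule field_le_epsilon)
  fix ep::real assume ep: "0 < ep"
  obtain N where N: "ALL n>=N. cdist (Cb X A) (s n x) (u x) < ep / 2" using near[of "ep/2"] ep by auto
  obtain N' where N': "4 * (1/2) ^ N' < ep / 2" using small[of "ep/2"] ep by auto
  define n where "n = max N N'"
  have "(1/2::real) ^ n <= (1/2) ^ N'" by(rule power_decreasing) (auto simp: n_def)
  moreover have "cdist (Ca X F A) (?q (u x)) (?q (s n x)) <= cdist (Cb X A) (s n x) (u x)"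
  using Ca_class_mi_le[OF gpre_axioms F ux[OF x] sx[OF x]] by(simp add: E.cdist_comm)
  moreover have "cdist (Cb X A) (s n x) (u x) < ep / 2" using N by(simp add: n_def)
  ultimately show "cdist (Ca X F A) (?q (u x)) (ga x) <= 0 + ep" using Q.cdist_tri[OF Ca_class_closed[OF ux[OF x]] Ca_class_closed[OF sx[OF x]] gac[OF x], of n]
  sq[OF x, of n] N' ep by linarith
  qed
  thus "?q (u x) = ga x" using Q.cdist_eq_0_iff[of "?q (u x)" "ga x"] Q.cdist_ge0 ux[OF x] gac[OF x] by(simp add: order_antisym)
  obtain N where N: "cdist (Cb X A) (s N x) (u x) < 1" using near[of 1] by auto
  have "cdist (Cb X A) (u x) (s 0 x) <= cdist (Cb X A) (u x) (s N x) + cdist (Cb X A) (s N x) (s 0 x)" using ux[OF x] sx[OF x] by(intro E.cdist_tri)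
  also have "\<dots> <= 1 + 4" using N cau[of 0 N x] x by(simp add: E.cdist_comm[of "u x"])
  finally have "cnorm (Cb X A) (u x) <= cnorm (Cb X A) (s 0 x) + 5" using E.norm_le[of "u x" "s 0 x"] ux[OF x] sx[OF x] by simp
  thus "cnorm (Cb X A) (u x) <= cnorm (Ca X F A) (ga x) + 7" using s[of 0] x by(auto simp: P_def)
 qed
qed

end

text \<open>The lifts that can serve as outer factor of a composition: continuity makes
  \<open>x \<mapsto> g (f a x)\<close> continuous, and the bound makes it bounded when
  \<open>f a\<close> is.\<close>

definition camor::"'g monoid=>('g, 'a) galg=>('g, 'b) galg=>'x topology=>'x filter =>('a=>'x=>'b)=>bool" where "camor G A B X F f <-> amor G A B X F f &
  cmap (ntop A) (ntop (Cb X B)) f & (EX K. ALL a:cA A. cnorm (Cb X B) (f a) <= cnorm A a + K)"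

theorem Mor_clift: assumes A: "calg G A" and B: "calg G B" and F: "fspace X F" and ph: "ph:Mor G A (Ca X F B)"
 obtains f where "camor G A B X F f" "ph = mor_of X F A B f"
proof -
 interpret A: gpre G A using A by(rule calg_gpre)
 interpret B: gpre G B using B by(rule calg_gpre)
 have Q: "gpre G (Ca X F B)" by(rule B.Ca_gpre[OF F])
 have compl: "Metric_space.mcomplete (cA B) (cdist B)" using B by(simp add: calg_def cstar_algebra_iff)
 have T: "ntop A = Metric_space.mtopology (cA A) (cdist A)" by(simp add: norm_topology_def)
 have "cmap (ntop A) (ntop (Ca X F B)) (%x. ph x)" by(rule Mor_cont[OF A Q ph]) simp
 then obtain f where f: "cmap (ntop A) (ntop (Cb X B)) f" "!!x. x:cA A==>clA X F B (f x) = ph x"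
  "!!x. x:cA A==>cnorm (Cb X B) (f x) <= cnorm (Ca X F B) (ph x) + 7" unfolding T by(rule B.cont_lift[OF A.metric F compl]) blast
 have eq: "ph = mor_of X F A B f" using ph f(2) by(intro extensionalityI[of _ "cA A"]) (auto simp: Mor_iff mor_of_def)
 interpret E: gpre G "Cb X B" by(rule B.Cb_gpre)
 have fc: "f a:cA (Cb X B)" if "a:cA A" for a using f(1) that by(simp add: E.cmap_ntop)
 have "amor G A B X F f" using ph unfolding eq by(subst amor_iff_Mor[OF A.gpre_axioms B.gpre_axioms F fc])
 moreover have "cnorm (Cb X B) (f a) <= cnorm A a + 7" if "a:cA A" for a using f(3)[OF that] Mor_norm[OF A Q ph that] by simp
 ultimately show thesis using f(1) eq by(intro that[of f]) (auto simp: camor_def)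
qed

section \<open>Realizations and weak topologies\<close>

text \<open>The weak topology of a family of pieces. With closed simplices as pieces it is the
  topology of a realization; with products of simplices it gives the product of two realizations a
  topology for which continuity is tested on compact pieces.\<close>

definition wtop::"'z::topological_space set set=>'z topology" where "wtop PP = topology (%U. U <= \<Union>PP & (ALL P:PP. openin (tos P) (U Int P)))"

lemma op_wtop: "openin (wtop PP) U <-> U <= \<Union>PP & (ALL P:PP. openin (tos P) (U Int P))"
proof -
 have "istopology (%U. U <= \<Union>PP & (ALL P:PP. openin (tos P) (U Int P)))" unfolding istopology_def
 proof(intro conjI allI impI ballI)
  fix U V P assume U: "U <= \<Union>PP & (ALL P:PP. openin (tos P) (U Int P))" and V: "V <= \<Union>PP & (ALL P:PP. openin (tos P) (V Int P))" and P: "P:PP"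
  have "(U Int V) Int P = (U Int P) Int (V Int P)" by blast
  thus "openin (tos P) (U Int V Int P)" using U V P by(metis openin_Int)
 next
  fix K P assume K: "ALL U:K. U <= \<Union>PP & (ALL P:PP. openin (tos P) (U Int P))" and P: "P:PP"
  have "openin (tos P) (\<Union>((%U. U Int P) ` K))" using K P by(intro openin_Union) blast
  moreover have "\<Union>((%U. U Int P) ` K) = \<Union>K Int P" by blast
  ultimately show "openin (tos P) (\<Union>K Int P)" by simp
 qed blast+
 thus ?thesis by(simp add: wtop_def topology_inverse')
qed

lemma tsp_wtop [simp]: "tsp (wtop PP) = \<Union>PP"
proof(rule antisym)
 show "tsp (wtop PP) <= \<Union>PP" using openin_topspace[of "wtop PP"] unfolding op_wtop by blast
 have "openin (wtop PP) (\<Union>PP)" unfolding op_wtop by(auto simp: Int_absorb1 Union_upper)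
 thus "\<Union>PP <= tsp (wtop PP)" by(rule openin_subset)
qed

lemma cmap_wtop: "cmap (wtop PP) T f <-> (ALL P:PP. cmap (tos P) T f)"
proof(intro iffI ballI)
 fix P assume c: "cmap (wtop PP) T f" and P: "P:PP"
 show "cmap (tos P) T f" unfolding continuous_map_def
 proof(intro conjI allI impI)
  show "f:tsp (tos P) \<rightarrow> tsp T" using c P by(auto simp: continuous_map_def)
  fix U assume "openin T U"
  hence "openin (wtop PP) {x:\<Union>PP. f x:U}" using c by(simp add: continuous_map_def)
  hence "openin (tos P) ({x:\<Union>PP. f x:U} Int P)" using P by(simp add: op_wtop)
  moreover have "{x:\<Union>PP. f x:U} Int P = {x:tsp (tos P). f x:U}" using P by auto
  ultimately show "openin (tos P) {x:tsp (tos P). f x:U}" by simp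
 qed
next
 assume c: "ALL P:PP. cmap (tos P) T f"
 show "cmap (wtop PP) T f" unfolding continuous_map_def
 proof(intro conjI allI impI)
  show "f:tsp (wtop PP) \<rightarrow> tsp T" using c by(auto simp: continuous_map_def)
  fix U assume U: "openin T U"
  have "openin (tos P) ({x:\<Union>PP. f x:U} Int P)" if P: "P:PP" for P
  proof -
  have "openin (tos P) {x:tsp (tos P). f x:U}" using c P U by(simp add: continuous_map_def)
  moreover have "{x:\<Union>PP. f x:U} Int P = {x:tsp (tos P). f x:U}" using P by auto
  ultimately show ?thesis by simp
  qed
  thus "openin (wtop PP) {x:tsp (wtop PP). f x:U}" by(auto simp: op_wtop)
 qed
qed

text \<open>The working notion of continuity between weak topologies. That every piece lands in one
  piece is more than continuity; it makes the notion stable under composition and products and keeps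
  finitely many simplices in play on each piece.\<close>

definition pmap::"'y::topological_space set set=>'z::topological_space set set=>('y=>'z)=>bool" where
 "pmap PP QQ h <-> (ALL P:PP. EX Q:QQ. h ` P <= Q & con_on P h)"

lemma pmapD: assumes "pmap PP QQ h" "P:PP"
 obtains Q where "Q:QQ" "h ` P <= Q" "con_on P h" using assms by(auto simp: pmap_def)

lemma cont_map_pieces: assumes "cmap (wtop QQ) T f" "Q:QQ" "con_on P h" "h ` P <= Q" shows "cmap (tos P) T (%x. f (h x))"
proof -
 have "cmap (tos P) (tos Q) h" using assms(3,4) by(simp add: continuous_map_in_subtopology image_subset_iff_funcset)
 moreover have "cmap (tos Q) T f" using assms(1,2) by(simp add: cmap_wtop)
 ultimately show ?thesis using continuous_map_compose[of "tos P" "tos Q" h T f] by(simp add: o_def)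
qed

lemma pmap_cmap: assumes "pmap PP QQ h" shows "cmap (wtop PP) (wtop QQ) h" unfolding cmap_wtop
proof
 fix P assume "P:PP"
 with assms obtain Q where Q: "Q:QQ" "h ` P <= Q" "con_on P h" by(rule pmapD)
 show "cmap (tos P) (wtop QQ) h" by(rule cont_map_pieces[of QQ _ "%x. x", OF _ Q(1,3,2)]) simp
qed

lemma pmap_comp: assumes h: "pmap PP QQ h" and k: "pmap QQ RR k" shows "pmap PP RR (%x. k (h x))" unfolding pmap_def
proof
 fix P assume "P:PP"
 with h obtain Q where Q: "Q:QQ" "h ` P <= Q" "con_on P h" by(rule pmapD)
 from k Q(1) obtain R where R: "R:RR" "k ` Q <= R" "con_on Q k" by(rule pmapD)
 show "EX R:RR. (%x. k (h x)) ` P <= R & con_on P (%x. k (h x))" using Q R by(intro bexI[of _ R]) (auto intro: continuous_on_compose2)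
qed

definition supp::"'v pt=>'v set" where "supp x = {v. x v ~= 0}"

definition cells::"'v set=>'v pt set set" where "cells S = rl ` spx S"

lemma spxD: "sg:spx S==>finite sg & sg ~= {} & sg <= S" by(simp add: sx_def)

lemma spx_mono: "S <= S'==>spx S <= spx S'" by(auto simp: sx_def)

lemma in_rl: "x:rl S <-> (ALL v. 0 <= x v) & supp x:spx S & sum x (supp x) = 1" by(simp add: realization_def supp_def)

lemma rl_fin: assumes "finite sg" shows "x:rl sg <-> (ALL v. 0 <= x v) & supp x <= sg & sum x sg = 1"
proof -
 have "sum x (supp x) = sum x sg" if "supp x <= sg" using that assms by(intro sum.mono_neutral_left) (auto simp: supp_def)
 moreover have "supp x ~= {}" if "sum x sg = 1"
 proof
  assume "supp x = {}"
  hence "sum x sg = 0" by(intro sum.neutral) (auto simp: supp_def)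
  with that show False by simp
 qed
 ultimately show ?thesis using assms by(auto simp: in_rl sx_def finite_subset)
qed

lemma supp_spx: "x:rl S==>supp x:spx S" by(simp add: in_rl)

lemma supp_fin: "x:rl S==>finite (supp x)" by(simp add: in_rl sx_def)

lemma supp_sub: "x:rl S==>supp x <= S" by(simp add: in_rl sx_def)

lemma supp_nonempty: "x:rl S==>supp x ~= {}" by(simp add: in_rl sx_def)

lemma rl_iff_supp: "x:rl S==>x:rl S' <-> supp x <= S'" by(auto simp: in_rl sx_def)

lemma rl_mono: "S <= S'==>rl S <= rl S'" unfolding subset_iff in_rl sx_def by blast

lemma rl_supp: "x:rl S==>x:rl (supp x)" by(auto simp: in_rl sx_def)

lemma Union_cells [simp]: "\<Union>(cells S) = rl S"
proof
 show "\<Union>(cells S) <= rl S" using rl_mono by(fastforce simp: cells_def dest: spxD)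
 show "rl S <= \<Union>(cells S)" using rl_supp supp_spx by(force simp: cells_def)
qed

lemma rtop_weak: "rtop S = wtop (cells S)" unfolding topology_eq openin_realization_topology op_wtop Union_cells by(simp add: cells_def)

lemma tsp_rl_topology [simp]: "tsp (rtop S) = rl S" by(simp add: rtop_weak)

lemma rl_seg: assumes x: "x:rl S" and y: "y:rl S" and t: "0 <= t" "t <= 1" shows "segment t x y:rl S"
proof -
 define sg where "sg = supp x Un supp y"
 have fin: "finite sg" and sub: "sg <= S" using supp_fin[OF x] supp_fin[OF y] supp_sub[OF x] supp_sub[OF y] by(auto simp: sg_def)
 have "x:rl sg" "y:rl sg" using rl_iff_supp[OF x] rl_iff_supp[OF y] by(auto simp: sg_def)
 hence *: "ALL v. 0 <= x v" "ALL v. 0 <= y v" "sum x sg = 1" "sum y sg = 1" "supp x <= sg" "supp y <= sg" by(auto simp: rl_fin[OF fin])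
 have "sum (segment t x y) sg = (1 - t) * sum x sg + t * sum y sg" by(simp add: segment_def sum.distrib sum_distrib_left)
 moreover have "supp (segment t x y) <= sg" by(auto simp: supp_def segment_def sg_def)
 ultimately have "segment t x y:rl sg" using * t by(auto simp: rl_fin[OF fin] segment_def)
 thus ?thesis using rl_mono[OF sub] by blast
qed

lemma seg_0 [simp]: "segment 0 x y = x" and segment_1 [simp]: "segment 1 x y = y" by(auto simp: segment_def)

lemma supp_vtx [simp]: "supp (vertex v) = {v}" by(auto simp: supp_def vertex_def)

lemma vtx_in_rl [simp]: "vertex v:rl S <-> v:S" by(auto simp: in_rl sx_def) (auto simp: vertex_def)

lemma in_rl_singleton: "x:rl {v} <-> x = vertex v"
proof
 assume "x:rl {v}"
 hence "supp x <= {v}" "x v = 1" by(auto simp: rl_fin)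
 thus "x = vertex v" by(auto simp: supp_def vertex_def fun_eq_iff)
qed simp

lemma aff_supp: "aff al x = (%w. \<Sum>v | v:supp x & al v = w. x v)" by(simp add: affine_map_def supp_def)

lemma aff_sum: assumes "finite sg" "supp x <= sg" shows "aff al x w = (\<Sum>v\<in>sg. if al v = w then x v else 0)"
proof -
 have "aff al x w = (\<Sum>v\<in>supp x. if al v = w then x v else 0)" unfolding aff_supp by(rule sum.inter_filter[OF finite_subset[OF assms(2,1)]])
 also have "\<dots> = (\<Sum>v\<in>sg. if al v = w then x v else 0)" using assms by(intro sum.mono_neutral_left) (auto simp: supp_def)
 finally show ?thesis .
qed

text \<open>Barycentric coordinates are nonnegative, so nothing cancels and the support of the image
  is the full image of the support. The tails of products, which depend on supports, rely on this
  equality.\<close>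

lemma aff_pos: assumes x: "x:rl S" shows "0 <= aff al x w" "supp (aff al x) = al ` supp x"
proof -
 have pos: "!!v. 0 <= x v" and fin: "finite (supp x)" using x supp_fin by(auto simp: in_rl)
 note eq = aff_sum[OF fin subset_refl]
 show "0 <= aff al x w" unfolding eq by(intro sum_nonneg) (use pos in auto)
 have "aff al x w = 0 <-> w ~: al ` supp x" for w unfolding eq using fin pos by(subst sum_nonneg_eq_0_iff) (auto simp: supp_def)
 thus "supp (aff al x) = al ` supp x" by(auto simp: supp_def)
qed

lemma aff_rl: assumes x: "x:rl S" and al: "al ` supp x <= S'" shows "aff al x:rl S'"
proof -
 note fin = supp_fin[OF x]
 have "(\<Sum>w\<in>al ` supp x. aff al x w) = (\<Sum>w\<in>al ` supp x. \<Sum>v\<in>supp x. if al v = w then x v else 0)"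
  by(simp add: aff_sum[OF fin subset_refl])
 also have "\<dots> = (\<Sum>v\<in>supp x. \<Sum>w\<in>al ` supp x. if al v = w then x v else 0)" by(rule sum.swap)
 also have "\<dots> = (\<Sum>v\<in>supp x. x v)" using fin by(intro sum.cong) auto
 finally have "sum (aff al x) (supp (aff al x)) = 1" using x by(simp add: aff_pos[OF x] in_rl)
 thus ?thesis using al fin supp_nonempty[OF x] unfolding in_rl sx_def aff_pos(2)[OF x] by(simp add: aff_pos(1)[OF x])
qed

lemma aff_comp: assumes x: "x:rl S" shows "aff al (aff be x) = aff (al o be) x"
proof
 fix w
 note fin = supp_fin[OF x]
 have "aff al (aff be x) w
  = (\<Sum>u\<in>be ` supp x. if al u = w then (\<Sum>v\<in>supp x. if be v = u then x v else 0) else 0)" using fin aff_pos(2)[OF x, of be]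
  by(subst aff_sum[of "be ` supp x"]) (simp_all add: aff_sum[OF fin subset_refl] cong: if_cong)
 also have "\<dots> = (\<Sum>u\<in>be ` supp x. \<Sum>v\<in>supp x. if be v = u then (if al u = w then x v else 0) else 0)"
  by(intro sum.cong refl) (simp split: if_split cong: if_cong)
 also have "\<dots> = (\<Sum>v\<in>supp x. \<Sum>u\<in>be ` supp x. if be v = u then (if al u = w then x v else 0) else 0)" by(rule sum.swap)
 also have "\<dots> = (\<Sum>v\<in>supp x. if al (be v) = w then x v else 0)" using fin by(intro sum.cong) auto
 finally show "aff al (aff be x) w = aff (al o be) x w" by(simp add: aff_sum[OF fin subset_refl])
qed

lemma aff_id [simp]: "aff (%v. v) x = x"
proof
 fix w
 have *: "{v. v:supp x & v = w} = (if w:supp x then {w} else {})" by auto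
 show "aff (%v. v) x w = x w" unfolding aff_supp * by(simp add: supp_def)
qed

lemma cont_on_fun_apply: "con_on S (%x. x v)" for S::"'v pt set" by(rule continuous_on_subset[OF continuous_on_product_coordinates]) simp

lemma cont_on_apply: fixes f::"'x::topological_space=>'v=>real" shows "con_on S f==>con_on S (%x. f x v)" by(rule continuous_on_product_then_coordinatewise)

lemma cont_on_seg: fixes f g::"'x::topological_space=>'v=>real" assumes "con_on S t" "con_on S f" "con_on S g"
 shows "con_on S (%x. segment (t x) (f x) (g x))" unfolding segment_def
 by(intro continuous_on_coordinatewise_then_product continuous_intros assms cont_on_apply[OF assms(2)]
  cont_on_apply[OF assms(3)])

lemma cont_on_aff: assumes "finite sg" shows "con_on (rl sg) (aff al)"
proof(rule continuous_on_coordinatewise_then_product)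
 fix w
 have "con_on (rl sg) (%x. \<Sum>v\<in>sg. if al v = w then x v else 0)"
 proof(intro continuous_on_sum)
  show "con_on (rl sg) (%x. if al v = w then x v else 0)" for v by(cases "al v = w") (simp_all add: cont_on_fun_apply)
 qed
 moreover have "aff al x w = (\<Sum>v\<in>sg. if al v = w then x v else 0)" if "x:rl sg" for x using supp_sub[OF that] assms by(intro aff_sum)
 ultimately show "con_on (rl sg) (%x. aff al x w)" by(simp cong: continuous_on_cong)
qed

lemma cpt_rl: assumes "finite sg" shows "compact (rl sg)"
proof -
 define K where "K = (\<Pi>\<^sub>E v\<in>UNIV. if v:sg then {0..1} else {0::real})"
 have "compactin (product_topology (%v. euclidean) UNIV) K" unfolding K_def by(subst compactin_PiE) auto
 hence "compact K" by(simp add: euclidean_product_topology)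
 moreover have "closed {x::'a=>real. sum x sg = 1}" by(intro closed_Collect_eq continuous_on_sum cont_on_fun_apply continuous_on_const)
 moreover have "rl sg = K Int {x. sum x sg = 1}"
 proof(intro Set.set_eqI iffI)
  fix x assume "x:rl sg"
  hence x: "ALL v. 0 <= x v" "supp x <= sg" "sum x sg = 1" by(auto simp: rl_fin[OF assms])
  have "x v <= 1" if "v:sg" for v using member_le_sum[of v sg x] x assms that by auto
  thus "x:K Int {x. sum x sg = 1}" using x by(auto simp: K_def supp_def)
 next
  fix x assume "x:K Int {x. sum x sg = 1}"
  hence x: "x v:(if v:sg then {0..1} else {0})" "sum x sg = 1" for v by(auto simp: K_def PiE_iff)
  have "0 <= x v" "v ~: sg==>x v = 0" for v using x(1)[of v] by(auto split: if_splits)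
  thus "x:rl sg" using x(2) by(auto simp: rl_fin[OF assms] supp_def)
 qed
 ultimately show ?thesis by(simp add: compact_Int_closed)
qed

lemma closed_rl: assumes "finite sg" shows "closed (rl sg)"
proof -
 have "rl sg = (\<Inter>v. {x. 0 <= x v}) Int (INT v:- sg. {x. x v = 0}) Int {x. sum x sg = 1}" by(auto simp: rl_fin[OF assms] supp_def)
 moreover have "closed \<dots>" by(intro closed_Int closed_INT ballI closed_Collect_eq closed_Collect_le continuous_on_sum
  cont_on_fun_apply continuous_on_const)
 ultimately show ?thesis by simp
qed

lemma pmap_aff: assumes "al:S \<rightarrow> S'" shows "pmap (cells S) (cells S') (aff al)" unfolding pmap_def
proof
 fix P assume "P:cells S"
 then obtain sg where sg: "sg:spx S" "P = rl sg" by(auto simp: cells_def)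
 have "al ` sg:spx S'" using sg assms by(auto simp: sx_def)
 moreover have "aff al x:rl (al ` sg)" if "x:rl sg" for x using that by(intro aff_rl) (auto dest: supp_sub)
 ultimately show "EX Q:cells S'. aff al ` P <= Q & con_on P (aff al)" using sg by(intro bexI[of _ "rl (al ` sg)"])
  (auto simp: cells_def intro: cont_on_aff dest: spxD)
qed

section \<open>Filters of tails\<close>

text \<open>Covers the filter of a realization as well as the filters of twofold and threefold
  products, whose tails are indexed by \<open>m ## n\<close> and \<open>m ## n ## p\<close>.\<close>

definition tfil::"'b rel=>('b=>'z set)=>'z filter" where "tfil b Y = (INF v\<in>Fd b. principal (Y v))"

definition tails::"'z::topological_space set set=>'b rel=>('b=>'z set)=>bool" where
 "tails PP b Y <-> dset b & (ALL v:Fd b. Y v <= \<Union>PP) & (ALL v v'. (v, v'):b --> Y v' <= Y v)"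

lemma dset_refl: "[|dset m; x:Fd m|]==>(x, x):m" by(auto simp: directed_set_def preorder_on_def refl_on_def)

lemma dset_trans: "[|dset m; (x, y):m; (y, z):m|]==>(x, z):m" by(auto simp: directed_set_def preorder_on_def dest: transD)

lemma dset_ub: "[|dset m; x:Fd m; y:Fd m|]==>EX z:Fd m. (x, z):m & (y, z):m" unfolding directed_set_def by(meson FieldI2)

lemma dset_ne: "dset m==>EX x. x:Fd m" by(auto simp: directed_set_def)

lemma dset_fin_ub: assumes m: "dset m" shows "finite K==>K <= Fd m==>EX z:Fd m. ALL x:K. (x, z):m"
proof(induction K rule: finite_induct)
 case empty
 thus ?case using dset_ne[OF m] by auto
next
 case (insert x K)
 then obtain z where z: "z:Fd m" "ALL x:K. (x, z):m" by auto
 obtain w where "w:Fd m" "(x, w):m" "(z, w):m" using dset_ub[OF m _ z(1), of x] insert by auto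
 thus ?case using z dset_trans[OF m] by blast
qed

lemma dset_setI: assumes "EX x. (x, x):m" "!!x y. (x, y):m==>(x, x):m & (y, y):m" and "!!x y z. [|(x, y):m; (y, z):m|]==>(x, z):m"
  and "!!x y. [|(x, x):m; (y, y):m|]==>EX z. (x, z):m & (y, z):m" shows "dset m"
proof -
 have F: "x:Fd m <-> (x, x):m" for x using assms(2) by(auto simp: Field_def)
 have "Fd m ~= {}" using assms(1) F by blast
 moreover have "preorder_on (Fd m) m" unfolding preorder_on_def refl_on_def using F assms(3) FieldI1 FieldI2 by(fast intro: transI)
 moreover have "EX z. (x, z):m & (y, z):m" if "x:Fd m" "y:Fd m" for x y using that assms(4) by(simp add: F)
 ultimately show ?thesis unfolding directed_set_def by blast
qed

lemma ev_tfil: assumes "dset b" and dec: "!!v v'. (v, v'):b==>Y v' <= Y v" shows "eventually Q (tfil b Y) <-> (EX v:Fd b. ALL z:Y v. Q z)" unfolding tfil_def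
proof(subst eventually_INF_base)
 show "Fd b ~= {}" using dset_ne[OF assms(1)] by blast
 show "EX x:Fd b. principal (Y x) <= inf (principal (Y v)) (principal (Y v'))" if v: "v:Fd b" "v':Fd b" for v v'
 proof -
  obtain w where w: "w:Fd b" "(v, w):b" "(v', w):b" using dset_ub[OF assms(1) v] by blast
  hence "principal (Y w) <= inf (principal (Y v)) (principal (Y v'))" using dec by simp
  thus ?thesis using w(1) by blast
 qed
qed (simp add: eventually_principal)

lemma ev_tails: "tails PP b Y==>eventually Q (tfil b Y) <-> (EX v:Fd b. ALL z:Y v. Q z)" by(rule ev_tfil) (auto simp: tails_def)

lemma tails_fspace: "tails PP b Y==>fspace (wtop PP) (tfil b Y)"
proof -
 assume t: "tails PP b Y"
 then obtain v where "v:Fd b" "Y v <= \<Union>PP" using dset_ne[of b] by(auto simp: tails_def)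
 thus ?thesis unfolding fspace_def ev_tails[OF t] tsp_wtop by blast
qed

definition tls::"'i rel=>'i=>'i pt set" where "tls m x = rl (m `` {x})"

lemma spx_filter_tail: "sfil m = tfil m (tls m)" by(simp add: simplex_filter_def tfil_def tls_def)

lemma tails_spx: "dset m==>tails (cells (Fd m)) m (tls m)" unfolding tails_def tls_def Union_cells
 by(intro conjI ballI allI impI rl_mono) (auto intro: FieldI2 dset_trans)

lemma fspace_sx: "dset m==>fspace (rtop (Fd m)) (sfil m)" unfolding rtop_weak spx_filter_tail by(intro tails_fspace tails_spx)

lemma ev_sfil: "dset m==>eventually Q (sfil m) <-> (EX x:Fd m. ALL z:rl (m `` {x}). Q z)"
 unfolding spx_filter_tail using ev_tails[OF tails_spx] by(simp add: tls_def)

lemma tls_rl: "p:tls m x==>p:rl (Fd m)" unfolding tls_def using rl_mono[of "m `` {x}" "Fd m"] by(auto intro: FieldI2)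

lemma cof_flim: assumes m: "dset m" and n: "dset n" and al: "cofinal m n al" shows "filterlim (aff al) (sfil n) (sfil m)" unfolding filterlim_iff
proof(intro allI impI)
 fix Q assume "eventually Q (sfil n)"
 then obtain y where y: "y:Fd n" "ALL z:rl (n `` {y}). Q z" by(auto simp: ev_sfil[OF n])
 obtain x where x: "x:Fd m" "!!k. (x, k):m==>(y, al k):n" using al y(1) by(auto simp: cofinal_def)
 have "aff al z:rl (n `` {y})" if "z:rl (m `` {x})" for z using that x(2) by(intro aff_rl) (auto dest: supp_sub)
 thus "eventually (%z. Q (aff al z)) (sfil m)" using x(1) y(2) by(auto simp: ev_sfil[OF m])
qed

lemma cof_comp: assumes "dset n" "cofinal k m al" "cofinal m n be" shows "cofinal k n (be o al)" unfolding cofinal_def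
proof(intro conjI ballI)
 show "be o al:Fd k \<rightarrow> Fd n" using assms by(auto simp: cofinal_def Pi_iff)
 fix y assume "y:Fd n"
 then obtain x where x: "x:Fd m" "!!k. (x, k):m==>(y, be k):n" using assms(3) by(auto simp: cofinal_def)
 then obtain z where "z:Fd k" "!!l. (z, l):k==>(x, al l):m" using assms(2) by(auto simp: cofinal_def)
 thus "EX x:Fd k. ALL l. (x, l):k --> (y, (be o al) l):n" using x by auto
qed

lemma pmap_cof: "cofinal m n al==>pmap (cells (Fd m)) (cells (Fd n)) (aff al)" by(rule pmap_aff) (simp add: cofinal_def)

section \<open>Compactness\<close>

text \<open>A finite subcover turns locally uniform eventual statements into one that is uniform on
  \<open>K\<close>. All uniformity on compact pieces below is obtained in this way.\<close>

lemma cpt_ev: assumes K: "compact K" and loc: "!!t. t:K==>EX V. open V & t:V & (\<forall>\<^sub>F x in F. ALL s:V Int K. Q x s)"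
 shows "\<forall>\<^sub>F x in F. ALL t:K. Q x t"
proof -
 obtain V where V: "!!t. t:K==>open (V t)" "!!t. t:K==>t:V t" and ev: "!!t. t:K==>\<forall>\<^sub>F x in F. ALL s:V t Int K. Q x s" using loc by metis
 obtain D where D: "D <= K" "finite D" "K <= (UN t:D. V t)" using compactE_image[OF K, of K V] V by blast
 have "\<forall>\<^sub>F x in F. ALL t:D. ALL s:V t Int K. Q x s" using D ev by(intro eventually_ball_finite) auto
 thus ?thesis by eventually_elim (use D in blast)
qed

lemma cmap_atin: assumes P: "pre_cstar B" and f: "cmap (tos S) (ntop B) f" and x: "x:S" and ep: "0 < ep"
 obtains V where "open V" "x:V" "!!y. y:V Int S==>cdist B (f y) (f x) < ep"
proof -
 obtain U where U: "openin (tos S) U" "x:U" "!!y. y:U==>cdist B (f y) (f x) < ep" using f x ep unfolding pre_cstar.cont_map_norm_topology_open[OF P] by force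
 thus thesis using that by(metis openin_open Int_commute IntD2 IntI)
qed

text \<open>Compactness of the unit interval makes continuity at the points \<open>(x, t)\<close>
  uniform in \<open>t\<close>, as the supremum norm of paths requires.\<close>

lemma curry_cont: assumes B: "gpre G B" and H: "cmap (tos (S \<times> {0..1::real})) (ntop B) H"
 shows "cmap (tos S) (ntop (cyl B)) (%x. \<lambda>t\<in>{0..1}. H (x, t))"
proof -
 interpret B: gpre G B by(rule B)
 interpret C: gpre G "cyl B" unfolding cyl_def by(rule B.Cb_gpre)
 have Hc: "H (x, t):cA B" if "x:S" "t:{0..1}" for x t using H that by(simp add: B.cmap_ntop)
 have mem: "(\<lambda>t\<in>{0..1}. H (x, t)):cA (cyl B)" if x: "x:S" for x
 proof -
  have "cmap (tos {0..1}) (tos (S \<times> {0..1})) (%t. (x, t))" using x by(auto simp: continuous_map_in_subtopology intro!: continuous_intros)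
  from continuous_map_compose[OF this H]
  have c: "cmap (tos {0..1}) (ntop B) (%t. H (x, t))" by(simp add: o_def)
  have "compactin euclideanreal ((%t. cnorm B (H (x, t))) ` {0..1})" by(rule image_compactin[OF _ B.cont_map_norm[OF c]]) (simp add: compactin_subtopology)
  hence "bounded ((%t. cnorm B (H (x, t))) ` {0..1})" by(simp add: compact_imp_bounded)
  then obtain K where "ALL t:{0..1}. cnorm B (H (x, t)) <= K" by(auto simp: bounded_iff abs_le_iff)
  thus ?thesis using c by(auto simp: cyl_def cA_Cb)
 qed
 show ?thesis unfolding C.cont_map_norm_topology_open
 proof(intro conjI ballI allI impI)
  fix x and ep::real assume x: "x:tsp (tos S)" and ep: "0 < ep"
  hence xS: "x:S" by simp
  have "\<forall>\<^sub>F y in nhds x. ALL t:{0..1}. y:S --> cdist B (H (y, t)) (H (x, t)) <= ep / 2"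
  proof(rule cpt_ev)
  fix t::real assume t: "t:{0..1}"
  have "0 < ep / 4" "(x, t):S \<times> {0..1}" using ep xS t by auto
  then obtain W where W: "open W" "(x, t):W"
  "!!y. y:W Int (S \<times> {0..1})==>cdist B (H y) (H (x, t)) < ep / 4" using cmap_atin[OF gpre_pre_cstar[OF B] H] by metis
  obtain U V where UV: "open U" "open V" "x:U" "t:V" "U \<times> V <= W" using W(1,2) by(metis open_prod_elim mem_Times_iff fst_conv snd_conv)
  have "cdist B (H (y, s)) (H (x, s)) <= ep / 2" if "y:U" "y:S" "s:V Int {0..1}" for y s
  proof -
  have 1: "cdist B (H (y, s)) (H (x, t)) < ep / 4" "cdist B (H (x, s)) (H (x, t)) < ep / 4" using W(3)[of "(y, s)"] W(3)[of "(x, s)"] that UV xS by auto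
  have "cdist B (H (y, s)) (H (x, s)) <= cdist B (H (y, s)) (H (x, t)) + cdist B (H (x, t)) (H (x, s))" using that t xS by(intro B.cdist_tri Hc) auto
  thus ?thesis using 1 by(simp add: B.cdist_comm[of "H (x, t)"])
  qed
  hence "\<forall>\<^sub>F y in nhds x. ALL s:V Int {0..1}. y:S --> cdist B (H (y, s)) (H (x, s)) <= ep / 2"
  unfolding eventually_nhds using UV by(intro exI[of _ U]) auto
  thus "EX V. open V & t:V & (\<forall>\<^sub>F y in nhds x. ALL s:V Int {0..1}. y:S --> cdist B (H (y, s)) (H (x, s)) <= ep / 2)" using UV by blast
  qed simp
  then obtain U where U: "open U" "x:U" "!!y t. [|y:U; t:{0..1}; y:S|]==>cdist B (H (y, t)) (H (x, t)) <= ep / 2" unfolding eventually_nhds by blast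
  have "cdist (cyl B) (\<lambda>t\<in>{0..1}. H (y, t)) (\<lambda>t\<in>{0..1}. H (x, t)) < ep" if y: "y:S Int U" for y
  proof -
  have "cdist (cyl B) (\<lambda>t\<in>{0..1}. H (y, t)) (\<lambda>t\<in>{0..1}. H (x, t)) <= ep / 2"
  using mem[of y] mem[OF xS] y ep U(3)[of y] unfolding cyl_def by(subst B.cdist_Cb_le_iff) auto
  thus ?thesis using ep by simp
  qed
  thus "EX U. openin (tos S) U & x:U & (ALL y:U. cdist (cyl B) (\<lambda>t\<in>{0..1}. H (y, t)) (\<lambda>t\<in>{0..1}. H (x, t)) < ep)"
  using U xS by(intro exI[of _ "S Int U"]) (auto simp: openin_open)
 qed (use mem in auto)
qed

section \<open>Paths in an algebra\<close>

context gpre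
begin

lemma cyl_gpre: "gpre G (cyl A)" unfolding cyl_def by(rule Cb_gpre)

lemma opn_cyl: "opn (cyl A) q u v = (\<lambda>t\<in>{0..1}. opn A q (u t) (v t))" by(simp add: cyl_def opn_Cb)

lemma cyl_val [simp]: "[|u:cA (cyl A); t:{0..1}|]==>u t:cA A" unfolding cyl_def by(rule Cb_val) auto

lemma cyl_val' [simp]: "[|u:cA (cyl A); 0 <= t; t <= 1|]==>u t:cA A" by simp

lemma cdist_cyl_le_iff: "[|u:cA (cyl A); v:cA (cyl A); 0 <= K|]
 ==>cdist (cyl A) u v <= K <-> (ALL t:{0..1}. cdist A (u t) (v t) <= K)" unfolding cyl_def by(subst cdist_Cb_le_iff) auto

lemma cdist_cyl_val: "[|u:cA (cyl A); v:cA (cyl A); t:{0..1}|]==>cdist A (u t) (v t) <= cdist (cyl A) u v" unfolding cyl_def by(rule cdist_val_le) auto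

lemma norm_cyl_val: "[|u:cA (cyl A); t:{0..1}|]==>cnorm A (u t) <= cnorm (cyl A) u" unfolding cyl_def by(rule nval_le) auto

lemma norm_cyl_leI: "[|0 <= K; !!t. t:{0..1}==>cnorm A (u t) <= K|]==>cnorm (cyl A) u <= K" unfolding cyl_def by(rule norm_Cb_leI) auto

lemma cA_cyl: "u:cA (cyl A) <->
  u:extensional {0..1} & cmap (tos {0..1}) (ntop A) u"
proof -
 have "EX K. ALL t:{0..1}. cnorm A (u t) <= K" if c: "cmap (tos {0..1}) (ntop A) u"
 proof -
  have "compactin euclideanreal ((%t. cnorm A (u t)) ` {0..1})" by(rule image_compactin[OF _ cont_map_norm[OF c]]) (simp add: compactin_subtopology)
  hence "bounded ((%t. cnorm A (u t)) ` {0..1})" by(simp add: compact_imp_bounded)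
  thus ?thesis by(auto simp: bounded_iff abs_le_iff)
 qed
 thus ?thesis by(auto simp: cyl_def cA_Cb)
qed

lemma ev_eq: "u:cA (cyl A)==>ev A t u = u t" by(simp add: ev_def)

lemma cyl_rpm: assumes u: "u:cA (cyl A)" and r: "con_on {0..1} r" "r:{0..1} \<rightarrow> {0..1}" shows "(\<lambda>t\<in>{0..1}. u (r t)):cA (cyl A)"
proof -
 have "cmap (tos {0..1}) (tos {0..1}) r" using r by(auto simp: continuous_map_in_subtopology)
 moreover have "cmap (tos {0..1}) (ntop A) u" using u by(simp add: cA_cyl)
 ultimately have "cmap (tos {0..1}) (ntop A) (u o r)" by(rule continuous_map_compose)
 thus ?thesis by(simp add: cA_cyl o_def)
qed

definition cpath::"(real=>'a)=>(real=>'a)=>real=>'a" where "cpath u v = (\<lambda>t\<in>{0..1}. if t <= 1/2 then u (2 * t) else v (2 * t - 1))"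

lemma cpath_cyl: assumes u: "u:cA (cyl A)" and v: "v:cA (cyl A)" and eq: "u 1 = v 0" shows "cpath u v:cA (cyl A)"
proof -
 have c: "cmap (tos {0..1}) (ntop A) w" if "w:cA (cyl A)" for w using that by(simp add: cA_cyl)
 let ?X = "tos {0..1::real}"
 have "cmap ?X (ntop A) (%t. if t <= 1/2 then u (2 * t) else v (2 * t - 1))"
 proof(rule continuous_map_cases_le)
  have "cmap (subtopology ?X {x:tsp ?X. x <= 1/2}) ?X (%t. 2 * t)"
  by(auto simp: subtopology_subtopology continuous_map_in_subtopology intro!: continuous_intros)
  from continuous_map_compose[OF this c[OF u]]
  show "cmap (subtopology ?X {x:tsp ?X. x <= 1/2}) (ntop A) (%t. u (2 * t))" by(simp add: o_def)
  have "cmap (subtopology ?X {x:tsp ?X. 1/2 <= x}) ?X (%t. 2 * t - 1)"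
  by(auto simp: subtopology_subtopology continuous_map_in_subtopology intro!: continuous_intros)
  from continuous_map_compose[OF this c[OF v]]
  show "cmap (subtopology ?X {x:tsp ?X. 1/2 <= x}) (ntop A) (%t. v (2 * t - 1))" by(simp add: o_def)
  show "u (2 * t) = v (2 * t - 1)" if "t = 1/2" for t::real unfolding that using eq by simp
 qed auto
 thus ?thesis by(auto simp: cA_cyl cpath_def)
qed

lemma opn_cpath: "opn (cyl A) q (cpath u v) (cpath u' v') = cpath (opn (cyl A) q u u') (opn (cyl A) q v v')" by(auto simp: opn_cyl cpath_def)

end

lemma calg_cyl_gpre: "gpre G B==>gpre G (cyl B)" by(rule gpre.cyl_gpre)

section \<open>Contractive maps compatible with the operations\<close>

text \<open>Evaluations, constant paths and reparametrizations of paths belong here: they are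
  contractive by direct estimate, without completeness of the algebra, and they need not be
  extensional as members of \<open>Mor\<close> are.\<close>

definition alg_map::"'g monoid=>('g, 'b) galg=>('g, 'c) galg=>('b=>'c)=>bool" where "alg_map G B D ps <-> (ALL x:cA B. ps x:cA D) &
  (ALL x:cA B. ALL y:cA B. cdist D (ps x) (ps y) <= cdist B x y) & (ALL q:opcs G. ALL x:cA B. ALL y:cA B. ps (opn B q x y) = opn D q (ps x) (ps y))"

lemma alg_mapD: "[|alg_map G B D ps; x:cA B|]==>ps x:cA D" "[|alg_map G B D ps; x:cA B; y:cA B|]==>cdist D (ps x) (ps y) <= cdist B x y"
 "[|alg_map G B D ps; q:opcs G; x:cA B; y:cA B|] ==>ps (opn B q x y) = opn D q (ps x) (ps y)" by(auto simp: alg_map_def)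

lemma Mor_alg_map: "[|calg G B; gpre G D; ps:Mor G B D|]==>alg_map G B D ps" by(auto simp: alg_map_def Mor_closed Mor_opn Mor_cdist)

lemma alg_map_Mor: assumes "alg_map G B D ps" "ph:Mor G A B" "gpre G A" shows "(\<lambda>x\<in>cA A. ps (ph x)):Mor G A D" unfolding Mor_iff
proof(intro conjI ballI)
 interpret A: gpre G A by fact
 show "(\<lambda>x\<in>cA A. ps (ph x)):cA A \<rightarrow> cA D" using assms by(auto simp: alg_mapD(1) Mor_closed)
 show "(\<lambda>x\<in>cA A. ps (ph x)) (opn A q x y)
  = opn D q ((\<lambda>x\<in>cA A. ps (ph x)) x) ((\<lambda>x\<in>cA A. ps (ph x)) y)" if "q:opcs G" "x:cA A" "y:cA A" for q x y
  using that assms(1,2) by(simp add: Mor_opn Mor_closed alg_mapD(3))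
qed simp

lemma alg_map_norm: assumes B: "gpre G B" and D: "gpre G D" and ps: "alg_map G B D ps" and x: "x:cA B" shows "cnorm D (ps x) <= cnorm B x"
proof -
 interpret B: gpre G B by(rule B)
 interpret D: gpre G D by(rule D)
 have "Scale 0:opcs G" by(simp add: opcs_def)
 from alg_mapD(3)[OF ps this x x] have "ps (czero B) = czero D" using alg_mapD(1)[OF ps x] x by simp
 thus ?thesis using alg_mapD(2)[OF ps x, of "czero B"] alg_mapD(1)[OF ps x] x by simp
qed

lemma alg_map_Cb: assumes B: "gpre G B" and D: "gpre G D" and ps: "alg_map G B D ps" and f: "f:cA (Cb X B)" shows "(\<lambda>x\<in>tsp X. ps (f x)):cA (Cb X D)"
proof -
 interpret B: gpre G B by(rule B)
 have "cmap X (ntop D) (%x. ps (f x))" using f by(intro cmap_contr[OF gpre_pre_cstar[OF B] gpre_pre_cstar[OF D]]) (auto simp: alg_mapD[OF ps] cA_Cb)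
 moreover have "cnorm D (ps (f x)) <= cnorm (Cb X B) f" if "x:tsp X" for x
  using order_trans[OF alg_map_norm[OF B D ps B.Cb_val[OF f that]] B.nval_le[OF f that]] .
 ultimately show ?thesis by(auto simp: cA_Cb)
qed

lemma alg_map_aeq: assumes B: "gpre G B" and D: "gpre G D" and ps: "alg_map G B D ps"
  and ev: "\<forall>\<^sub>F x in F. u x:cA B & v x:cA B" and eq: "aeq F B u v" shows "aeq F D (%x. ps (u x)) (%x. ps (v x))"
proof -
 interpret D: gpre G D by(rule D)
 show ?thesis by(rule D.aeq_bound[OF eq[unfolded aeq_def]]) (use ev in eventually_elim, use alg_mapD(2)[OF ps] in blast)
qed

lemma aeq_restr: assumes "fspace X F" shows "aeq F B (restrict u (tsp X)) v <-> aeq F B u v"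
  "aeq F B u (restrict v (tsp X)) <-> aeq F B u v" using assms by(auto simp: fspace_def intro!: aeq_cong elim: eventually_mono)

lemma amor_alg_map: assumes B: "gpre G B" and D: "gpre G D" and ps: "alg_map G B D ps" and F: "fspace X F" and A: "gpre G A" and f: "amor G A B X F f"
 shows "amor G A D X F (%a. \<lambda>x\<in>tsp X. ps (f a x))" unfolding amor_def
proof(intro conjI ballI)
 interpret A: gpre G A by(rule A)
 interpret B: gpre G B by(rule B)
 show "(\<lambda>x\<in>tsp X. ps (f a x)):cA (Cb X D)" if "a:cA A" for a using amorD(1)[OF f that] by(rule alg_map_Cb[OF B D ps])
 fix q x y assume q: "q:opcs G" and xy: "x:cA A" "y:cA A"
 have ev: "\<forall>\<^sub>F p in F. p:tsp X" using F by(simp add: fspace_def)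
 have fc: "f a p:cA B" if "p:tsp X" "a:cA A" for a p using amorD(1)[OF f that(2)] that(1) by simp
 have "aeq F D (%p. ps (f (opn A q x y) p)) (%p. ps (opn B q (f x p) (f y p)))"
 proof(rule alg_map_aeq[OF B D ps _ amorD(2)[OF f q xy]])
  show "\<forall>\<^sub>F p in F. f (opn A q x y) p:cA B & opn B q (f x p) (f y p):cA B" using ev by eventually_elim (use fc xy q in simp)
 qed
 hence "aeq F D (%p. ps (f (opn A q x y) p)) (%p. opn D q (ps (f x p)) (ps (f y p)))" by(rule iffD1[OF aeq_cong, rotated -1])
  (use ev in "eventually_elim, use fc xy q alg_mapD(3)[OF ps] in auto")+
 thus "aeq F D (\<lambda>p\<in>tsp X. ps (f (opn A q x y) p)) (%p. opn D q ((\<lambda>p\<in>tsp X. ps (f x p)) p) ((\<lambda>p\<in>tsp X. ps (f y p)) p))"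
  by(rule iffD1[OF aeq_cong, rotated -1]) (use ev in "eventually_elim, simp")+
qed

text \<open>Asymptotically equal functions induce the same map into the quotient, and whether that
  map is a homomorphism is decided there.\<close>

lemma amor_cong: assumes B: "gpre G B" and F: "fspace X F" and A: "gpre G A" and f: "amor G A B X F f" and f': "!!a. a:cA A==>f' a:cA (Cb X B)"
  and eq: "!!a. a:cA A==>aeq F B (f a) (f' a)" shows "amor G A B X F f'"
proof -
 have "mor_of X F A B f = mor_of X F A B f'" using eq amorD(1)[OF f] f' by(subst mor_of_eq_iff[OF B F]) auto
 thus ?thesis using f amor_iff_Mor[OF A B F amorD(1)[OF f]] amor_iff_Mor[OF A B F f'] by simp
qed

definition pb::"'y topology=>('y=>'x)=>('a=>'x=>'b)=>'a=>'y=>'b" where "pb Y h f = (%a. \<lambda>p\<in>tsp Y. f a (h p))"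

lemma Cb_pb: assumes f: "f:cA (Cb X B)" and h: "cmap Y X h" shows "(\<lambda>p\<in>tsp Y. f (h p)):cA (Cb Y B)"
proof -
 have "cmap Y (ntop B) (%p. f (h p))" using continuous_map_compose[OF h, of _ f] f by(simp add: cA_Cb o_def)
 moreover have "h p:tsp X" if "p:tsp Y" for p using h that by(auto simp: continuous_map_def)
 ultimately show ?thesis using f by(auto simp: cA_Cb)
qed

lemma amor_pb: assumes f: "amor G A B X F f" and h: "cmap Y X h" "filterlim h F E" and E: "fspace Y E"
 shows "amor G A B Y E (pb Y h f)" unfolding amor_def pb_def
proof(intro conjI ballI)
 show "(\<lambda>p\<in>tsp Y. f a (h p)):cA (Cb Y B)" if "a:cA A" for a using amorD(1)[OF f that] h(1) by(rule Cb_pb)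
 have ev: "\<forall>\<^sub>F p in E. p:tsp Y" using E by(simp add: fspace_def)
 fix q x y assume q: "q:opcs G" and xy: "x:cA A" "y:cA A"
 show "aeq E B (\<lambda>p\<in>tsp Y. f (opn A q x y) (h p)) (%p. opn B q ((\<lambda>p\<in>tsp Y. f x (h p)) p) ((\<lambda>p\<in>tsp Y. f y (h p)) p))"
  by(rule iffD1[OF aeq_cong, OF _ _ aeq_comp[OF amorD(2)[OF f q xy] h(2)]]) (use ev in "eventually_elim, simp")+
qed

text \<open>Composition with a homotopy of the base space turns a lift into a lift with values in
  paths. The hypothesis \<open>lim\<close> is uniform in the time \<open>t\<close>, as asymptotic
  compatibility in the supremum norm of paths demands.\<close>

lemma amor_htpy: fixes H::"'x::topological_space \<times> real=>'z::topological_space" assumes B: "gpre G B" and f: "amor G A B (wtop QQ) E f" and A: "gpre G A"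
  and H: "pmap ((%P. P \<times> {0..1}) ` PP) QQ H" and lim: "!!Q. eventually Q E==>\<forall>\<^sub>F p in F. ALL t:{0..1}. Q (H (p, t))"
  and F: "fspace (wtop PP) F" shows "amor G A (cyl B) (wtop PP) F (%a. \<lambda>p\<in>\<Union>PP. \<lambda>t\<in>{0..1}. f a (H (p, t)))" unfolding amor_def
proof(intro conjI ballI)
 interpret A: gpre G A by(rule A)
 interpret B: gpre G B by(rule B)
 interpret C: gpre G "cyl B" by(rule B.cyl_gpre)
 have HQ: "H (p, t):\<Union>QQ" if "p:\<Union>PP" "t:{0..1}" for p t
 proof -
  obtain P where P: "P:PP" "p:P" using \<open>p:\<Union>PP\<close> by blast
  then obtain Q where "Q:QQ" "H ` (P \<times> {0..1}) <= Q" using H by(auto simp: pmap_def)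
  thus ?thesis using P \<open>t:{0..1}\<close> by blast
 qed
 show cm: "(\<lambda>p\<in>\<Union>PP. \<lambda>t\<in>{0..1}. f a (H (p, t))):cA (Cb (wtop PP) (cyl B))" if a: "a:cA A" for a
 proof -
  note fa = amorD(1)[OF f a]
  have c: "cmap (wtop PP) (ntop (cyl B)) (%p. \<lambda>t\<in>{0..1}. f a (H (p, t)))" unfolding cmap_wtop
  proof
  fix P assume "P:PP"
  then obtain Q where Q: "Q:QQ" "H ` (P \<times> {0..1}) <= Q" "con_on (P \<times> {0..1}) H" using H by(auto simp: pmap_def)
  have "cmap (tos (P \<times> {0..1})) (ntop B) (%z. f a (H z))" using fa by(intro cont_map_pieces[OF _ Q(1,3,2)]) (simp add: cA_Cb)
  thus "cmap (tos P) (ntop (cyl B)) (%p. \<lambda>t\<in>{0..1}. f a (H (p, t)))" by(rule curry_cont[OF B])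
  qed
  have "cnorm (cyl B) (\<lambda>t\<in>{0..1}. f a (H (p, t))) <= cnorm (Cb (wtop QQ) B) (f a)" if p: "p:\<Union>PP" for p
  using HQ[OF p] fa by(intro B.norm_cyl_leI) (auto intro!: B.nval_le simp: B.norm_Cb_ge0)
  thus ?thesis using c by(auto simp: cA_Cb)
 qed
 fix q x y assume q: "q:opcs G" and xy: "x:cA A" "y:cA A"
 show "aeq F (cyl B) (\<lambda>p\<in>\<Union>PP. \<lambda>t\<in>{0..1}. f (opn A q x y) (H (p, t)))
  (%p. opn (cyl B) q ((\<lambda>p\<in>\<Union>PP. \<lambda>t\<in>{0..1}. f x (H (p, t))) p) ((\<lambda>p\<in>\<Union>PP. \<lambda>t\<in>{0..1}. f y (H (p, t))) p))"
 proof(rule C.aeqI)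
  fix ep::real assume ep: "0 < ep"
  have "\<forall>\<^sub>F z in E. cdist B (f (opn A q x y) z) (opn B q (f x z) (f y z)) < ep" by(rule B.aeqD[OF amorD(2)[OF f q xy] ep])
  from lim[OF this] F[unfolded fspace_def tsp_wtop]
  show "\<forall>\<^sub>F p in F. cdist (cyl B) ((\<lambda>p\<in>\<Union>PP. \<lambda>t\<in>{0..1}. f (opn A q x y) (H (p, t))) p)
  (opn (cyl B) q ((\<lambda>p\<in>\<Union>PP. \<lambda>t\<in>{0..1}. f x (H (p, t))) p)
  ((\<lambda>p\<in>\<Union>PP. \<lambda>t\<in>{0..1}. f y (H (p, t))) p)) <= ep"
  proof eventually_elim
  case (elim p)
  have m: "(\<lambda>t\<in>{0..1}. f a (H (p, t))):cA (cyl B)" if "a:cA A" for a using C.Cb_val[OF cm[OF that], of p] elim(2) by simp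
  show ?case using elim m xy q ep C.opn_closed[OF q m[OF xy(1)] m[OF xy(2)]] by(subst B.cdist_cyl_le_iff) (auto simp: B.opn_cyl less_imp_le)
  qed
 qed
qed

section \<open>Asymptotic homotopy\<close>

text \<open>The ends of \<open>H\<close> agree with \<open>f\<close> and \<open>f'\<close> only
  asymptotically, because lifts of equal homomorphisms differ by functions vanishing at
  infinity.\<close>

definition ahom::"'g monoid=>('g, 'a) galg=>('g, 'b) galg=>'x topology=>'x filter =>('a=>'x=>'b)=>('a=>'x=>'b)=>bool" where
 "ahom G A B X F f f' <-> amor G A B X F f & amor G A B X F f' & (EX H. amor G A (cyl B) X F H &
  (ALL a:cA A. aeq F B (%p. H a p 0) (f a) & aeq F B (%p. H a p 1) (f' a)))"

lemma ahomI: assumes "amor G A B X F f" "amor G A B X F f'" "amor G A (cyl B) X F H" "!!a. a:cA A==>aeq F B (%p. H a p 0) (f a)"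
  "!!a. a:cA A==>aeq F B (%p. H a p 1) (f' a)" shows "ahom G A B X F f f'" using assms unfolding ahom_def by blast

lemma alg_map_val: "[|gpre G B; t:{0..1}|]==>alg_map G (cyl B) B (%u. u t)" by(auto simp: alg_map_def gpre.cyl_val gpre.cdist_cyl_val gpre.opn_cyl)

lemma alg_map_const: "gpre G B==>alg_map G B (cyl B) (%b. \<lambda>t\<in>{0..1}. b)"
proof -
 assume "gpre G B"
 then interpret B: gpre G B .
 have m: "(\<lambda>t\<in>{0..1}. b):cA (cyl B)" if "b:cA B" for b using that by(auto simp: B.cA_cyl)
 hence "cdist (cyl B) (\<lambda>t\<in>{0..1}. x) (\<lambda>t\<in>{0..1}. y) <= cdist B x y" if "x:cA B" "y:cA B" for x y
  using that by(subst B.cdist_cyl_le_iff) auto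
 with m show ?thesis by(auto simp: alg_map_def B.opn_cyl)
qed

lemma alg_map_rpm: assumes "gpre G B" and r: "con_on {0..1} r" "r:{0..1} \<rightarrow> {0..1}"
 shows "alg_map G (cyl B) (cyl B) (%u. \<lambda>t\<in>{0..1}. u (r t))"
proof -
 interpret B: gpre G B by fact
 interpret C: gpre G "cyl B" by(rule B.cyl_gpre)
 note m = B.cyl_rpm[OF _ r]
 have "cdist (cyl B) (\<lambda>t\<in>{0..1}. x (r t)) (\<lambda>t\<in>{0..1}. y (r t)) <= cdist (cyl B) x y" if "x:cA (cyl B)" "y:cA (cyl B)" for x y
  using that r(2) by(subst B.cdist_cyl_le_iff) (auto intro!: m B.cdist_cyl_val)
 with m show ?thesis using r(2) by(auto simp: alg_map_def B.opn_cyl Pi_iff)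
qed

lemma ahom_aeq: assumes A: "gpre G A" and B: "gpre G B" and F: "fspace X F" and f: "amor G A B X F f" "amor G A B X F f'"
  and eq: "!!a. a:cA A==>aeq F B (f a) (f' a)" shows "ahom G A B X F f f'"
proof(rule ahomI[OF f amor_alg_map[OF B calg_cyl_gpre[OF B] alg_map_const[OF B] F A f(1)]])
 interpret B: gpre G B by(rule B)
 have ev: "\<forall>\<^sub>F p in F. p:tsp X" using F by(simp add: fspace_def)
 fix a assume a: "a:cA A"
 have "aeq F B (%p. (\<lambda>x\<in>tsp X. \<lambda>t\<in>{0..1::real}. f a x) p t) v <-> aeq F B (f a) v" if "t:{0..1::real}" for v t
  by(rule aeq_cong[OF _ always_eventually]) (use ev in eventually_elim, use that in simp_all)
 from this[of 0 "f a"] this[of 1 "f' a"]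
 show "aeq F B (%p. (\<lambda>x\<in>tsp X. \<lambda>t\<in>{0..1::real}. f a x) p 0) (f a)"
  "aeq F B (%p. (\<lambda>x\<in>tsp X. \<lambda>t\<in>{0..1::real}. f a x) p 1) (f' a)" using eq[OF a] by(simp_all del: restrict_apply)
qed

lemma ahom_refl: "[|gpre G A; gpre G B; fspace X F; amor G A B X F f|]==>ahom G A B X F f f"
 by(rule ahom_aeq) (auto simp: aeq_def gpre_pre_cstar pre_cstar.cdist_self)

lemma ahom_sym: assumes A: "gpre G A" and B: "gpre G B" and F: "fspace X F" and h: "ahom G A B X F f f'" shows "ahom G A B X F f' f"
proof -
 obtain H where f: "amor G A B X F f" "amor G A B X F f'" and H: "amor G A (cyl B) X F H" and e: "!!a. a:cA A==>aeq F B (%p. H a p 0) (f a)"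
  "!!a. a:cA A==>aeq F B (%p. H a p 1) (f' a)" using h unfolding ahom_def by blast
 have ev: "\<forall>\<^sub>F p in F. p:tsp X" using F by(simp add: fspace_def)
 have r: "alg_map G (cyl B) (cyl B) (%u. \<lambda>t\<in>{0..1}. u (1 - t))" by(rule alg_map_rpm[OF B]) (auto intro!: continuous_intros)
 show ?thesis
 proof(rule ahomI[OF f(2,1) amor_alg_map[OF calg_cyl_gpre[OF B] calg_cyl_gpre[OF B] r F A H]])
  fix a assume a: "a:cA A"
  show "aeq F B (%p. (\<lambda>x\<in>tsp X. \<lambda>t\<in>{0..1}. H a x (1 - t)) p 0) (f' a)"
  by(rule iffD1[OF aeq_cong, OF _ _ e(2)[OF a]]) (use ev in "eventually_elim, simp")+
  show "aeq F B (%p. (\<lambda>x\<in>tsp X. \<lambda>t\<in>{0..1}. H a x (1 - t)) p 1) (f a)"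
  by(rule iffD1[OF aeq_cong, OF _ _ e(1)[OF a]]) (use ev in "eventually_elim, simp")+
 qed
qed

text \<open>\<open>H1\<close> at time 1 and \<open>H2\<close> at time 0 agree only asymptotically,
  so their values cannot simply be concatenated to continuous paths. \<open>H2\<close> is shifted by
  the difference of these ends, which tends to 0.\<close>

lemma ahom_trans: assumes A: "gpre G A" and B: "gpre G B" and F: "fspace X F" and h1: "ahom G A B X F f0 f1" and h2: "ahom G A B X F f1 f2"
 shows "ahom G A B X F f0 f2"
proof -
 interpret A: gpre G A by(rule A)
 interpret B: gpre G B by(rule B)
 interpret C: gpre G "cyl B" by(rule B.cyl_gpre)
 interpret E: gpre G "Cb X (cyl B)" by(rule C.Cb_gpre)
 obtain H1 where f: "amor G A B X F f0" "amor G A B X F f1" and H1: "amor G A (cyl B) X F H1" and e1: "!!a. a:cA A==>aeq F B (%p. H1 a p 0) (f0 a)"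
  "!!a. a:cA A==>aeq F B (%p. H1 a p 1) (f1 a)" using h1 unfolding ahom_def by blast
 obtain H2 where f2: "amor G A B X F f2" and H2: "amor G A (cyl B) X F H2" and e2: "!!a. a:cA A==>aeq F B (%p. H2 a p 0) (f1 a)"
  "!!a. a:cA A==>aeq F B (%p. H2 a p 1) (f2 a)" using h2 unfolding ahom_def by blast
 have ev: "\<forall>\<^sub>F p in F. p:tsp X" using F by(simp add: fspace_def)
 have Hc: "H1 a p:cA (cyl B)" "H2 a p:cA (cyl B)" if "a:cA A" "p:tsp X" for a p using amorD(1)[OF H1 that(1)] amorD(1)[OF H2 that(1)] that(2) by simp_all
 note rp = alg_map_Cb[OF C.gpre_axioms C.gpre_axioms alg_map_rpm[OF B]]
 \<comment> \<open>Because of \<open>min\<close> and \<open>max\<close>, \<open>W\<close> is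
   \<open>H1\<close> at double speed on the first half of the interval and
   \<open>H1 1 + H2 (2 t - 1) - H2 0\<close> on the second, and no case distinction has to be proved
   continuous.\<close>
 define W where "W = (%a. cadd (Cb X (cyl B)) (\<lambda>p\<in>tsp X. \<lambda>t\<in>{0..1}. H1 a p (min 1 (2 * t)))
  (cminus (Cb X (cyl B)) (\<lambda>p\<in>tsp X. \<lambda>t\<in>{0..1}. H2 a p (max 0 (2 * t - 1))) (\<lambda>p\<in>tsp X. \<lambda>t\<in>{0..1}. H2 a p 0)))"
 have Wcb: "W a:cA (Cb X (cyl B))" if a: "a:cA A" for a unfolding W_def
  by(intro E.add_closed E.mi_closed rp amorD(1)[OF H1 a] amorD(1)[OF H2 a] continuous_intros) auto
 have Wp: "W a p:cA (cyl B)" if "a:cA A" "p:tsp X" for a p by(rule C.Cb_val[OF Wcb[OF that(1)] that(2)])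
 have Wt: "W a p t = cadd B (H1 a p (min 1 (2 * t))) (cminus B (H2 a p (max 0 (2 * t - 1))) (H2 a p 0))" if "p:tsp X" "t:{0..1}" for a p t
  using that by(simp add: W_def Cb_simps cmi_Cb cyl_def)
 \<comment> \<open>The second half of \<open>W\<close>. It is asymptotically equal to
   \<open>H2\<close> and inherits from it the compatibility with the operations.\<close>
 define V where "V = (%a. \<lambda>p\<in>tsp X. \<lambda>t\<in>{0..1}. W a p ((1 + t) / 2))"
 have l: "alg_map G (cyl B) (cyl B) (%u. \<lambda>t\<in>{0..1}. u (t / 2))" and r: "alg_map G (cyl B) (cyl B) (%u. \<lambda>t\<in>{0..1}. u ((1 + t) / 2))"
  by(rule alg_map_rpm[OF B]; auto intro!: continuous_intros)+
 have Vc: "V a:cA (Cb X (cyl B))" if "a:cA A" for a unfolding V_def by(rule alg_map_Cb[OF C.gpre_axioms C.gpre_axioms r Wcb[OF that]])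
 have Wl: "(\<lambda>t\<in>{0..1}. W a p (t / 2)) = H1 a p" if "a:cA A" "p:tsp X" for a p
  using Hc[OF that] that by(intro extensionalityI[of _ "{0..1}"]) (auto simp: Wt B.cA_cyl min_def)
 have Vt: "V a p t = cadd B (H1 a p 1) (cminus B (H2 a p t) (H2 a p 0))" if "p:tsp X" "t:{0..1}" for a p t using that by(simp add: V_def Wt field_simps)
 have HV: "aeq F (cyl B) (H2 a) (V a)" if a: "a:cA A" for a
 proof(rule C.aeq_bound)
  show "((%p. cdist B (H1 a p 1) (f1 a p) + cdist B (H2 a p 0) (f1 a p)) ---> 0) F"
  by(intro tendsto_add_zero e1(2)[OF a, unfolded aeq_def] e2(1)[OF a, unfolded aeq_def])
  show "\<forall>\<^sub>F p in F. cdist (cyl B) (H2 a p) (V a p) <= cdist B (H1 a p 1) (f1 a p) + cdist B (H2 a p 0) (f1 a p)" using ev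
  proof eventually_elim
  case (elim p)
  have f1: "f1 a p:cA B" using amorD(1)[OF f(2) a] elim by simp
  have "cdist B (H2 a p t) (V a p t) <= cdist B (H1 a p 1) (f1 a p) + cdist B (H2 a p 0) (f1 a p)" if "t:{0..1}" for t
  using B.cdist_shift[of "H2 a p t" "H1 a p 1" "H2 a p 0"] B.cdist_tri[of "H1 a p 1" "f1 a p" "H2 a p 0"]
  Hc[OF a elim] f1 that by(simp add: Vt[OF elim that] B.cdist_comm)
  thus ?case using Hc[OF a elim] Vc[OF a] elim by(subst B.cdist_cyl_le_iff) auto
  qed
 qed
 note V = amor_cong[OF C.gpre_axioms F A H2 Vc HV]
 \<comment> \<open>The distance of two paths is controlled by the distances of their halves; so
   compatibility of \<open>W\<close> with the operations reduces to that of \<open>H1\<close> and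
   \<open>V\<close>.\<close>
 have split: "cdist (cyl B) u v <= cdist (cyl B) (\<lambda>t\<in>{0..1}. u (t / 2)) (\<lambda>t\<in>{0..1}. v (t / 2))
  + cdist (cyl B) (\<lambda>t\<in>{0..1}. u ((1 + t) / 2)) (\<lambda>t\<in>{0..1}. v ((1 + t) / 2))" (is "_ <= ?l + ?r")
  if uv: "u:cA (cyl B)" "v:cA (cyl B)" for u v
 proof -
  have "cdist B (u t) (v t) <= ?l + ?r" if t: "t:{0..1}" for t using B.cdist_cyl_val[OF alg_mapD(1)[OF l uv(1)] alg_mapD(1)[OF l uv(2)], of "2 * t"]
  B.cdist_cyl_val[OF alg_mapD(1)[OF r uv(1)] alg_mapD(1)[OF r uv(2)], of "2 * t - 1"] t
  by(cases "t <= 1/2") (auto intro: order_trans simp: add_increasing add_increasing2)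
  thus ?thesis using uv by(subst B.cdist_cyl_le_iff) auto
 qed
 have W: "amor G A (cyl B) X F W" unfolding amor_def
 proof(intro conjI ballI Wcb)
  fix q x y assume q: "q:opcs G" and xy: "x:cA A" "y:cA A"
  note o = A.opn_closed[OF q xy]
  show "aeq F (cyl B) (W (opn A q x y)) (%p. opn (cyl B) q (W x p) (W y p))"
  proof(rule C.aeq_bound)
  show "((%p. cdist (cyl B) (H1 (opn A q x y) p) (opn (cyl B) q (H1 x p) (H1 y p))
  + cdist (cyl B) (V (opn A q x y) p) (opn (cyl B) q (V x p) (V y p))) ---> 0) F"
  by(intro tendsto_add_zero amorD(2)[OF H1 q xy, unfolded aeq_def] amorD(2)[OF V q xy, unfolded aeq_def])
  show "\<forall>\<^sub>F p in F. cdist (cyl B) (W (opn A q x y) p) (opn (cyl B) q (W x p) (W y p))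
  <= cdist (cyl B) (H1 (opn A q x y) p) (opn (cyl B) q (H1 x p) (H1 y p))
  + cdist (cyl B) (V (opn A q x y) p) (opn (cyl B) q (V x p) (V y p))" using ev
  proof eventually_elim
  case (elim p)
  have c: "W x p:cA (cyl B)" "W y p:cA (cyl B)" "W (opn A q x y) p:cA (cyl B)" by(rule Wp[OF _ elim], rule xy o)+
  show ?case using split[OF c(3) C.opn_closed[OF q c(1,2)]] elim
  unfolding alg_mapD(3)[OF l q c(1,2)] alg_mapD(3)[OF r q c(1,2)] Wl[OF xy(1) elim] Wl[OF xy(2) elim] Wl[OF o elim] by(simp add: V_def)
  qed
  qed
 qed
 show ?thesis
 proof(rule ahomI[OF f(1) f2 W])
  fix a assume a: "a:cA A"
  show "aeq F B (%p. W a p 0) (f0 a)" by(rule iffD1[OF aeq_cong, OF _ _ e1(1)[OF a]]) (use ev in \<open>eventually_elim, use Hc a in "simp add: Wt"\<close>)+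
  have "aeq F B (%p. W a p 1) (%p. H2 a p 1)"
  proof(rule B.aeq_bound[OF HV[OF a, unfolded aeq_def]])
  show "\<forall>\<^sub>F p in F. cdist B (W a p 1) (H2 a p 1) <= cdist (cyl B) (H2 a p) (V a p)" using ev
  proof eventually_elim
  case (elim p)
  thus ?case using B.cdist_cyl_val[of "H2 a p" "V a p" 1] Vc[OF a] Hc[OF a elim] by(simp add: Vt Wt B.cdist_comm)
  qed
  qed
  thus "aeq F B (%p. W a p 1) (f2 a)" by(rule B.aeq_trans[OF _ e2(2)[OF a]]) (use ev in "eventually_elim, use Wp Hc a amorD(1)[OF f2 a] in simp")
 qed
qed

section \<open>Homotopy classes and germs in terms of lifts\<close>

lemma Ca_map_class: assumes B: "gpre G B" and D: "gpre G D" and ps: "alg_map G B D ps" and F: "fspace X F" and f: "f:cA (Cb X B)"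
 shows "Ca_map X F B D ps (clA X F B f) = clA X F D (\<lambda>x\<in>tsp X. ps (f x))"
proof -
 interpret B: gpre G B by(rule B)
 interpret D: gpre G D by(rule D)
 have "Ca_map X F B D ps (clA X F B f) = (UN f:clA X F B f. clA X F D (\<lambda>x\<in>tsp X. ps (f x)))" using f by(simp add: Ca_map_def)
 also have "\<dots> = clA X F D (\<lambda>x\<in>tsp X. ps (f x))"
 proof(rule B.Ca_class_UN[OF F f])
  fix g assume g: "g:cA (Cb X B)" "aeq F B g f"
  have "aeq F D (%x. ps (g x)) (%x. ps (f x))"
  proof(rule alg_map_aeq[OF B D ps _ g(2)])
  show "\<forall>\<^sub>F x in F. g x:cA B & f x:cA B" using F[unfolded fspace_def] by eventually_elim (use f g in simp)
  qed
  thus "clA X F D (\<lambda>x\<in>tsp X. ps (g x)) = clA X F D (\<lambda>x\<in>tsp X. ps (f x))" using alg_map_Cb[OF B D ps] f g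
  by(subst D.Ca_class_eq_iff[OF F]) (simp_all add: aeq_restr[OF F] del: restrict_apply)
 qed
 finally show ?thesis .
qed

lemma alg_map_cong: assumes "alg_map G B D ps" "gpre G B" "!!x. x:cA B==>ps' x = ps x"
 shows "alg_map G B D ps'" using assms by(auto simp: alg_map_def gpre.opn_closed)

lemma alg_map_ev: "[|gpre G B; t:{0..1}|]==>alg_map G (cyl B) B (ev B t)" by(rule alg_map_cong[OF alg_map_val]) (auto simp: gpre.cyl_gpre gpre.ev_eq)

abbreviation Ca_homotopy::"'g monoid=>('g, 'a) galg=>('g, 'b) galg=>'x topology=>'x filter =>(('a=>('x=>'b) set)*('a=>('x=>'b) set)) set" where
 "Ca_homotopy G A B X F == homotopy_rel G A (Ca X F B) (Ca X F (cyl B)) (Ca_map X F (cyl B) B (ev B 0)) (Ca_map X F (cyl B) B (ev B 1))"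

lemma comp_Ca_map: assumes B: "gpre G B" and D: "gpre G D" and ps: "alg_map G B D ps" and F: "fspace X F" and f: "amor G A B X F f"
 shows "compose (cA A) (Ca_map X F B D ps) (mor_of X F A B f) = mor_of X F A D (%a. \<lambda>x\<in>tsp X. ps (f a x))" unfolding compose_def
proof(rule extensionalityI)
 show "(\<lambda>x\<in>cA A. Ca_map X F B D ps (mor_of X F A B f x)) x = mor_of X F A D (%a. \<lambda>x\<in>tsp X. ps (f a x)) x" if "x:cA A" for x
  using that amorD(1)[OF f that] by(simp add: mor_of_def Ca_map_class[OF B D ps F])
qed (auto simp: mor_of_def)

lemma mor_of_ev_iff: assumes B: "gpre G B" and F: "fspace X F" and t: "t:{0..1}" and f: "amor G A B X F f" and H: "amor G A (cyl B) X F H"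
 shows "compose (cA A) (Ca_map X F (cyl B) B (ev B t)) (mor_of X F A (cyl B) H) = mor_of X F A B f <-> (ALL a:cA A. aeq F B (%p. H a p t) (f a))"
proof -
 interpret B: gpre G B by(rule B)
 note C = B.cyl_gpre
 interpret C: gpre G "cyl B" by(rule C)
 have eq: "(\<lambda>x\<in>tsp X. ev B t (H a x)) = (\<lambda>x\<in>tsp X. H a x t)" if "a:cA A" for a
  using amorD(1)[OF H that] by(intro restrict_ext) (simp add: B.ev_eq)
 have m: "(\<lambda>x\<in>tsp X. ev B t (H a x)):cA (Cb X B)" if "a:cA A" for a by(rule alg_map_Cb[OF C B alg_map_ev[OF B t] amorD(1)[OF H that]])
 show ?thesis unfolding comp_Ca_map[OF C B alg_map_ev[OF B t] F H] using amorD(1)[OF f] m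
  by(subst mor_of_eq_iff[OF B F]) (auto simp: eq aeq_restr[OF F] simp del: restrict_apply)
qed

lemma Ca_htpy_iff: assumes A: "gpre G A" and B: "gpre G B" and F: "fspace X F" and f: "amor G A B X F f" "amor G A B X F f'"
 shows "(mor_of X F A B f, mor_of X F A B f'):Ca_homotopy G A B X F <-> ahom G A B X F f f'"
proof
 note C = gpre.cyl_gpre[OF B]
 assume "(mor_of X F A B f, mor_of X F A B f'):Ca_homotopy G A B X F"
 then obtain Ph where Ph: "Ph:Mor G A (Ca X F (cyl B))" and e: "compose (cA A) (Ca_map X F (cyl B) B (ev B 0)) Ph = mor_of X F A B f"
  "compose (cA A) (Ca_map X F (cyl B) B (ev B 1)) Ph = mor_of X F A B f'" by(auto simp: homotopy_rel_def)
 obtain H where H: "amor G A (cyl B) X F H" "Ph = mor_of X F A (cyl B) H" using Mor_lift[OF A C F Ph] .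
 show "ahom G A B X F f f'"
 proof(rule ahomI[OF f H(1)])
  show "aeq F B (%p. H a p 0) (f a)" if "a:cA A" for a using e(1) that mor_of_ev_iff[OF B F _ f(1) H(1), of 0] by(simp add: H(2))
  show "aeq F B (%p. H a p 1) (f' a)" if "a:cA A" for a using e(2) that mor_of_ev_iff[OF B F _ f(2) H(1), of 1] by(simp add: H(2))
 qed
next
 note C = gpre.cyl_gpre[OF B]
 assume "ahom G A B X F f f'"
 then obtain H where H: "amor G A (cyl B) X F H"
  "ALL a:cA A. aeq F B (%p. H a p 0) (f a)" "ALL a:cA A. aeq F B (%p. H a p 1) (f' a)" unfolding ahom_def by blast
 hence "compose (cA A) (Ca_map X F (cyl B) B (ev B 0)) (mor_of X F A (cyl B) H) = mor_of X F A B f"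
  "compose (cA A) (Ca_map X F (cyl B) B (ev B 1)) (mor_of X F A (cyl B) H) = mor_of X F A B f'"
  using mor_of_ev_iff[OF B F _ f(1) H(1), of 0] mor_of_ev_iff[OF B F _ f(2) H(1), of 1] by simp_all
 thus "(mor_of X F A B f, mor_of X F A B f'):Ca_homotopy G A B X F"
  using mor_of_Mor[OF H(1) A C F] mor_of_Mor[OF f(1) A B F] mor_of_Mor[OF f(2) A B F] unfolding homotopy_rel_def by blast
qed

lemma htpy_rel_sub: "homotopy_rel G A FB FIB e0 e1 <= Mor G A FB \<times> Mor G A FB" by(auto simp: homotopy_rel_def)

lemma equivI': assumes "r <= A \<times> A" "!!x. x:A==>(x, x):r" "!!x y. (x, y):r==>(y, x):r" "!!x y z. [|(x, y):r; (y, z):r|]==>(x, z):r" shows "equiv A r"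
proof(rule equivI[OF assms(1)])
 show "refl_on A r" using assms(2) by(simp add: refl_on_def)
 show "sym r" using assms(3) by(rule symI)
 show "trans r" using assms(4) by(rule transI)
qed

lemma equiv_Ca_htpy: assumes A: "gpre G A" and B: "gpre G B" and F: "fspace X F" shows "equiv (Mor G A (Ca X F B)) (Ca_homotopy G A B X F)"
proof(rule equivI'[OF htpy_rel_sub])
 note iff = Ca_htpy_iff[OF A B F]
 have lift: "EX f. amor G A B X F f & ph = mor_of X F A B f" if "ph:Mor G A (Ca X F B)" for ph using Mor_lift[OF A B F that] by blast
 have sub: "ph:Mor G A (Ca X F B)" "ps:Mor G A (Ca X F B)" if "(ph, ps):Ca_homotopy G A B X F" for ph ps using that htpy_rel_sub by blast+
 show "(ph, ph):Ca_homotopy G A B X F" if "ph:Mor G A (Ca X F B)" for ph using lift[OF that] iff ahom_refl[OF A B F] by blast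
 show "(ps, ph):Ca_homotopy G A B X F" if h: "(ph, ps):Ca_homotopy G A B X F" for ph ps
 proof -
  obtain f g where fg: "amor G A B X F f" "ph = mor_of X F A B f" "amor G A B X F g" "ps = mor_of X F A B g"
  using lift[OF sub(1)[OF h]] lift[OF sub(2)[OF h]] by blast
  thus ?thesis using h iff[OF fg(1,3)] iff[OF fg(3,1)] ahom_sym[OF A B F] by simp
 qed
 show "(ph, om):Ca_homotopy G A B X F" if h: "(ph, ps):Ca_homotopy G A B X F" "(ps, om):Ca_homotopy G A B X F" for ph ps om
 proof -
  obtain f g k where fg: "amor G A B X F f" "ph = mor_of X F A B f" "amor G A B X F g" "ps = mor_of X F A B g"
  "amor G A B X F k" "om = mor_of X F A B k" using lift[OF sub(1)[OF h(1)]] lift[OF sub(2)[OF h(1)]] lift[OF sub(2)[OF h(2)]] by blast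
  thus ?thesis using h iff[OF fg(1,3)] iff[OF fg(3,5)] iff[OF fg(1,5)] ahom_trans[OF A B F, of f g k] by simp
 qed
qed

lemma ahom_pb: assumes h: "ahom G A B X F f f'" and c: "cmap Y X k" "filterlim k F E" and E: "fspace Y E" shows "ahom G A B Y E (pb Y k f) (pb Y k f')"
proof -
 obtain H where f: "amor G A B X F f" "amor G A B X F f'" and H: "amor G A (cyl B) X F H" and e: "!!a. a:cA A==>aeq F B (%p. H a p 0) (f a)"
  "!!a. a:cA A==>aeq F B (%p. H a p 1) (f' a)" using h unfolding ahom_def by blast
 have ev: "\<forall>\<^sub>F p in E. p:tsp Y" using E by(simp add: fspace_def)
 show ?thesis
 proof(rule ahomI[OF amor_pb[OF f(1) c E] amor_pb[OF f(2) c E] amor_pb[OF H c E]])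
  fix a assume a: "a:cA A"
  show "aeq E B (%p. pb Y k H a p 0) (pb Y k f a)" by(rule iffD1[OF aeq_cong, OF _ _ aeq_comp[OF e(1)[OF a] c(2)]])
  (use ev in "eventually_elim, simp add: pb_def")+
  show "aeq E B (%p. pb Y k H a p 1) (pb Y k f' a)" by(rule iffD1[OF aeq_cong, OF _ _ aeq_comp[OF e(2)[OF a] c(2)]])
  (use ev in "eventually_elim, simp add: pb_def")+
 qed
qed

lemma pb_pb: "cmap Z Y h==>pb Z h (pb Y k f) = pb Z (%p. k (h p)) f" by(auto simp: pb_def continuous_map_def intro!: ext)

lemma pb_cong: "(!!p. p:tsp Y==>h p = k p)==>pb Y h f = pb Y k f" unfolding pb_def by(intro ext restrict_ext) simp

lemma ev_prod_princ: "eventually P (F \<times>\<^sub>F principal S) <-> (\<forall>\<^sub>F x in F. ALL t:S. P (x, t))"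
 unfolding eventually_prod_filter eventually_principal
proof(intro iffI)
 assume "EX Pf Pg. eventually Pf F & (ALL x:S. Pg x) & (ALL x y. Pf x --> Pg y --> P (x, y))"
 thus "\<forall>\<^sub>F x in F. ALL t:S. P (x, t)" by(auto elim: eventually_mono)
next
 assume "\<forall>\<^sub>F x in F. ALL t:S. P (x, t)"
 thus "EX Pf Pg. eventually Pf F & (ALL x:S. Pg x) & (ALL x y. Pf x --> Pg y --> P (x, y))" by(intro exI[of _ "%x. ALL t:S. P (x, t)"] exI[of _ "%t. t:S"]) auto
qed

text \<open>The mechanism behind every independence statement: maps of spaces that are homotopic
  through maps tending to infinity, uniformly in time, pull one lift back to homotopic
  lifts.\<close>

lemma ahom_htpy: fixes H::"'x::topological_space \<times> real=>'z::topological_space" assumes A: "gpre G A" and B: "gpre G B" and f: "amor G A B (wtop QQ) E f"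
  and H: "pmap ((%P. P \<times> {0..1}) ` PP) QQ H" and lim: "filterlim H E (F \<times>\<^sub>F principal {0..1})" and F: "fspace (wtop PP) F"
 shows "ahom G A B (wtop PP) F (pb (wtop PP) (%p. H (p, 0)) f) (pb (wtop PP) (%p. H (p, 1)) f)"
proof -
 interpret B: gpre G B by(rule B)
 have ev: "\<forall>\<^sub>F p in F. p:\<Union>PP" using F by(simp add: fspace_def)
 have lim': "\<forall>\<^sub>F p in F. ALL t:{0..1}. Q (H (p, t))" if "eventually Q E" for Q using lim that by(simp add: filterlim_iff ev_prod_princ)
 have end_asym: "amor G A B (wtop PP) F (pb (wtop PP) (%p. H (p, t)) f)" if t: "t:{0..1}" for t
 proof(rule amor_pb[OF f _ _ F])
  have "pmap PP ((%P. P \<times> {0..1}) ` PP) (%p. (p, t))" unfolding pmap_def using t by(fastforce intro!: continuous_intros)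
  from pmap_cmap[OF pmap_comp[OF this H]]
  show "cmap (wtop PP) (wtop QQ) (%p. H (p, t))" .
  show "filterlim (%p. H (p, t)) E F" unfolding filterlim_iff
  proof(intro allI impI)
  fix P assume "eventually P E"
  from lim'[OF this] show "\<forall>\<^sub>F p in F. P (H (p, t))" by eventually_elim (use t in blast)
  qed
 qed
 show ?thesis
 proof(rule ahomI[OF end_asym end_asym amor_htpy[OF B f A H lim' F]])
  fix a assume "a:cA A"
  show "aeq F B (%p. (\<lambda>p\<in>\<Union>PP. \<lambda>t\<in>{0..1}. f a (H (p, t))) p 0) (pb (wtop PP) (%p. H (p, 0)) f a)"
  by(rule iffD1[OF aeq_cong, OF _ _ B.aeq_refl[of F "pb (wtop PP) (%p. H (p, 0)) f a"]]) (use ev in "eventually_elim, simp add: pb_def")+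
  show "aeq F B (%p. (\<lambda>p\<in>\<Union>PP. \<lambda>t\<in>{0..1}. f a (H (p, t))) p 1) (pb (wtop PP) (%p. H (p, 1)) f a)"
  by(rule iffD1[OF aeq_cong, OF _ _ B.aeq_refl[of F "pb (wtop PP) (%p. H (p, 1)) f a"]]) (use ev in "eventually_elim, simp add: pb_def")+
 qed auto
qed

subsection \<open>Simpltotic morphisms\<close>

abbreviation stop::"'i rel=>'i pt topology" where "stop m == rtop (Fd m)"

abbreviation sasym::"'g monoid=>('g, 'a) galg=>('g, 'b) galg=>'i rel =>('a=>'i pt=>'b)=>bool" where "sasym G A B m == amor G A B (stop m) (sfil m)"

abbreviation shom::"'g monoid=>('g, 'a) galg=>('g, 'b) galg=>'i rel =>('a=>'i pt=>'b)=>('a=>'i pt=>'b)=>bool" where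
 "shom G A B m == ahom G A B (stop m) (sfil m)"

abbreviation smor::"'i rel=>('g, 'a) galg=>('g, 'b) galg =>('a=>'i pt=>'b)=>('a=>('i, 'b) simpl)" where "smor m == mor_of (stop m) (sfil m)"

abbreviation spb::"'i rel=>('i=>'j)=>('a=>'j pt=>'b)=>('a=>'i pt=>'b)" where "spb k al == pb (stop k) (aff al)"

definition hcls::"'g monoid=>('g, 'a) galg=>('g, 'b) galg=>'i rel =>('a=>'i pt=>'b)=>('a=>('i, 'b) simpl) set" where
 "hcls G A B m f = simpl_mor_class G A B m (smor m A B f)"

context
 fixes G::"'g monoid" and A::"('g, 'a) galg" and B::"('g, 'b) galg" assumes A: "gpre G A" and B: "gpre G B"
begin

interpretation A: gpre G A by(rule A)
interpretation B: gpre G B by(rule B)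

lemma equiv_simpl_htpy: "dset m==>equiv (Mor G A (Simpl m B)) (simpl_homotopy G A B m)" unfolding simpl_homotopy_def by(rule equiv_Ca_htpy[OF A B fspace_sx])

lemma simpl_htpy_iff: assumes m: "dset m" and f: "sasym G A B m f" "sasym G A B m f'"
 shows "(smor m A B f, smor m A B f'):simpl_homotopy G A B m <-> shom G A B m f f'" unfolding simpl_homotopy_def by(rule Ca_htpy_iff[OF A B fspace_sx[OF m] f])

lemma smor_Mor: "[|dset m; sasym G A B m f|]==>smor m A B f:Mor G A (Simpl m B)" by(rule mor_of_Mor[OF _ A B fspace_sx])

lemma hcls_eq_iff: assumes m: "dset m" and f: "sasym G A B m f" "sasym G A B m f'"
 shows "hcls G A B m f = hcls G A B m f' <-> shom G A B m f f'" unfolding hcls_def simpl_htpy_iff[OF m f, symmetric]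
 by(rule eq_equiv_class_iff[OF equiv_simpl_htpy[OF m] smor_Mor[OF m f(1)] smor_Mor[OF m f(2)]])

lemma in_hcls_iff: assumes m: "dset m" and f: "sasym G A B m f" shows "ph:hcls G A B m f <-> (EX f'. sasym G A B m f' & ph = smor m A B f' & shom G A B m f f')"
proof
 assume "ph:hcls G A B m f"
 hence h: "(smor m A B f, ph):simpl_homotopy G A B m" by(simp add: hcls_def)
 hence "ph:Mor G A (Simpl m B)" using htpy_rel_sub by(fastforce simp: simpl_homotopy_def)
 then obtain f' where "sasym G A B m f'" "ph = smor m A B f'" by(rule Mor_lift[OF A B fspace_sx[OF m]])
 thus "EX f'. sasym G A B m f' & ph = smor m A B f' & shom G A B m f f'" using h simpl_htpy_iff[OF m f] by blast
qed (auto simp: hcls_def simpl_htpy_iff[OF m f])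

lemma simpl_mor_iff: assumes m: "dset m" shows "c:simpl_mor G A B m <-> (EX f. sasym G A B m f & c = hcls G A B m f)"
proof
 assume "c:simpl_mor G A B m"
 then obtain ph where ph: "ph:Mor G A (Simpl m B)" "c = simpl_mor_class G A B m ph" by(auto simp: simpl_mor_def quotient_def)
 thus "EX f. sasym G A B m f & c = hcls G A B m f" using Mor_lift[OF A B fspace_sx[OF m] ph(1)] unfolding hcls_def by metis
next
 assume "EX f. sasym G A B m f & c = hcls G A B m f"
 thus "c:simpl_mor G A B m" using smor_Mor[OF m] by(auto simp: simpl_mor_def hcls_def intro: quotientI)
qed

lemma sasym_spb: assumes k: "dset k" and m: "dset m" and al: "cofinal k m al" and f: "sasym G A B m f" shows "sasym G A B k (spb k al f)"
proof(rule amor_pb[OF f _ cof_flim[OF k m al] fspace_sx[OF k]])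
 show "cmap (stop k) (stop m) (aff al)" unfolding rtop_weak by(rule pmap_cmap[OF pmap_cof[OF al]])
qed

lemma shom_spb: assumes k: "dset k" and m: "dset m" and al: "cofinal k m al" and f: "shom G A B m f f'" shows "shom G A B k (spb k al f) (spb k al f')"
proof(rule ahom_pb[OF f _ cof_flim[OF k m al] fspace_sx[OF k]])
 show "cmap (stop k) (stop m) (aff al)" unfolding rtop_weak by(rule pmap_cmap[OF pmap_cof[OF al]])
qed

lemma pullback_class: assumes k: "dset k" and m: "dset m" and al: "cofinal k m al" and f: "f:cA (Cb (stop m) B)"
 shows "pullback k m al B (Simpl_class m B f) = Simpl_class k B (\<lambda>x\<in>rl (Fd k). f (aff al x))"
proof -
 note Fm = fspace_sx[OF m] and Fk = fspace_sx[OF k]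
 have c: "cmap (stop k) (stop m) (aff al)" unfolding rtop_weak by(rule pmap_cmap[OF pmap_cof[OF al]])
 have mem: "(\<lambda>x\<in>rl (Fd k). g (aff al x)):cA (Cb (stop k) B)" if "g:cA (Cb (stop m) B)" for g using Cb_pb[OF that c] by simp
 have "pullback k m al B (Simpl_class m B f)
  = (UN f:Simpl_class m B f. Simpl_class k B (\<lambda>x\<in>rl (Fd k). f (aff al x)))" using f by(simp add: pullback_def)
 also have "\<dots> = Simpl_class k B (\<lambda>x\<in>rl (Fd k). f (aff al x))"
 proof(rule B.Ca_class_UN[OF Fm f])
  fix g assume g: "g:cA (Cb (stop m) B)" "aeq (sfil m) B g f"
  show "Simpl_class k B (\<lambda>x\<in>rl (Fd k). g (aff al x))
  = Simpl_class k B (\<lambda>x\<in>rl (Fd k). f (aff al x))" using mem[OF f] mem[OF g(1)] aeq_comp[OF g(2) cof_flim[OF k m al]]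
  aeq_restr[OF Fk, of B] by(subst B.Ca_class_eq_iff[OF Fk]) (simp_all del: restrict_apply)
 qed
 finally show ?thesis .
qed

lemma comp_pullback: assumes k: "dset k" and m: "dset m" and al: "cofinal k m al" and f: "sasym G A B m f"
 shows "compose (cA A) (pullback k m al B) (smor m A B f) = smor k A B (spb k al f)" unfolding compose_def
proof(rule extensionalityI)
 show "(\<lambda>x\<in>cA A. pullback k m al B (smor m A B f x)) x = smor k A B (spb k al f) x" if "x:cA A" for x
  using that amorD(1)[OF f that] by(simp add: mor_of_def pullback_class[OF k m al] pb_def)
qed (auto simp: mor_of_def)

lemma pullback_mor_hcls: assumes k: "dset k" and m: "dset m" and al: "cofinal k m al" and f: "sasym G A B m f"
 shows "pullback_mor G A B k m al (hcls G A B m f) = hcls G A B k (spb k al f)"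
proof -
 have "simpl_mor_class G A B k (compose (cA A) (pullback k m al B) ph) = hcls G A B k (spb k al f)" if ph: "ph:hcls G A B m f" for ph
 proof -
  obtain f' where f': "sasym G A B m f'" "ph = smor m A B f'" "shom G A B m f f'" using iffD1[OF in_hcls_iff[OF m f] ph] by blast
  have "simpl_mor_class G A B k (compose (cA A) (pullback k m al B) ph) = hcls G A B k (spb k al f')"
  by(simp add: f'(2) comp_pullback[OF k m al f'(1)] hcls_def)
  also have "\<dots> = hcls G A B k (spb k al f)" using hcls_eq_iff[OF k sasym_spb[OF k m al f] sasym_spb[OF k m al f'(1)]] shom_spb[OF k m al f'(3)] by simp
  finally show ?thesis .
 qed
 moreover have "hcls G A B m f ~= {}" using in_hcls_iff[OF m f] ahom_refl[OF A B fspace_sx[OF m] f] f by blast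
 ultimately show ?thesis unfolding pullback_mor_def by simp
qed

end

text \<open>\<open>k\<close> is a common refinement over which \<open>f\<close> and \<open>g\<close>
  become homotopic. Its type is left free, since the constructions of refinements produce larger
  types than those of \<open>m\<close> and \<open>n\<close>.\<close>

definition wit::"'k rel=>'g monoid=>('g, 'a) galg=>('g, 'b) galg =>'i rel=>('a=>'i pt=>'b)=>'j rel=>('a=>'j pt=>'b)=>bool" where
 "wit k G A B m f n g <-> dset k & (EX al be. cofinal k m al & cofinal k n be & shom G A B k (spb k al f) (spb k be g))"

lemma limit_eq_iff: fixes n::"'j rel" assumes A: "gpre G A" and B: "gpre G B" and m: "dset m" and n: "dset n" and f: "sasym G A B m f" and g: "sasym G A B n g"
 shows "limit_eq G A B (m, hcls G A B m f) (n, hcls G A B n g) <-> (EX k::'j rel. wit k G A B m f n g)"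
proof -
 have "pullback_mor G A B k m al (hcls G A B m f) = pullback_mor G A B k n be (hcls G A B n g)
  <-> shom G A B k (spb k al f) (spb k be g)" if k: "dset k" and al: "cofinal k m al" and be: "cofinal k n be" for k::"'j rel" and al be
  by(simp add: pullback_mor_hcls[OF A B k m al f] pullback_mor_hcls[OF A B k n be g]
  hcls_eq_iff[OF A B k sasym_spb[OF A B k m al f] sasym_spb[OF A B k n be g]])
 note eq = this
 show ?thesis
 proof
  assume "limit_eq G A B (m, hcls G A B m f) (n, hcls G A B n g)"
  then obtain k::"'j rel" and al be where k: "dset k" "cofinal k m al" "cofinal k n be"
  and "pullback_mor G A B k m al (hcls G A B m f) = pullback_mor G A B k n be (hcls G A B n g)" unfolding limit_eq_def split by blast
  hence "shom G A B k (spb k al f) (spb k be g)" using eq[OF k] by blast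
  with k show "EX k::'j rel. wit k G A B m f n g" unfolding wit_def by blast
 next
  assume "EX k::'j rel. wit k G A B m f n g"
  then obtain k::"'j rel" and al be where k: "dset k" "cofinal k m al" "cofinal k n be" and "shom G A B k (spb k al f) (spb k be g)" unfolding wit_def by blast
  hence "pullback_mor G A B k m al (hcls G A B m f) = pullback_mor G A B k n be (hcls G A B n g)" using eq[OF k] by blast
  with k show "limit_eq G A B (m, hcls G A B m f) (n, hcls G A B n g)" unfolding limit_eq_def split by blast
 qed
qed

lemma germs_iff: assumes "gpre G A" "gpre G B"
 shows "p:germs G A B <-> (EX m f. dset m & sasym G A B m f & p = (m, hcls G A B m f))" using simpl_mor_iff[OF assms] by(auto simp: germs_def)

subsection \<open>Linear homotopies\<close>

text \<open>Like \<open>simplex_filter\<close>, but with only the tails at elements of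
  \<open>U\<close>. A lift obeys few asymptotic conditions, so it is still a lift for a suitable
  small \<open>U\<close>; this is how index types are reduced.\<close>

definition ufilter::"'i rel=>'i set=>'i pt filter" where "ufilter n U = (INF y\<in>U. principal (rl (n `` {y})))"

definition ucofinal::"'i rel=>'j rel=>'j set=>('i=>'j)=>bool" where "ucofinal m n U al <-> al:Fd m \<rightarrow> Fd n &
  (ALL y:U. EX x:Fd m. ALL k. (x, k):m --> (y, al k):n)"

lemma spx_filter_ufilter: "sfil n = ufilter n (Fd n)" by(simp add: simplex_filter_def ufilter_def)

lemma cof_ucof: "cofinal m n al <-> ucofinal m n (Fd n) al" by(simp add: cofinal_def ucofinal_def)

lemma flim_ufilter:
 "filterlim h (ufilter n U) F <-> (ALL y:U. \<forall>\<^sub>F x in F. h x:rl (n `` {y}))" by(simp add: ufilter_def filterlim_INF filterlim_principal)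

lemma ucof_tail: assumes "ucofinal m n U al" "y:U"
 obtains x where "x:Fd m" "!!z. z:rl (m `` {x})==>aff al z:rl (n `` {y})"
proof -
 obtain x where x: "x:Fd m" "!!k. (x, k):m==>(y, al k):n" using assms by(auto simp: ucofinal_def)
 have "aff al z:rl (n `` {y})" if "z:rl (m `` {x})" for z using that x(2) by(intro aff_rl) (auto dest: supp_sub)
 with x(1) show thesis by(rule that)
qed

lemma ucof_flim: assumes m: "dset m" and al: "ucofinal m n U al"
 shows "filterlim (aff al) (ufilter n U) (sfil m)" unfolding flim_ufilter ev_sfil[OF m] using ucof_tail[OF al] by metis

text \<open>Realizations of full simplices and their tails are convex, so straight lines connect the
  two affine maps inside a finite simplex and inside every tail that contains both ends.\<close>

lemma linear_htpy: assumes A: "gpre G A" and B: "gpre G B" and k: "dset k" and al: "ucofinal k n U al" and be: "ucofinal k n U be"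
  and f: "amor G A B (stop n) (ufilter n U) f" shows "shom G A B k (spb k al f) (spb k be f)"
proof -
 define H where "H = (%(p, t). segment t (aff al p) (aff be p))"
 have "pmap ((%P. P \<times> {0..1}) ` cells (Fd k)) (cells (Fd n)) H" unfolding pmap_def
 proof
  fix Q assume "Q:(%P. P \<times> {0..1::real}) ` cells (Fd k)"
  then obtain sg where sg: "sg:spx (Fd k)" "Q = rl sg \<times> {0..1}" by(auto simp: cells_def)
  have fin: "finite sg" using sg by(simp add: sx_def)
  let ?ta = "al ` sg Un be ` sg"
  have "?ta:spx (Fd n)" using sg(1) al be by(auto simp: sx_def ucofinal_def)
  moreover have "H (p, t):rl ?ta" if "p:rl sg" "t:{0..1}" for p t using that unfolding H_def by(auto intro!: rl_seg aff_rl[OF that(1)] dest: supp_sub)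
  moreover have "con_on Q H" unfolding H_def case_prod_unfold sg(2) by(intro cont_on_seg continuous_intros
  continuous_on_compose2[OF cont_on_aff[OF fin]]) auto
  ultimately show "EX R:cells (Fd n). H ` Q <= R & con_on Q H" unfolding sg(2) cells_def by(intro bexI[of _ "rl ?ta"]) auto
 qed
 moreover have "filterlim H (ufilter n U) (sfil k \<times>\<^sub>F principal {0..1})" unfolding flim_ufilter ev_prod_princ
 proof
  fix y assume y: "y:U"
  have "\<forall>\<^sub>F p in sfil k. aff al p:rl (n `` {y})" "\<forall>\<^sub>F p in sfil k. aff be p:rl (n `` {y})"
  using ucof_flim[OF k al] ucof_flim[OF k be] y by(auto simp: flim_ufilter)
  thus "\<forall>\<^sub>F p in sfil k. ALL t:{0..1}. H (p, t):rl (n `` {y})" by eventually_elim (auto simp: H_def intro: rl_seg)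
 qed
 ultimately have "ahom G A B (wtop (cells (Fd k))) (sfil k)
  (pb (wtop (cells (Fd k))) (%p. H (p, 0)) f) (pb (wtop (cells (Fd k))) (%p. H (p, 1)) f)" using f fspace_sx[OF k] unfolding rtop_weak
  by(intro ahom_htpy[OF A B, of "cells (Fd n)" "ufilter n U"])
 thus ?thesis by(simp add: rtop_weak H_def)
qed

section \<open>Composition of asymptotic morphisms on products\<close>

text \<open>The supremum norm controls the first variable uniformly in the second, so continuity in
  each variable gives joint continuity.\<close>

lemma uncurry_cont: assumes C: "gpre G C" and F: "cmap (tos P) (ntop (Cb Y C)) F" and Q: "cmap (tos Q) Y (%z. z)"
 shows "cmap (tos (P \<times> Q)) (ntop C) (%(x, z). F x z)"
proof -
 interpret C: gpre G C by(rule C)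
 interpret E: gpre G "Cb Y C" by(rule C.Cb_gpre)
 have Fc: "F x:cA (Cb Y C)" if "x:P" for x using F that by(simp add: E.cmap_ntop)
 have QY: "z:tsp Y" if "z:Q" for z using Q that by(auto simp: continuous_map_def)
 have Fv: "F x z:cA C" if "x:P" "z:Q" for x z by(rule C.Cb_val[OF Fc[OF that(1)] QY[OF that(2)]])
 show ?thesis unfolding C.cont_map_norm_topology_open
 proof(intro conjI ballI allI impI)
  show "(case w of (x, z)=>F x z):cA C" if "w:tsp (tos (P \<times> Q))" for w using that Fv by auto
  fix w and ep::real assume w: "w:tsp (tos (P \<times> Q))" and ep: "0 < ep"
  obtain x0 z0 where xz: "w = (x0, z0)" "x0:P" "z0:Q" using w by auto
  have pos: "0 < ep / 2" using ep by simp
  obtain U where U: "open U" "x0:U" "!!x. x:U Int P==>cdist (Cb Y C) (F x) (F x0) < ep / 2" by(rule cmap_atin[OF E.pre_cstar_axioms F xz(2) pos]) blast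
  have "cmap (tos Q) (ntop C) (%z. F x0 z)" using continuous_map_compose[OF Q, of "ntop C" "F x0"] Fc[OF xz(2)] by(simp add: cA_Cb o_def)
  then obtain V where V: "open V" "z0:V" "!!z. z:V Int Q==>cdist C (F x0 z) (F x0 z0) < ep / 2" by(rule cmap_atin[OF C.pre_cstar_axioms _ xz(3) pos]) blast
  have "cdist C (F x z) (F x0 z0) < ep" if "x:U Int P" "z:V Int Q" for x z
  proof -
  have "cdist C (F x z) (F x0 z0) <= cdist C (F x z) (F x0 z) + cdist C (F x0 z) (F x0 z0)" using that xz by(intro C.cdist_tri Fv) auto
  also have "cdist C (F x z) (F x0 z) <= cdist (Cb Y C) (F x) (F x0)" using that xz QY by(intro C.cdist_val_le Fc) auto
  finally show ?thesis using U(3)[OF that(1)] V(3)[OF that(2)] by simp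
  qed
  thus "EX W. openin (tos (P \<times> Q)) W & w:W & (ALL y:W. cdist C (case y of (x, z)=>F x z) (case w of (x, z)=>F x z) < ep)" using xz U(2) V(2)
  by(intro exI[of _ "(P \<times> Q) Int (U \<times> V)"] conjI openin_open_Int open_Times U(1) V(1)) auto
 qed
qed

lemma cont_map_top_of_set_piece: "P:PP==>cmap (tos P) (wtop PP) (%z. z)" using cmap_wtop[of PP "wtop PP" "%z. z"] by simp

definition pprod::"'x::topological_space set set=>'y::topological_space set set=>('x*'y) set set" where
 "pprod PP QQ = (%(P, Q). P \<times> Q) ` (PP \<times> QQ)"

lemma Union_pprod [simp]: "\<Union>(pprod PP QQ) = \<Union>PP \<times> \<Union>QQ" unfolding pprod_def by auto

text \<open>
 Convergence \<open>(x, z) \<rightarrow> \<infinity>\<close> in a product where \<open>z\<close> has to be far out depending on the cell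
 containing \<open>x\<close>.
\<close>

definition sdp::"'x filter=>('x=>'c)=>'j rel=>('x*'j pt) filter" where "sdp F cell n = Abs_filter (%R. EX xi. (ALL c. xi c:Fd n) &
  (\<forall>\<^sub>F x in F. ALL z:rl (n `` {xi (cell x)}). R (x, z)))"

lemma ev_sdp: fixes F::"'x filter" and n::"'j rel" assumes n: "dset n" shows "eventually R (sdp F cell n) <-> (EX xi. (ALL c. xi c:Fd n) &
  (\<forall>\<^sub>F x in F. ALL z:rl (n `` {xi (cell x)}). R (x, z)))" unfolding sdp_def
proof(rule eventually_Abs_filter, rule is_filter.intro)
 show "EX xi. (ALL c. xi c:Fd n) & (\<forall>\<^sub>F x in F. ALL z:rl (n `` {xi (cell x)}). True)" using dset_ne[OF n] by auto
 fix R S::"'x*'j pt=>bool"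
 assume "EX xi. (ALL c. xi c:Fd n) & (\<forall>\<^sub>F x in F. ALL z:rl (n `` {xi (cell x)}). R (x, z))"
  and "EX xi. (ALL c. xi c:Fd n) & (\<forall>\<^sub>F x in F. ALL z:rl (n `` {xi (cell x)}). S (x, z))"
 then obtain xi ze where xi: "!!c. xi c:Fd n" "!!c. ze c:Fd n" and R: "\<forall>\<^sub>F x in F. ALL z:rl (n `` {xi (cell x)}). R (x, z)"
  and S: "\<forall>\<^sub>F x in F. ALL z:rl (n `` {ze (cell x)}). S (x, z)" by blast
 have "ALL c. EX y. y:Fd n & (xi c, y):n & (ze c, y):n" using dset_ub[OF n xi(1) xi(2)] by blast
 then obtain et where et: "!!c. et c:Fd n" "!!c. (xi c, et c):n" "!!c. (ze c, et c):n" by metis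
 have sub: "rl (n `` {et c}) <= rl (n `` {xi c})"
  "rl (n `` {et c}) <= rl (n `` {ze c})" for c by(intro rl_mono; use dset_trans[OF n et(2)] dset_trans[OF n et(3)] in blast)+
 show "EX xi. (ALL c. xi c:Fd n) & (\<forall>\<^sub>F x in F. ALL z:rl (n `` {xi (cell x)}). R (x, z) & S (x, z))"
 proof(intro exI conjI allI)
  show "\<forall>\<^sub>F x in F. ALL z:rl (n `` {et (cell x)}). R (x, z) & S (x, z)" using R S by eventually_elim (use sub in blast)
 qed (rule et)
next
 fix R S::"'x*'j pt=>bool"
 assume RS: "ALL x. R x --> S x" and "EX xi. (ALL c. xi c:Fd n) & (\<forall>\<^sub>F x in F. ALL z:rl (n `` {xi (cell x)}). R (x, z))"
 then obtain xi where xi: "!!c. xi c:Fd n" and R: "\<forall>\<^sub>F x in F. ALL z:rl (n `` {xi (cell x)}). R (x, z)" by blast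
 show "EX xi. (ALL c. xi c:Fd n) & (\<forall>\<^sub>F x in F. ALL z:rl (n `` {xi (cell x)}). S (x, z))"
 proof(intro exI conjI allI)
  show "\<forall>\<^sub>F x in F. ALL z:rl (n `` {xi (cell x)}). S (x, z)" using R by eventually_elim (use RS in blast)
 qed (rule xi)
qed

lemma sdp_fspace: assumes n: "dset n" and F: "fspace (wtop PP) F" shows "fspace (wtop (pprod PP (cells (Fd n)))) (sdp F cell n)"
proof -
 obtain y where y: "y:Fd n" using dset_ne[OF n] by blast
 have sub: "rl (n `` {y}) <= rl (Fd n)" by(rule rl_mono) (auto intro: FieldI2)
 show ?thesis unfolding fspace_def ev_sdp[OF n] tsp_wtop Union_pprod Union_cells
 proof(intro exI[of _ "%_. y"] conjI allI y)
  show "\<forall>\<^sub>F x in F. ALL z:rl (n `` {y}). (x, z):\<Union>PP \<times> rl (Fd n)"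
  using F[unfolded fspace_def tsp_wtop] by eventually_elim (use sub in blast)
 qed
qed

text \<open>
 Pointwise smallness in the quotient algebra becomes uniform on compact sets, hence smallness
 along \<open>sdp\<close>.
\<close>

lemma as_unifity: fixes K::"'c=>'x::topological_space set" and I::"'q::topological_space set" assumes C: "gpre G C" and n: "dset n" and I: "compact I"
  and K: "!!x. x:X==>x:K (cell x)" "!!c. compact (K c)" and P: "!!c. cmap (tos (K c \<times> I)) (ntop (Cb (stop n) C)) (%(x, s). P x s)"
  and Q: "!!c. cmap (tos (K c \<times> I)) (ntop (Cb (stop n) C)) (%(x, s). Q x s)"
  and le: "\<forall>\<^sub>F x in F. x:X & (ALL s:I. cdist (Simpl n C) (Simpl_class n C (P x s)) (Simpl_class n C (Q x s)) <= ep)"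
  and ep: "0 <= ep" and de: "0 < de" shows "\<forall>\<^sub>F w in sdp F cell n. ALL s:I. cdist C (P (fst w) s (snd w)) (Q (fst w) s (snd w)) <= ep + de"
proof -
 interpret C: gpre G C by(rule C)
 interpret E: gpre G "Cb (stop n) C" by(rule C.Cb_gpre)
 note Fn = fspace_sx[OF n]
 interpret S: gpre G "Simpl n C" by(rule C.Ca_gpre[OF Fn])
 let ?q = "Simpl_class n C"
 \<comment> \<open>The estimate on classes holds only eventually along \<open>F\<close>, so a cell
   may contain points where it fails. The claim for a whole cell is therefore restricted to its good
   points.\<close>
 define good where "good = (%x. ALL s:I. cdist (Simpl n C) (?q (P x s)) (?q (Q x s)) <= ep)"
 have PQc: "P x s:cA (Cb (stop n) C)" "Q x s:cA (Cb (stop n) C)" if "x:K c" "s:I" for x s c using P[of c] Q[of c] that by(auto simp: E.cmap_ntop)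
 have "EX y. y:Fd n & (ALL z:rl (n `` {y}). ALL x:K c. ALL s:I. good x --> cdist C (P x s z) (Q x s z) <= ep + de)" for c
 proof -
  have "\<forall>\<^sub>F z in sfil n. ALL w:K c \<times> I. good (fst w) -->
  cdist C (P (fst w) (snd w) z) (Q (fst w) (snd w) z) <= ep + de"
  proof(rule cpt_ev)
  show "compact (K c \<times> I)" using K(2) I by(rule compact_Times)
  fix w0 assume "w0:K c \<times> I"
  then obtain x0 s0 where w0: "w0 = (x0, s0)" "x0:K c" "s0:I" by blast
  have pos: "0 < de / 8" using de by simp
  obtain V1 where V1: "open V1" "w0:V1" "!!w. w:V1 Int (K c \<times> I)==>cdist (Cb (stop n) C) (case w of (x, s)=>P x s) (case w0 of (x, s)=>P x s) < de / 8"
  using cmap_atin[OF E.pre_cstar_axioms P[of c] _ pos] w0 by blast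
  obtain V2 where V2: "open V2" "w0:V2" "!!w. w:V2 Int (K c \<times> I)==>cdist (Cb (stop n) C) (case w of (x, s)=>Q x s) (case w0 of (x, s)=>Q x s) < de / 8"
  using cmap_atin[OF E.pre_cstar_axioms Q[of c] _ pos] w0 by blast
  define V where "V = V1 Int V2"
  have V: "open V" "w0:V" using V1 V2 by(auto simp: V_def)
  have near: "cdist (Cb (stop n) C) (P x s) (P x0 s0) < de / 8" "cdist (Cb (stop n) C) (Q x s) (Q x0 s0) < de / 8"
  if "(x, s):V" "x:K c" "s:I" for x s using V1(3)[of "(x, s)"] V2(3)[of "(x, s)"] that by(auto simp: V_def w0)
  have "\<forall>\<^sub>F z in sfil n. ALL w:V Int (K c \<times> I). good (fst w) -->
  cdist C (P (fst w) (snd w) z) (Q (fst w) (snd w) z) <= ep + de"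
  proof(cases "EX w:V Int (K c \<times> I). good (fst w)")
  case False
  thus ?thesis by auto
  next
  case True
  \<comment> \<open>The centre \<open>x0\<close> of the neighbourhood need not be good. The estimate
    passes from a good point of \<open>V\<close> to the centre and from there to all of
    \<open>V\<close>; these moves cost less than \<open>de\<close> in total.\<close>
  then obtain x1 s1 where w1: "(x1, s1):V" "x1:K c" "s1:I" "good x1" by auto
  note c0 = PQc[OF w0(2,3)] and c1 = PQc[OF w1(2,3)]
  have "cdist (Simpl n C) (?q (P x0 s0)) (?q (Q x0 s0)) <= cdist (Simpl n C) (?q (P x0 s0)) (?q (P x1 s1)) + cdist (Simpl n C) (?q (P x1 s1)) (?q (Q x0 s0))"
  using c0 c1 by(intro S.cdist_tri) auto
  also have "cdist (Simpl n C) (?q (P x1 s1)) (?q (Q x0 s0))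
  <= cdist (Simpl n C) (?q (P x1 s1)) (?q (Q x1 s1)) + cdist (Simpl n C) (?q (Q x1 s1)) (?q (Q x0 s0))" using c0 c1 by(intro S.cdist_tri) auto
  also have "cdist (Simpl n C) (?q (P x0 s0)) (?q (P x1 s1)) <= de / 8" using Ca_class_mi_le[OF C Fn c0(1) c1(1)] near(1)[OF w1(1-3)] by(simp add: E.cdist_comm)
  also have "cdist (Simpl n C) (?q (Q x1 s1)) (?q (Q x0 s0)) <= de / 8" using Ca_class_mi_le[OF C Fn c1(2) c0(2)] near(2)[OF w1(1-3)] by simp
  also have "cdist (Simpl n C) (?q (P x1 s1)) (?q (Q x1 s1)) <= ep" using w1 by(simp add: good_def)
  finally have "cdist (Simpl n C) (?q (P x0 s0)) (?q (Q x0 s0)) <= ep + de / 4" by simp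
  hence "\<forall>\<^sub>F z in sfil n. cdist C (P x0 s0 z) (Q x0 s0 z) <= ep + de / 4 + de / 4"
  using C.cdist_Ca_le_iff[OF Fn c0, of "ep + de / 4"] ep de by(auto dest!: spec[of _ "de / 4"])
  moreover have "\<forall>\<^sub>F z in sfil n. z:rl (Fd n)" using Fn by(simp add: fspace_def)
  ultimately show ?thesis
  proof eventually_elim
  case (elim z)
  have "cdist C (P x s z) (Q x s z) <= ep + de" if w: "(x, s):V" "x:K c" "s:I" for x s
  proof -
  note c = PQc[OF w(2,3)]
  have m: "P x s z:cA C" "Q x s z:cA C" "P x0 s0 z:cA C" "Q x0 s0 z:cA C" using c c0 elim(2) by simp_all
  have "cdist C (P x s z) (Q x s z) <= cdist C (P x s z) (P x0 s0 z) + cdist C (P x0 s0 z) (Q x s z)" using m by(intro C.cdist_tri)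
  also have "cdist C (P x0 s0 z) (Q x s z) <= cdist C (P x0 s0 z) (Q x0 s0 z) + cdist C (Q x0 s0 z) (Q x s z)" using m by(intro C.cdist_tri)
  also have "cdist C (P x s z) (P x0 s0 z) <= de / 8" using C.cdist_val_le[OF c(1) c0(1), of z] near(1)[OF w] elim(2) by simp
  also have "cdist C (Q x0 s0 z) (Q x s z) <= de / 8" using C.cdist_val_le[OF c(2) c0(2), of z] near(2)[OF w] elim(2) by(simp add: C.cdist_comm[of "Q x0 s0 z"])
  finally show ?thesis using elim(1) de by simp
  qed
  thus ?case by auto
  qed
  qed
  thus "EX V. open V & w0:V & (\<forall>\<^sub>F z in sfil n. ALL w:V Int (K c \<times> I). good (fst w) -->
  cdist C (P (fst w) (snd w) z) (Q (fst w) (snd w) z) <= ep + de)" using V by blast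
  qed
  thus ?thesis by(auto simp: ev_sfil[OF n])
 qed
 then obtain xi where xi: "!!c. xi c:Fd n" and xi': "!!c z x s. [|z:rl (n `` {xi c}); x:K c; s:I; good x|]==>cdist C (P x s z) (Q x s z) <= ep + de" by metis
 show ?thesis unfolding ev_sdp[OF n]
 proof(intro exI[of _ xi] conjI allI xi)
  show "\<forall>\<^sub>F x in F. ALL z:rl (n `` {xi (cell x)}).
  ALL s:I. cdist C (P (fst (x, z)) s (snd (x, z))) (Q (fst (x, z)) s (snd (x, z))) <= ep + de" using le
  proof eventually_elim
  case (elim x)
  hence "good x" "x:K (cell x)" using K(1) by(auto simp: good_def)
  thus ?case using xi' by simp
  qed
 qed
qed

abbreviation scasym::"'g monoid=>('g, 'a) galg=>('g, 'b) galg=>'i rel =>('a=>'i pt=>'b)=>bool" where "scasym G A B m == camor G A B (stop m) (sfil m)"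

lemma casym_asym: "camor G A B X F f==>amor G A B X F f" by(simp add: camor_def)

lemma casym_cont: "camor G A B X F f==>cmap (ntop A) (ntop (Cb X B)) f" by(simp add: camor_def)

lemma casym_bound: "camor G A B X F f==>EX K. ALL a:cA A. cnorm (Cb X B) (f a) <= cnorm A a + K" by(simp add: camor_def)

lemma casym_class_opn: assumes B: "gpre G B" and C: "gpre G C" and F: "fspace X F" and g: "amor G B C X F g" and q: "q:opcs G" and xy: "x:cA B" "y:cA B"
 shows "clA X F C (opn (Cb X C) q (g x) (g y)) = clA X F C (g (opn B q x y))"
 using Mor_opn[OF mor_of_Mor[OF g B C F] q xy] gpre.opn_Ca[OF C F q] amorD(1)[OF g] xy q by(simp add: mor_of_def gpre.opn_closed[OF B])

lemma asym_class_cdist: assumes B: "calg G B" and C: "gpre G C" and F: "fspace X F" and g: "amor G B C X F g" and xy: "x:cA B" "y:cA B"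
 shows "cdist (Ca X F C) (clA X F C (g x)) (clA X F C (g y)) <= cdist B x y"
 using Mor_cdist[OF B gpre.Ca_gpre[OF C F] mor_of_Mor[OF g calg_gpre[OF B] C F] xy] xy by(simp add: mor_of_def)

definition psi::"'x set=>'y set=>('b=>'y=>'c)=>('a=>'x=>'b)=>'a=>'x*'y=>'c" where "psi X Y g f = (%a. \<lambda>w\<in>X \<times> Y. g (f a (fst w)) (snd w))"

definition psi_cyl::"'x set=>'y set=>('b=>'y=>'c)=>('a=>'x=>real=>'b)=>'a=>'x*'y=>real=>'c" where
 "psi_cyl X Y g f = (%a. \<lambda>w\<in>X \<times> Y. \<lambda>t\<in>{0..1}. g (f a (fst w) t) (snd w))"

text \<open>In the quotient by functions vanishing at infinity \<open>g\<close> is an exact and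
  contractive homomorphism, so the error of \<open>f\<close> bounds the error of the classes;
  \<open>as_unifity\<close> turns this into a pointwise estimate along \<open>sdp\<close>. With
  values in paths the lemma also covers homotopies of \<open>f\<close>; constant paths give
  \<open>amor_psi\<close>.\<close>

lemma amor_psi_cyl: fixes PP::"'x::topological_space set set" assumes A: "gpre G A" and B: "calg G B" and C: "gpre G C" and n: "dset n"
  and F: "fspace (wtop PP) F" and f: "amor G A (cyl B) (wtop PP) F f" and g: "scasym G B C n g"
  and K: "!!x. x:\<Union>PP==>x:K (cell x)" "!!c. compact (K c)" "!!c. K c = {} \<or> K c:PP"
 shows "amor G A (cyl C) (wtop (pprod PP (cells (Fd n)))) (sdp F cell n) (psi_cyl (\<Union>PP) (rl (Fd n)) g f)"
proof -
 interpret A: gpre G A by(rule A)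
 interpret B: gpre G B using B by(rule calg_gpre)
 interpret C: gpre G C by(rule C)
 interpret BI: gpre G "cyl B" by(rule B.cyl_gpre)
 interpret CI: gpre G "cyl C" by(rule C.cyl_gpre)
 note Fn = fspace_sx[OF n]
 interpret S: gpre G "Simpl n C" by(rule C.Ca_gpre[OF Fn])
 interpret E: gpre G "Cb (stop n) C" by(rule C.Cb_gpre)
 let ?E = "Cb (stop n) C"
 let ?W = "wtop (pprod PP (cells (Fd n)))"
 have gc: "g b:cA ?E" if "b:cA B" for b using amorD(1)[OF casym_asym[OF g] that] .
 have fc: "f a x:cA (cyl B)" if "a:cA A" "x:\<Union>PP" for a x using amorD(1)[OF f that(1)] that(2) by simp
 have ftc: "f a x t:cA B" if "a:cA A" "x:\<Union>PP" "t:{0..1}" for a x t using fc[OF that(1,2)] that(3) by simp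
 have fcont: "cmap (tos (P \<times> {0..1})) (ntop B) (%(x, t). f a x t)" if "P:PP" "a:cA A" for P a
 proof(rule uncurry_cont[OF B.gpre_axioms])
  show "cmap (tos P) (ntop (Cb (tos {0..1}) B)) (f a)" using amorD(1)[OF f that(2)] that(1) by(simp add: cA_Cb cmap_wtop cyl_def)
 qed simp
 have gfcont: "cmap (tos (P \<times> {0..1})) (ntop ?E) (%(x, t). g (f a x t))" if "P:PP" "a:cA A" for P a
  using continuous_map_compose[OF fcont[OF that] casym_cont[OF g]] by(simp add: o_def case_prod_unfold)
 have gfcontK: "cmap (tos (K c \<times> {0..1})) (ntop ?E) (%(x, t). g (f a x t))" if "a:cA A" for c a using K(3)[of c] gfcont[OF _ that] by auto
 obtain M where M: "!!b. b:cA B==>cnorm ?E (g b) <= cnorm B b + M" using casym_bound[OF g] by blast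
 let ?Ps = "psi_cyl (\<Union>PP) (rl (Fd n)) g f"
 have val: "?Ps a (x, z) t = g (f a x t) z" if "x:\<Union>PP" "z:rl (Fd n)" "t:{0..1}" for a x z t using that by(auto simp: psi_cyl_def)
 have cm: "?Ps a:cA (Cb ?W (cyl C))" if a: "a:cA A" for a
 proof -
  have "cmap ?W (ntop (cyl C)) (%w. \<lambda>t\<in>{0..1}. g (f a (fst w) t) (snd w))" unfolding cmap_wtop
  proof
  fix R assume "R:pprod PP (cells (Fd n))"
  then obtain P Q where R: "P:PP" "Q:cells (Fd n)" "R = P \<times> Q" by(auto simp: pprod_def)
  have "cmap (tos ((P \<times> {0..1}) \<times> Q)) (ntop C) (%(v, z). (%(x, t). g (f a x t)) v z)" using R(2) by(intro uncurry_cont[OF C gfcont[OF R(1) a]])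
  (simp add: rtop_weak cont_map_top_of_set_piece)
  moreover have "cmap (tos (R \<times> {0..1})) (tos ((P \<times> {0..1}) \<times> Q))
  (%w. ((fst (fst w), snd w), snd (fst w)))" by(auto simp: continuous_map_in_subtopology R(3)
  intro!: cont_prod)
  ultimately have "cmap (tos (R \<times> {0..1})) (ntop C)
  ((%(v, z). (%(x, t). g (f a x t)) v z) o (%w. ((fst (fst w), snd w), snd (fst w))))" by(intro continuous_map_compose)
  hence "cmap (tos (R \<times> {0..1})) (ntop C) (%w. g (f a (fst (fst w)) (snd w)) (snd (fst w)))" by(simp add: o_def)
  from curry_cont[OF C this]
  show "cmap (tos R) (ntop (cyl C)) (%w. \<lambda>t\<in>{0..1}. g (f a (fst w) t) (snd w))" by simp
  qed
  moreover have "cnorm (cyl C) (\<lambda>t\<in>{0..1}. g (f a x t) z) <= max 0 (cnorm (Cb (wtop PP) (cyl B)) (f a) + M)"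
  if x: "x:\<Union>PP" and z: "z:rl (Fd n)" for x z
  proof(rule C.norm_cyl_leI)
  fix t::real assume t: "t:{0..1}"
  have "cnorm C (g (f a x t) z) <= cnorm ?E (g (f a x t))" using gc[OF ftc[OF a x t]] z by(intro C.nval_le) auto
  also have "\<dots> <= cnorm B (f a x t) + M" by(rule M[OF ftc[OF a x t]])
  also have "cnorm B (f a x t) <= cnorm (cyl B) (f a x)" by(rule B.norm_cyl_val[OF fc[OF a x] t])
  also have "cnorm (cyl B) (f a x) <= cnorm (Cb (wtop PP) (cyl B)) (f a)" using amorD(1)[OF f a] x by(intro BI.nval_le) auto
  finally show "cnorm C ((\<lambda>t\<in>{0..1}. g (f a x t) z) t) <= max 0 (cnorm (Cb (wtop PP) (cyl B)) (f a) + M)" using t by simp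
  qed simp
  ultimately show ?thesis by(auto simp: cA_Cb psi_cyl_def)
 qed
 show ?thesis unfolding amor_def
 proof(intro conjI ballI cm)
  fix q a b assume q: "q:opcs G" and ab: "a:cA A" "b:cA A"
  have ab': "opn A q a b:cA A" using q ab by simp
  let ?P = "%x t. g (f (opn A q a b) x t)" and ?Q = "%x t. opn ?E q (g (f a x t)) (g (f b x t))"
  have Pc: "cmap (tos (K c \<times> {0..1})) (ntop ?E) (%(x, t). ?P x t)" for c by(rule gfcontK[OF ab'])
  have Qc: "cmap (tos (K c \<times> {0..1})) (ntop ?E) (%(x, t). ?Q x t)" for c
  using E.cont_map_opn[OF q gfcontK[OF ab(1), of c] gfcontK[OF ab(2), of c]] by(simp add: case_prod_unfold)
  show "aeq (sdp F cell n) (cyl C) (?Ps (opn A q a b)) (%w. opn (cyl C) q (?Ps a w) (?Ps b w))"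
  proof(rule CI.aeqI)
  fix ep::real assume ep: "0 < ep"
  have "\<forall>\<^sub>F x in F. x:\<Union>PP & (ALL t:{0..1}. cdist (Simpl n C) (Simpl_class n C (?P x t)) (Simpl_class n C (?Q x t)) <= ep / 2)"
  using BI.aeqD[OF amorD(2)[OF f q ab] half_gt_zero[OF ep]] F[unfolded fspace_def tsp_wtop]
  proof eventually_elim
  case (elim x)
  have "cdist (Simpl n C) (Simpl_class n C (?P x t)) (Simpl_class n C (?Q x t)) <= ep / 2" if t: "t:{0..1}" for t
  proof -
  note m = ftc[OF ab(1) elim(2) t] ftc[OF ab(2) elim(2) t]
  have "cdist (Simpl n C) (Simpl_class n C (?P x t)) (Simpl_class n C (?Q x t))
  <= cdist B (f (opn A q a b) x t) (opn B q (f a x t) (f b x t))" unfolding casym_class_opn[OF B.gpre_axioms C Fn casym_asym[OF g] q m]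
  using m q ftc[OF ab' elim(2) t] by(intro asym_class_cdist[OF B C Fn casym_asym[OF g]]) auto
  also have "\<dots> = cdist B (f (opn A q a b) x t) (opn (cyl B) q (f a x) (f b x) t)" using t by(simp add: B.opn_cyl)
  also have "\<dots> <= cdist (cyl B) (f (opn A q a b) x) (opn (cyl B) q (f a x) (f b x))"
  using fc[OF ab(1) elim(2)] fc[OF ab(2) elim(2)] fc[OF ab' elim(2)] q t by(intro B.cdist_cyl_val) auto
  finally show ?thesis using elim(1) by simp
  qed
  thus ?case using elim(2) by blast
  qed
  note le = this
  have "\<forall>\<^sub>F w in sdp F cell n. ALL t:{0..1}. cdist C (?P (fst w) t (snd w)) (?Q (fst w) t (snd w)) <= ep / 2 + ep / 2"
  by(rule as_unifity[where K = K and X = "\<Union>PP" and P = ?P and Q = ?Q]) (use C n K Pc Qc le ep in "simp_all del: Union_iff")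
  thus "\<forall>\<^sub>F w in sdp F cell n. cdist (cyl C) (?Ps (opn A q a b) w) (opn (cyl C) q (?Ps a w) (?Ps b w)) <= ep"
  using sdp_fspace[OF n F, of cell, unfolded fspace_def tsp_wtop Union_pprod Union_cells]
  proof eventually_elim
  case (elim w)
  obtain x z where w: "w = (x, z)" "x:\<Union>PP" "z:rl (Fd n)" using elim(2) by auto
  have m: "?Ps a w:cA (cyl C)" if "a:cA A" for a using CI.Cb_val[OF cm[OF that], of w] elim(2) by simp
  have "cdist C (?Ps (opn A q a b) w t) (opn C q (?Ps a w t) (?Ps b w t)) <= ep" if t: "t:{0..1}" for t using elim(1) t w by(simp add: val opn_Cb)
  moreover have "opn (cyl C) q u v t = opn C q (u t) (v t)" if "t:{0..1}" for u v and t::real using that by(simp add: C.opn_cyl)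
  ultimately show ?case using m[OF ab(1)] m[OF ab(2)] m[OF ab'] q ep by(subst C.cdist_cyl_le_iff) auto
  qed
  qed
 qed
qed

lemma amor_psi: fixes PP::"'x::topological_space set set" assumes A: "gpre G A" and B: "calg G B" and C: "gpre G C" and n: "dset n"
  and F: "fspace (wtop PP) F" and f: "amor G A B (wtop PP) F f" and g: "scasym G B C n g"
  and K: "!!x. x:\<Union>PP==>x:K (cell x)" "!!c. compact (K c)" "!!c. K c = {} \<or> K c:PP" shows "amor G A C (wtop (pprod PP (cells (Fd n)))) (sdp F cell n)
  (psi (\<Union>PP) (rl (Fd n)) g f)"
proof -
 note Bg = calg_gpre[OF B]
 let ?W = "wtop (pprod PP (cells (Fd n)))"
 let ?f = "%a. \<lambda>x\<in>tsp (wtop PP). \<lambda>t\<in>{0..1::real}. f a x"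
 have f': "amor G A (cyl B) (wtop PP) F ?f" by(rule amor_alg_map[OF Bg gpre.cyl_gpre[OF Bg] alg_map_const[OF Bg] F A f])
 have "amor G A (cyl C) ?W (sdp F cell n) (psi_cyl (\<Union>PP) (rl (Fd n)) g ?f)" by(rule amor_psi_cyl[OF A B C n F f' g, where K = K]) (fact K)+
 from amor_alg_map[OF gpre.cyl_gpre[OF C] C alg_map_val[OF C, of 0] sdp_fspace[OF n F] A this]
 have "amor G A C ?W (sdp F cell n) (%a. \<lambda>w\<in>tsp ?W. psi_cyl (\<Union>PP) (rl (Fd n)) g ?f a w 0)" by simp
 moreover have "(%a. \<lambda>w\<in>tsp ?W. psi_cyl (\<Union>PP) (rl (Fd n)) g ?f a w 0)
  = psi (\<Union>PP) (rl (Fd n)) g f" unfolding psi_def psi_cyl_def by(intro ext) (auto simp: restrict_def)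
 ultimately show ?thesis by simp
qed

section \<open>Extension over skeleta\<close>

text \<open>Recursion over the number of vertices. \<open>L\<close> is a subcomplex on which the map
  is prescribed, and \<open>Good\<close> is a property of the restriction to one simplex, so that
  extensions over different simplices do not interfere.\<close>

lemma skeleton_ext: fixes Good::"'v set=>('v pt=>'z)=>bool" assumes cong: "!!sg I J. [|!!x. x:rl sg==>J x = I x; Good sg I|]==>Good sg J"
  and L: "!!sg ta. [|sg:L; ta:spx sg|]==>ta:L" and base: "!!sg. sg:L==>Good sg I0"
  and step: "!!sg I. [|sg:spx V; sg ~: L; !!ta. [|ta:spx sg; ta ~= sg|]==>Good ta I|] ==>EX J. (ALL x:bdry sg. J x = I x) & Good sg J"
 obtains I where "!!sg x. [|sg:L; x:rl sg|]==>I x = I0 x" "!!sg. sg:spx V==>Good sg I"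
proof -
 define E where "E sg I = (SOME J. (ALL x:bdry sg. J x = I x) & Good sg J)" for sg I
 \<comment> \<open>Step \<open>n\<close> fills the interiors of the simplices with
   \<open>Suc n\<close> vertices outside \<open>L\<close>. The value at a point is thus final once
   its support has at most \<open>n\<close> vertices, as \<open>late\<close> records.\<close>
 define S where "S = rec_nat I0 (%n I x. if card (supp x) = Suc n & supp x ~: L then E (supp x) I x else I x)"
 have S_Suc: "S (Suc n) x = (if card (supp x) = Suc n & supp x ~: L then E (supp x) (S n) x else S n x)" for n x by(simp add: S_def)
 define I where "I x = S (card (supp x)) x" for x
 have late: "S n x = I x" if "card (supp x) <= n" for n x using that by(induction n rule: dec_induct) (simp_all add: S_Suc I_def)
 have "S n x = I0 x" if "supp x:L" for n x using that by(induction n) (simp_all add: S_Suc, simp add: S_def)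
 hence LI: "I x = I0 x" if "sg:L" "x:rl sg" for sg x using L[OF that(1) supp_spx[OF that(2)]] by(simp add: I_def)
 have "Good sg I" if "sg:spx V" for sg using that
 proof(induction "card sg" arbitrary: sg rule: less_induct)
  case less
  have fin: "finite sg" "sg ~= {}" using less.prems by(auto simp: sx_def)
  then obtain n where n: "card sg = Suc n" by(metis card_0_eq not0_implies_Suc)
  show ?case
  proof(cases "sg:L")
  case True
  show ?thesis by(rule cong[OF LI[OF True] base[OF True]])
  next
  case False
  have small: "card ta <= n" if "ta:spx sg" "ta ~= sg" for ta
  proof -
  have "card ta < card sg" using that fin(1) by(intro psubset_card_mono) (auto simp: sx_def)
  thus ?thesis using n by simp
  qed
  have G: "Good ta (S n)" if ta: "ta:spx sg" "ta ~= sg" for ta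
  proof(rule cong)
  show "Good ta I"
  proof(rule less.hyps)
  show "card ta < card sg" using small[OF ta] n by simp
  have "sg <= V" using less.prems by(simp add: sx_def)
  thus "ta:spx V" by(rule subsetD[OF spx_mono ta(1)])
  qed
  show "S n x = I x" if "x:rl ta" for x
  proof(rule late)
  have "card (supp x) <= card ta" using ta(1) supp_sub[OF that] by(intro card_mono) (auto simp: sx_def)
  thus "card (supp x) <= n" using small[OF ta] by simp
  qed
  qed
  have E: "(ALL x:bdry sg. E sg (S n) x = S n x) & Good sg (E sg (S n))" using someI_ex[OF step[OF less.prems False G]] unfolding E_def .
  show ?thesis
  proof(rule cong[OF _ conjunct2[OF E]])
  fix x assume x: "x:rl sg"
  show "I x = E sg (S n) x"
  proof(cases "supp x = sg")
  case True
  thus ?thesis using n False by(simp add: I_def S_Suc)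
  next
  case ne: False
  hence "x:bdry sg" using supp_spx[OF x] rl_supp[OF x] unfolding boundary_def by blast
  with E have "E sg (S n) x = S n x" by blast
  with late[OF small[OF supp_spx[OF x] ne]] show ?thesis by simp
  qed
  qed
  qed
 qed
 with LI show thesis by(rule that)
qed

lemma bdry_sub: "bdry sg <= rl sg"
proof
 fix x assume "x:bdry sg"
 then obtain ta where "ta:spx sg" "x:rl ta" unfolding boundary_def by blast
 thus "x:rl sg" using rl_mono[of ta sg] by(auto simp: sx_def)
qed

lemma bdry_iff: assumes "finite sg" shows "x:bdry sg <-> x:rl sg & (EX v:sg. x v = 0)"
proof
 assume "x:bdry sg"
 then obtain ta where ta: "ta:spx sg" "ta ~= sg" "x:rl ta" unfolding boundary_def by blast
 then obtain v where "v:sg" "v ~: supp x" using supp_sub[of x ta] by(auto simp: sx_def)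
 thus "x:rl sg & (EX v:sg. x v = 0)" using \<open>x:bdry sg\<close> bdry_sub by(auto simp: supp_def)
next
 assume *: "x:rl sg & (EX v:sg. x v = 0)"
 hence "supp x ~= sg" by(auto simp: supp_def)
 thus "x:bdry sg" using * supp_spx[of x sg] rl_supp[of x sg] unfolding boundary_def by blast
qed

lemma fin_spx: "finite sg==>finite (spx sg)" by(rule finite_subset[of _ "Pow sg"]) (auto simp: sx_def)

lemma closed_bdry: "finite sg==>closed (bdry sg)" unfolding boundary_def by(intro closed_UN ballI closed_rl) (auto simp: fin_spx dest: spxD)

lemma cont_on_bdry: assumes "finite sg" "!!ta. [|ta:spx sg; ta ~= sg|]==>con_on (rl ta) f" shows "con_on (bdry sg) f" unfolding boundary_def using assms
 by(intro continuous_on_closed_Union closed_rl) (auto simp: fin_spx dest: spxD)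

lemma bdry_nonempty: assumes "finite sg" "2 <= card sg" shows "bdry sg ~= {}"
proof -
 obtain v where v: "v:sg" using assms(2) by fastforce
 hence "{v} ~= sg" using assms(2) by auto
 with v have "vertex v:bdry sg" unfolding boundary_def by(auto simp: sx_def intro!: exI[of _ "{v}"])
 thus ?thesis by blast
qed

lemma cont_on_Min: fixes f::"'v=>'x::topological_space=>real" assumes "finite sg" "sg ~= {}" "!!v. v:sg==>con_on S (f v)"
 shows "con_on S (%x. MIN v\<in>sg. f v x)" using assms by(induction sg rule: finite_ne_induct) (auto intro: continuous_on_min)

text \<open>
 For \<open>s <= 1/2\<close> the first component is the projection from the barycenter to the boundary, where \<open>s\<close>
 is the weight of the barycenter in \<open>x\<close>.
\<close>

lemma cone_map: assumes fin: "finite sg" and ne: "sg ~= {}"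
 obtains h where "con_on (rl sg) h" "h:rl sg \<rightarrow> rl sg \<times> {1} Un bdry sg \<times> {0..1::real}" "!!x. x:bdry sg==>h x = (x, 0)"
proof -
 define N where "N = real (card sg)"
 have N: "N > 0" using fin ne by(simp add: N_def card_gt_0_iff)
 define M where "M x = (MIN v\<in>sg. x v)" for x::"'a=>real"
 \<comment> \<open>The cap keeps the denominator \<open>1 - s x\<close> of \<open>r\<close> away
   from 0, and it is where the time \<open>2 * s x\<close> reaches 1.\<close>
 define s where "s x = min (1/2) (N * M x)" for x
 define r where "r x = (%v. (x v - (if v:sg then s x / N else 0)) / (1 - s x))" for x
 have cs: "con_on (rl sg) s" unfolding s_def M_def by(intro continuous_intros cont_on_Min fin ne cont_on_fun_apply)
 have s12: "s x <= 1/2" for x by(simp add: s_def)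
 have cr: "con_on (rl sg) r" unfolding r_def
 proof(rule continuous_on_coordinatewise_then_product)
  fix v
  have c: "con_on (rl sg) (%x. if v:sg then s x / N else 0)" using N by(cases "v:sg") (auto intro!: continuous_intros cs)
  show "con_on (rl sg) (%x. (x v - (if v:sg then s x / N else 0)) / (1 - s x))"
  by(intro continuous_on_divide continuous_on_diff cont_on_fun_apply c continuous_on_const cs ballI)
  (use s12 in "simp add: order.strict_iff_order, smt (verit) s12")
 qed
 have M: "M x <= x v" if "v:sg" for x v using that fin by(simp add: M_def)
 have Mex: "EX v:sg. M x = x v" for x
 proof -
  have "M x:x ` sg" unfolding M_def using fin ne by(intro Min_in) auto
  thus ?thesis by auto
 qed
 have x0: "0 <= x v" "x v = 0 \<or> v:sg" "sum x sg = 1" if "x:rl sg" for x v using that fin by(auto simp: rl_fin supp_def)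
 have s0: "0 <= s x" if "x:rl sg" for x using Mex[of x] x0(1)[OF that] N by(auto simp: s_def)
 have rr: "r x:rl sg" if x: "x:rl sg" for x
 proof -
  have "s x / N <= x v" if "v:sg" for v using M[OF that, of x] N by(simp add: s_def min_def field_simps) (smt (verit) mult_left_mono)
  hence "0 <= r x v" for v using x0(1,2)[OF x, of v] s12[of x] by(auto simp: r_def)
  moreover have "sum (r x) sg = 1" using N s12[of x] x0(3)[OF x] by(simp add: r_def sum_divide_distrib[symmetric] sum_subtractf N_def)
  moreover have "supp (r x) <= sg" using x0(2)[OF x] by(auto simp: supp_def r_def)
  ultimately show ?thesis by(simp add: rl_fin[OF fin])
 qed
 \<comment> \<open>Below the cap the whole barycentric part is removed, so the least coordinate of
   \<open>x\<close> becomes 0.\<close>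
 have rb: "r x:bdry sg" if x: "x:rl sg" and s: "s x ~= 1/2" for x
 proof -
  have "s x = N * M x" using s by(auto simp: s_def min_def split: if_splits)
  hence "EX v:sg. r x v = 0" using Mex[of x] N by(auto simp: r_def)
  thus ?thesis using rr[OF x] by(simp add: bdry_iff[OF fin])
 qed
 show thesis
 proof(rule that[of "%x. (r x, 2 * s x)"])
  show "con_on (rl sg) (%x. (r x, 2 * s x))" by(intro continuous_on_Pair cr continuous_on_mult_left cs)
  show "(%x. (r x, 2 * s x)):rl sg \<rightarrow> rl sg \<times> {1} Un bdry sg \<times> {0..1}"
  proof
  fix x assume x: "x:rl sg"
  show "(r x, 2 * s x):rl sg \<times> {1} Un bdry sg \<times> {0..1}" using rr[OF x] rb[OF x] s0[OF x] s12[of x] by(cases "s x = 1/2") auto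
  qed
  show "(r x, 2 * s x) = (x, 0)" if "x:bdry sg" for x
  proof -
  obtain v where x: "x:rl sg" "v:sg" "x v = 0" using \<open>x:bdry sg\<close> bdry_iff[OF fin] by blast
  hence "N * M x <= 0" using M[OF x(2), of x] N by(simp add: mult_le_0_iff)
  hence "s x <= 0" by(simp add: s_def)
  hence "s x = 0" using s0[OF x(1)] by simp
  thus ?thesis by(auto simp: r_def fun_eq_iff)
  qed
 qed
qed

text \<open>The simplex is the union of two closed sets: the points sent to the cylinder over the
  boundary, where \<open>I\<close> is continuous, and the points sent to time 1, where
  \<open>e\<close> no longer depends on the value of \<open>I\<close>.\<close>

lemma cone_ext_cont: assumes fin: "finite sg" and h: "con_on (rl sg) h" "h:rl sg \<rightarrow> rl sg \<times> {1} Un bdry sg \<times> {0..1::real}"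
  and I: "con_on (bdry sg) I" "I ` bdry sg <= P" and e: "con_on ((bdry sg \<times> P) \<times> {0..1}) (%w. e (fst (fst w)) (snd (fst w)) (snd w))"
  "!!y p. e y p 1 = e1 y" "con_on (rl sg) e1" shows "con_on (rl sg) (%x. e (fst (h x)) (I (fst (h x))) (snd (h x)))"
proof -
 let ?S = "rl sg Int h -` (bdry sg \<times> {0..1})" and ?T = "rl sg Int h -` (rl sg \<times> {1})"
 note cl = closed_rl[OF fin]
 have c: "closed ?S" "closed ?T" by(intro continuous_closed_preimage[OF h(1) cl] closed_Times closed_bdry[OF fin] cl; simp)+
 have hS: "con_on ?S (%x. fst (h x))" "con_on ?S (%x. snd (h x))" by(intro continuous_on_fst continuous_on_snd continuous_on_subset[OF h(1)]; blast)+
 have 0: "con_on ?S (%x. ((fst (h x), I (fst (h x))), snd (h x)))" by(intro continuous_on_Pair hS continuous_on_compose2[OF I(1) hS(1)]) auto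
 have 1: "con_on ?S (%x. e (fst (h x)) (I (fst (h x))) (snd (h x)))" using continuous_on_compose2[OF e(1) 0] I(2) by fastforce
 have "con_on ?T (%x. e1 (fst (h x)))" by(rule continuous_on_compose2[OF e(3)]) (auto intro!: continuous_on_fst continuous_on_subset[OF h(1)])
 hence 2: "con_on ?T (%x. e (fst (h x)) (I (fst (h x))) (snd (h x)))" by(rule continuous_on_eq) (auto simp: e(2))
 have eq: "rl sg = ?S Un ?T" using h(2) by auto
 show ?thesis by(subst eq) (rule continuous_on_closed_Un[OF c 1 2])
qed

section \<open>Homotopies by carriers\<close>

text \<open>The boundary of a simplex is a finite union of faces; directedness puts their images
  into one common piece.\<close>

definition up_directed::"'z set set=>bool" where "up_directed PP <-> PP ~= {} & (ALL P:PP. ALL Q:PP. EX R:PP. P Un Q <= R)"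

lemma up_dset_fin: assumes "up_directed PP" "finite TT" "!!ta. ta:TT==>EX P:PP. f ta <= P" shows "EX P:PP. \<Union>(f ` TT) <= P" using assms(2,3)
proof(induction TT rule: finite_induct)
 case empty
 thus ?case using assms(1) by(auto simp: up_directed_def)
next
 case (insert ta TT)
 have "EX P:PP. \<Union>(f ` TT) <= P" by(intro insert.IH) (simp add: insert.prems)
 then obtain P Q where "P:PP" "Q:PP" "\<Union>(f ` TT) <= P" "f ta <= Q" using insert.prems[of ta] by blast
 then obtain R where "R:PP" "P Un Q <= R" using assms(1) unfolding up_directed_def by blast
 with \<open>\<Union>(f ` TT) <= P\<close> \<open>f ta <= Q\<close> show ?case by(intro bexI[of _ R]) auto
qed

text \<open>The contraction may leave the piece \<open>P\<close> for a larger one, but not the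
  carrier \<open>K\<close>.\<close>

definition contracts::"('z::topological_space=>real=>'z)=>'z set=>'z set=>'z set=>'z=>bool" where
 "contracts c P K P' z0 <-> con_on ((P Int K) \<times> {0..1}) (%w. c (fst w) (snd w)) &
  (ALL z:P Int K. c z 0 = z & c z 1 = z0 & (ALL t:{0..1}. c z t:P' Int K))"

text \<open>The acyclic carrier argument. A homotopy is obtained from a map on the full simplex with
  vertex set \<open>V \<times> UNIV\<close>, two copies of \<open>V\<close>: the given maps
  prescribe it on the simplices inside one copy, and contractibility of the carriers extends it over
  all others.\<close>

lemma cA_htpy: fixes Th0 Th1::"'v pt=>'z::topological_space" assumes up: "up_directed PP" and Th: "pmap (cells V) PP Th0" "pmap (cells V) PP Th1"
  "!!sg. sg:spx V==>Th0 ` rl sg <= K sg" "!!sg. sg:spx V==>Th1 ` rl sg <= K sg" and mono: "!!ta sg. ta <= sg==>K ta <= K sg"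
  and contr: "!!sg P. [|sg:spx V; P:PP|]==>EX P':PP. EX c z0. contracts c P (K sg) P' z0"
 obtains H::"'v pt \<times> real=>'z" where "pmap ((%P. P \<times> {0..1}) ` cells V) PP H" "!!p. p:rl V==>H (p, 0) = Th0 p" "!!p. p:rl V==>H (p, 1) = Th1 p"
  "!!sg p t. [|sg:spx V; p:rl sg; t:{0..1}|]==>H (p, t):K sg"
proof -
 define Good where "Good sg I <-> con_on (rl sg) I & I ` rl sg <= K (fst ` sg) &
  (EX P:PP. I ` rl sg <= P)" for sg::"('v \<times> bool) set" and I::"('v \<times> bool=>real)=>'z"
 define Th where "Th s = (if s then Th1 else Th0)" for s
 define L where "L = (UN s::bool. spx (V \<times> {s}))"
 \<comment> \<open>On a simplex inside one copy of \<open>V\<close> all vertices carry the same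
   flag, so the quantifier merely reads it off; elsewhere the value is a placeholder that the
   extension overwrites.\<close>
 define I0 where "I0 z = Th (EX v:supp z. snd v) (aff fst z)" for z
 have Th': "pmap (cells V) PP (Th s)" "!!sg. sg:spx V==>Th s ` rl sg <= K sg" for s using Th by(auto simp: Th_def)
 have I0: "I0 z = Th s (aff fst z)" if "z:rl sg" "sg <= V \<times> {s}" for z s sg
 proof -
  have "(EX v:supp z. snd v) = s"
  proof -
  have "ALL v:supp z. snd v = s" using that(2) supp_sub[OF that(1)] by auto
  thus ?thesis using supp_nonempty[OF that(1)] by blast
  qed
  thus ?thesis by(simp add: I0_def)
 qed
 have cong: "Good sg J" if "!!x. x:rl sg==>J x = I x" "Good sg I" for sg::"('v \<times> bool) set" and I J
 proof -
  have "J ` rl sg = I ` rl sg" using that(1) by auto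
  thus ?thesis using that unfolding Good_def by(simp cong: continuous_on_cong)
 qed
 have base: "Good sg I0" if sg: "sg:L" for sg::"('v \<times> bool) set"
 proof -
  obtain s where s: "sg:spx (V \<times> {s})" using sg by(auto simp: L_def)
  hence s': "sg <= V \<times> {s}" "finite sg" and f: "fst ` sg:spx V" by(auto simp: sx_def)
  have aff: "aff fst z:rl (fst ` sg)" if "z:rl sg" for z using that by(intro aff_rl) (auto dest: supp_sub)
  obtain P where P: "P:PP" "Th s ` rl (fst ` sg) <= P" "con_on (rl (fst ` sg)) (Th s)" using pmapD[OF Th'(1), of "rl (fst ` sg)"] f by(auto simp: cells_def)
  have G: "Good sg (%z. Th s (aff fst z))" unfolding Good_def
  using continuous_on_compose2[OF P(3) cont_on_aff[OF s'(2)]] aff Th'(2)[OF f, of s] P by(auto intro!: bexI[of _ P])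
  show ?thesis by(rule cong[OF I0[OF _ s'(1)] G])
 qed
 have Lcl: "ta:L" if "sg:L" "ta:spx sg" for sg ta
 proof -
  obtain s where "sg:spx (V \<times> {s})" using \<open>sg:L\<close> by(auto simp: L_def)
  hence "ta:spx (V \<times> {s})" using that(2) by(auto simp: sx_def)
  thus ?thesis by(auto simp: L_def)
 qed
 have step: "EX J. (ALL x:bdry sg. J x = I x) & Good sg J"
  if sg: "sg:spx (V \<times> UNIV)" "sg ~: L" and I: "!!ta. [|ta:spx sg; ta ~= sg|]==>Good ta I" for sg I
 proof -
  have fin: "finite sg" "sg ~= {}" and f: "fst ` sg:spx V" using sg(1) by(auto simp: sx_def)
  have "2 <= card sg"
  proof(rule ccontr)
  assume "~ 2 <= card sg"
  hence "card sg = 1" using fin by(metis card_0_eq less_2_cases not_le One_nat_def)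
  then obtain v where "sg = {v}" by(rule card_1_singletonE)
  thus False using sg by(auto simp: L_def sx_def)
  qed
  note bne = bdry_nonempty[OF fin(1) this]
  have Ib: "con_on (bdry sg) I" by(rule cont_on_bdry[OF fin(1)]) (use I in "auto simp: Good_def")
  have IK: "I x:K (fst ` sg)" if "x:bdry sg" for x
  proof -
  obtain ta where ta: "ta:spx sg" "ta ~= sg" "x:rl ta" using \<open>x:bdry sg\<close> by(auto simp: boundary_def)
  thus ?thesis using I[OF ta(1,2)] mono[of "fst ` ta" "fst ` sg"] by(force simp: Good_def sx_def)
  qed
  have "EX P:PP. \<Union>((%ta. I ` rl ta) ` {ta:spx sg. ta ~= sg}) <= P" by(rule up_dset_fin[OF up]) (use I fin_spx[OF fin(1)] in "auto simp: Good_def")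
  then obtain P where P: "P:PP" "I ` bdry sg <= P" unfolding boundary_def image_UN by blast
  obtain P' c z0 where c: "P':PP" "contracts c P (K (fst ` sg)) P' z0" using contr[OF f P(1)] by blast
  \<comment> \<open>\<open>cone_ext_cont\<close> requires a value at time 1 independent of
    \<open>p\<close> for every \<open>p\<close>, whereas \<open>c\<close> is under control on the
    carrier only.\<close>
  define e where "e t p = (if t = 1 then z0 else c p t)" for t p
  have e: "e t p = c p t" if "p:P Int K (fst ` sg)" for t p using c(2) that by(auto simp: contracts_def e_def)
  obtain h where h: "con_on (rl sg) h"
  "h:rl sg \<rightarrow> rl sg \<times> {1} Un bdry sg \<times> {0..1::real}" "!!x. x:bdry sg==>h x = (x, 0)" using cone_map[OF fin] by blast
  define J where "J x = e (snd (h x)) (I (fst (h x)))" for x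
  have z0: "z0:P' Int K (fst ` sg)"
  proof -
  obtain x where "x:bdry sg" using bne by blast
  hence "I x:P Int K (fst ` sg)" using IK P by blast
  thus ?thesis using c(2) unfolding contracts_def by(metis atLeastAtMost_iff order_refl zero_le_one)
  qed
  have "J x:P' Int K (fst ` sg)" if "x:rl sg" for x
  proof(cases "snd (h x) = 1")
  case True
  thus ?thesis using z0 by(simp add: J_def e_def)
  next
  case False
  hence "fst (h x):bdry sg" "snd (h x):{0..1}" using funcset_mem[OF h(2) that] by(auto simp: mem_Times_iff)
  thus ?thesis using c(2) IK P unfolding J_def contracts_def by(auto simp: e image_subset_iff)
  qed
  moreover have "con_on (rl sg) J" unfolding J_def
  proof(rule cone_ext_cont[where e = "%y p t. e t p" and ?e1.0 = "%_. z0" and P = "P Int K (fst ` sg)",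
  OF fin(1) h(1,2) Ib])
  have ec: "con_on ((P Int K (fst ` sg)) \<times> {0..1}) (%w. e (snd w) (fst w))"
  using c(2)[unfolded contracts_def, THEN conjunct1] by(rule continuous_on_eq) (auto simp: e)
  have "con_on ((bdry sg \<times> (P Int K (fst ` sg))) \<times> {0..1}) (%w. (snd (fst w), snd w))" by(intro cont_prod)
  from continuous_on_compose2[OF ec this]
  show "con_on ((bdry sg \<times> (P Int K (fst ` sg))) \<times> {0..1}) (%w. e (snd w) (snd (fst w)))" by fastforce
  qed (use IK P in "auto simp: e_def")
  moreover have "J x = I x" if x: "x:bdry sg" for x using h(3)[OF x] c(2) IK[OF x] P x by(auto simp: J_def e contracts_def)
  ultimately show ?thesis using c(1) unfolding Good_def by(intro exI[of _ J]) auto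
 qed
 obtain I where I: "!!sg x. [|sg:L; x:rl sg|]==>I x = I0 x" "!!sg. sg:spx (V \<times> UNIV)==>Good sg I"
 proof(rule skeleton_ext[of Good L I0 "V \<times> UNIV"])
  show "Good sg J" if "!!x. x:rl sg==>J x = I x" "Good sg I" for sg I J by(rule cong[OF that])
 qed ((rule Lcl base step; assumption) | blast)+
 \<comment> \<open>Time \<open>t\<close> is the point at parameter \<open>t\<close> of the segment
   joining the two copies of \<open>p\<close>; this lies in the simplex on both copies of the
   support of \<open>p\<close>.\<close>
 define j where "j s = aff (%v::'v. (v, s::bool))" for s
 define H where "H = (%(p, t). I (segment t (j False p) (j True p)))"
 have jr: "j s p:rl (sg \<times> {s})" if "p:rl sg" for s p sg unfolding j_def using that by(intro aff_rl) (auto dest: supp_sub)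
 have jend: "I (j s p) = Th s p" if p: "p:rl V" for s p
 proof -
  have m: "j s p:rl (supp p \<times> {s})" by(rule jr[OF rl_supp[OF p]])
  have sub: "supp p \<times> {s} <= V \<times> {s}" using supp_sub[OF p] by blast
  have "I (j s p) = I0 (j s p)" using supp_spx[OF p] by(intro I(1)[OF _ m]) (auto simp: L_def sx_def)
  also have "\<dots> = Th s (aff fst (j s p))" by(rule I0[OF m sub])
  also have "aff fst (j s p) = p" unfolding j_def aff_comp[OF p] by(simp add: o_def)
  finally show ?thesis .
 qed
 have seg: "segment t (j False p) (j True p):rl (sg \<times> UNIV)" if "p:rl sg" "t:{0..1}" for p t sg
  using that(2) by(intro rl_seg subsetD[OF rl_mono jr[OF that(1)]]) auto
 have G: "Good (sg \<times> UNIV) I" if "sg:spx V" for sg using that by(intro I(2)) (auto simp: sx_def)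
 show thesis
 proof(rule that[of H])
  show "H (p, 0) = Th0 p" "H (p, 1) = Th1 p" if "p:rl V" for p using jend[OF that, of False] jend[OF that, of True] by(simp_all add: H_def Th_def)
  show "H (p, t):K sg" if "sg:spx V" "p:rl sg" "t:{0..1}" for sg p t using G[OF that(1)] seg[OF that(2,3)] by(force simp: Good_def H_def)
  show "pmap ((%P. P \<times> {0..1}) ` cells V) PP H" unfolding pmap_def
  proof
  fix Q assume "Q:(%P. P \<times> {0..1::real}) ` cells V"
  then obtain sg where sg: "sg:spx V" "Q = rl sg \<times> {0..1}" by(auto simp: cells_def)
  have fin: "finite sg" using sg by(simp add: sx_def)
  obtain P where P: "con_on (rl (sg \<times> UNIV)) I" "P:PP" "I ` rl (sg \<times> UNIV) <= P" using G[OF sg(1)] by(auto simp: Good_def)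
  have "con_on Q (%w. segment (snd w) (j False (fst w)) (j True (fst w)))" unfolding sg(2) j_def by(intro cont_on_seg continuous_on_snd continuous_on_id
  continuous_on_compose2[OF cont_on_aff[OF fin]] continuous_on_fst) auto
  from continuous_on_compose2[OF P(1) this]
  have "con_on Q H" using seg by(fastforce simp: H_def sg(2) case_prod_unfold)
  moreover have "H ` Q <= P" using P(3) seg by(fastforce simp: H_def sg(2))
  ultimately show "EX P:PP. H ` Q <= P & con_on Q H" using P(2) by blast
  qed
 qed
qed

text \<open>Each piece contracts to a point of the tail \<open>Y v\<close>, and on the way every
  tail with index below \<open>v\<close> is preserved. One contraction thus works for any
  intersection of such tails, which is what the carriers in \<open>tail_htpy\<close> are made
  of.\<close>

definition contr_sys::"'z::topological_space set set=>'b rel=>('b=>'z set)=>bool" where "contr_sys PP b Y <-> tails PP b Y & up_directed PP &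
  (ALL v:Fd b. ALL P:PP. EX P':PP. EX c. EX z0:Y v Int P'.
  con_on (P \<times> {0..1::real}) (%w. c (fst w) (snd w)) & (ALL z:P. c z 0 = z & c z 1 = z0 &
  (ALL t:{0..1}. c z t:P' & (ALL v'. (v', v):b & z:Y v' --> c z t:Y v'))))"

lemma contr_sysE: assumes "contr_sys PP b Y" "v:Fd b" "P:PP"
 obtains P' c z0 where "P':PP" "z0:Y v Int P'" "con_on (P \<times> {0..1::real}) (%w. c (fst w) (snd w))" "!!z. z:P==>c z 0 = z & c z 1 = z0"
  "!!z t v'. [|z:P; t:{0..1}|]==>c z t:P' & ((v', v):b & z:Y v' --> c z t:Y v')"
proof -
 obtain P' c z0 where *: "P':PP" "z0:Y v Int P'" "con_on (P \<times> {0..1::real}) (%w. c (fst w) (snd w))" "ALL z:P. c z 0 = z & c z 1 = z0 &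
  (ALL t:{0..1}. c z t:P' & (ALL v'. (v', v):b & z:Y v' --> c z t:Y v'))"
  using assms(1)[unfolded contr_sys_def, THEN conjunct2, THEN conjunct2, rule_format, OF assms(2,3)] by(elim bexE exE conjE)
 show thesis by(rule that[OF *(1-3)]) (use *(4) in simp_all)
qed

lemma contr_sys_tails: "contr_sys PP b Y==>tails PP b Y" by(simp add: contr_sys_def)

lemma flim_tfil: "filterlim h (tfil b Y) F <-> (ALL v:Fd b. \<forall>\<^sub>F x in F. h x:Y v)" by(simp add: tfil_def filterlim_INF filterlim_principal)

definition htpc::"'v set=>'v pt filter=>'z::topological_space set set=>'z filter =>('v pt=>'z)=>('v pt=>'z)=>bool" where
 "htpc V F PP E Th Th' <-> (EX H. pmap ((%P. P \<times> {0..1::real}) ` cells V) PP H &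
  filterlim H E (F \<times>\<^sub>F principal {0..1}) & (ALL p:rl V. H (p, 0) = Th p & H (p, 1) = Th' p))"

lemma shom_htpc: assumes A: "gpre G A" and B: "gpre G B" and k: "dset k" and f: "amor G A B (wtop PP) E f" and h: "htpc (Fd k) (sfil k) PP E Th Th'"
 shows "shom G A B k (pb (stop k) Th f) (pb (stop k) Th' f)"
proof -
 obtain H where H: "pmap ((%P. P \<times> {0..1::real}) ` cells (Fd k)) PP H" "filterlim H E (sfil k \<times>\<^sub>F principal {0..1})"
  "!!p. p:rl (Fd k)==>H (p, 0) = Th p" "!!p. p:rl (Fd k)==>H (p, 1) = Th' p" using h unfolding htpc_def by blast
 have "shom G A B k (pb (stop k) (%p. H (p, 0)) f) (pb (stop k) (%p. H (p, 1)) f)" using ahom_htpy[OF A B f H(1,2)] fspace_sx[OF k] by(simp add: rtop_weak)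
 moreover have "pb (stop k) (%p. H (p, 0)) f = pb (stop k) Th f" "pb (stop k) (%p. H (p, 1)) f = pb (stop k) Th' f" by(intro pb_cong; simp add: H(3,4))+
 ultimately show ?thesis by simp
qed

section \<open>Refinements over which maps tending to infinity become homotopic\<close>

definition prod_rel::"'k rel=>'l rel=>('k*'l) rel" where "prod_rel k l = {((x, y), (x', y')). (x, x'):k & (y, y'):l}"

lemma prod_rel: assumes k: "dset k" and l: "dset l" shows directed_prod: "dset (prod_rel k l)" and cofinal_fst: "cofinal (prod_rel k l) k fst"
  and cofinal_snd: "cofinal (prod_rel k l) l snd" and Field_prod: "Fd (prod_rel k l) = Fd k \<times> Fd l"
proof -
 have refl: "(w, w):prod_rel k l <-> w:Fd k \<times> Fd l" for w using dset_refl[OF k] dset_refl[OF l] by(auto simp: prod_rel_def intro: FieldI1)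
 obtain x0 y0 where x0: "x0:Fd k" "y0:Fd l" using dset_ne[OF k] dset_ne[OF l] by blast
 show "dset (prod_rel k l)"
 proof(rule dset_setI)
  show "EX w. (w, w):prod_rel k l" unfolding refl using x0 by blast
  show "(w, w):prod_rel k l & (w', w'):prod_rel k l" if "(w, w'):prod_rel k l" for w w'
  unfolding refl using that by(auto simp: prod_rel_def intro: FieldI1 FieldI2)
  show "(w, w''):prod_rel k l" if "(w, w'):prod_rel k l" "(w', w''):prod_rel k l" for w w' w''
  using that dset_trans[OF k] dset_trans[OF l] unfolding prod_rel_def by blast
  show "EX z. (w, z):prod_rel k l & (w', z):prod_rel k l" if w: "(w, w):prod_rel k l" "(w', w'):prod_rel k l" for w w'
  proof -
  obtain x x' where "(fst w, x):k" "(fst w', x):k" "(snd w, x'):l" "(snd w', x'):l"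
  using w dset_ub[OF k, of "fst w" "fst w'"] dset_ub[OF l, of "snd w" "snd w'"] unfolding refl by auto
  thus ?thesis by(intro exI[of _ "(x, x')"]) (auto simp: prod_rel_def case_prod_unfold)
  qed
 qed
 show F: "Fd (prod_rel k l) = Fd k \<times> Fd l"
 proof
  show "Fd (prod_rel k l) <= Fd k \<times> Fd l" by(auto simp: Field_def prod_rel_def)
  show "Fd k \<times> Fd l <= Fd (prod_rel k l)" using refl by(blast intro: FieldI1)
 qed
 show "cofinal (prod_rel k l) k fst" "cofinal (prod_rel k l) l snd" unfolding cofinal_def F using x0 by(auto simp: prod_rel_def)
qed

lemma dset_cof_sub: assumes D: "dset D" and U: "U <= Fd D" "ALL w:Fd D. EX u:U. (w, u):D"
 shows "Fd (D Int U \<times> U) = U" "dset (D Int U \<times> U)" "cofinal D n al==>cofinal (D Int U \<times> U) n al"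
proof -
 have refl: "(w, w):D Int U \<times> U <-> w:U" for w using dset_refl[OF D] U(1) by blast
 show F: "Fd (D Int U \<times> U) = U" using refl by(auto simp: Field_def)
 have up: "EX u:U. (w, u):D & (w', u):D" if "w:Fd D" "w':Fd D" for w w' using dset_ub[OF D that] U(2) dset_trans[OF D] by metis
 show "dset (D Int U \<times> U)"
 proof(rule dset_setI)
  show "EX w. (w, w):D Int U \<times> U" unfolding refl using dset_ne[OF D] U(2) by blast
  show "EX z. (w, z):D Int U \<times> U & (w', z):D Int U \<times> U"
  if "(w, w):D Int U \<times> U" "(w', w'):D Int U \<times> U" for w w' using up[of w w'] that U(1) by blast
 qed (use refl dset_trans[OF D] in blast)+
 show "cofinal (D Int U \<times> U) n al" if c: "cofinal D n al" unfolding cofinal_def F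
 proof(intro conjI ballI)
  show "al:U \<rightarrow> Fd n" using c U(1) by(auto simp: cofinal_def)
  fix y assume "y:Fd n"
  then obtain x where x: "x:Fd D" "!!w. (x, w):D==>(y, al w):n" using c unfolding cofinal_def by blast
  thus "EX x:U. ALL w. (x, w):D Int U \<times> U --> (y, al w):n" using bspec[OF U(2) x(1)] dset_trans[OF D] by blast
 qed
qed

text \<open>The refinement consists of triples \<open>(x, x', v)\<close> for which \<open>Th\<close>
  and \<open>Th'\<close> send the tails at \<open>x\<close> and \<open>x'\<close> into
  \<open>Y v\<close>. The third component remembers a tail that the images of both maps share, and
  so provides carriers for both of them.\<close>

lemma tail_htpy: fixes Y::"'b=>'z::topological_space set" and k::"'k rel" and k'::"'l rel" assumes Z: "contr_sys PP b Y" and k: "dset k" and k': "dset k'"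
  and Th: "pmap (cells (Fd k)) PP Th" "filterlim Th (tfil b Y) (sfil k)" and Th': "pmap (cells (Fd k')) PP Th'" "filterlim Th' (tfil b Y) (sfil k')"
 obtains kk::"('k*'l*'b) rel" and al be where "dset kk" "cofinal kk k al" "cofinal kk k' be"
  "htpc (Fd kk) (sfil kk) PP (tfil b Y) (%p. Th (aff al p)) (%p. Th' (aff be p))"
proof -
 have tb: "tails PP b Y" and up: "up_directed PP" using Z by(auto simp: contr_sys_def)
 hence b: "dset b" and dec: "!!v v'. (v, v'):b==>Y v' <= Y v" by(auto simp: tails_def)
 define good where "good x x' v <-> x:Fd k & x':Fd k' & v:Fd b &
  Th ` rl (k `` {x}) <= Y v & Th' ` rl (k' `` {x'}) <= Y v" for x x' v
 have above: "EX y y'. (x, y):k & (x', y'):k' & good y y' v" if F: "x:Fd k" "x':Fd k'" "v:Fd b" for x x' v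
 proof -
  obtain z z' where z: "z:Fd k" "Th ` rl (k `` {z}) <= Y v" "z':Fd k'" "Th' ` rl (k' `` {z'}) <= Y v"
  using Th(2) Th'(2) F(3) unfolding flim_tfil ev_sfil[OF k] ev_sfil[OF k'] by(metis image_subsetI)
  obtain y y' where y: "y:Fd k" "(x, y):k" "(z, y):k" "y':Fd k'" "(x', y'):k'" "(z', y'):k'" using dset_ub[OF k F(1) z(1)] dset_ub[OF k' F(2) z(3)] by blast
  have "rl (k `` {y}) <= rl (k `` {z})" "rl (k' `` {y'}) <= rl (k' `` {z'})" using dset_trans[OF k y(3)] dset_trans[OF k' y(6)] by(auto intro!: rl_mono)
  hence "good y y' v" using z y F(3) unfolding good_def by blast
  thus ?thesis using y by blast
 qed
 define D where "D = prod_rel k (prod_rel k' b)"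
 define U where "U = {(x, x', v). good x x' v}"
 define kk where "kk = D Int U \<times> U"
 have D: "((x, x', v), (y, y', u)):D <-> (x, y):k & (x', y'):k' & (v, u):b" for x x' v y y' u by(simp add: D_def prod_rel_def)
 note kb = prod_rel[OF k' b]
 note kD = prod_rel[OF k kb(1), folded D_def]
 have FD: "Fd D = Fd k \<times> Fd k' \<times> Fd b" unfolding D_def Field_prod[OF k kb(1)] Field_prod[OF k' b] ..
 have U: "U <= Fd D" by(auto simp: FD U_def good_def)
 have Uc: "ALL w:Fd D. EX u:U. (w, u):D"
 proof
  fix w assume that: "w:Fd D"
  obtain x x' v where w: "w = (x, x', v)" by(cases w)
  with that have "x:Fd k" "x':Fd k'" "v:Fd b" by(simp_all add: FD)
  from above[OF this] this(3) obtain y y' where "(x, y):k" "(x', y'):k'" "good y y' v" "v:Fd b" by blast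
  thus "EX u:U. (w, u):D" using w dset_refl[OF b] by(intro bexI[of _ "(y, y', v)"]) (auto simp: D U_def)
 qed
 note kk = dset_cof_sub[OF kD(1) U Uc, folded kk_def]
 have cof: "cofinal kk k fst" "cofinal kk k' (fst o snd)" by(rule kk(3) kD(2) kk(3)[OF cof_comp[OF k' kD(3) kb(2)]])+
 have dir: "dset kk" and Fkk: "w:Fd kk <-> good (fst w) (fst (snd w)) (snd (snd w))" for w using kk(1,2) by(auto simp: U_def)
 have kkD: "(w, w'):kk==>(w, w'):D & w:U" for w w' by(simp add: kk_def)
 \<comment> \<open>All tails \<open>Y v\<close> promised by triples below every vertex of the
   simplex. Larger simplices have fewer lower bounds and hence larger carriers; a simplex beyond a
   triple with last component \<open>v\<close> is carried by \<open>Y v\<close>, whence the homotopy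
   tends to infinity.\<close>
 define K where "K sg = \<Union>PP Int (INT v:{v. EX x x'. ALL s:sg. ((x, x', v), s):kk}. Y v)" for sg
 have "EX H. pmap ((%P. P \<times> {0..1::real}) ` cells (Fd kk)) PP H & (ALL p:rl (Fd kk). H (p, 0) = Th (aff fst p) & H (p, 1) = Th' (aff (fst o snd) p)) &
  (ALL sg:spx (Fd kk). ALL p:rl sg. ALL t:{0..1}. H (p, t):K sg)"
 proof(rule cA_htpy[where K = K and PP = PP])
  note pm = pmap_comp[OF pmap_cof[OF cof(1)] Th(1)] pmap_comp[OF pmap_cof[OF cof(2)] Th'(1)]
  show "pmap (cells (Fd kk)) PP (%p. Th (aff fst p))" "pmap (cells (Fd kk)) PP (%p. Th' (aff (fst o snd) p))" by(fact pm)+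
  have in_P: "h p:\<Union>PP" if "pmap (cells (Fd kk)) PP h" "p:rl (Fd kk)" for h p using that(1) that(2)[folded Union_cells] unfolding pmap_def by blast
  fix sg assume sg: "sg:spx (Fd kk)"
  have sub: "rl sg <= rl (Fd kk)" using sg by(intro rl_mono) (simp add: sx_def)
  have "Th (aff fst p):Y v & Th' (aff (fst o snd) p):Y v" if p: "p:rl sg" and v: "ALL s:sg. ((x, x', v), s):kk" for x x' v p
  proof -
  have "sg ~= {}" using sg by(simp add: sx_def)
  hence "good x x' v" using v by(force dest: kkD simp: U_def)
  moreover have "aff fst p:rl (k `` {x})" "aff (fst o snd) p:rl (k' `` {x'})" using p v by(intro aff_rl[OF p]; fastforce simp: D dest: supp_sub kkD)+
  ultimately show ?thesis by(auto simp: good_def)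
  qed
  thus "(%p. Th (aff fst p)) ` rl sg <= K sg" "(%p. Th' (aff (fst o snd) p)) ` rl sg <= K sg"
  using in_P[OF pm(1) subsetD[OF sub]] in_P[OF pm(2) subsetD[OF sub]] unfolding K_def by auto
  fix P assume P: "P:PP"
  \<comment> \<open>Any vertex of the simplex will do: every \<open>v\<close> occurring in
    \<open>K sg\<close> lies below its last component, so the contraction into that tail preserves
    \<open>K sg\<close>.\<close>
  obtain s where s: "s:sg" using sg by(auto simp: sx_def)
  hence "s:Fd kk" using sg by(auto simp: sx_def)
  hence sb: "snd (snd s):Fd b" by(auto simp: Fkk good_def)
  obtain P' c z0 where c: "P':PP" "z0:Y (snd (snd s)) Int P'" "con_on (P \<times> {0..1::real}) (%w. c (fst w) (snd w))" "!!z. z:P==>c z 0 = z & c z 1 = z0"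
  "!!z t v'. [|z:P; t:{0..1}|]==>c z t:P' & ((v', snd (snd s)):b & z:Y v' --> c z t:Y v')" by(rule contr_sysE[OF Z sb P]) blast
  have b: "(v, snd (snd s)):b" if "ALL s:sg. ((x, x', v), s):kk" for x x' v using bspec[OF that s] by(cases s) (auto simp: D dest: kkD)
  have "c z t:P' Int K sg" if "z:P Int K sg" "t:{0..1}" for z t
  proof -
  have z: "z:P" "!!v x x'. ALL s:sg. ((x, x', v), s):kk==>z:Y v" using that(1) unfolding K_def by blast+
  note c = c(1) c(5)[OF z(1) that(2)]
  have "c z t:Y v" if v: "ALL s:sg. ((x, x', v), s):kk" for v x x' using c(2)[of v] z(2)[OF v] b[OF v] by blast
  thus ?thesis using c(1) c(2) unfolding K_def by blast
  qed
  hence "contracts c P (K sg) P' z0" unfolding contracts_def using c(4) by(auto intro: continuous_on_subset[OF c(3)])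
  thus "EX P':PP. EX c z0. contracts c P (K sg) P' z0" using c(1) by blast
 next
  show "K ta <= K sg" if "ta <= sg" for ta sg using that unfolding K_def by blast
 qed (use up in blast)+
 then obtain H where H: "pmap ((%P. P \<times> {0..1::real}) ` cells (Fd kk)) PP H"
  "ALL p:rl (Fd kk). H (p, 0) = Th (aff fst p) & H (p, 1) = Th' (aff (fst o snd) p)"
  and HK: "!!sg p t. [|sg:spx (Fd kk); p:rl sg; t:{0..1}|]==>H (p, t):K sg" by blast
 have "filterlim H (tfil b Y) (sfil kk \<times>\<^sub>F principal {0..1})" unfolding flim_tfil ev_prod_princ ev_sfil[OF dir]
 proof
  fix v assume v: "v:Fd b"
  obtain x x' where "x:Fd k" "x':Fd k'" using dset_ne[OF k] dset_ne[OF k'] by blast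
  then obtain y y' where g: "good y y' v" using above v by blast
  have "H (p, t):Y v" if p: "p:rl (kk `` {(y, y', v)})" and t: "t:{0..1}" for p t
  proof -
  have "supp p:spx (Fd kk)" using supp_spx[OF p] by(auto simp: sx_def intro: FieldI2)
  from HK[OF this rl_supp[OF p] t] show ?thesis using supp_sub[OF p] unfolding K_def by blast
  qed
  thus "EX x:Fd kk. ALL p:rl (kk `` {x}). ALL t:{0..1}. H (p, t):Y v" using g by(intro bexI[of _ "(y, y', v)"]) (auto simp: Fkk)
 qed
 with H have "htpc (Fd kk) (sfil kk) PP (tfil b Y) (%p. Th (aff fst p)) (%p. Th' (aff (fst o snd) p))" unfolding htpc_def by blast
 with dir cof show thesis by(rule that)
qed

text \<open>The form in which the uniqueness of maps tending to infinity is applied: different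
  representatives of a composite are exhibited as pullbacks of one and the same lift
  \<open>f\<close>.\<close>

lemma wit_tail: fixes Y::"'b=>'z::topological_space set" and k::"'k rel" and k'::"'l rel"
 assumes A: "gpre G A" and B: "gpre G B" and Z: "contr_sys PP b Y" and k: "dset k" and k': "dset k'"
  and Th: "pmap (cells (Fd k)) PP Th" "filterlim Th (tfil b Y) (sfil k)" and Th': "pmap (cells (Fd k')) PP Th'" "filterlim Th' (tfil b Y) (sfil k')"
  and f: "amor G A B (wtop PP) (tfil b Y) f" shows "EX kk::('k*'l*'b) rel. wit kk G A B k (pb (stop k) Th f) k' (pb (stop k') Th' f)"
proof -
 obtain kk::"('k*'l*'b) rel" and al be where kk: "dset kk" "cofinal kk k al" "cofinal kk k' be"
  and h: "htpc (Fd kk) (sfil kk) PP (tfil b Y) (%p. Th (aff al p)) (%p. Th' (aff be p))" using tail_htpy[OF Z k k' Th Th'] .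
 have "cmap (stop kk) (stop k) (aff al)" "cmap (stop kk) (stop k') (aff be)" unfolding rtop_weak by(intro pmap_cmap pmap_cof kk)+
 with shom_htpc[OF A B kk(1) f h] kk show ?thesis unfolding wit_def by(intro exI[of _ kk] conjI exI[of _ al] exI[of _ be]) (simp_all add: pb_pb)
qed

section \<open>Contractible systems of tails on realizations and their products\<close>

lemma up_dset_cells: assumes "S ~= {}" shows "up_directed (cells S)" unfolding up_directed_def
proof(intro conjI ballI)
 show "cells S ~= {}" using assms by(auto simp: cells_def sx_def)
 fix P Q assume "P:cells S" "Q:cells S"
 then obtain sg ta where *: "sg:spx S" "ta:spx S" "P = rl sg" "Q = rl ta" by(auto simp: cells_def)
 hence "sg Un ta:spx S" by(auto simp: sx_def)
 thus "EX R:cells S. P Un Q <= R" using * rl_mono[of sg "sg Un ta"] rl_mono[of ta "sg Un ta"] by(intro bexI[of _ "rl (sg Un ta)"]) (auto simp: cells_def)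
qed

lemma up_dset_pprod: "up_directed PP==>up_directed QQ==>up_directed (pprod PP QQ)" unfolding up_directed_def pprod_def
proof(elim conjE, intro conjI ballI)
 assume "PP ~= {}" "QQ ~= {}" thus "(%(P, Q). P \<times> Q) ` (PP \<times> QQ) ~= {}" by blast
 assume PP: "ALL P:PP. ALL Q:PP. EX R:PP. P Un Q <= R" and QQ: "ALL P:QQ. ALL Q:QQ. EX R:QQ. P Un Q <= R"
 fix U V assume "U:(%(P, Q). P \<times> Q) ` (PP \<times> QQ)" "V:(%(P, Q). P \<times> Q) ` (PP \<times> QQ)"
 then obtain P P' Q Q' where *: "P:PP" "P':PP" "Q:QQ" "Q':QQ" "U = P \<times> Q" "V = P' \<times> Q'" by auto
 obtain R S where "R:PP" "P Un P' <= R" "S:QQ" "Q Un Q' <= S" using PP[rule_format, OF *(1,2)] QQ[rule_format, OF *(3,4)] by blast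
 thus "EX R:(%(P, Q). P \<times> Q) ` (PP \<times> QQ). U Un V <= R" using * by(intro bexI[of _ "R \<times> S"]) auto
qed

text \<open>The contraction runs along straight lines to the vertex \<open>v\<close>, which belongs
  to all tails with index below \<open>v\<close>; tails are convex.\<close>

lemma contr_sys_spx: assumes m: "dset m" shows "contr_sys (cells (Fd m)) m (tls m)" unfolding contr_sys_def
proof(intro conjI ballI tails_spx[OF m] up_dset_cells)
 show "Fd m ~= {}" using dset_ne[OF m] by blast
 fix v P assume v: "v:Fd m" and "P:cells (Fd m)"
 then obtain sg where sg: "sg:spx (Fd m)" "P = rl sg" by(auto simp: cells_def)
 show "EX P':cells (Fd m). EX c. EX z0:tls m v Int P'.
  con_on (P \<times> {0..1::real}) (%w. c (fst w) (snd w)) & (ALL z:P. c z 0 = z & c z 1 = z0 &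
  (ALL t:{0..1}. c z t:P' & (ALL v'. (v', v):m & z:tls m v' --> c z t:tls m v')))"
 proof(intro bexI exI conjI ballI)
  show "rl (insert v sg):cells (Fd m)" using sg v by(auto simp: cells_def sx_def)
  show "vertex v:tls m v Int rl (insert v sg)" using dset_refl[OF m v] by(simp add: tls_def)
  show "con_on (P \<times> {0..1::real}) (%w. segment (snd w) (fst w) (vertex v))"
  by(intro cont_on_seg continuous_on_snd continuous_on_fst continuous_on_id continuous_on_const)
  fix z assume z: "z:P"
  show "segment 0 z (vertex v) = z" "segment 1 z (vertex v) = vertex v" by simp_all
  fix t::real assume t: "t:{0..1}"
  show "segment t z (vertex v):rl (insert v sg)" using z t sg by(intro rl_seg) (auto intro: subsetD[OF rl_mono])
  show "ALL v'. (v', v):m & z:tls m v' --> segment t z (vertex v):tls m v'" using t by(auto simp: tls_def intro!: rl_seg)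
 qed
qed

text \<open>First \<open>q\<close> is contracted by \<open>c\<close>, then \<open>p\<close> is moved to \<open>x\<close>.\<close>

definition two_stage::"('z=>real=>'z)=>'z=>'v pt*'z=>'v pt=>real=>'v pt*'z" where
 "two_stage c z0 p x t = (if t <= 1/2 then (fst p, c (snd p) (2 * t)) else (segment (2 * t - 1) (fst p) x, z0))"

lemma theta_path_two_stage: "theta_path p x w = two_stage (%q t. segment t q w) w p x" by(simp add: theta_path_def two_stage_def fun_eq_iff)

lemma cont_on_two_stage: fixes c::"'z::topological_space=>real=>'z" assumes c: "con_on (Q \<times> {0..1}) (%w. c (fst w) (snd w))" "!!q. q:Q==>c q 1 = z0"
  and p: "con_on D p" "!!w. w:D==>snd (p w):Q" and x: "con_on D x" and t: "con_on D t" "!!w. w:D==>t w:{0..1}"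
 shows "con_on D (%w. two_stage c z0 (p w) (x w) (t w))" unfolding two_stage_def
proof(rule continuous_on_cases_le[OF _ _ t(1)])
 have "con_on {w:D. t w <= 1/2} (%w. (snd (p w), 2 * t w))" by(intro continuous_on_Pair continuous_on_snd continuous_on_mult_left continuous_on_subset[OF p(1)]
  continuous_on_subset[OF t(1)]) auto
 from continuous_on_compose2[OF c(1) this]
 have "con_on {w:D. t w <= 1/2} (%w. c (snd (p w)) (2 * t w))" using p(2) t(2) by fastforce
 thus "con_on {w:D. t w <= 1/2} (%w. (fst (p w), c (snd (p w)) (2 * t w)))" by(intro continuous_on_Pair continuous_on_fst continuous_on_subset[OF p(1)]) auto
 show "con_on {w:D. 1/2 <= t w} (%w. (segment (2 * t w - 1) (fst (p w)) (x w), z0))"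
  by(intro continuous_on_Pair cont_on_seg continuous_on_fst continuous_on_const continuous_on_diff
  continuous_on_mult_left continuous_on_subset[OF p(1)] continuous_on_subset[OF x] continuous_on_subset[OF t(1)]) auto
 show "(fst (p w), c (snd (p w)) (2 * t w)) = (segment (2 * t w - 1) (fst (p w)) (x w), z0)" if w: "w:D" "t w = 1/2" for w
 proof -
  have "2 * t w = 1" using w(2) by simp
  thus ?thesis using c(2)[OF p(2)[OF w(1)]] by simp
 qed
qed

lemma Field_sharp: assumes m: "dset m" and n: "dset n" shows "Fd (m ## n) = Fd m \<times> (spx (Fd m) \<rightarrow>\<^sub>E Fd n)"
proof
 show "Fd (m ## n) <= Fd m \<times> (spx (Fd m) \<rightarrow>\<^sub>E Fd n)" by(auto simp: sharp_def Field_def)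
 show "Fd m \<times> (spx (Fd m) \<rightarrow>\<^sub>E Fd n) <= Fd (m ## n)"
 proof
  fix v assume "v:Fd m \<times> (spx (Fd m) \<rightarrow>\<^sub>E Fd n)"
  hence "(v, v):m ## n" using dset_refl[OF m] dset_refl[OF n] by(auto simp: sharp_def)
  thus "v:Fd (m ## n)" by(rule FieldI1)
 qed
qed

lemma dset_sharp: assumes m: "dset m" and n: "dset n" shows "dset (m ## n)"
proof(rule dset_setI)
 have refl: "(v, v):m ## n <-> v:Fd (m ## n)" for v
 proof
  assume "v:Fd (m ## n)"
  thus "(v, v):m ## n" unfolding Field_sharp[OF m n] using dset_refl[OF m] dset_refl[OF n] by(auto simp: sharp_def)
 qed (rule FieldI1)
 obtain x y where "x:Fd m" "y:Fd n" using dset_ne[OF m] dset_ne[OF n] by blast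
 hence "(x, \<lambda>sg\<in>spx (Fd m). y):Fd (m ## n)" by(simp add: Field_sharp[OF m n])
 thus "EX v. (v, v):m ## n" unfolding refl by blast
 show "(v, v):m ## n & (w, w):m ## n" if "(v, w):m ## n" for v w unfolding refl using that by(auto intro: FieldI1 FieldI2)
 show "(u, w):m ## n" if "(u, v):m ## n" "(v, w):m ## n" for u v w using that dset_trans[OF m] dset_trans[OF n] unfolding sharp_def by blast
 show "EX w. (u, w):m ## n & (v, w):m ## n" if uv: "(u, u):m ## n" "(v, v):m ## n" for u v
 proof -
  obtain x xi y et where e: "u = (x, xi)" "v = (y, et)" by(metis surj_pair)
  hence F: "x:Fd m" "y:Fd m" "xi:spx (Fd m) \<rightarrow>\<^sub>E Fd n" "et:spx (Fd m) \<rightarrow>\<^sub>E Fd n"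
  using uv unfolding refl Field_sharp[OF m n] by auto
  obtain z where z: "(x, z):m" "(y, z):m" using dset_ub[OF m F(1,2)] by blast
  have "EX w. w:Fd n & (xi sg, w):n & (et sg, w):n" if "sg:spx (Fd m)" for sg using dset_ub[OF n PiE_mem[OF F(3) that] PiE_mem[OF F(4) that]] by blast
  then obtain ze where ze: "!!sg. sg:spx (Fd m)==>ze sg:Fd n & (xi sg, ze sg):n & (et sg, ze sg):n" by metis
  thus ?thesis using F z e by(intro exI[of _ "(z, restrict ze (spx (Fd m)))"]) (auto simp: sharp_def)
 qed
qed

text \<open>The function in an element of \<open>m ## b\<close> says, for each simplex, how far out
  \<open>q\<close> must be when that simplex contains \<open>p\<close> in its interior. As
  \<open>Y\<close> is arbitrary, the construction can be iterated to triple products.\<close>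

definition ptails::"'i rel=>('b=>'z set)=>'i*('i set=>'b)=>('i pt*'z) set" where "ptails m Y v = {(p, q). p:tls m (fst v) & q:Y (snd v (supp p))}"

text \<open>While \<open>q\<close> is contracted, \<open>p\<close> rests and its support is
  unchanged; when \<open>p\<close> then moves to the vertex \<open>x\<close>, \<open>q\<close> is
  already beyond everything that the supports met on the way can demand.\<close>

lemma contr_sys_prod: assumes m: "dset m" and Z: "contr_sys PP b Y" shows "contr_sys (pprod (cells (Fd m)) PP) (m ## b) (ptails m Y)"
proof -
 have tb: "tails PP b Y" and up: "up_directed PP" using Z by(auto simp: contr_sys_def)
 hence b: "dset b" and dec: "!!v v'. (v, v'):b==>Y v' <= Y v" and YP: "!!v. v:Fd b==>Y v <= \<Union>PP" by(auto simp: tails_def)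
 note FS = Field_sharp[OF m b]
 have sup: "supp p:spx (Fd m)" if "p:tls m x" for p x using supp_spx[OF tls_rl[OF that]] .
 show ?thesis unfolding contr_sys_def
 proof(intro conjI ballI)
  show "tails (pprod (cells (Fd m)) PP) (m ## b) (ptails m Y)" unfolding tails_def Union_pprod Union_cells
  proof(intro conjI ballI allI impI dset_sharp m b)
  fix v assume v: "v:Fd (m ## b)"
  show "ptails m Y v <= rl (Fd m) \<times> \<Union>PP"
  proof
  fix w assume "w:ptails m Y v"
  hence w: "fst w:tls m (fst v)" "snd w:Y (snd v (supp (fst w)))" by(auto simp: ptails_def)
  have "snd v (supp (fst w)):Fd b" using v sup[OF w(1)] by(auto simp: FS)
  thus "w:rl (Fd m) \<times> \<Union>PP" using YP w tls_rl[OF w(1)] by(cases w) fastforce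
  qed
  next
  fix v v' assume "(v, v'):m ## b"
  hence *: "(fst v, fst v'):m" "!!sg. sg:spx (Fd m)==>(snd v sg, snd v' sg):b" by(auto simp: sharp_def)
  have "tls m (fst v') <= tls m (fst v)" using tails_spx[OF m] *(1) by(simp add: tails_def)
  thus "ptails m Y v' <= ptails m Y v" using dec[OF *(2)[OF sup]] unfolding ptails_def by blast
  qed
  show "up_directed (pprod (cells (Fd m)) PP)" using dset_ne[OF m] by(intro up_dset_pprod up_dset_cells up) blast
  fix v P assume v: "v:Fd (m ## b)" and "P:pprod (cells (Fd m)) PP"
  then obtain sg P1 where sg: "sg:spx (Fd m)" and P1: "P1:PP" and P: "P = rl sg \<times> P1" by(auto simp: pprod_def cells_def)
  obtain x xi where x: "v = (x, xi)" "x:Fd m" "xi:spx (Fd m) \<rightarrow>\<^sub>E Fd b" using v by(auto simp: FS)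
  have sg': "insert x sg:spx (Fd m)" using sg x by(auto simp: sx_def)
  have simp: "ta:spx (Fd m)" if "ta:spx (insert x sg)" for ta using that sg' by(auto simp: sx_def)
  have "finite (xi ` spx (insert x sg))" using sg' by(intro finite_imageI fin_spx) (simp add: sx_def)
  \<comment> \<open>During the motion of \<open>p\<close> its support is a face of
    \<open>insert x sg\<close>. There are finitely many faces, so one \<open>w\<close> dominates the
    requirements of all of them.\<close>
  then obtain w where w: "w:Fd b" "!!ta. ta:spx (insert x sg)==>(xi ta, w):b" using dset_fin_ub[OF b, of "xi ` spx (insert x sg)"] PiE_mem[OF x(3) simp] by auto
  obtain P1' c z0 where c: "P1':PP" "z0:Y w Int P1'" "con_on (P1 \<times> {0..1::real}) (%w. c (fst w) (snd w))" "!!z. z:P1==>c z 0 = z & c z 1 = z0"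
  "!!z t v'. [|z:P1; t:{0..1}|]==>c z t:P1' & ((v', w):b & z:Y v' --> c z t:Y v')" by(rule contr_sysE[OF Z w(1) P1]) blast
  define C where "C p = two_stage c z0 p (vertex x)" for p
  let ?P' = "rl (insert x sg) \<times> P1'"
  have z0Y: "z0:Y (xi' ta)" if "!!ta. ta:spx (Fd m)==>(xi' ta, xi ta):b" "ta:spx (insert x sg)" for xi' ta
  using c(2) dec dset_trans[OF b that(1)[OF simp[OF that(2)]] w(2)[OF that(2)]] by blast
  have seg: "segment t p (vertex x):rl (insert x sg)" if "p:rl sg" "t:{0..1}" for p t using that by(intro rl_seg) (auto intro: subsetD[OF rl_mono])
  show "EX P':pprod (cells (Fd m)) PP. EX c. EX z0:ptails m Y v Int P'.
  con_on (P \<times> {0..1::real}) (%w. c (fst w) (snd w)) & (ALL z:P. c z 0 = z & c z 1 = z0 & (ALL t:{0..1}. c z t:P' &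
  (ALL v'. (v', v):m ## b & z:ptails m Y v' --> c z t:ptails m Y v')))"
  proof(intro bexI exI conjI ballI)
  show "?P':pprod (cells (Fd m)) PP" using sg' c(1) by(auto simp: pprod_def cells_def)
  have "z0:Y (xi {x})" using dset_refl[OF b PiE_mem[OF x(3)]] by(intro z0Y[of xi]) (auto simp: sx_def)
  thus "(vertex x, z0):ptails m Y v Int ?P'" using c(2) x dset_refl[OF m x(2)] by(simp add: ptails_def tls_def)
  show "con_on (P \<times> {0..1::real}) (%w. C (fst w) (snd w))" unfolding C_def P by(rule cont_on_two_stage[OF c(3)])
  (use c(4) in "auto intro!: continuous_on_fst continuous_on_snd continuous_on_id continuous_on_const")
  fix z assume "z:P"
  then obtain p q where z: "z = (p, q)" "p:rl sg" "q:P1" by(auto simp: P)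
  show "C z 0 = z" "C z 1 = (vertex x, z0)" using c(4)[OF z(3)] z by(simp_all add: C_def two_stage_def)
  fix t::real assume t: "t:{0..1}"
  have "p:rl (insert x sg)" using seg[OF z(2), of 0] by simp
  thus "C z t : ?P'" using c(2) c(5)[OF z(3), of "2 * t"] t seg[OF z(2), of "2 * t - 1"] by(simp add: C_def two_stage_def z(1))
  show "ALL v'. (v', v):m ## b & z:ptails m Y v' --> C z t:ptails m Y v'"
  proof(intro allI impI)
  fix v' assume "(v', v):m ## b & z:ptails m Y v'"
  hence v': "(fst v', x):m" "!!ta. ta:spx (Fd m)==>(snd v' ta, xi ta):b"
  and pq: "p:tls m (fst v')" "q:Y (snd v' (supp p))" by(auto simp: sharp_def x(1) ptails_def z(1))
  show "C z t:ptails m Y v'"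
  proof(cases "t <= 1/2")
  case True
  have "supp p:spx (insert x sg)" using supp_spx[OF z(2)] by(auto simp: sx_def)
  hence "(snd v' (supp p), w):b" using dset_trans[OF b v'(2) w(2)] simp by blast
  hence "c q (2 * t):Y (snd v' (supp p))" using c(5)[OF z(3), of "2 * t"] pq(2) t True by simp
  thus ?thesis using pq True by(simp add: C_def two_stage_def z(1) ptails_def)
  next
  case False
  have "segment (2 * t - 1) p (vertex x):tls m (fst v')" using pq(1) v'(1) t False by(auto simp: tls_def intro!: rl_seg)
  moreover have "z0:Y (snd v' (supp (segment (2 * t - 1) p (vertex x))))" using supp_spx[OF seg[OF z(2)]] t False by(intro z0Y[of "snd v'"] v'(2)) auto
  ultimately show ?thesis using False by(simp add: C_def two_stage_def z(1) ptails_def)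
  qed
  qed
  qed
 qed
qed

section \<open>Comparison of the filters on products\<close>

lemma amor_filter_mono: assumes "amor G A B X F f" "F' <= F" shows "amor G A B X F' f" using assms tendsto_mono[OF assms(2)] unfolding amor_def aeq_def by blast

lemma ptails_le_sdp: assumes m: "dset m" and n: "dset n" shows "tfil (m ## n) (ptails m (tls n)) <= sdp (sfil m) supp n"
proof(rule filter_leI)
 fix R assume "eventually R (sdp (sfil m) supp n)"
 then obtain xi x where xi: "!!c. xi c:Fd n" "x:Fd m"
  "!!p q. [|p:tls m x; q:tls n (xi (supp p))|]==>R (p, q)" unfolding ev_sdp[OF n] ev_sfil[OF m] tls_def by blast
 let ?v = "(x, restrict xi (spx (Fd m)))"
 have "?v:Fd (m ## n)" using xi by(simp add: Field_sharp[OF m n])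
 moreover have "R w" if "w:ptails m (tls n) ?v" for w
 proof -
  obtain p q where w: "w = (p, q)" "p:tls m x" "q:tls n (restrict xi (spx (Fd m)) (supp p))" using \<open>w:_\<close> by(auto simp: ptails_def)
  thus ?thesis using xi(3) supp_spx[OF tls_rl[OF w(2)]] by simp
 qed
 ultimately show "eventually R (tfil (m ## n) (ptails m (tls n)))" unfolding ev_tails[OF contr_sys_tails[OF contr_sys_prod[OF m contr_sys_spx[OF n]]]] by blast
qed

text \<open>A tail of the iterated filter is given by a function \<open>xi\<close> of the simplex of
  the first variable and a function \<open>ze\<close> of the simplices of the first two. Currying
  \<open>ze\<close> combines both into one element of \<open>m ## n ## k\<close>.\<close>

lemma ptails_assoc: assumes m: "dset m" and n: "dset n" and k: "dset k"
 shows "filterlim (%(x, y, z). ((x, y), z)) (sdp (sdp (sfil m) supp n) (%(x, y). (supp x, supp y)) k)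
  (tfil (m ## n ## k) (ptails m (ptails n (tls k))))" unfolding filterlim_iff
proof(intro allI impI)
 fix R assume "eventually R (sdp (sdp (sfil m) supp n) (%(x, y). (supp x, supp y)) k)"
 then obtain ze xi x where ze: "!!c. ze c:Fd k" "!!c. xi c:Fd n" "x:Fd m"
  "!!p q r. [|p:tls m x; q:tls n (xi (supp p)); r:tls k (ze (supp p, supp q))|]==>R ((p, q), r)"
  unfolding ev_sdp[OF k] ev_sdp[OF n] ev_sfil[OF m] tls_def by fastforce
 let ?v = "(x, \<lambda>c\<in>spx (Fd m). (xi c, \<lambda>d\<in>spx (Fd n). ze (c, d)))"
 have "?v:Fd (m ## n ## k)" using ze by(auto simp: Field_sharp[OF m dset_sharp[OF n k]] Field_sharp[OF n k])
 moreover have "R ((p, q), r)" if "(p, q, r):ptails m (ptails n (tls k)) ?v" for p q r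
 proof -
  have "p:tls m x" using that by(simp add: ptails_def)
  from that supp_spx[OF tls_rl[OF this]] have q: "q:tls n (xi (supp p))"
  "r:tls k ((\<lambda>d\<in>spx (Fd n). ze (supp p, d)) (supp q))" by(auto simp: ptails_def)
  with supp_spx[OF tls_rl[OF q(1)]] \<open>p:tls m x\<close> show ?thesis by(intro ze(4)) auto
 qed
 ultimately show "\<forall>\<^sub>F w in tfil (m ## n ## k) (ptails m (ptails n (tls k))). R (case w of (x, y, z)=>((x, y), z))"
  unfolding ev_tails[OF contr_sys_tails[OF contr_sys_prod[OF m contr_sys_prod[OF n contr_sys_spx[OF k]]]]] by(intro bexI[of _ ?v]) auto
qed

section \<open>The maps \<open>Th\<close>\<close>

context
 fixes m::"'i rel" and n::"'j rel" assumes m: "dset m" and n: "dset n"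
begin

lemma spx_fst: "sg:spx (Fd (m ## n))==>fst ` sg:spx (Fd m)" by(auto simp: sx_def Field_sharp[OF m n])

text \<open>Well-founded recursion over proper subsets: each value is an upper bound of the finitely
  many earlier values on faces and of the finitely many prescribed elements.\<close>

lemma thc_exists: "EX th. theta_choice m n th"
proof -
 define P where "P f sg r <-> (sg:spx (Fd (m ## n)) --> r:Fd n &
  (ALL ta:spx sg - {sg}. (f ta, r):n) & (ALL (x, xi):sg. (xi (fst ` sg), r):n))" for f::"('i*('i set=>'j)) set=>'j" and sg r
 have "EX th. ALL sg. P th sg (th sg)"
 proof(rule dependent_wf_choice[OF wf_finite_psubset])
  fix f g::"_=>'j" and sg::"('i*('i set=>'j)) set" and r assume eq: "!!ta. (ta, sg):finite_psubset==>f ta = g ta"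
  have "f ta = g ta" if "sg:spx (Fd (m ## n))" "ta:spx sg - {sg}" for ta using that by(intro eq) (auto simp: finite_psubset_def sx_def)
  thus "P f sg r = P g sg r" unfolding P_def by auto
 next
  fix sg::"('i*('i set=>'j)) set" and f::"_=>'j" assume IH: "!!ta. (ta, sg):finite_psubset==>P f ta (f ta)"
  show "EX r. P f sg r"
  proof(cases "sg:spx (Fd (m ## n))")
  case True
  let ?K = "f ` (spx sg - {sg}) Un (%v. snd v (fst ` sg)) ` sg"
  have fin: "finite sg" using True by(simp add: sx_def)
  have "f ta:Fd n" if "ta:spx sg - {sg}" for ta
  proof -
  have "(ta, sg):finite_psubset" "ta:spx (Fd (m ## n))" using that True by(auto simp: finite_psubset_def sx_def)
  thus ?thesis using IH[of ta] by(simp add: P_def)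
  qed
  moreover have "snd v (fst ` sg):Fd n" if "v:sg" for v
  proof -
  have "v:Fd (m ## n)" using that True by(auto simp: sx_def)
  hence "snd v:spx (Fd m) \<rightarrow>\<^sub>E Fd n" by(auto simp: Field_sharp[OF m n])
  thus ?thesis using spx_fst[OF True] by(rule PiE_mem)
  qed
  ultimately have K: "?K <= Fd n" by blast
  have "finite ?K" using fin fin_spx[OF fin] by simp
  from dset_fin_ub[OF n this K] obtain r where r: "r:Fd n" "ALL x:?K. (x, r):n" ..
  have "P f sg r" unfolding P_def using r by(simp add: ball_Un case_prod_unfold)
  thus ?thesis ..
  qed (simp add: P_def)
 qed
 then obtain th where th: "!!sg. P th sg (th sg)" by blast
 have "(th ta, th sg):n" if "sg:spx (Fd (m ## n))" "ta:spx sg" for sg ta using th[of sg] that dset_refl[OF n, of "th sg"] by(cases "ta = sg") (auto simp: P_def)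
 thus ?thesis using th unfolding theta_choice_def P_def by blast
qed

lemma thcD: assumes "theta_choice m n th" "sg:spx (Fd (m ## n))"
 shows "th sg:Fd n" "ta:spx sg==>(th ta, th sg):n" "(x, xi):sg==>(xi (fst ` sg), th sg):n" using assms unfolding theta_choice_def by blast+

text \<open>The invariant of the recursion over skeleta. Values lie in the part of
  \<open>X_theta\<close> over the faces of the simplex, and the last clause keeps their second
  components in a finite simplex, as a map between pieces must.\<close>

definition Good where "Good th sg I <-> con_on (rl sg) I & (ALL x:rl sg. EX ta:spx sg. I x:rl ta \<times> rl (n `` {th ta})) &
  (EX rh:spx (Fd n). I ` rl sg <= rl sg \<times> rl rh)" for th::"('i*('i set=>'j)) set=>'j"

lemma GoodE: assumes "Good th sg I"
 obtains rh where "con_on (rl sg) I" "rh:spx (Fd n)" "!!x. x:rl sg==>fst (I x):rl sg & snd (I x):rl rh"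
  "!!x. x:rl sg==>EX ta:spx sg. fst (I x):rl ta & snd (I x):rl (n `` {th ta})"
proof -
 obtain rh where "rh:spx (Fd n)" "I ` rl sg <= rl sg \<times> rl rh" using assms unfolding Good_def by auto
 with assms show thesis unfolding Good_def by(intro that[of rh]) (auto simp: image_subset_iff mem_Times_iff)
qed

lemma Good_cong: assumes "!!x. x:rl sg==>J x = I x" "Good th sg I" shows "Good th sg J"
proof -
 have "J ` rl sg = I ` rl sg" using assms(1) by auto
 thus ?thesis using assms unfolding Good_def by(simp cong: continuous_on_cong)
qed

lemma Good_vtx: assumes th: "theta_choice m n th" and k: "k:Fd (m ## n)" and I: "I (vertex k) = (vertex k, vertex (th {k}))" shows "Good th {k} I"
proof -
 have s: "{k}:spx (Fd (m ## n))" using k by(simp add: sx_def)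
 have r: "rl {k} = {vertex k}" by(auto simp: in_rl_singleton)
 have "th {k}:Fd n" "(th {k}, th {k}):n" using thcD(1)[OF th s] dset_refl[OF n] by auto
 thus ?thesis unfolding Good_def r using I by(auto simp: sx_def intro!: bexI[of _ "{k}"] bexI[of _ "{th {k}}"])
qed

text \<open>In the first half of the path the first component stays in a face \<open>ta\<close>, and
  the second runs to the vertex \<open>th sg\<close>, which lies above \<open>th ta\<close>. In the
  second half the second component is this vertex, so the first may roam over all of
  \<open>sg\<close>.\<close>

lemma Good_step: assumes th: "theta_choice m n th" and sg: "sg:spx (Fd (m ## n))" and I: "!!ta. [|ta:spx sg; ta ~= sg|]==>Good th ta I"
  and h: "con_on (rl sg) h" "h:rl sg \<rightarrow> rl sg \<times> {1} Un bdry sg \<times> {0..1::real}"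
 shows "Good th sg (%x. theta_path (I (fst (h x))) (fst (h x)) (vertex (th sg)) (snd (h x)))" (is "Good th sg ?J")
proof -
 have fin: "finite sg" "sg ~= {}" using sg by(auto simp: sx_def)
 let ?w = "th sg"
 have w: "?w:Fd n" "(?w, ?w):n" using thcD(1)[OF th sg] dset_refl[OF n] by auto
 have Ib: "con_on (bdry sg) I" by(rule cont_on_bdry[OF fin(1)]) (use I in "auto simp: Good_def")
 have rs: "rl ta <= rl sg" if "ta:spx sg" for ta using that by(intro rl_mono) (simp add: sx_def)
 have IX: "EX ta:spx sg. I x:rl ta \<times> rl (n `` {th ta})" if x: "x:bdry sg" for x
 proof -
  obtain ta where ta: "ta:spx sg" "ta ~= sg" "x:rl ta" using x by(auto simp: boundary_def)
  obtain rh where "rh:spx ta" "fst (I x):rl rh & snd (I x):rl (n `` {th rh})" by(rule GoodE[OF I[OF ta(1,2)]]) (use ta(3) in blast)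
  moreover have "spx ta <= spx sg" using ta(1) by(intro spx_mono) (simp add: sx_def)
  ultimately show ?thesis by(intro bexI[of _ rh]) (auto simp: mem_Times_iff)
 qed
 have "EX P:cells (Fd n). \<Union>((%ta. snd ` I ` rl ta) ` {ta:spx sg. ta ~= sg}) <= P"
 proof(rule up_dset_fin[OF up_dset_cells])
  show "Fd n ~= {}" using w by blast
  show "EX P:cells (Fd n). snd ` I ` rl ta <= P" if "ta:{ta:spx sg. ta ~= sg}" for ta
  proof -
  from I[of ta] that have "Good th ta I" by simp
  then obtain rh where "rh:spx (Fd n)" "!!x. x:rl ta==>snd (I x):rl rh" by(rule GoodE) blast
  thus ?thesis by(intro bexI[of _ "rl rh"]) (auto simp: cells_def)
  qed
 qed (simp add: fin_spx[OF fin(1)])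
 then obtain rh where rh: "rh:spx (Fd n)" and "\<Union>((%ta. snd ` I ` rl ta) ` {ta:spx sg. ta ~= sg}) <= rl rh" unfolding cells_def by(elim bexE imageE) simp
 hence rhb: "snd (I x):rl rh" if "x:bdry sg" for x using that by(auto simp: boundary_def UN_subset_iff image_subset_iff)
 let ?rh = "insert ?w rh"
 have rh': "?rh:spx (Fd n)" using rh w by(auto simp: sx_def)
 have hx: "snd (h x) = 1 & fst (h x):rl sg \<or> fst (h x):bdry sg & snd (h x):{0..1}" if "x:rl sg" for x
  using funcset_mem[OF h(2) that] by(auto simp: mem_Times_iff)
 have J: "(EX ta:spx sg. ?J x:rl ta \<times> rl (n `` {th ta})) & ?J x:rl sg \<times> rl ?rh" if x: "x:rl sg" for x
 proof -
  have sgsg: "sg:spx sg" using fin by(simp add: sx_def)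
  show ?thesis using hx[OF x]
  proof
  assume "snd (h x) = 1 & fst (h x):rl sg"
  thus ?thesis using w sgsg by(intro conjI bexI[of _ sg]) (auto simp: theta_path_def)
  next
  assume b: "fst (h x):bdry sg & snd (h x):{0..1}"
  obtain p q where pq: "I (fst (h x)) = (p, q)" by(metis surj_pair)
  obtain ta where ta: "ta:spx sg" "p:rl ta" "q:rl (n `` {th ta})" using IX[OF conjunct1[OF b]] pq by auto
  have q: "q:rl rh" using rhb[OF conjunct1[OF b]] pq by simp
  have 1: "segment t q (vertex ?w):rl (n `` {th ta}) Int rl ?rh" if "t:{0..1}" for t
  using that ta thcD(2)[OF th sg ta(1)] subsetD[OF rl_mono q, of ?rh] by(auto intro!: rl_seg)
  have 2: "segment t p (fst (h x)):rl sg" if "t:{0..1}" for t using that ta rs[OF ta(1)] b bdry_sub by(intro rl_seg) auto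
  show ?thesis
  proof(cases "snd (h x) <= 1/2")
  case True
  thus ?thesis using b 1[of "2 * snd (h x)"] ta rs[OF ta(1)] pq by(intro conjI bexI[of _ ta]) (auto simp: theta_path_def)
  next
  case False
  thus ?thesis using b w 2[of "2 * snd (h x) - 1"] sgsg pq by(intro conjI bexI[of _ sg]) (auto simp: theta_path_def)
  qed
  qed
 qed
 have "con_on (rl sg) ?J"
 proof(rule cone_ext_cont[where e = "%y p. theta_path p y (vertex ?w)" and ?e1.0 = "%y. (y, vertex ?w)"
  and P = UNIV, OF fin(1) h Ib])
  show "con_on ((bdry sg \<times> UNIV) \<times> {0..1}) (%w. theta_path (snd (fst w)) (fst (fst w)) (vertex ?w) (snd w))"
  unfolding theta_path_two_stage by(rule cont_on_two_stage[where Q = UNIV])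
  (auto intro!: cont_on_seg continuous_on_fst continuous_on_snd continuous_on_id continuous_on_const)
 qed (auto simp: theta_path_def intro!: continuous_on_Pair continuous_on_id continuous_on_const)
 thus ?thesis using J rh' unfolding Good_def by blast
qed

text \<open>The recursion equation is made part of the property extended over skeleta, the
  subcomplex being the set of vertices; the maps \<open>h sg\<close> are the cone maps.\<close>

lemma Thm_nonempty: "Theta_maps m n ~= {}"
proof -
 obtain th where th: "theta_choice m n th" using thc_exists by blast
 define Q where "Q sg I <-> Good th sg I & (card sg >= 2 --> (EX h. con_on (rl sg) h &
  h:rl sg \<rightarrow> rl sg \<times> {1} Un bdry sg \<times> {0..1::real} & (ALL x:bdry sg. h x = (x, 0)) &
  (ALL x:rl sg. I x = theta_path (I (fst (h x))) (fst (h x)) (vertex (th sg)) (snd (h x)))))" for sg I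
 define I0 where "I0 x = (x, vertex (th (supp x)))" for x
 obtain I where I: "!!sg x. [|sg:(%k. {k}) ` Fd (m ## n); x:rl sg|]==>I x = I0 x" "!!sg. sg:spx (Fd (m ## n))==>Q sg I"
 proof(rule skeleton_ext[of Q "(%k. {k}) ` Fd (m ## n)" I0 "Fd (m ## n)"])
  show "Q sg J" if eq: "!!x. x:rl sg==>J x = I x" and Q: "Q sg I" for sg I J unfolding Q_def
  proof(intro conjI impI)
  show "Good th sg J" using Q by(intro Good_cong[of sg J I th, OF eq]) (auto simp: Q_def)
  assume "2 <= card sg"
  then obtain h where h: "con_on (rl sg) h" "h:rl sg \<rightarrow> rl sg \<times> {1} Un bdry sg \<times> {0..1::real}" "ALL x:bdry sg. h x = (x, 0)"
  "!!x. x:rl sg==>I x = theta_path (I (fst (h x))) (fst (h x)) (vertex (th sg)) (snd (h x))" using Q unfolding Q_def by blast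
  have hx: "fst (h x):rl sg" if "x:rl sg" for x using funcset_mem[OF h(2) that] bdry_sub by(auto simp: mem_Times_iff)
  have JJ: "J x = theta_path (J (fst (h x))) (fst (h x)) (vertex (th sg)) (snd (h x))" if "x:rl sg" for x
  unfolding eq[OF that] eq[OF hx[OF that]] by(rule h(4)[OF that])
  show "EX h. con_on (rl sg) h &
  h:rl sg \<rightarrow> rl sg \<times> {1} Un bdry sg \<times> {0..1::real} & (ALL x:bdry sg. h x = (x, 0)) &
  (ALL x:rl sg. J x = theta_path (J (fst (h x))) (fst (h x)) (vertex (th sg)) (snd (h x)))" by(intro exI[of _ h] conjI h(1-3) ballI JJ)
  qed
  show "ta:(%k. {k}) ` Fd (m ## n)" if "sg:(%k. {k}) ` Fd (m ## n)" "ta:spx sg" for sg ta using that by(auto simp: sx_def subset_singleton_iff)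
  show "Q sg I0" if "sg:(%k. {k}) ` Fd (m ## n)" for sg using that Good_vtx[OF th, of _ I0] by(auto simp: Q_def I0_def)
  show "EX J. (ALL x:bdry sg. J x = I x) & Q sg J" if sg: "sg:spx (Fd (m ## n))" and I: "!!ta. [|ta:spx sg; ta ~= sg|]==>Q ta I" for sg I
  proof -
  have fin: "finite sg" "sg ~= {}" using sg by(auto simp: sx_def)
  obtain h where h: "con_on (rl sg) h" "h:rl sg \<rightarrow> rl sg \<times> {1} Un bdry sg \<times> {0..1::real}"
  "!!x. x:bdry sg==>h x = (x, 0)" using cone_map[OF fin] by blast
  define J where "J x = theta_path (I (fst (h x))) (fst (h x)) (vertex (th sg)) (snd (h x))" for x
  have J: "Good th sg J" unfolding J_def by(rule Good_step[OF th sg _ h(1,2)]) (use I in "auto simp: Q_def")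
  have JI: "J x = I x" if "x:bdry sg" for x using h(3)[OF that] by(simp add: J_def theta_path_def)
  \<comment> \<open>The equation has to mention \<open>J\<close> itself. For time different from 1
    it refers to boundary points, where \<open>J\<close> is \<open>I\<close>; at time 1
    \<open>theta_path\<close> ignores its first argument.\<close>
  have JJ: "J x = theta_path (J (fst (h x))) (fst (h x)) (vertex (th sg)) (snd (h x))" if x: "x:rl sg" for x
  proof(cases "snd (h x) = 1")
  case True
  thus ?thesis by(simp add: J_def theta_path_def)
  next
  case False
  hence "fst (h x):bdry sg" using funcset_mem[OF h(2) x] by(auto simp: mem_Times_iff)
  thus ?thesis using JI unfolding J_def by simp
  qed
  show ?thesis unfolding Q_def by(intro exI[of _ J] conjI impI exI[of _ h] J ballI JI h JJ)
  qed
 qed blast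
 have "EX h. ALL sg:spx (Fd (m ## n)). card sg >= 2 -->
  con_on (rl sg) (h sg) &
  h sg:rl sg \<rightarrow> rl sg \<times> {1} Un bdry sg \<times> {0..1::real} & (ALL x:bdry sg. h sg x = (x, 0)) &
  (ALL x:rl sg. I x = theta_path (I (fst (h sg x))) (fst (h sg x)) (vertex (th sg)) (snd (h sg x)))" by(rule bchoice) (use I(2) in "simp add: Q_def")
 moreover have "I x:X_theta m n th" if x: "x:rl (Fd (m ## n))" for x
 proof -
  have "Good th (supp x) I" using I(2)[OF supp_spx[OF x]] by(simp add: Q_def)
  then obtain ta where "ta:spx (supp x)" "fst (I x):rl ta & snd (I x):rl (n `` {th ta})" by(rule GoodE) (use rl_supp[OF x] in blast)
  moreover have "spx (supp x) <= spx (Fd (m ## n))" by(rule spx_mono[OF supp_sub[OF x]])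
  ultimately show ?thesis unfolding X_theta_def by(intro UN_I[of ta]) (auto simp: mem_Times_iff)
 qed
 moreover have "I (vertex k) = (vertex k, vertex (th {k}))" if "k:Fd (m ## n)" for k using I(1)[of "{k}" "vertex k"] that by(simp add: I0_def)
 ultimately have "I:I_theta m n th" unfolding I_theta_def by(simp add: case_prod_unfold)
 with th show ?thesis unfolding Theta_maps_def by blast
qed

text \<open>The equations in \<open>I_theta\<close> determine the map on a simplex from its
  boundary, so \<open>Good_step\<close> applies to an arbitrary member and not just to the one
  constructed above.\<close>

lemma I_theta_Good: assumes th: "theta_choice m n th" and I: "I:I_theta m n th" shows "sg:spx (Fd (m ## n))==>Good th sg I"
proof(induction "card sg" arbitrary: sg rule: less_induct)
 case less
 have fin: "finite sg" "sg ~= {}" "sg <= Fd (m ## n)" using less.prems by(auto simp: sx_def)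
 show ?case
 proof(cases "card sg >= 2")
  case False
  hence "card sg = 1" using fin by(metis card_0_eq less_2_cases not_le One_nat_def)
  then obtain k where "sg = {k}" by(rule card_1_singletonE)
  thus ?thesis using Good_vtx[OF th, of k I] fin I by(simp add: I_theta_def)
 next
  case True
  obtain h where h: "con_on (rl sg) h" "h:rl sg \<rightarrow> rl sg \<times> {1} Un bdry sg \<times> {0..1::real}"
  "!!x. x:rl sg==>I x = theta_path (I (fst (h x))) (fst (h x)) (vertex (th sg)) (snd (h x))"
  using I True less.prems unfolding I_theta_def case_prod_unfold by blast
  have "Good th ta I" if "ta:spx sg" "ta ~= sg" for ta
  proof(rule less.hyps)
  show "card ta < card sg" using that fin(1) by(intro psubset_card_mono) (auto simp: sx_def)
  show "ta:spx (Fd (m ## n))" using subsetD[OF spx_mono[OF fin(3)] that(1)] .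
  qed
  from Good_cong[OF h(3) Good_step[OF th less.prems this h(1,2)]] show ?thesis .
 qed
qed

definition Thc where "Thc th sg = (UN ta:spx sg. rl (fst ` ta) \<times> rl (n `` {th ta}))" for th::"('i*('i set=>'j)) set=>'j"

lemma Thm_cA: assumes "Th:Theta_maps m n"
 obtains th where "theta_choice m n th" "pmap (cells (Fd (m ## n))) (pprod (cells (Fd m)) (cells (Fd n))) Th"
  "!!sg. sg:spx (Fd (m ## n))==>Th ` rl sg <= Thc th sg"
proof -
 obtain th I where th: "theta_choice m n th" and I: "I:I_theta m n th" and Th: "Th = (%p. map_prod (aff fst) id (I p))"
  using assms unfolding Theta_maps_def by blast
 have aff: "aff fst p:rl (fst ` ta)" if "p:rl ta" for p::"'i*('i set=>'j)=>real" and ta using that by(intro aff_rl[OF that]) (auto dest: supp_sub)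
 have Th': "Th = (%p. (aff fst (fst (I p)), snd (I p)))" by(simp add: Th map_prod_def case_prod_unfold)
 show thesis
 proof(rule that[OF th])
  fix sg assume sg: "sg:spx (Fd (m ## n))"
  show "Th ` rl sg <= Thc th sg"
  proof(rule image_subsetI)
  fix x assume "x:rl sg"
  then obtain ta where ta: "ta:spx sg" "fst (I x):rl ta & snd (I x):rl (n `` {th ta})" by(rule_tac GoodE[OF I_theta_Good[OF th I sg]]) blast
  thus "Th x:Thc th sg" unfolding Thc_def Th' by(intro UN_I[of ta]) (auto intro: aff)
  qed
 next
  show "pmap (cells (Fd (m ## n))) (pprod (cells (Fd m)) (cells (Fd n))) Th" unfolding pmap_def
  proof
  fix P assume "P:cells (Fd (m ## n))"
  then obtain sg where sg: "sg:spx (Fd (m ## n))" "P = rl sg" by(auto simp: cells_def)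
  have fin: "finite sg" using sg by(simp add: sx_def)
  obtain rh where rh: "con_on P I" "rh:spx (Fd n)" "!!x. x:P==>fst (I x):P & snd (I x):rl rh" by(rule GoodE[OF I_theta_Good[OF th I sg(1)]]) (auto simp: sg(2))
  have "con_on P (%p. aff fst (fst (I p)))" by(rule continuous_on_compose2[OF cont_on_aff[OF fin] continuous_on_fst[OF rh(1)]]) (use rh(3) sg(2) in auto)
  hence "con_on P Th" unfolding Th' by(intro continuous_on_Pair continuous_on_snd rh(1))
  moreover have "Th ` P <= rl (fst ` sg) \<times> rl rh" using rh(3) aff unfolding Th' sg(2) by auto
  ultimately show "EX Q:pprod (cells (Fd m)) (cells (Fd n)). Th ` P <= Q & con_on P Th"
  using rh(2) spx_fst[OF sg(1)] by(intro bexI[of _ "rl (fst ` sg) \<times> rl rh"]) (auto simp: pprod_def cells_def)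
  qed
 qed
qed

text \<open>The support of \<open>p\<close> is the image of some \<open>rh\<close> contained in
  \<open>ta\<close>. By the two conditions on \<open>th\<close>, the element required over that
  support lies below \<open>th rh\<close>, which lies below \<open>th ta\<close>; here both
  conditions come together.\<close>

lemma Thc_tail: assumes th: "theta_choice m n th" and sg: "sg:spx ((m ## n) `` {v})" shows "Thc th sg <= ptails m (tls n) v"
proof
 fix z assume "z:Thc th sg"
 then obtain ta p q where ta: "ta:spx sg" and z: "z = (p, q)" and p: "p:rl (fst ` ta)" and q: "q:rl (n `` {th ta})" unfolding Thc_def by blast
 have tav: "ta <= (m ## n) `` {v}" and fin: "finite ta" using ta sg by(auto simp: sx_def)
 hence taF: "ta:spx (Fd (m ## n))" using ta by(auto simp: sx_def intro: FieldI2)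
 have "fst ` ta <= m `` {fst v}" using tav by(auto simp: sharp_def)
 hence 1: "p:tls m (fst v)" unfolding tls_def using subsetD[OF rl_mono p] by blast
 obtain rh where rh: "rh <= ta" "supp p = fst ` rh" using supp_sub[OF p] by(metis subset_imageE)
 hence rhs: "rh:spx ta" "rh:spx (Fd (m ## n))" using supp_nonempty[OF p] taF by(auto simp: sx_def finite_subset)
 obtain x xi where x: "(x, xi):rh" using rhs(1) by(auto simp: sx_def)
 have "((fst v, snd v), (x, xi)):m ## n" using x rh(1) tav by auto
 hence "(snd v (supp p), xi (supp p)):n" using spx_fst[OF rhs(2)] rh(2) by(auto simp: sharp_def)
 moreover have "(xi (supp p), th rh):n" "(th rh, th ta):n" using thcD(3)[OF th rhs(2) x] thcD(2)[OF th taF rhs(1)] rh(2) by simp_all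
 ultimately have "(snd v (supp p), th ta):n" using dset_trans[OF n] by blast
 hence "n `` {th ta} <= n `` {snd v (supp p)}" using dset_trans[OF n] by blast
 hence "q:tls n (snd v (supp p))" unfolding tls_def using subsetD[OF rl_mono q] by blast
 with 1 show "z:ptails m (tls n) v" by(simp add: z ptails_def)
qed

text \<open>The union of the two carriers contracts by a single \<open>theta_path\<close>, whose
  target \<open>w\<close> lies above \<open>th sg\<close> and \<open>th' sg\<close>. The homotopy
  lives over \<open>m ## n\<close> itself and not over a refinement, because
  \<open>simpl_comp\<close> must be a single class over \<open>m ## n\<close>.\<close>

lemma Thm_htpc: assumes "Th:Theta_maps m n" "Th':Theta_maps m n" shows "htpc (Fd (m ## n)) (sfil (m ## n)) (pprod (cells (Fd m)) (cells (Fd n)))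
  (tfil (m ## n) (ptails m (tls n))) Th Th'"
proof -
 note ds = dset_sharp[OF m n]
 obtain th where th: "theta_choice m n th" "pmap (cells (Fd (m ## n))) (pprod (cells (Fd m)) (cells (Fd n))) Th"
  "!!sg. sg:spx (Fd (m ## n))==>Th ` rl sg <= Thc th sg" by(rule Thm_cA[OF assms(1)]) blast
 obtain th' where th': "theta_choice m n th'" "pmap (cells (Fd (m ## n))) (pprod (cells (Fd m)) (cells (Fd n))) Th'"
  "!!sg. sg:spx (Fd (m ## n))==>Th' ` rl sg <= Thc th' sg" by(rule Thm_cA[OF assms(2)]) blast
 define K where "K sg = Thc th sg Un Thc th' sg" for sg
 let ?PP = "pprod (cells (Fd m)) (cells (Fd n))"
 have "EX H. pmap ((%P. P \<times> {0..1::real}) ` cells (Fd (m ## n))) ?PP H & (ALL p:rl (Fd (m ## n)). H (p, 0) = Th p & H (p, 1) = Th' p) &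
  (ALL sg:spx (Fd (m ## n)). ALL p:rl sg. ALL t:{0..1}. H (p, t):K sg)"
 proof(rule cA_htpy[where K = K and PP = ?PP])
  show "up_directed ?PP" using dset_ne[OF m] dset_ne[OF n] by(intro up_dset_pprod up_dset_cells) blast+
  show "K ta <= K sg" if "ta <= sg" for ta sg using spx_mono[OF that] unfolding K_def Thc_def by blast
  fix sg assume sg: "sg:spx (Fd (m ## n))"
  show "Th ` rl sg <= K sg" "Th' ` rl sg <= K sg" using th(3)[OF sg] th'(3)[OF sg] by(auto simp: K_def)
  fix P assume "P : ?PP"
  then obtain rh rh' where rh: "rh:spx (Fd m)" "rh':spx (Fd n)" "P = rl rh \<times> rl rh'" by(auto simp: pprod_def cells_def)
  obtain w where w: "w:Fd n" "(th sg, w):n" "(th' sg, w):n" using dset_ub[OF n thcD(1)[OF th(1) sg] thcD(1)[OF th'(1) sg]] by blast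
  obtain v where v: "v:fst ` sg" using sg by(auto simp: sx_def)
  let ?P' = "rl (fst ` sg Un rh) \<times> rl (insert w rh')"
  let ?c = "%z. theta_path z (vertex v) (vertex w)"
  have P': "?P' : ?PP"
  proof -
  have "fst ` sg Un rh:spx (Fd m)" using rh(1) spx_fst[OF sg] by(simp add: sx_def)
  moreover have "insert w rh':spx (Fd n)" using rh(2) w(1) by(simp add: sx_def)
  ultimately show ?thesis by(force simp: pprod_def cells_def)
  qed
  have *: "?c z t:Thc et sg" if et: "theta_choice m n et" "(et sg, w):n" and z: "z:Thc et sg" and t: "t:{0..1}" for et z t
  proof -
  obtain ta p q where ta: "ta:spx sg" "z = (p, q)" "p:rl (fst ` ta)" "q:rl (n `` {et ta})" using z unfolding Thc_def by blast
  have sgsg: "sg:spx sg" using sg by(simp add: sx_def)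
  have "(et ta, w):n" using dset_trans[OF n thcD(2)[OF et(1) sg ta(1)] et(2)] .
  hence 1: "segment s q (vertex w):rl (n `` {et ta})" if "s:{0..1}" for s using ta(4) that by(intro rl_seg) auto
  have "p:rl (fst ` sg)" using ta(1) by(intro subsetD[OF rl_mono ta(3)]) (auto simp: sx_def)
  hence 2: "segment s p (vertex v):rl (fst ` sg)" if "s:{0..1}" for s using v that by(intro rl_seg) auto
  show ?thesis
  proof(cases "t <= 1/2")
  case True
  thus ?thesis using ta 1[of "2 * t"] t unfolding Thc_def by(intro UN_I[OF ta(1)]) (simp add: theta_path_def)
  next
  case False
  thus ?thesis using 2[of "2 * t - 1"] t ta(2) et(2) unfolding Thc_def by(intro UN_I[OF sgsg]) (simp add: theta_path_def)
  qed
  qed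
  have P'c: "?c z t : ?P'" if z: "z:P" and t: "t:{0..1}" for z t
  proof -
  obtain p q where pq: "z = (p, q)" "p:rl (fst ` sg Un rh)" "q:rl (insert w rh')" using z rh(3) by(auto intro: subsetD[OF rl_mono])
  hence "segment s p (vertex v):rl (fst ` sg Un rh)" "segment s q (vertex w):rl (insert w rh')" if "s:{0..1}" for s using that v by(intro rl_seg; auto)+
  from this[of "2 * t"] this[of "2 * t - 1"] show ?thesis using t pq by(auto simp: theta_path_def)
  qed
  have "contracts ?c P (K sg) ?P' (vertex v, vertex w)" unfolding contracts_def
  proof(intro conjI ballI)
  show "con_on ((P Int K sg) \<times> {0..1}) (%z. ?c (fst z) (snd z))" unfolding theta_path_two_stage by(rule cont_on_two_stage[where Q = UNIV])
  (auto intro!: cont_on_seg continuous_on_fst continuous_on_snd continuous_on_id continuous_on_const)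
  fix z assume z: "z:P Int K sg"
  show "?c z 0 = z" "?c z 1 = (vertex v, vertex w)" by(simp_all add: theta_path_def)
  show "?c z t : ?P' Int K sg" if t: "t:{0..1}" for t using z P'c[OF _ t] *[OF th(1) w(2) _ t] *[OF th'(1) w(3) _ t] unfolding K_def by blast
  qed
  with P' show "EX P':?PP. EX c z0. contracts c P (K sg) P' z0" by blast
 qed (fact | blast)+
 then obtain H where H: "pmap ((%P. P \<times> {0..1::real}) ` cells (Fd (m ## n))) ?PP H" "ALL p:rl (Fd (m ## n)). H (p, 0) = Th p & H (p, 1) = Th' p"
  and HK: "!!sg p t. [|sg:spx (Fd (m ## n)); p:rl sg; t:{0..1}|]==>H (p, t):K sg" by blast
 have "filterlim H (tfil (m ## n) (ptails m (tls n))) (sfil (m ## n) \<times>\<^sub>F principal {0..1})" unfolding flim_tfil ev_prod_princ ev_sfil[OF ds]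
 proof
  fix v assume v: "v:Fd (m ## n)"
  have "H (p, t):ptails m (tls n) v" if p: "p:rl ((m ## n) `` {v})" and t: "t:{0..1}" for p t
  proof -
  have "supp p:spx (Fd (m ## n))" using supp_spx[OF p] by(auto simp: sx_def intro: FieldI2)
  from HK[OF this rl_supp[OF p] t] show ?thesis using Thc_tail[OF th(1) supp_spx[OF p]] Thc_tail[OF th'(1) supp_spx[OF p]] unfolding K_def by blast
  qed
  with v show "EX x:Fd (m ## n). ALL p:rl ((m ## n) `` {x}). ALL t:{0..1}. H (p, t):ptails m (tls n) v" by blast
 qed
 with H show ?thesis unfolding htpc_def by blast
qed

lemma Thm_flim: assumes "Th:Theta_maps m n" shows "pmap (cells (Fd (m ## n))) (pprod (cells (Fd m)) (cells (Fd n))) Th"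
  "filterlim Th (tfil (m ## n) (ptails m (tls n))) (sfil (m ## n))"
proof -
 obtain th where th: "theta_choice m n th" "pmap (cells (Fd (m ## n))) (pprod (cells (Fd m)) (cells (Fd n))) Th"
  "!!sg. sg:spx (Fd (m ## n))==>Th ` rl sg <= Thc th sg" by(rule Thm_cA[OF assms]) blast
 show "pmap (cells (Fd (m ## n))) (pprod (cells (Fd m)) (cells (Fd n))) Th" by(rule th)
 show "filterlim Th (tfil (m ## n) (ptails m (tls n))) (sfil (m ## n))" unfolding flim_tfil ev_sfil[OF dset_sharp[OF m n]]
 proof
  fix v assume v: "v:Fd (m ## n)"
  have "Th p:ptails m (tls n) v" if p: "p:rl ((m ## n) `` {v})" for p
  proof -
  have "supp p:spx (Fd (m ## n))" using supp_spx[OF p] by(auto simp: sx_def intro: FieldI2)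
  thus ?thesis using th(3) rl_supp[OF p] Thc_tail[OF th(1) supp_spx[OF p]] by blast
  qed
  with v show "EX x:Fd (m ## n). ALL p:rl ((m ## n) `` {x}). Th p:ptails m (tls n) v" by blast
 qed
qed

end

section \<open>Change of index type\<close>

definition small::"'y itself=>'s set=>bool" where "small Y S <-> (EX h::'s=>'y. inj_on h S)"

lemma small_iff: "small (Y::'y itself) S <-> (card_of S, card_of (UNIV::'y set)):ordLeq" unfolding card_of_ordLeq[symmetric] small_def by simp

lemma small_sub: "small Y S==>T <= S==>small Y T" unfolding small_def using inj_on_subset by blast

lemma small_image: "small Y S==>small Y (h ` S)" unfolding small_iff using card_of_image ordLeq_transitive by blast

text \<open>Expresses that \<open>Q\<close> depends on a small set of eventual statements, so that
  \<open>F0\<close> may be replaced by a filter with a small set of generators.\<close>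

definition conds::"'y itself=>'x filter=>('x filter=>bool)=>bool" where
 "conds Y F0 Q <-> (EX E. small Y E & (ALL P:E. eventually P F0) & (ALL F. (ALL P:E. eventually P F) --> Q F))"

lemma conds_mono: "[|conds Y F0 Q; !!F. Q F==>R F|]==>conds Y F0 R" unfolding conds_def by blast

lemma conds_event: "eventually P F0==>conds Y F0 (eventually P)" unfolding conds_def small_def by(rule exI[of _ "{P}"]) auto

lemma conds_trivial: "(!!F. Q F)==>conds Y F0 Q" unfolding conds_def small_def by(rule exI[of _ "{}"]) auto

context
 fixes Y::"'y itself" assumes inf: "infinite (UNIV::'y set)"
begin

lemma small_UN: "[|small Y I; !!i. i:I==>small Y (S i)|]==>small Y (UN i:I. S i)" unfolding small_iff using inf by(intro card_of_UNION_ordLeq_infinite) auto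

lemma small_nat: "small Y (S::nat set)"
proof(rule small_sub[OF _ subset_UNIV])
 obtain h::"nat=>'y" where "inj h" using infinite_countable_subset[OF inf] by blast
 thus "small Y (UNIV::nat set)" unfolding small_def by blast
qed

lemma small_fin: "finite S==>small Y S" using finite_imp_inj_to_nat_seg[of S] small_nat inj_on_def unfolding small_def
 by(metis comp_inj_on inj_on_subset subset_UNIV)

lemma small_Un: "[|small Y S; small Y T|]==>small Y (S Un T)"
 using small_UN[of "UNIV::bool set" "%b. if b then S else T"] small_fin[of "UNIV::bool set"] by(simp add: UNIV_bool Un_commute)

lemma small_Times: "[|small Y S; small Y T|]==>small Y (S \<times> T)"
proof -
 assume "small Y S" "small Y T"
 hence "small Y (UN x:S. Pair x ` T)" by(intro small_UN small_image)
 also have "(UN x:S. Pair x ` T) = S \<times> T" by auto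
 finally show ?thesis .
qed

lemma conds_ball: assumes "small Y I" "!!i. i:I==>conds Y F0 (Q i)" shows "conds Y F0 (%F. ALL i:I. Q i F)"
proof -
 have "ALL i:I. EX E. small Y E & (ALL P:E. eventually P F0) & (ALL F. (ALL P:E. eventually P F) --> Q i F)" using assms(2) unfolding conds_def by blast
 from bchoice[OF this] obtain E where
  E: "ALL i:I. small Y (E i) & (ALL P:E i. eventually P F0) & (ALL F. (ALL P:E i. eventually P F) --> Q i F)" ..
 have "small Y (UN i:I. E i)" by(rule small_UN[OF assms(1)]) (use E in simp)
 thus ?thesis unfolding conds_def using E by(intro exI[of _ "UN i:I. E i"]) simp
qed

lemma conds_conj: "[|conds Y F0 Q; conds Y F0 R|]==>conds Y F0 (%F. Q F & R F)"
proof -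
 assume "conds Y F0 Q" "conds Y F0 R"
 hence ifc: "conds Y F0 (if b then Q else R)" for b by simp
 have "conds Y F0 (%F. ALL b:UNIV. (if b then Q else R) F)" by(rule conds_ball[OF small_fin]) (rule finite, rule ifc)
 thus ?thesis by(rule conds_mono) (metis (full_types) UNIV_I)
qed

lemma conds_aeq: assumes B: "gpre G B" and eq: "aeq F0 B u v" shows "conds Y F0 (%F. aeq F B u v)"
proof(rule conds_mono[OF conds_ball[OF small_nat[of UNIV]]])
 note B' = gpre_pre_cstar[OF B]
 show "conds Y F0 (eventually (%x. cdist B (u x) (v x) < 1 / Suc N))" for N by(rule conds_event[OF pre_cstar.aeqD[OF B' eq]]) simp
 fix F assume *: "ALL N:UNIV. \<forall>\<^sub>F x in F. cdist B (u x) (v x) < 1 / Suc N"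
 show "aeq F B u v"
 proof(rule pre_cstar.aeqI[OF B'])
  fix ep::real assume "0 < ep"
  then obtain N where "1 / Suc N < ep" using nat_approx_posE by blast
  with * show "\<forall>\<^sub>F x in F. cdist B (u x) (v x) <= ep" by(auto elim!: eventually_mono dest: spec[of _ N])
 qed
qed

text \<open>The scalars are the obstacle, as \<open>'y\<close> may be countable. For nonzero
  \<open>a\<close> the scalar \<open>c\<close> is determined by the pair of \<open>a\<close> and
  \<open>cscale A c a\<close>, so these conditions are indexed by pairs of elements of
  \<open>A\<close>; for \<open>a = 0\<close> the single condition that \<open>f\<close> of zero
  tends to zero takes care of all scalars.\<close>

lemma conds_amor: fixes A::"('g, 'a) galg" assumes A: "gpre G A" and B: "gpre G B" and f: "amor G A B X F0 f" and F0: "fspace X F0"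
  and sA: "small Y (cA A)" and sG: "small Y (cA G)" shows "conds Y F0 (%F. amor G A B X F f)"
proof -
 interpret A: gpre G A by(rule A)
 interpret B: gpre G B by(rule B)
 define Q where "Q = opcs G - range Scale"
 let ?c = "%F q a b. aeq F B (f (opn A q a b)) (%p. opn B q (f a p) (f b p))"
 have "Q = {Add, Mult, Star, Grade} Un Act ` cA G" by(auto simp: Q_def opcs_def)
 hence sQ: "small Y Q" using small_Un[OF small_fin[of "{Add, Mult, Star, Grade}"] small_image[OF sG, of Act]] by simp
 have Qo: "Q <= opcs G" by(simp add: Q_def)
 have 1: "conds Y F0 (%F. ALL q:Q. ALL a:cA A. ALL b:cA A. ?c F q a b)" using Qo amorD(2)[OF f] by(intro conds_ball sQ sA conds_aeq[OF B]) auto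
 have 2: "conds Y F0 (%F. ALL a:cA A. ALL b:cA A. ALL c. a ~= czero A --> b = cscale A c a --> ?c F (Scale c) a a)"
 proof(intro conds_ball sA)
  fix a b assume ab: "a:cA A" "b:cA A"
  show "conds Y F0 (%F. ALL c. a ~= czero A --> b = cscale A c a --> ?c F (Scale c) a a)"
  proof(cases "EX c. a ~= czero A & b = cscale A c a")
  case True
  then obtain c where c: "a ~= czero A" "b = cscale A c a" by blast
  have "c' = c" if "b = cscale A c' a" for c'
  proof -
  have "cscale A (c - c') a = czero A"
  using A.scale_add_left[OF ab(1), of c "- c'"] A.scale_scale[OF ab(1), of "- 1" c'] A.minus_self[OF ab(2)] c(2) that by(simp add: cminus_def)
  hence "cmod (c - c') * cnorm A a = 0" using A.norm_scale[OF ab(1), of "c - c'"] A.norm_eq_zero[OF A.zero_closed] by simp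
  thus ?thesis using c(1) A.norm_eq_zero[OF ab(1)] by simp
  qed
  moreover have "?c F0 (Scale c) a a" by(rule amorD(2)[OF f _ ab(1,1)]) (simp add: opcs_def)
  ultimately show ?thesis by(intro conds_mono[OF conds_aeq[OF B]]) blast+
  qed (auto intro: conds_trivial)
 qed
 have S0: "Scale 0:opcs G" by(simp add: opcs_def)
 have z: "cscale A 0 (czero A) = czero A" "cscale B c (czero B) = czero B" for c by simp_all
 have "?c F0 (Scale 0) (czero A) (czero A)" by(rule amorD(2)[OF f S0]) simp_all
 hence "aeq F0 B (f (czero A)) (%p. czero B)" using z(1) F0 amorD(1)[OF f A.zero_closed]
  by(elim iffD1[OF aeq_cong, rotated -1]) (auto simp: fspace_def elim!: eventually_mono)
 note 3 = conds_aeq[OF B this] and 4 = conds_event[OF F0[unfolded fspace_def]]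
 show ?thesis
 proof(rule conds_mono[OF conds_conj[OF conds_conj[OF 1 2] conds_conj[OF 3 4]]])
  fix F assume *: "((ALL q:Q. ALL a:cA A. ALL b:cA A. ?c F q a b) & (ALL a:cA A. ALL b:cA A. ALL c. a ~= czero A --> b = cscale A c a --> ?c F (Scale c) a a)) &
  aeq F B (f (czero A)) (%p. czero B) & (\<forall>\<^sub>F x in F. x:tsp X)"
  have fv: "\<forall>\<^sub>F p in F. f (czero A) p:cA B"
  using conjunct2[OF conjunct2[OF *]] by eventually_elim (rule B.Cb_val[OF amorD(1)[OF f A.zero_closed]])
  have "?c F (Scale c) a b" if a: "a:cA A" "b:cA A" for c a b
  proof(cases "a = czero A")
  case True
  have nb: "\<forall>\<^sub>F p in F. cnorm B (f (czero A) p) <= cnorm (Cb X B) (f (czero A))"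
  using conjunct2[OF conjunct2[OF *]] by eventually_elim (rule B.nval_le[OF amorD(1)[OF f A.zero_closed]])
  have nz: "cnorm B (czero B) <= cnorm (Cb X B) (f (czero A))" using B.norm_eq_zero[OF B.zero_closed] B.norm_Cb_ge0[OF amorD(1)[OF f A.zero_closed]] by simp
  have "aeq F B (%p. opn B (Scale c) (f (czero A) p) (f (czero A) p)) (%p. opn B (Scale c) (czero B) (czero B))"
  by(rule B.aeq_opn[OF _ _ _ _ nb]) (use * fv nz in "auto simp: opcs_def elim!: eventually_mono")
  from B.aeq_sym[OF this] have "aeq F B (%p. czero B) (%p. opn B (Scale c) (f a p) (f b p))" using True by simp
  moreover have "\<forall>\<^sub>F p in F. f (czero A) p:cA B & czero B:cA B & opn B (Scale c) (f a p) (f b p):cA B"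
  using fv by eventually_elim (use True B.scale_closed in simp)
  ultimately show ?thesis using * B.aeq_trans[of F "f (czero A)" "%p. czero B" "%p. opn B (Scale c) (f a p) (f b p)"] True by simp
  next
  case False
  hence "?c F (Scale c) a a" using conjunct2[OF conjunct1[OF *], rule_format, OF a(1) A.scale_closed[OF a(1)]] by blast
  thus ?thesis by simp
  qed
  hence "?c F q a b" if "q:opcs G" "a:cA A" "b:cA A" for q a b using * that by(cases "q:Q") (auto simp: Q_def)
  thus "amor G A B X F f" using amorD(1)[OF f] unfolding amor_def by blast
 qed
qed

text \<open>One element of \<open>k\<close> for each condition suffices. The set \<open>W\<close> is
  kept inside \<open>U\<close> so that given maps out of \<open>k\<close> can remain cofinal after
  the reduction.\<close>

lemma conds_ufilter: assumes k: "dset k" and Q: "conds Y (sfil k) Q" and W: "small Y W" "W <= Fd k" shows "EX U<=Fd k. W <= U & small Y U & Q (ufilter k U)"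
proof -
 obtain E where E: "small Y E" "ALL P:E. eventually P (sfil k)" "!!F. (ALL P:E. eventually P F)==>Q F" using Q unfolding conds_def by blast
 have "ALL P:E. EX x. x:Fd k & (ALL z:rl (k `` {x}). P z)" using E(2) unfolding ev_sfil[OF k] by blast
 from bchoice[OF this] obtain y where y: "!!P. P:E==>y P:Fd k" "!!P z. [|P:E; z:rl (k `` {y P})|]==>P z" by blast
 let ?U = "W Un y ` E"
 have "eventually P (ufilter k ?U)" if "P:E" for P
 proof -
  have "ufilter k ?U <= principal (rl (k `` {y P}))" unfolding ufilter_def by(rule INF_lower) (use that in blast)
  thus ?thesis using y(2)[OF that] by(simp add: le_principal eventually_mono)
 qed
 hence "Q (ufilter k ?U)" by(intro E(3)) blast
 thus ?thesis using W small_Un[OF W(1) small_image[OF E(1), of y]] y(1) by(intro exI[of _ ?U]) auto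
qed

lemma small_Fpow: assumes U: "small Y U" shows "small Y {F. finite F & F <= U}"
proof -
 define W where "W = rec_nat {{}} (%_ S. (%(x, F). insert x F) ` (U \<times> S))"
 have "small Y (W n)" for n by(induction n) (simp_all add: W_def small_fin small_image[OF small_Times[OF U]])
 hence "small Y (\<Union>n. W n)" by(intro small_UN small_nat)
 moreover have "F:(\<Union>n. W n)" if "finite F" "F <= U" for F using that
 proof induction
  case empty
  show ?case by(rule UN_I[of 0]) (simp_all add: W_def)
 next
  case (insert x F)
  then obtain n where "F:W n" by blast
  thus ?case using insert.prems by(intro UN_I[of "Suc n"]) (auto simp: W_def)
 qed
 ultimately show ?thesis by(auto intro: small_sub)
qed

text \<open>The finite subsets of \<open>U\<close>, ordered by inclusion and transported into
  \<open>'y\<close>; each is sent to one of its upper bounds in \<open>k\<close>.\<close>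

lemma dset_sub: assumes k: "dset k" and U: "U <= Fd k" "small Y U" shows "EX (l::'y rel) ga. dset l & ucofinal l k U ga"
proof -
 define V where "V = {F. finite F & F <= U}"
 have "ALL F:V. EX z:Fd k. ALL x:F. (x, z):k" using dset_fin_ub[OF k] U(1) unfolding V_def by blast
 then obtain u where u: "ALL F:V. u F:Fd k & (ALL x:F. (x, u F):k)" by metis
 obtain j::"_=>'y" where j: "inj_on j V" using small_Fpow[OF U(2)] unfolding small_def V_def by blast
 define l where "l = {(j F, j F') | F F'. F:V & F':V & F <= F'}"
 have jl: "(j F, j F'):l <-> F <= F'" if "F:V" "F':V" for F F' using that j unfolding l_def by(auto simp: inj_on_eq_iff)
 have lV: "EX F:V. EX F':V. w = j F & w' = j F' & F <= F'" if "(w, w'):l" for w w' using that by(auto simp: l_def)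
 have Fl: "Fd l = j ` V" by(auto simp: Field_def l_def)
 have "dset l"
 proof(rule dset_setI)
  have "{}:V" by(simp add: V_def)
  thus "EX w. (w, w):l" using jl by blast
  show "(w, w):l & (w', w'):l" if "(w, w'):l" for w w' using lV[OF that] jl by blast
  show "(w, w''):l" if "(w, w'):l" "(w', w''):l" for w w' w'' using lV[OF that(1)] lV[OF that(2)] that by(auto simp: jl)
  show "EX z. (w, z):l & (w', z):l" if ww: "(w, w):l" "(w', w'):l" for w w'
  proof -
  obtain F F' where F: "F:V" "w = j F" "F':V" "w' = j F'" using lV[OF ww(1)] lV[OF ww(2)] by blast
  hence "F Un F':V" by(auto simp: V_def)
  thus ?thesis using F jl by blast
  qed
 qed
 moreover have "ucofinal l k U (%w. u (inv_into V j w))" unfolding ucofinal_def Fl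
 proof(intro conjI ballI)
  show "(%w. u (inv_into V j w)):j ` V \<rightarrow> Fd k" using j u by(auto simp: inv_into_f_f)
  fix y assume "y:U"
  hence y: "{y}:V" by(simp add: V_def)
  have "(y, u (inv_into V j w)):k" if w: "(j {y}, w):l" for w using lV[OF w] inj_onD[OF j _ y] u by(fastforce simp: inv_into_f_f[OF j])
  thus "EX x:j ` V. ALL w. (x, w):l --> (y, u (inv_into V j w)):k" using y by blast
 qed
 ultimately show ?thesis by blast
qed

end

section \<open>Calculus of witnesses for equality in the limit\<close>

lemma pb_affine: assumes "ga:Fd l \<rightarrow> Fd k" shows "spb l ga (spb k al f) = spb l (al o ga) f"
proof -
 have "cmap (stop l) (stop k) (aff ga)" unfolding rtop_weak by(rule pmap_cmap[OF pmap_aff[OF assms]])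
 thus ?thesis by(simp add: pb_pb) (rule pb_cong, simp add: aff_comp)
qed

lemma wit_sym: assumes "gpre G A" "gpre G B" "wit k G A B m f n g" shows "wit k G A B n g m f"
proof -
 obtain al be where "dset k" "cofinal k m al" "cofinal k n be" "shom G A B k (spb k al f) (spb k be g)" using assms(3) unfolding wit_def by blast
 thus ?thesis using ahom_sym[OF assms(1,2) fspace_sx] unfolding wit_def by blast
qed

lemma wit_shom: assumes "gpre G A" "gpre G B" and m: "dset m" and h: "shom G A B m f g" shows "wit m G A B m f m g"
proof -
 have "cofinal m m (%x. x)" by(auto simp: cofinal_def)
 thus ?thesis using shom_spb[OF assms(1,2) m m _ h] m unfolding wit_def by blast
qed

lemma cof_ucof_comp: assumes "cofinal k m al" "ucofinal l k U ga" "ALL x:Fd m. EX z:U. ALL w. (z, w):k --> (x, al w):m"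
 shows "cofinal l m (al o ga)" unfolding cofinal_def
proof(intro conjI ballI)
 show "al o ga:Fd l \<rightarrow> Fd m" using assms by(auto simp: cofinal_def ucofinal_def Pi_iff)
 fix x assume "x:Fd m"
 then obtain z where z: "z:U" "!!w. (z, w):k==>(x, al w):m" using assms(3) by blast
 then obtain y where "y:Fd l" "!!w. (y, w):l==>(z, ga w):k" using assms(2) unfolding ucofinal_def by blast
 thus "EX y:Fd l. ALL w. (y, w):l --> (x, (al o ga) w):m" using z(2) by auto
qed

text \<open>Over the product of the two refinements the pullbacks of \<open>g\<close> along the two
  cofinal maps are joined by a linear homotopy.\<close>

lemma wit_trans: fixes k::"'k rel" and l::"'l rel" assumes A: "gpre G A" and B: "gpre G B" and n: "dset n"
  and g: "sasym G A B n g" and 1: "wit k G A B m f n g" and 2: "wit l G A B n g p h" shows "wit (prod_rel k l) G A B m f p h"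
proof -
 obtain al be where k: "dset k" "cofinal k m al" "cofinal k n be" "shom G A B k (spb k al f) (spb k be g)" using 1 unfolding wit_def by blast
 obtain ga de where l: "dset l" "cofinal l n ga" "cofinal l p de" "shom G A B l (spb l ga g) (spb l de h)" using 2 unfolding wit_def by blast
 note pr = prod_rel[OF k(1) l(1)]
 let ?r = "prod_rel k l"
 have F: "fst:Fd ?r \<rightarrow> Fd k" "snd:Fd ?r \<rightarrow> Fd l" using pr(2,3) by(simp_all add: cofinal_def)
 have dm: "dset n==>cofinal ?r n (be o fst) & cofinal ?r n (ga o snd)" using cof_comp[OF _ pr(2) k(3)] cof_comp[OF _ pr(3) l(2)] by blast
 have cof: "cofinal ?r m (al o fst)" "cofinal ?r p (de o snd)" using cof_ucof_comp[OF k(2), of ?r "Fd k" fst] cof_ucof_comp[OF l(3), of ?r "Fd l" snd]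
  k(2) l(3) pr(2,3) by(simp_all add: cof_ucof[symmetric]) (auto simp: cofinal_def)
 have "shom G A B ?r (spb ?r (be o fst) g) (spb ?r (ga o snd) g)"
  using linear_htpy[OF A B pr(1), of n "Fd n" _ _ g] dm[OF n] g by(simp add: cof_ucof spx_filter_ufilter)
 moreover have "shom G A B ?r (spb ?r (al o fst) f) (spb ?r (be o fst) g)" "shom G A B ?r (spb ?r (ga o snd) g) (spb ?r (de o snd) h)"
  using shom_spb[OF A B pr(1) k(1) pr(2) k(4)] shom_spb[OF A B pr(1) l(1) pr(3) l(4)] by(simp_all add: pb_affine F)
 ultimately have "shom G A B ?r (spb ?r (al o fst) f) (spb ?r (de o snd) h)" using ahom_trans[OF A B fspace_sx[OF pr(1)]] by blast
 thus ?thesis using pr(1) cof unfolding wit_def by blast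
qed

lemma cof_points: assumes "cofinal k m al" "small Y (Fd m)" shows "EX W<=Fd k. small Y W & (ALL x:Fd m. EX z:W. ALL w. (z, w):k --> (x, al w):m)"
proof -
 have "ALL x:Fd m. EX z. z:Fd k & (ALL w. (z, w):k --> (x, al w):m)" using assms(1) unfolding cofinal_def by blast
 from bchoice[OF this] obtain z where "ALL x:Fd m. z x:Fd k & (ALL w. (z x, w):k --> (x, al w):m)" ..
 thus ?thesis by(intro exI[of _ "z ` Fd m"]) (auto intro: small_image[OF assms(2)])
qed

text \<open>The conditions on both lifts, on the homotopy and on its ends are few, and so are the
  elements of \<open>m\<close> and \<open>n\<close> at which cofinality has to be preserved. A small
  \<open>U\<close> in \<open>k\<close> accommodates all of them.\<close>

lemma wit_small: fixes Y::"'y itself" and k::"'k rel" assumes inf: "infinite (UNIV::'y set)" and A: "gpre G A" and B: "gpre G B"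
  and sm: "small Y (cA A)" "small Y (cA G)" "small Y (Fd m)" "small Y (Fd n)" and w: "wit k G A B m f n g" shows "EX l::'y rel. wit l G A B m f n g"
proof -
 obtain al be where k: "dset k" "cofinal k m al" "cofinal k n be" "shom G A B k (spb k al f) (spb k be g)" using w unfolding wit_def by blast
 note Fk = fspace_sx[OF k(1)]
 let ?f = "spb k al f" and ?g = "spb k be g"
 obtain H where h: "sasym G A B k ?f" "sasym G A B k ?g" "sasym G A (cyl B) k H"
  "!!a. a:cA A==>aeq (sfil k) B (%p. H a p 0) (?f a) & aeq (sfil k) B (%p. H a p 1) (?g a)" using k(4) unfolding ahom_def by blast
 note C = gpre.cyl_gpre[OF B]
 have "conds Y (sfil k) (%F. (amor G A B (stop k) F ?f & amor G A B (stop k) F ?g) &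
  amor G A (cyl B) (stop k) F H & (ALL a:cA A. aeq F B (%p. H a p 0) (?f a) & aeq F B (%p. H a p 1) (?g a)))"
  by(intro conds_conj conds_ball conds_amor[OF _ A] conds_aeq[OF _ B] inf sm Fk h B C) (use h(4) in blast)+
 hence c: "conds Y (sfil k) (%F. ahom G A B (stop k) F ?f ?g)" by(rule conds_mono) (auto simp: ahom_def)
 obtain W W' where W: "W <= Fd k" "small Y W" "ALL x:Fd m. EX z:W. ALL w. (z, w):k --> (x, al w):m"
  and W': "W' <= Fd k" "small Y W'" "ALL x:Fd n. EX z:W'. ALL w. (z, w):k --> (x, be w):n" using cof_points[OF k(2) sm(3)] cof_points[OF k(3) sm(4)] by blast
 obtain U where U: "U <= Fd k" "W Un W' <= U" "small Y U" "ahom G A B (stop k) (ufilter k U) ?f ?g"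
  using conds_ufilter[OF inf k(1) c small_Un[OF inf W(2) W'(2)]] W(1) W'(1) by blast
 obtain l::"'y rel" and ga where l: "dset l" "ucofinal l k U ga" using dset_sub[OF inf k(1) U(1,3)] by blast
 have ga: "ga:Fd l \<rightarrow> Fd k" using l(2) by(simp add: ucofinal_def)
 have "cmap (stop l) (stop k) (aff ga)" unfolding rtop_weak by(rule pmap_cmap[OF pmap_aff[OF ga]])
 from ahom_pb[OF U(4) this ucof_flim[OF l] fspace_sx[OF l(1)]]
 have "shom G A B l (spb l (al o ga) f) (spb l (be o ga) g)" by(simp add: pb_affine[OF ga])
 moreover have "ALL x:Fd m. EX z:U. ALL w. (z, w):k --> (x, al w):m" "ALL x:Fd n. EX z:U. ALL w. (z, w):k --> (x, be w):n" using W(3) W'(3) U(2) by blast+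
 hence "cofinal l m (al o ga)" "cofinal l n (be o ga)" using cof_ucof_comp[OF _ l(2)] k(2,3) by blast+
 ultimately show ?thesis using l(1) unfolding wit_def by blast
qed

text \<open>The map \<open>ga\<close> need not be cofinal in \<open>m\<close>, so \<open>m\<close>
  and \<open>n\<close> are compared over their product: its first projection and \<open>ga\<close>
  after its second are linearly homotopic for the coarser filter given by \<open>U\<close>, along
  which \<open>f\<close> is still a lift.\<close>

lemma germ_small: fixes Y::"'y itself" and m::"'i rel" assumes inf: "infinite (UNIV::'y set)" and A: "gpre G A" and B: "gpre G B"
  and sm: "small Y (cA A)" "small Y (cA G)" and m: "dset m" and f: "sasym G A B m f"
 shows "EX (n::'y rel) g (k::('i*'y) rel). dset n & sasym G A B n g & wit k G A B m f n g"
proof -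
 note c = conds_amor[OF inf A B f fspace_sx[OF m] sm]
 obtain U where U: "U <= Fd m" "small Y U" "amor G A B (stop m) (ufilter m U) f" using conds_ufilter[OF inf m c small_fin[OF inf finite.emptyI]] by blast
 obtain n::"'y rel" and ga where n: "dset n" "ucofinal n m U ga" using dset_sub[OF inf m U(1,2)] by blast
 have ga: "ga:Fd n \<rightarrow> Fd m" using n(2) by(simp add: ucofinal_def)
 note pr = prod_rel[OF m n(1)]
 let ?r = "prod_rel m n"
 have "cmap (stop n) (stop m) (aff ga)" unfolding rtop_weak by(rule pmap_cmap[OF pmap_aff[OF ga]])
 from amor_pb[OF U(3) this ucof_flim[OF n] fspace_sx[OF n(1)]]
 have g: "sasym G A B n (spb n ga f)" .
 have "ucofinal ?r m U fst" using pr(2) U(1) unfolding ucofinal_def cofinal_def by blast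
 moreover have "ucofinal ?r m U (ga o snd)" unfolding ucofinal_def
 proof(intro conjI ballI)
  show "ga o snd:Fd ?r \<rightarrow> Fd m" using ga pr(3) by(auto simp: cofinal_def Pi_iff)
  fix y assume "y:U"
  then obtain x where x: "x:Fd n" "!!w. (x, w):n==>(y, ga w):m" using n(2) unfolding ucofinal_def by blast
  then obtain z where z: "z:Fd ?r" "!!w. (z, w) : ?r==>(x, snd w):n" using pr(3) unfolding cofinal_def by blast
  thus "EX z:Fd ?r. ALL w. (z, w) : ?r --> (y, (ga o snd) w):m" using x(2)[OF z(2)] by(intro bexI[of _ z] z(1)) auto
 qed
 ultimately have "shom G A B ?r (spb ?r fst f) (spb ?r (ga o snd) f)" by(rule linear_htpy[OF A B pr(1) _ _ U(3)])
 hence "shom G A B ?r (spb ?r fst f) (spb ?r snd (spb n ga f))" using pr(3) by(simp add: pb_affine cofinal_def)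
 hence "wit ?r G A B m f n (spb n ga f)" using pr unfolding wit_def by blast
 with n(1) g show ?thesis by blast
qed

section \<open>The composition product\<close>

lemma scasym_cont: assumes g: "scasym G B C (n::'j rel) g" and u: "u:cA (Cb (wtop PP) B)" and R: "R:PP"
 shows "cmap (tos R) (ntop (Cb (stop n) C)) (%x. g (u x))" using continuous_map_compose[OF _ casym_cont[OF g], of "tos R" u] u R
 by(simp add: cA_Cb cmap_wtop o_def)

context
 fixes G::"'g monoid" and A::"('g, 'a) galg" and B::"('g, 'b) galg" and C::"('g, 'c) galg"
  and PP::"'x::topological_space set set" and F::"'x filter" and cell::"'x=>'d" and K and n::"'j rel"
 assumes A: "gpre G A" and B: "calg G B" and C: "calg G C" and n: "dset n" and F: "fspace (wtop PP) F"
  and K: "!!x. x:\<Union>PP==>x:K (cell x)" "!!c. compact (K c)" "!!c. K c = {} \<or> K c:PP"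
begin

interpretation B: gpre G B using B by(rule calg_gpre)
interpretation C: gpre G C using C by(rule calg_gpre)

text \<open>\<open>as_unifity\<close> with a one-point parameter set. The base is any space with
  compact pieces, since it will be a realization as well as a product of two realizations.\<close>

lemma psi_unif: assumes P: "!!R. R:PP==>cmap (tos R) (ntop (Cb (stop n) C)) P" and Q: "!!R. R:PP==>cmap (tos R) (ntop (Cb (stop n) C)) Q"
  and eq: "aeq F (Simpl n C) (%x. Simpl_class n C (P x)) (%x. Simpl_class n C (Q x))"
 shows "aeq (sdp F cell n) C (%w. P (fst w) (snd w)) (%w. Q (fst w) (snd w))"
proof(rule C.aeqI)
 fix ep::real assume ep: "0 < ep"
 interpret S: gpre G "Simpl n C" by(rule C.Ca_gpre[OF fspace_sx[OF n]])
 have c: "cmap (tos (K c \<times> {0::real})) (ntop (Cb (stop n) C)) (%(x, s). R x)" if "!!S. S:PP==>cmap (tos S) (ntop (Cb (stop n) C)) R" for R c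
 proof -
  have 1: "cmap (tos (K c)) (ntop (Cb (stop n) C)) R" using K(3)[of c] that[of "K c"] by auto
  have 2: "cmap (tos (K c \<times> {0::real})) (tos (K c)) fst" by(auto simp: continuous_map_in_subtopology intro!: continuous_on_fst continuous_on_id)
  show ?thesis using continuous_map_compose[OF 2 1] by(simp add: o_def case_prod_unfold)
 qed
 have "\<forall>\<^sub>F x in F. x:\<Union>PP & (ALL s:{0::real}. cdist (Simpl n C) (Simpl_class n C (P x)) (Simpl_class n C (Q x)) <= ep / 2)"
  using S.aeqD[OF eq half_gt_zero[OF ep]] F[unfolded fspace_def tsp_wtop] by eventually_elim simp
 from as_unifity[where K = K and P = "%x _. P x" and Q = "%x _. Q x", OF C.gpre_axioms n _ K(1,2) c[OF P] c[OF Q] this, of "ep / 2"]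
 show "\<forall>\<^sub>F w in sdp F cell n. cdist C (P (fst w) (snd w)) (Q (fst w) (snd w)) <= ep" using ep by simp
qed

lemma psi_cong: assumes g: "scasym G B C n g" and uv: "u:cA (Cb (wtop PP) B)" "v:cA (Cb (wtop PP) B)" and eq: "aeq F B u v"
 shows "aeq (sdp F cell n) C (%w. g (u (fst w)) (snd w)) (%w. g (v (fst w)) (snd w))"
proof(rule psi_unif[OF scasym_cont[OF g uv(1)] scasym_cont[OF g uv(2)]])
 note Fn = fspace_sx[OF n]
 show "aeq F (Simpl n C) (%x. Simpl_class n C (g (u x))) (%x. Simpl_class n C (g (v x)))"
 proof(rule pre_cstar.aeq_bound[OF gpre_pre_cstar[OF C.Ca_gpre[OF Fn]]])
  show "((%x. cdist B (u x) (v x)) ---> 0) F" using eq by(simp add: aeq_def)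
  show "\<forall>\<^sub>F x in F. cdist (Simpl n C) (Simpl_class n C (g (u x))) (Simpl_class n C (g (v x))) <= cdist B (u x) (v x)"
  using B.ev_Cb_val[OF F uv(1)] B.ev_Cb_val[OF F uv(2)] by eventually_elim (rule asym_class_cdist[OF B C.gpre_axioms Fn casym_asym[OF g]])
 qed
qed

lemma psi_ends: fixes H::"'a=>'x*'j pt=>'c" assumes "aeq (sdp F cell n) C u (%w. g (f a (fst w)) (snd w))" "!!w. w:\<Union>PP \<times> rl (Fd n)==>v w = u w"
 shows "aeq (sdp F cell n) C v (psi (\<Union>PP) (rl (Fd n)) g f a)" by(rule iffD1[OF aeq_cong, OF _ _ assms(1)];
  use sdp_fspace[OF n F, of cell, unfolded fspace_def] in "eventually_elim, simp add: psi_def assms(2) del: split_paired_All")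

lemma amor_psi': "[|amor G A B (wtop PP) F f; scasym G B C n g|]==>amor G A C (wtop (pprod PP (cells (Fd n))))
  (sdp F cell n) (psi (\<Union>PP) (rl (Fd n)) g f)" by(rule amor_psi[where K = K, OF A B C.gpre_axioms n F]; (assumption | rule K))

text \<open>The homotopy of \<open>f\<close> takes values in paths of \<open>B\<close>, and
  \<open>g\<close> is applied to these paths pointwise in time; continuity of \<open>g\<close> makes
  the results paths again.\<close>

lemma psi_hom1: assumes h: "ahom G A B (wtop PP) F f f'" and g: "scasym G B C n g" shows "ahom G A C (wtop (pprod PP (cells (Fd n)))) (sdp F cell n)
  (psi (\<Union>PP) (rl (Fd n)) g f) (psi (\<Union>PP) (rl (Fd n)) g f')"
proof -
 obtain H where f: "amor G A B (wtop PP) F f" "amor G A B (wtop PP) F f'" and H: "amor G A (cyl B) (wtop PP) F H"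
  and e: "!!a. a:cA A==>aeq F B (%p. H a p 0) (f a) & aeq F B (%p. H a p 1) (f' a)" using h unfolding ahom_def by blast
 have v: "(\<lambda>x\<in>tsp (wtop PP). H a x t):cA (Cb (wtop PP) B)" if "a:cA A" "t:{0..1}" for a t
  by(rule alg_map_Cb[OF B.cyl_gpre B.gpre_axioms alg_map_val[OF B.gpre_axioms that(2)] amorD(1)[OF H that(1)]])
 have en: "aeq (sdp F cell n) C (%w. psi_cyl (\<Union>PP) (rl (Fd n)) g H a w t) (psi (\<Union>PP) (rl (Fd n)) g f a)"
  if a: "a:cA A" and t: "t:{0..1}" and f: "amor G A B (wtop PP) F f" and e: "aeq F B (%p. H a p t) (f a)" for a t f
 proof(rule psi_ends[where g = g and f = f and a = a])
  show "aeq (sdp F cell n) C (%w. g ((\<lambda>x\<in>tsp (wtop PP). H a x t) (fst w)) (snd w)) (%w. g (f a (fst w)) (snd w))"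
  by(rule psi_cong[OF g v[OF a t] amorD(1)[OF f a]]) (use e in "simp only: aeq_restr[OF F]")
 qed (use t in "auto simp: psi_cyl_def")
 have Ps: "amor G A (cyl C) (wtop (pprod PP (cells (Fd n)))) (sdp F cell n) (psi_cyl (\<Union>PP) (rl (Fd n)) g H)"
  by(rule amor_psi_cyl[OF A B C.gpre_axioms n F H g, where K = K]) (fact K)+
 show ?thesis by(rule ahomI[where H = "psi_cyl (\<Union>PP) (rl (Fd n)) g H"]) (use e en f g amor_psi' Ps in auto)
qed

text \<open>The given homotopy of \<open>g\<close> need not be continuous on \<open>B\<close>, so it
  is replaced by a continuous lift \<open>H'\<close> of the same homomorphism into the algebra of
  paths. Its ends have the classes of \<open>g\<close> and \<open>g'\<close> at each element of
  \<open>B\<close>, and \<open>psi_unif\<close> turns this into asymptotic equality along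
  \<open>sdp\<close>.\<close>

lemma psi_hom2: assumes h: "shom G B C n g g'" and g: "scasym G B C n g" "scasym G B C n g'" and f: "amor G A B (wtop PP) F f"
 shows "ahom G A C (wtop (pprod PP (cells (Fd n)))) (sdp F cell n) (psi (\<Union>PP) (rl (Fd n)) g f) (psi (\<Union>PP) (rl (Fd n)) g' f)"
proof -
 note Fn = fspace_sx[OF n] and CI = C.cyl_gpre
 interpret CI: gpre G "cyl C" by(rule CI)
 obtain H where H: "sasym G B (cyl C) n H"
  and e: "!!b. b:cA B==>aeq (sfil n) C (%p. H b p 0) (g b) & aeq (sfil n) C (%p. H b p 1) (g' b)" using h unfolding ahom_def by blast
 obtain H' where H': "scasym G B (cyl C) n H'" "mor_of (stop n) (sfil n) B (cyl C) H = mor_of (stop n) (sfil n) B (cyl C) H'"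
  by(rule Mor_clift[OF B calg_cyl[OF C] Fn mor_of_Mor[OF H B.gpre_axioms CI Fn]]) blast
 have H'v: "H' b:cA (Cb (stop n) (cyl C))" if "b:cA B" for b by(rule amorD(1)[OF casym_asym[OF H'(1)] that])
 have HH: "aeq (sfil n) (cyl C) (H' b) (H b)" if b: "b:cA B" for b
  using H'(2) mor_of_eq_iff[of G "cyl C" "stop n" "sfil n" B H H', OF CI Fn amorD(1)[OF H] H'v] b CI.aeq_sym by blast
 have vt: "(\<lambda>z\<in>tsp (stop n). u z t):cA (Cb (stop n) C)" if "u:cA (Cb (stop n) (cyl C))" "t:{0..1}" for t u
  by(rule alg_map_Cb[OF CI C.gpre_axioms alg_map_val[OF C.gpre_axioms that(2)] that(1)])
 have H't: "aeq (sfil n) C (\<lambda>z\<in>tsp (stop n). H' b z t) (g b)" if b: "b:cA B" and t: "t:{0..1}" and eq: "aeq (sfil n) C (%p. H b p t) (g b)"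
  and g: "scasym G B C n g" for b t g
 proof(rule C.aeq_trans[where v = "\<lambda>z\<in>tsp (stop n). H b z t"])
  have "\<forall>\<^sub>F z in sfil n. H' b z:cA (cyl C) & H b z:cA (cyl C)"
  using CI.ev_Cb_val[OF Fn H'v[OF b]] CI.ev_Cb_val[OF Fn amorD(1)[OF H b]] by eventually_elim simp
  from alg_map_aeq[OF CI C.gpre_axioms alg_map_val[OF C.gpre_axioms t] this HH[OF b]]
  show "aeq (sfil n) C (\<lambda>z\<in>tsp (stop n). H' b z t) (\<lambda>z\<in>tsp (stop n). H b z t)" by(simp only: aeq_restr[OF Fn])
  show "aeq (sfil n) C (\<lambda>z\<in>tsp (stop n). H b z t) (g b)" using eq by(simp only: aeq_restr[OF Fn])
  show "\<forall>\<^sub>F z in sfil n. (\<lambda>z\<in>tsp (stop n). H' b z t) z:cA C & (\<lambda>z\<in>tsp (stop n). H b z t) z:cA C & g b z:cA C"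
  using C.ev_Cb_val[OF Fn vt[OF H'v[OF b] t]] C.ev_Cb_val[OF Fn vt[OF amorD(1)[OF H b] t]]
  C.ev_Cb_val[OF Fn amorD(1)[OF casym_asym[OF g] b]] by eventually_elim simp
 qed
 interpret EI: gpre G "Cb (stop n) (cyl C)" by(rule CI.Cb_gpre)
 interpret E: gpre G "Cb (stop n) C" by(rule C.Cb_gpre)
 let ?Ps = "psi (\<Union>PP) (rl (Fd n)) H' f"
 have Ps: "amor G A (cyl C) (wtop (pprod PP (cells (Fd n)))) (sdp F cell n) ?Ps" by(rule amor_psi[OF A B CI n F f H'(1)]) (fact K)+
 have en: "aeq (sdp F cell n) C (%w. ?Ps a w t) (psi (\<Union>PP) (rl (Fd n)) g f a)" if a: "a:cA A" and t: "t:{0..1}" and g: "scasym G B C n g"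
  and e: "!!b. b:cA B==>aeq (sfil n) C (%p. H b p t) (g b)" for a t g
 proof(rule psi_ends[where g = g and f = f and a = a])
  let ?P = "%x. \<lambda>z\<in>tsp (stop n). H' (f a x) z t"
  have Pc: "cmap (tos R) (ntop (Cb (stop n) C)) ?P" if R: "R:PP" for R
  proof(rule cmap_contr[OF EI.pre_cstar_axioms E.pre_cstar_axioms _ _
  scasym_cont[OF H'(1) amorD(1)[OF f a] R]])
  show "(\<lambda>z\<in>tsp (stop n). u z t):cA (Cb (stop n) C)" if "u:cA (Cb (stop n) (cyl C))" for u by(rule vt[OF that t])
  note vt = this
  show "cdist (Cb (stop n) C) (\<lambda>z\<in>tsp (stop n). u z t) (\<lambda>z\<in>tsp (stop n). v z t) <= cdist (Cb (stop n) (cyl C)) u v"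
  if "u:cA (Cb (stop n) (cyl C))" "v:cA (Cb (stop n) (cyl C))" for u v
  proof(subst C.cdist_Cb_le_iff[OF vt[OF that(1)] vt[OF that(2)] EI.cdist_ge0], rule ballI)
  fix z assume z: "z:tsp (stop n)"
  have "cdist C (u z t) (v z t) <= cdist (cyl C) (u z) (v z)" by(rule C.cdist_cyl_val[OF CI.Cb_val[OF that(1) z] CI.Cb_val[OF that(2) z] t])
  also have "\<dots> <= cdist (Cb (stop n) (cyl C)) u v" by(rule CI.cdist_val_le[OF that z])
  finally show "cdist C ((\<lambda>z\<in>tsp (stop n). u z t) z) ((\<lambda>z\<in>tsp (stop n). v z t) z) <= cdist (Cb (stop n) (cyl C)) u v" using z by simp
  qed
  qed
  have "\<forall>\<^sub>F x in F. Simpl_class n C (?P x) = Simpl_class n C (g (f a x))" using B.ev_Cb_val[OF F amorD(1)[OF f a]]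
  proof eventually_elim
  case (elim x)
  show ?case using H't[OF elim t e[OF elim] g] vt[OF H'v[OF elim] t] amorD(1)[OF casym_asym[OF g] elim] by(subst C.Ca_class_eq_iff[OF Fn]) simp_all
  qed
  hence eq: "aeq F (Simpl n C) (%x. Simpl_class n C (?P x)) (%x. Simpl_class n C (g (f a x)))"
  by(rule iffD2[OF aeq_cong[OF _ always_eventually]]) (auto simp: pre_cstar.aeq_refl[OF gpre_pre_cstar[OF C.Ca_gpre[OF Fn]]])
  show "aeq (sdp F cell n) C (%w. ?P (fst w) (snd w)) (%w. g (f a (fst w)) (snd w))" by(rule psi_unif[OF Pc scasym_cont[OF g amorD(1)[OF f a]] eq])
 qed (use t in "auto simp: psi_def")
 show ?thesis by(rule ahomI[OF _ _ Ps]) (use e en g f amor_psi' in auto)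
qed

end

abbreviation pcells::"'i rel=>'j rel=>('i pt*'j pt) set set" where "pcells m n == pprod (cells (Fd m)) (cells (Fd n))"

abbreviation ptail::"'i rel=>'j rel=>('i pt*'j pt) filter" where "ptail m n == tfil (m ## n) (ptails m (tls n))"

abbreviation spsi where "spsi m n == psi (rl (Fd m)) (rl (Fd n))"

text \<open>More general than \<open>Theta_maps\<close>: by \<open>cmp_tail\<close> any such map
  computes the composition product in the limit, which leaves the freedom to use maps adapted to the
  situation.\<close>

definition adm::"'k rel=>'i rel=>'j rel=>('k pt=>'i pt*'j pt)=>bool" where
 "adm k m n Th <-> pmap (cells (Fd k)) (pcells m n) Th & filterlim Th (ptail m n) (sfil k)"

text \<open>The empty set serves as default for sets that are not simplices, since the compactness
  arguments ask for a piece for every value of the cell index.\<close>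

definition cell_of::"'v set=>'v set=>'v pt set" where "cell_of S c = (if c:spx S then rl c else {})"

lemma cell_of: "x:\<Union>(cells S)==>x:cell_of S (supp x)" "compact (cell_of S c)" "cell_of S c = {} \<or> cell_of S c:cells S"
proof -
 show "x:\<Union>(cells S)==>x:cell_of S (supp x)" unfolding Union_cells using rl_supp[of x S] supp_spx[of x S] by(simp add: cell_of_def)
qed (auto simp: cell_of_def cells_def cpt_rl dest: spxD)

lemma ahom_filter_mono: "[|ahom G A B X F f f'; F' <= F|]==>ahom G A B X F' f f'" unfolding ahom_def aeq_def using amor_filter_mono tendsto_mono by meson

lemma adm_sdp: "[|dset m; dset n; adm k m n Th|]==>filterlim Th (sdp (sfil m) supp n) (sfil k)"
 using filterlim_mono[OF _ ptails_le_sdp order_refl] unfolding adm_def by blast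

lemma adm_cont: "adm k m n Th==>cmap (stop k) (wtop (pcells m n)) Th" unfolding rtop_weak adm_def using pmap_cmap by blast

lemma adm_Theta: "[|dset m; dset n; Th:Theta_maps m n|]==>adm (m ## n) m n Th" using Thm_flim unfolding adm_def by blast

lemma adm_in: "[|adm k m n Th; p:rl (Fd k)|]==>Th p:rl (Fd m) \<times> rl (Fd n)" using adm_cont[of k m n Th] by(auto simp: continuous_map_def Pi_iff)

lemma uncurry_Cb: assumes C: "gpre G C" and F: "F:cA (Cb (stop m) (Cb (stop n) C))"
 shows "(\<lambda>w\<in>rl (Fd m) \<times> rl (Fd n). F (fst w) (snd w)):cA (Cb (wtop (pcells m n)) C)"
proof -
 interpret C: gpre G C by(rule C)
 interpret E: gpre G "Cb (stop n) C" by(rule C.Cb_gpre)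
 have "cmap (wtop (pcells m n)) (ntop C) (%(x, z). F x z)" unfolding cmap_wtop
 proof
  fix R assume "R:pcells m n"
  then obtain P Q where R: "P:cells (Fd m)" "Q:cells (Fd n)" "R = P \<times> Q" by(auto simp: pprod_def)
  show "cmap (tos R) (ntop C) (%(x, z). F x z)" unfolding R(3)
  proof(rule uncurry_cont[OF C])
  show "cmap (tos P) (ntop (Cb (stop n) C)) F" using F R(1) by(simp add: cA_Cb rtop_weak cmap_wtop)
  show "cmap (tos Q) (stop n) (%z. z)" unfolding rtop_weak by(rule cont_map_top_of_set_piece[OF R(2)])
  qed
 qed
 moreover have "cnorm C (F x z) <= cnorm (Cb (stop m) (Cb (stop n) C)) F" if "x:rl (Fd m)" "z:rl (Fd n)" for x z
  using C.nval_le[of "F x" "stop n" z] E.nval_le[OF F, of x] E.Cb_val[OF F, of x] that by simp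
 ultimately show ?thesis by(auto simp: cA_Cb case_prod_unfold)
qed

text \<open>The composition product on the level of lifts, with an arbitrary but fixed choice of the
  map \<Theta>.\<close>

definition cmp::"'i rel=>'j rel=>('b=>'j pt=>'c)=>('a=>'i pt=>'b) =>'a=>('i*('i set=>'j)=>real)=>'c" where
 "cmp m n g f = pb (stop (m ## n)) (SOME Th. Th:Theta_maps m n) (spsi m n g f)"

lemma some_Theta: "[|dset m; dset n|]==>(SOME Th. Th:Theta_maps m n):Theta_maps m n" using Thm_nonempty by(simp add: some_in_eq)

context
 fixes G::"'g monoid" and A::"('g, 'a) galg" and B::"('g, 'b) galg" and C::"('g, 'c) galg" and m::"'i rel" and n::"'j rel"
 assumes A: "gpre G A" and B: "calg G B" and C: "calg G C" and m: "dset m" and n: "dset n"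
begin

interpretation B: gpre G B using B by(rule calg_gpre)
interpretation C: gpre G C using C by(rule calg_gpre)

lemma weak_spx: "fspace (wtop (cells (Fd m))) (sfil m)" using fspace_sx[OF m] by(simp add: rtop_weak)

lemma spsi_asym: "[|sasym G A B m f; scasym G B C n g|]==>amor G A C (wtop (pcells m n)) (ptail m n) (spsi m n g f)"
 using amor_psi'[OF A B C n weak_spx cell_of, of f g] amor_filter_mono[OF _ ptails_le_sdp[OF m n]] by(simp add: rtop_weak)

lemma spsi_hom: assumes "shom G A B m f f'" "shom G B C n g g'" "scasym G B C n g" "scasym G B C n g'"
 shows "ahom G A C (wtop (pcells m n)) (ptail m n) (spsi m n g f) (spsi m n g' f')"
proof -
 have f': "amor G A B (wtop (cells (Fd m))) (sfil m) f'" using assms(1) by(simp add: ahom_def rtop_weak)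
 have "ahom G A C (wtop (pcells m n)) (sdp (sfil m) supp n) (spsi m n g f) (spsi m n g f')"
  using psi_hom1[OF A B C n weak_spx cell_of, of f f' g] assms by(simp add: rtop_weak)
 moreover have "ahom G A C (wtop (pcells m n)) (sdp (sfil m) supp n) (spsi m n g f') (spsi m n g' f')"
  using psi_hom2[OF A B C n weak_spx cell_of assms(2-4) f'] by simp
 ultimately show ?thesis using ahom_trans[OF A C.gpre_axioms sdp_fspace[OF n weak_spx]] ahom_filter_mono[OF _ ptails_le_sdp[OF m n]] by blast
qed

lemma adm_pb_hom: assumes k: "dset k" and Th: "adm k m n Th" and h: "ahom G A C (wtop (pcells m n)) (ptail m n) u v"
 shows "shom G A C k (pb (stop k) Th u) (pb (stop k) Th v)" by(rule ahom_pb[OF h adm_cont[OF Th] _ fspace_sx[OF k]]) (use Th in "simp add: adm_def")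

lemma adm_pb_asym: "[|dset k; adm k m n Th; amor G A C (wtop (pcells m n)) (ptail m n) u|]==>sasym G A C k (pb (stop k) Th u)"
 using amor_pb[OF _ adm_cont _ fspace_sx] unfolding adm_def by blast

text \<open>\<open>Theta_pullback\<close> unites over all functions \<open>F\<close> with the
  prescribed classes. One of them is \<open>x \<mapsto> g (f a x)\<close>; any other has pointwise
  the same classes, is asymptotically equal to it along \<open>sdp\<close> by
  \<open>psi_unif\<close>, and so yields the same class over \<open>m ## n\<close>.\<close>

lemma Theta_pullback_smor: assumes Th: "Th:Theta_maps m n" and f: "sasym G A B m f" and g: "scasym G B C n g"
 shows "compose (cA A) (Theta_pullback m n Th C) (compose (cA A) (Simpl_map m B (Simpl n C) (smor n B C g)) (smor m A B f))
  = smor (m ## n) A C (pb (stop (m ## n)) Th (spsi m n g f))"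
proof -
 note Fm = fspace_sx[OF m] and Fn = fspace_sx[OF n] and ds = dset_sharp[OF m n] and ad = adm_Theta[OF m n Th]
 note Fs = fspace_sx[OF ds]
 have Sg: "gpre G (Simpl n C)" by(rule C.Ca_gpre[OF Fn])
 interpret S: gpre G "Simpl n C" by(rule Sg)
 interpret E: gpre G "Cb (stop n) C" by(rule C.Cb_gpre)
 have am: "alg_map G B (Simpl n C) (smor n B C g)" by(rule Mor_alg_map[OF B Sg mor_of_Mor[OF casym_asym[OF g] B.gpre_axioms C.gpre_axioms Fn]])
 have fv: "f a x:cA B" if "a:cA A" "x:rl (Fd m)" for a x using B.Cb_val[OF amorD(1)[OF f that(1)], of x] that(2) by simp
 let ?q = "%a. \<lambda>x\<in>tsp (stop m). smor n B C g (f a x)"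
 have q: "?q a = (\<lambda>x\<in>rl (Fd m). Simpl_class n C (g (f a x)))" if "a:cA A" for a using fv[OF that] by(auto simp: mor_of_def intro!: restrict_ext)
 have qc: "?q a:cA (Cb (stop m) (Simpl n C))" if "a:cA A" for a by(rule amorD(1)[OF amor_alg_map[OF B.gpre_axioms Sg am Fm A f] that])
 have 1: "compose (cA A) (Simpl_map m B (Simpl n C) (smor n B C g)) (smor m A B f)
  = mor_of (stop m) (sfil m) A (Simpl n C) ?q" by(rule comp_Ca_map[OF B.gpre_axioms Sg am Fm f])
 let ?cl = "%F. Simpl_class (m ## n) C (\<lambda>p\<in>rl (Fd (m ## n)). F (fst (Th p)) (snd (Th p)))"
 have 2: "Theta_pullback m n Th C (Simpl_class m (Simpl n C) (?q a)) = Simpl_class (m ## n) C (pb (stop (m ## n)) Th (spsi m n g f) a)" if a: "a:cA A" for a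
 proof -
  let ?F0 = "\<lambda>x\<in>rl (Fd m). g (f a x)"
  let ?SS = "{F:cA (Cb (stop m) (Cb (stop n) C)). (\<lambda>x\<in>rl (Fd m). Simpl_class n C (F x)):Simpl_class m (Simpl n C) (?q a)}"
  have gcont: "cmap (tos R) (ntop (Cb (stop n) C)) (%x. g (f a x))" if "R:cells (Fd m)" for R
  using scasym_cont[OF g _ that, of "f a"] amorD(1)[OF f a] by(simp add: rtop_weak)
  obtain M where M: "!!b. b:cA B==>cnorm (Cb (stop n) C) (g b) <= cnorm B b + M" using casym_bound[OF g] by blast
  have F0: "?F0:cA (Cb (stop m) (Cb (stop n) C))"
  proof -
  have "cnorm (Cb (stop n) C) (g (f a x)) <= cnorm (Cb (stop m) B) (f a) + M" if "x:rl (Fd m)" for x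
  using M[OF fv[OF a that]] B.nval_le[OF amorD(1)[OF f a], of x] that by simp
  moreover have "cmap (stop m) (ntop (Cb (stop n) C)) (%x. g (f a x))" using gcont by(simp add: rtop_weak cmap_wtop)
  ultimately show ?thesis by(auto simp: cA_Cb)
  qed
  have memF: "(\<lambda>p\<in>rl (Fd (m ## n)). F (fst (Th p)) (snd (Th p))):cA (Cb (stop (m ## n)) C)" if F: "F:cA (Cb (stop m) (Cb (stop n) C))" for F
  proof -
  have "(\<lambda>p\<in>tsp (stop (m ## n)). (\<lambda>w\<in>rl (Fd m) \<times> rl (Fd n). F (fst w) (snd w)) (Th p)):cA (Cb (stop (m ## n)) C)"
  by(rule Cb_pb[OF uncurry_Cb[OF C.gpre_axioms F] adm_cont[OF ad]])
  thus ?thesis using adm_in[OF ad] by(simp cong: restrict_cong)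
  qed
  have eqF: "?cl F = ?cl ?F0" if F: "F : ?SS" for F
  proof -
  have Fc: "cmap (tos R) (ntop (Cb (stop n) C)) F" if "R:cells (Fd m)" for R using F that by(simp add: cA_Cb rtop_weak cmap_wtop)
  have "aeq (sfil m) (Simpl n C) (\<lambda>x\<in>tsp (stop m). Simpl_class n C (F x)) (\<lambda>x\<in>tsp (stop m). Simpl_class n C (g (f a x)))"
  using F S.in_Ca_class_iff[OF Fm qc[OF a]] q[OF a] by simp
  hence "aeq (sfil m) (Simpl n C) (%x. Simpl_class n C (F x)) (%x. Simpl_class n C (g (f a x)))" by(simp only: aeq_restr[OF Fm])
  from psi_unif[OF A B C n weak_spx cell_of Fc gcont this]
  have "aeq (sdp (sfil m) supp n) C (%w. F (fst w) (snd w)) (%w. g (f a (fst w)) (snd w))" .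
  from aeq_comp[OF this adm_sdp[OF m n ad]]
  have *: "aeq (sfil (m ## n)) C (%p. F (fst (Th p)) (snd (Th p))) (%p. g (f a (fst (Th p))) (snd (Th p)))" .
  have "aeq (sfil (m ## n)) C (\<lambda>p\<in>rl (Fd (m ## n)). F (fst (Th p)) (snd (Th p))) (\<lambda>p\<in>rl (Fd (m ## n)). ?F0 (fst (Th p)) (snd (Th p)))"
  by(rule iffD1[OF aeq_cong, OF _ _ *]; use Fs[unfolded fspace_def] in "eventually_elim") (use adm_in[OF ad] in "auto simp: mem_Times_iff")
  moreover have "F:cA (Cb (stop m) (Cb (stop n) C))" using F by blast
  ultimately show ?thesis using C.Ca_class_eq_iff[OF Fs memF memF[OF F0]] by blast
  qed
  have "(\<lambda>x\<in>rl (Fd m). Simpl_class n C (?F0 x)) = ?q a" unfolding q[OF a] by(auto intro!: restrict_ext)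
  hence F0S: "?F0 : ?SS" using F0 S.Ca_class_self[OF Fm qc[OF a]] by simp
  have "Theta_pullback m n Th C (Simpl_class m (Simpl n C) (?q a)) = (UN F:?SS. ?cl F)" using S.Ca_class_closed[OF qc[OF a]] by(simp add: Theta_pullback_def)
  also have "\<dots> = ?cl ?F0" using F0S eqF by blast
  also have "(\<lambda>p\<in>rl (Fd (m ## n)). ?F0 (fst (Th p)) (snd (Th p))) = pb (stop (m ## n)) Th (spsi m n g f) a"
  using adm_in[OF ad] by(auto simp: pb_def psi_def mem_Times_iff intro!: restrict_ext)
  finally show ?thesis .
 qed
 show ?thesis unfolding 1 unfolding compose_def mor_of_def[of _ _ A] by(rule restrict_ext) (simp only: restrict_apply 2 if_True)
qed

lemma in_hcls_casym: assumes g: "sasym G B C n g" and ps: "ps:hcls G B C n g"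
 obtains g' where "scasym G B C n g'" "ps = smor n B C g'" "shom G B C n g g'"
proof -
 note Bg = B.gpre_axioms and Cg = C.gpre_axioms and Fn = fspace_sx[OF n]
 obtain g1 where g1: "sasym G B C n g1" "ps = smor n B C g1" "shom G B C n g g1" using iffD1[OF in_hcls_iff[OF Bg Cg n g] ps] by blast
 obtain g' where g': "scasym G B C n g'" "smor n B C g1 = smor n B C g'" by(rule Mor_clift[OF B C Fn mor_of_Mor[OF g1(1) Bg Cg Fn]]) blast
 have "shom G B C n g g'" using g1(3) simpl_htpy_iff[OF Bg Cg n g g1(1)] simpl_htpy_iff[OF Bg Cg n g casym_asym[OF g'(1)]] g'(2) by simp
 with g' g1(2) show thesis by(intro that) simp_all
qed

lemma hcls_casym: assumes "d:simpl_mor G B C n"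
 obtains g where "scasym G B C n g" "d = hcls G B C n g"
proof -
 note Bg = B.gpre_axioms and Cg = C.gpre_axioms and Fn = fspace_sx[OF n]
 obtain g where g: "sasym G B C n g" "d = hcls G B C n g" using assms simpl_mor_iff[OF Bg Cg n] by blast
 obtain g' where g': "scasym G B C n g'" "smor n B C g = smor n B C g'" by(rule Mor_clift[OF B C Fn mor_of_Mor[OF g(1) Bg Cg Fn]]) blast
 with g(2) show thesis by(intro that[of g']) (simp_all add: hcls_def)
qed

lemma cmp_asym: "[|sasym G A B m f; scasym G B C n g|]==>sasym G A C (m ## n) (cmp m n g f)"
 unfolding cmp_def by(rule adm_pb_asym[OF dset_sharp[OF m n] adm_Theta[OF m n some_Theta[OF m n]] spsi_asym])

text \<open>All members of the union in \<open>simpl_comp\<close> coincide: other representatives of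
  the homotopy classes are handled by \<open>spsi_hom\<close>, other choices of the map by
  \<open>Thm_htpc\<close>. Outer representatives are first given continuous lifts.\<close>

lemma simpl_comp_hcls: assumes f: "sasym G A B m f" and g: "scasym G B C n g"
 shows "simpl_comp G A B C m n (hcls G B C n g) (hcls G A B m f) = hcls G A C (m ## n) (cmp m n g f)"
proof -
 note ds = dset_sharp[OF m n] and Bg = B.gpre_axioms and Cg = C.gpre_axioms
 let ?T = "SOME Th. Th:Theta_maps m n"
 let ?c = "%ps ph Th. simpl_mor_class G A C (m ## n) (compose (cA A) (Theta_pullback m n Th C) (compose (cA A) (Simpl_map m B (Simpl n C) ps) ph))"
 have eq: "?c ps ph Th = hcls G A C (m ## n) (cmp m n g f)" if ps: "ps:hcls G B C n g" and ph: "ph:hcls G A B m f" and Th: "Th:Theta_maps m n" for ps ph Th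
 proof -
  obtain f' where f': "sasym G A B m f'" "ph = smor m A B f'" "shom G A B m f f'" using iffD1[OF in_hcls_iff[OF A Bg m f] ph] by blast
  obtain g' where g': "scasym G B C n g'" "ps = smor n B C g'" "shom G B C n g g'" using in_hcls_casym[OF casym_asym[OF g] ps] .
  note s = spsi_asym[OF f'(1) g'(1)]
  have "shom G A C (m ## n) (cmp m n g f) (pb (stop (m ## n)) ?T (spsi m n g' f'))"
  unfolding cmp_def by(rule adm_pb_hom[OF ds adm_Theta[OF m n some_Theta[OF m n]] spsi_hom[OF f'(3) g'(3) g g'(1)]])
  moreover have "shom G A C (m ## n) (pb (stop (m ## n)) ?T (spsi m n g' f')) (pb (stop (m ## n)) Th (spsi m n g' f'))"
  by(rule shom_htpc[OF A Cg ds s Thm_htpc[OF m n some_Theta[OF m n] Th]])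
  ultimately have "shom G A C (m ## n) (cmp m n g f) (pb (stop (m ## n)) Th (spsi m n g' f'))" by(rule ahom_trans[OF A Cg fspace_sx[OF ds]])
  hence "hcls G A C (m ## n) (cmp m n g f) = hcls G A C (m ## n) (pb (stop (m ## n)) Th (spsi m n g' f'))"
  using hcls_eq_iff[OF A Cg ds cmp_asym[OF f g] adm_pb_asym[OF ds adm_Theta[OF m n Th] s]] by blast
  thus ?thesis using Theta_pullback_smor[OF Th f'(1) g'(1)] by(simp add: f'(2) g'(2) hcls_def)
 qed
 have "hcls G B C n g ~= {}" "hcls G A B m f ~= {}"
  using in_hcls_iff[OF Bg Cg n casym_asym[OF g]] ahom_refl[OF Bg Cg fspace_sx[OF n] casym_asym[OF g]] casym_asym[OF g]
  in_hcls_iff[OF A Bg m f] ahom_refl[OF A Bg fspace_sx[OF m] f] f by blast+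
 thus ?thesis unfolding simpl_comp_def using eq Thm_nonempty[OF m n] by(simp cong: SUP_cong)
qed

lemma cmp_tail: fixes k::"'k rel" assumes k: "dset k" and Th: "adm k m n Th" and f: "sasym G A B m f" and g: "scasym G B C n g"
 shows "EX kk::(('i*('i set=>'j))*'k*'i*('i set=>'j)) rel.
  wit kk G A C (m ## n) (cmp m n g f) k (pb (stop k) Th (spsi m n g f))" unfolding cmp_def using Th adm_Theta[OF m n some_Theta[OF m n]]
 by(intro wit_tail[OF A C.gpre_axioms contr_sys_prod[OF m contr_sys_spx[OF n]] dset_sharp[OF m n] k _ _ _ _ spsi_asym[OF f g]]) (simp_all add: adm_def)

end

section \<open>Passage of the composition product to the limit\<close>

lemma pmap_prod: assumes "pmap PP PP' h" "pmap QQ QQ' h'" shows "pmap (pprod PP QQ) (pprod PP' QQ') (%w. (h (fst w), h' (snd w)))" unfolding pmap_def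
proof
 fix R assume "R:pprod PP QQ"
 then obtain P Q where R: "P:PP" "Q:QQ" "R = P \<times> Q" by(auto simp: pprod_def)
 obtain P' Q' where P': "P':PP'" "h ` P <= P'" "con_on P h" and Q': "Q':QQ'" "h' ` Q <= Q'" "con_on Q h'"
  using pmapD[OF assms(1) R(1)] pmapD[OF assms(2) R(2)] by metis
 have "con_on R (%w. (h (fst w), h' (snd w)))" unfolding R(3) by(intro continuous_on_Pair continuous_on_compose2[OF P'(3)] continuous_on_compose2[OF Q'(3)]
  continuous_on_fst continuous_on_snd continuous_on_id) auto
 thus "EX S:pprod PP' QQ'. (%w. (h (fst w), h' (snd w))) ` R <= S & con_on R (%w. (h (fst w), h' (snd w)))"
  using P' Q' R(3) by(intro bexI[of _ "P' \<times> Q'"]) (auto simp: pprod_def)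
qed

lemma pmap_id: "pmap PP PP (%p. p)" unfolding pmap_def by(auto intro: continuous_on_id)

lemma pmap_assoc: "pmap (pprod PP (pprod QQ RR)) (pprod (pprod PP QQ) RR) (%(x, y, z). ((x, y), z))"
 "pmap (pprod (pprod PP QQ) RR) (pprod PP (pprod QQ RR)) (%w. (fst (fst w), snd (fst w), snd w))" unfolding pmap_def pprod_def case_prod_unfold
 by(auto intro!: cont_prod) (auto 0 4 simp: image_iff)

definition tmap where "tmap al be Th = (%p. (aff al (fst (Th p)), aff be (snd (Th p))))"

text \<open>The support of \<open>aff al p\<close> is the image of \<open>supp p\<close> under
  \<open>al\<close>. Hence the position required of the second variable still depends only on the
  simplex of \<open>p\<close>, as the filter \<open>sdp\<close> demands.\<close>

lemma adm_prod: assumes m: "dset m" and n: "dset n" and k: "dset k" and l: "dset l" and al: "cofinal k m al" and be: "cofinal l n be" and Th: "adm j k l Th"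
 shows "adm j m n (tmap al be Th)" unfolding adm_def tmap_def
proof
 let ?h = "%w. (aff al (fst w), aff be (snd w))"
 show "pmap (cells (Fd j)) (pcells m n) (%p. ?h (Th p))" by(rule pmap_comp[OF conjunct1[OF Th[unfolded adm_def]] pmap_prod[OF pmap_cof[OF al] pmap_cof[OF be]]])
 have "filterlim ?h (ptail m n) (sdp (sfil k) supp l)" unfolding flim_tfil ev_sdp[OF l] ev_sfil[OF k]
 proof
  fix v assume v: "v:Fd (m ## n)"
  note u = al[unfolded cof_ucof] be[unfolded cof_ucof]
  have v': "fst v:Fd m" "snd v c:Fd n" if "c:spx (Fd m)" for c using v that by(auto simp: Field_sharp[OF m n])
  have v1: "fst v:Fd m" using v by(auto simp: Field_sharp[OF m n])
  obtain x where x: "x:Fd k" "!!z. z:rl (k `` {x})==>aff al z:rl (m `` {fst v})" by(rule ucof_tail[OF u(1) v1]) blast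
  have "EX y. y:Fd l & (al ` c:spx (Fd m) -->
  (ALL z:rl (l `` {y}). aff be z:rl (n `` {snd v (al ` c)})))" for c using ucof_tail[OF u(2) v'(2)] dset_ne[OF l] by metis
  then obtain xi where xi: "!!c. xi c:Fd l" "!!c z. [|al ` c:spx (Fd m); z:rl (l `` {xi c})|] ==>aff be z:rl (n `` {snd v (al ` c)})" by metis
  have "?h (p, q):ptails m (tls n) v" if p: "p:rl (k `` {x})" and q: "q:rl (l `` {xi (supp p)})" for p q
  proof -
  have "al ` supp p:spx (Fd m)" using supp_spx[OF x(2)[OF p]] aff_pos(2)[OF p, of al] by(auto simp: sx_def intro: FieldI2)
  thus ?thesis using x(2)[OF p] xi(2)[OF _ q] by(simp add: ptails_def tls_def aff_pos(2)[OF p])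
  qed
  thus "EX xi. (ALL c. xi c:Fd l) & (EX x:Fd k. ALL p:rl (k `` {x}). ALL q:rl (l `` {xi (supp p)}). ?h (p, q):ptails m (tls n) v)"
  using xi(1) x(1) by(intro exI[of _ xi]) blast
 qed
 from filterlim_compose[OF this adm_sdp[OF k l Th]]
 show "filterlim (%p. ?h (Th p)) (ptail m n) (sfil j)" .
qed

lemma casym_spb: assumes B: "gpre G B" and C: "gpre G C" and l: "dset l" and n: "dset n" and be: "cofinal l n be" and g: "scasym G B C n g"
 shows "scasym G B C l (spb l be g)"
proof -
 interpret C: gpre G C by(rule C)
 interpret En: gpre G "Cb (stop n) C" by(rule C.Cb_gpre)
 interpret El: gpre G "Cb (stop l) C" by(rule C.Cb_gpre)
 let ?p = "%u. \<lambda>p\<in>tsp (stop l). u (aff be p)"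
 have c: "cmap (stop l) (stop n) (aff be)" unfolding rtop_weak by(rule pmap_cmap[OF pmap_cof[OF be]])
 have b: "aff be p:tsp (stop n)" if "p:tsp (stop l)" for p using c that by(auto simp: continuous_map_def)
 have P: "?p u:cA (Cb (stop l) C)" if "u:cA (Cb (stop n) C)" for u by(rule Cb_pb[OF that c])
 have "cdist (Cb (stop l) C) (?p u) (?p v) <= cdist (Cb (stop n) C) u v" if "u:cA (Cb (stop n) C)" "v:cA (Cb (stop n) C)" for u v
  by(subst C.cdist_Cb_le_iff[OF P[OF that(1)] P[OF that(2)] En.cdist_ge0]) (use C.cdist_val_le[OF that b] in "simp del: tsp_rl_topology")
 from cmap_contr[OF En.pre_cstar_axioms El.pre_cstar_axioms this P casym_cont[OF g]]
 have 1: "cmap (ntop B) (ntop (Cb (stop l) C)) (spb l be g)" unfolding pb_def by blast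
 obtain M where M: "!!x. x:cA B==>cnorm (Cb (stop n) C) (g x) <= cnorm B x + M" using casym_bound[OF g] by blast
 have "cnorm (Cb (stop l) C) (spb l be g x) <= cnorm B x + M" if x: "x:cA B" for x
 proof -
  note gx = amorD(1)[OF casym_asym[OF g] x]
  have "cnorm (Cb (stop l) C) (spb l be g x) <= cnorm (Cb (stop n) C) (g x)"
  by(rule C.norm_Cb_leI[OF En.norm_nonneg[OF gx]]) (use C.nval_le[OF gx b] in "simp add: pb_def")
  also note M[OF x]
  finally show ?thesis .
 qed
 thus ?thesis unfolding camor_def using 1 sasym_spb[OF B C l n be casym_asym[OF g]] by blast
qed

lemma wit_shom_right: assumes A: "gpre G A" and B: "gpre G B" and n: "dset n" and w: "wit k G A B m f n g" and h: "shom G A B n g g'"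
 shows "wit k G A B m f n g'"
proof -
 obtain al be where k: "dset k" "cofinal k m al" "cofinal k n be" "shom G A B k (spb k al f) (spb k be g)" using w unfolding wit_def by blast
 thus ?thesis using ahom_trans[OF A B fspace_sx[OF k(1)] k(4) shom_spb[OF A B k(1) n k(3) h]] unfolding wit_def by blast
qed

text \<open>The homotopies between the factors live over \<open>k\<close> and \<open>l\<close>, so
  the two products are homotopic over \<open>k ## l\<close>. The maps \<open>tmap\<close> from there
  to the products of the original realizations are admissible, and \<open>cmp_tail\<close> connects
  each pullback with the product it stands for.\<close>

lemma cmp_congr:
 fixes A::"('g, 'a) galg" and B::"('g, 'b) galg" and C::"('g, 'c) galg" and k::"'k rel" and l::"'l rel" and m::"'i rel" and n::"'j rel" and m'::"'i' rel" and n'::"'j' rel"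
 assumes A: "gpre G A" and B: "calg G B" and C: "calg G C" and m: "dset m" "dset m'" and n: "dset n" "dset n'"
  and f: "sasym G A B m f" "sasym G A B m' f'" and g: "scasym G B C n g" "scasym G B C n' g'" and wf: "wit k G A B m f m' f'" and wg: "wit l G B C n g n' g'"
 shows "EX kk::((('i*('i set=>'j))*('k*('k set=>'l))*'i*('i set=>'j)) \<times> (('i'*('i' set=>'j'))*('k*('k set=>'l))*'i'*('i' set=>'j'))) rel.
  wit kk G A C (m ## n) (cmp m n g f) (m' ## n') (cmp m' n' g' f')"
proof -
 note Bg = calg_gpre[OF B] and Cg = calg_gpre[OF C]
 obtain al al' where k: "dset k" "cofinal k m al" "cofinal k m' al'" "shom G A B k (spb k al f) (spb k al' f')" using wf unfolding wit_def by blast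
 obtain be be' where l: "dset l" "cofinal l n be" "cofinal l n' be'" "shom G B C l (spb l be g) (spb l be' g')" using wg unfolding wit_def by blast
 note d = dset_sharp[OF k(1) l(1)]
 obtain Th where Th: "adm (k ## l) k l Th" using Thm_nonempty[OF k(1) l(1)] adm_Theta[OF k(1) l(1)] by blast
 note ad = adm_prod[OF m(1) n(1) k(1) l(1) k(2) l(2) Th] adm_prod[OF m(2) n(2) k(1) l(1) k(3) l(3) Th]
 have eq: "pb (stop (k ## l)) (tmap al be Th) (spsi m n g f) = pb (stop (k ## l)) Th (spsi k l (spb l be g) (spb k al f))"
  if "adm (k ## l) m n (tmap al be Th)" for m::"'u rel" and n::"'v rel" and al be and f::"'a=>_" and g::"'b=>_=>'c"
  using adm_in[OF that] adm_in[OF Th] unfolding pb_def psi_def tmap_def by(intro ext restrict_ext) (auto simp: mem_Times_iff)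
 note cg = casym_spb[OF Bg Cg l(1) n(1) l(2) g(1)] casym_spb[OF Bg Cg l(1) n(2) l(3) g(2)]
 have h: "shom G A C (k ## l) (pb (stop (k ## l)) (tmap al be Th) (spsi m n g f)) (pb (stop (k ## l)) (tmap al' be' Th) (spsi m' n' g' f'))"
  using adm_pb_hom[OF A B C k(1) l(1) d Th spsi_hom[OF A B C k(1) l(1) k(4) l(4) cg]] unfolding eq[OF ad(1), symmetric] eq[OF ad(2), symmetric] .
 obtain kk1::"(('i*('i set=>'j))*('k*('k set=>'l))*'i*('i set=>'j)) rel"
  where w1: "wit kk1 G A C (m ## n) (cmp m n g f) (k ## l) (pb (stop (k ## l)) (tmap al be Th) (spsi m n g f))"
  using cmp_tail[OF A B C m(1) n(1) d ad(1) f(1) g(1)] ..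
 obtain kk2::"(('i'*('i' set=>'j'))*('k*('k set=>'l))*'i'*('i' set=>'j')) rel"
  where w2: "wit kk2 G A C (m' ## n') (cmp m' n' g' f') (k ## l) (pb (stop (k ## l)) (tmap al' be' Th) (spsi m' n' g' f'))"
  using cmp_tail[OF A B C m(2) n(2) d ad(2) f(2) g(2)] ..
 have s: "sasym G A C (k ## l) (pb (stop (k ## l)) (tmap al' be' Th) (spsi m' n' g' f'))" using h by(simp add: ahom_def)
 show ?thesis using wit_trans[OF A Cg d s wit_shom_right[OF A Cg d w1 h] wit_sym[OF A Cg w2]] by blast
qed

subsection \<open>Associativity\<close>

text \<open>
 The lift \<open>ka\<close> of the composition of \<open>h\<close> and \<open>g\<close> agrees asymptotically with the composition of the
 lifts at each element \<open>b\<close>, hence uniformly for \<open>b\<close> in a compact set, because \<open>g\<close> is continuous and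
 \<open>h\<close> is asymptotically contractive, uniformly on compact sets.
\<close>

lemma lift_unif: assumes A: "gpre G A" and B: "calg G B" and C: "calg G C" and D: "calg G D" and m: "dset m" and n: "dset n" and p: "dset p" and j: "dset j"
  and f: "sasym G A B m f" and g: "scasym G B C n g" and h: "scasym G C D p h" and Th: "adm j n p Th" and ka: "scasym G B D j ka"
  and eq: "!!b. b:cA B==>aeq (sfil j) D (ka b) (pb (stop j) Th (spsi n p h g) b)" and a: "a:cA A"
 shows "aeq (sdp (sfil m) supp j) D (%w. ka (f a (fst w)) (snd w)) (%w. h (g (f a (fst w)) (fst (Th (snd w)))) (snd (Th (snd w))))"
proof -
 note Bg = calg_gpre[OF B] and Cg = calg_gpre[OF C] and Dg = calg_gpre[OF D] and Fn = fspace_sx[OF n] and Fj = fspace_sx[OF j]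
 interpret B: gpre G B by(rule Bg)
 interpret C: gpre G C by(rule Cg)
 interpret D: gpre G D by(rule Dg)
 interpret En: gpre G "Cb (stop n) C" by(rule C.Cb_gpre)
 interpret Ep: gpre G "Cb (stop p) D" by(rule D.Cb_gpre)
 interpret Ej: gpre G "Cb (stop j) D" by(rule D.Cb_gpre)
 have fa: "f a:cA (Cb (wtop (cells (Fd m))) B)" using amorD(1)[OF f a] by(simp add: rtop_weak)
 have fv: "f a x:cA B" if "x:rl (Fd m)" for x using B.Cb_val[OF fa, of x] that by simp
 note gc = amorD(1)[OF casym_asym[OF g]] and hc = amorD(1)[OF casym_asym[OF h]] and kac = amorD(1)[OF casym_asym[OF ka]]
 have gv: "g b y:cA C" if "b:cA B" "y:rl (Fd n)" for b y using C.Cb_val[OF gc[OF that(1)], of y] that by simp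
 have hv: "h c z:cA D" if "c:cA C" "z:rl (Fd p)" for c z using D.Cb_val[OF hc[OF that(1)], of z] that by simp
 have Thv: "fst (Th q):rl (Fd n)" "snd (Th q):rl (Fd p)" if "q:rl (Fd j)" for q using adm_in[OF Th that] by(auto simp: mem_Times_iff)
 let ?k = "%b q. h (g b (fst (Th q))) (snd (Th q))"
 have cell_sub: "cell_of (Fd m) c <= rl (Fd m)" for c using rl_mono by(auto simp: cell_of_def dest!: spxD)
 show ?thesis
 proof(rule D.aeqI)
  fix ep::real assume ep: "0 < ep"
  hence pos: "0 < ep / 8" by simp
  have "EX y. y:Fd j & (ALL q:rl (j `` {y}). ALL x:cell_of (Fd m) c. cdist D (ka (f a x) q) (?k (f a x) q) <= ep)" for c
  proof -
  let ?c = "cell_of (Fd m) c"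
  have cc: "cmap (tos ?c) T (%x. u (f a x))" if "!!R. R:cells (Fd m)==>cmap (tos R) T (%x. u (f a x))" for T and u::"_=>'z"
  using that cell_of(3)[of "Fd m" c] by auto
  have cka: "cmap (tos ?c) (ntop (Cb (stop j) D)) (%x. ka (f a x))" and cg: "cmap (tos ?c) (ntop (Cb (stop n) C)) (%x. g (f a x))"
  by(rule cc, rule scasym_cont[OF ka fa], assumption) (rule cc, rule scasym_cont[OF g fa], assumption)
  have "\<forall>\<^sub>F q in sfil j. ALL x:?c. cdist D (ka (f a x) q) (?k (f a x) q) <= ep"
  proof(rule cpt_ev[OF cell_of(2)])
  fix x0 assume x0: "x0 : ?c"
  define b0 where "b0 = f a x0"
  have b0: "b0:cA B" using fv cell_sub x0 by(auto simp: b0_def)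
  obtain V1 where V1: "open V1" "x0:V1" "!!x. x:V1 Int ?c==>cdist (Cb (stop j) D) (ka (f a x)) (ka b0) < ep / 8"
  unfolding b0_def by(rule cmap_atin[OF Ej.pre_cstar_axioms cka x0 pos]) blast
  obtain V2 where V2: "open V2" "x0:V2" "!!x. x:V2 Int ?c==>cdist (Cb (stop n) C) (g (f a x)) (g b0) < ep / 8"
  unfolding b0_def by(rule cmap_atin[OF En.pre_cstar_axioms cg x0 pos]) blast
  \<comment> \<open>A compact neighbourhood of \<open>x0\<close> in its cell, on which
    \<open>g (f a s)\<close> stays uniformly close to \<open>g b0\<close>. It is the parameter set
    for \<open>as_unifity\<close>, so that applying \<open>h\<close> keeps both uniformly close over
    the whole neighbourhood.\<close>
  define I where "I = {s : ?c. cdist (Cb (stop n) C) (g (f a s)) (g b0) <= ep / 8}"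
  have "cmap (tos ?c) (ntop (Cb (stop n) C)) (%s. cminus (Cb (stop n) C) (g (f a s)) (g b0))"
  using En.cont_map_opn[of Add, OF _ cg, of "%_. cscale (Cb (stop n) C) (- 1) (g b0)"] En.scale_closed[OF gc[OF b0]] by(simp add: cminus_def opcs_def)
  from En.cont_map_norm[OF this]
  have "con_on ?c (%s. cnorm (Cb (stop n) C) (cminus (Cb (stop n) C) (g (f a s)) (g b0)))" by simp
  hence "con_on ?c (%s. cdist (Cb (stop n) C) (g (f a s)) (g b0))" by(rule continuous_on_eq) (use gc[OF fv] gc[OF b0] cell_sub in "auto simp: cdist_def")
  hence "closed I" unfolding I_def using cell_of(2)[of "Fd m" c] closed_rl by(intro continuous_on_closed_Collect_le) (auto simp: cell_of_def dest!: spxD)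
  hence I: "compact I" using cell_of(2)[of "Fd m" c] compact_Int_closed[of ?c I] by(simp add: I_def Int_absorb1 Collect_conj_eq Int_left_absorb)
  have Ic: "I <= ?c" "I <= rl (Fd m)" using cell_sub by(auto simp: I_def)
  have near: "cdist C (g (f a s) y) (g b0 y) <= ep / 8" if "s:I" "y:rl (Fd n)" for s y
  using C.cdist_val_le[OF gc[OF fv] gc[OF b0], of s y] that Ic by(auto simp: I_def)
  have "\<forall>\<^sub>F w in sdp (sfil n) supp p. ALL s:I. cdist D (h (g (f a s) (fst w)) (snd w)) (h (g b0 (fst w)) (snd w)) <= ep / 8 + ep / 8"
  proof(rule as_unifity[OF Dg p I, where X = "\<Union>(cells (Fd n))" and K = "cell_of (Fd n)"
  and P = "%y s. h (g (f a s) y)" and Q = "%y s. h (g b0 y)"])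
  fix d
  let ?d = "cell_of (Fd n) d"
  have dY: "cmap (tos ?d) (stop n) (%z. z)" using cont_map_top_of_set_piece[of ?d "cells (Fd n)"] cell_of(3)[of "Fd n" d] by(auto simp: rtop_weak)
  have "cmap (tos I) (ntop (Cb (stop n) C)) (%s. g (f a s))" using continuous_map_from_subtopology_mono[OF cg Ic(1)] .
  from uncurry_cont[OF Cg this dY]
  have 1: "cmap (tos (I \<times> ?d)) (ntop C) (%(s, y). g (f a s) y)" .
  have 2: "cmap (tos (?d \<times> I)) (tos (I \<times> ?d)) (%(y, s). (s, y))" by(auto simp: continuous_map_in_subtopology case_prod_unfold intro!: cont_prod)
  show "cmap (tos (?d \<times> I)) (ntop (Cb (stop p) D)) (%(y, s). h (g (f a s) y))"
  using continuous_map_compose[OF continuous_map_compose[OF 2 1] casym_cont[OF h]] by(simp add: o_def case_prod_unfold)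
  have 3: "cmap (tos ?d) (ntop C) (g b0)" using continuous_map_compose[OF dY, of "ntop C" "g b0"] gc[OF b0] by(simp add: cA_Cb o_def)
  have 4: "cmap (tos (?d \<times> I)) (tos ?d) fst" by(auto simp: continuous_map_in_subtopology intro!: continuous_on_fst continuous_on_id)
  show "cmap (tos (?d \<times> I)) (ntop (Cb (stop p) D)) (%(y, s). h (g b0 y))"
  using continuous_map_compose[OF continuous_map_compose[OF 4 3] casym_cont[OF h]] by(simp add: o_def case_prod_unfold)
  next
  show "\<forall>\<^sub>F y in sfil n. y:\<Union>(cells (Fd n)) &
  (ALL s:I. cdist (Simpl p D) (Simpl_class p D (h (g (f a s) y))) (Simpl_class p D (h (g b0 y))) <= ep / 8)" using Fn[unfolded fspace_def]
  proof eventually_elim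
  case (elim y)
  hence y: "y:rl (Fd n)" by simp
  have "cdist (Simpl p D) (Simpl_class p D (h (g (f a s) y))) (Simpl_class p D (h (g b0 y))) <= ep / 8" if s: "s:I" for s
  using order_trans[OF asym_class_cdist[OF C Dg fspace_sx[OF p] casym_asym[OF h] gv[OF fv y] gv[OF b0 y]] near[OF s y]] s Ic(2) by blast
  thus ?case using y by simp
  qed
  qed (use cell_of ep in simp_all)
  from adm_sdp[OF n p Th, unfolded filterlim_iff, rule_format, OF this]
  have k: "\<forall>\<^sub>F q in sfil j. ALL s:I. cdist D (?k (f a s) q) (?k b0 q) <= ep / 4" by simp
  have "\<forall>\<^sub>F q in sfil j. ALL x:V1 Int V2 Int ?c. cdist D (ka (f a x) q) (?k (f a x) q) <= ep"
  using k D.aeqD[OF eq[OF b0] pos] Fj[unfolded fspace_def]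
  proof eventually_elim
  case (elim q)
  hence q: "q:rl (Fd j)" by simp
  have e: "cdist D (ka b0 q) (?k b0 q) < ep / 8" using elim(2) q Thv[OF q] by(simp add: pb_def psi_def mem_Times_iff)
  show ?case
  proof
  fix x assume x: "x:V1 Int V2 Int ?c"
  have xI: "x:I" "x:rl (Fd m)" using x V2(3)[of x] cell_sub by(auto simp: I_def)
  note mem = D.Cb_val[OF kac[OF fv[OF xI(2)]], of q] D.Cb_val[OF kac[OF b0], of q]
  hv[OF gv[OF fv[OF xI(2)] Thv(1)[OF q]] Thv(2)[OF q]] hv[OF gv[OF b0 Thv(1)[OF q]] Thv(2)[OF q]]
  have "cdist D (ka (f a x) q) (?k (f a x) q) <= cdist D (ka (f a x) q) (ka b0 q) + cdist D (ka b0 q) (?k (f a x) q)" using mem q by(intro D.cdist_tri) auto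
  also have "cdist D (ka b0 q) (?k (f a x) q) <= cdist D (ka b0 q) (?k b0 q) + cdist D (?k b0 q) (?k (f a x) q)" using mem q by(intro D.cdist_tri) auto
  also have "cdist D (ka (f a x) q) (ka b0 q) <= ep / 8" using D.cdist_val_le[OF kac[OF fv[OF xI(2)]] kac[OF b0], of q] V1(3)[of x] x q by simp
  also have "cdist D (?k b0 q) (?k (f a x) q) <= ep / 4" using elim(1) xI(1) by(simp add: D.cdist_comm[of "?k b0 q"])
  finally show "cdist D (ka (f a x) q) (?k (f a x) q) <= ep" using e ep by simp
  qed
  qed
  thus "EX V. open V & x0:V & (\<forall>\<^sub>F q in sfil j. ALL x:V Int ?c. cdist D (ka (f a x) q) (?k (f a x) q) <= ep)"
  using V1 V2 by(intro exI[of _ "V1 Int V2"]) auto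
  qed
  thus ?thesis unfolding ev_sfil[OF j] by blast
  qed
  then obtain xi where xi: "!!c. xi c:Fd j" "!!c q x. [|q:rl (j `` {xi c}); x:cell_of (Fd m) c|]==>cdist D (ka (f a x) q) (?k (f a x) q) <= ep" by metis
  show "\<forall>\<^sub>F w in sdp (sfil m) supp j. cdist D (ka (f a (fst w)) (snd w)) (?k (f a (fst w)) (snd w)) <= ep" unfolding ev_sdp[OF j]
  proof(intro exI[of _ xi] conjI allI xi(1))
  show "\<forall>\<^sub>F x in sfil m. ALL z:rl (j `` {xi (supp x)}). cdist D (ka (f a (fst (x, z))) (snd (x, z))) (?k (f a (fst (x, z))) (snd (x, z))) <= ep"
  using fspace_sx[OF m, unfolded fspace_def]
  proof eventually_elim
  case (elim x)
  hence "x:cell_of (Fd m) (supp x)" by(intro cell_of(1)) simp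
  thus ?case using xi(2) by simp
  qed
  qed
 qed
qed

abbreviation cells3 where "cells3 m n p == pprod (cells (Fd m)) (pcells n p)"

abbreviation tail3 where "tail3 m n p == tfil (m ## n ## p) (ptails m (ptails n (tls p)))"

definition psi3 where "psi3 m n p h g f = (%a. \<lambda>w\<in>rl (Fd m) \<times> (rl (Fd n) \<times> rl (Fd p)).
  h (g (f a (fst w)) (fst (snd w))) (snd (snd w)))"

context
 fixes G::"'g monoid" and m::"'i rel" and n::"'j rel" and p::"'l rel" assumes m: "dset m" and n: "dset n" and p: "dset p"
begin

lemma contr_sys3: "contr_sys (cells3 m n p) (m ## n ## p) (ptails m (ptails n (tls p)))" by(intro contr_sys_prod contr_sys_spx m n p)

text \<open>Two applications of the product construction, the second with the product of the first
  two realizations as base and pairs of supports as cells. The reassociation then moves the result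
  to the filter of right-nested tails.\<close>

lemma psi3_asym: assumes A: "gpre G A" and B: "calg G B" and C: "calg G C" and D: "calg G D"
  and f: "sasym G A B m f" and g: "scasym G B C n g" and h: "scasym G C D p h" shows "amor G A D (wtop (cells3 m n p)) (tail3 m n p) (psi3 m n p h g f)"
proof -
 have s1: "amor G A C (wtop (pcells m n)) (sdp (sfil m) supp n) (spsi m n g f)"
  using amor_psi'[OF A B C n weak_spx[OF A B C m n] cell_of, of f g] f g by(simp add: rtop_weak)
 let ?K = "%(c, d). cell_of (Fd m) c \<times> cell_of (Fd n) d"
 have K: "x:\<Union>(pcells m n)==>x : ?K (case x of (x, y)=>(supp x, supp y))" "compact (?K c)" "?K c = {} \<or> ?K c:pcells m n" for x c
 proof -
  show "x:\<Union>(pcells m n)==>x : ?K (case x of (x, y)=>(supp x, supp y))" using cell_of(1)[of "fst x" "Fd m"] cell_of(1)[of "snd x" "Fd n"]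
  unfolding Union_pprod case_prod_unfold by(simp add: mem_Times_iff del: Union_cells)
  show "compact (?K c)" by(simp add: case_prod_unfold compact_Times cell_of(2))
  show "?K c = {} \<or> ?K c:pcells m n" using cell_of(3)[of "Fd m" "fst c"] cell_of(3)[of "Fd n" "snd c"] unfolding pprod_def by fastforce
 qed
 have s2: "amor G A D (wtop (pprod (pcells m n) (cells (Fd p)))) (sdp (sdp (sfil m) supp n) (%(x, y). (supp x, supp y)) p)
  (psi (\<Union>(pcells m n)) (rl (Fd p)) h (spsi m n g f))"
  by(rule amor_psi'[where K = ?K, OF A C D p sdp_fspace[OF n weak_spx[OF A B C m n]] _ _ _ s1 h]) (rule K, assumption | rule K)+
 note s3 = amor_pb[OF s2 pmap_cmap[OF pmap_assoc(1)] ptails_assoc[OF m n p] tails_fspace[OF contr_sys_tails[OF contr_sys3]]]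
 have "pb (wtop (cells3 m n p)) (%(x, y, z). ((x, y), z)) (psi (\<Union>(pcells m n)) (rl (Fd p)) h (spsi m n g f)) = psi3 m n p h g f"
  unfolding pb_def psi_def psi3_def tsp_wtop Union_pprod Union_cells by(intro ext restrict_ext) auto
 with s3 show ?thesis by simp
qed

text \<open>A cell of \<open>j\<close> is mapped by \<open>Th1\<close> into a product of two
  simplices, so only finitely many pairs of supports occur on it, and one element of
  \<open>p\<close> dominates what the tail requires of the third variable over all of them.\<close>

lemma left_tail: assumes k: "dset k" and j: "dset j" and Th1: "adm j m n Th1" and Th2: "adm k j p Th2"
 defines "Ph == %w. (fst (Th1 (fst (Th2 w))), snd (Th1 (fst (Th2 w))), snd (Th2 w))"
 shows "pmap (cells (Fd k)) (cells3 m n p) Ph" "filterlim Ph (tail3 m n p) (sfil k)"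
proof -
 have P1: "pmap (cells (Fd j)) (pcells m n) Th1" and P2: "pmap (cells (Fd k)) (pcells j p) Th2" using Th1 Th2 by(simp_all add: adm_def)
 from pmap_comp[OF pmap_comp[OF P2 pmap_prod[OF P1 pmap_id]] pmap_assoc(2)]
 show "pmap (cells (Fd k)) (cells3 m n p) Ph" by(simp add: Ph_def)
 let ?h = "%w. (fst (Th1 (fst w)), snd (Th1 (fst w)), snd w)"
 have "filterlim ?h (tail3 m n p) (sdp (sfil j) supp p)" unfolding flim_tfil ev_sdp[OF p]
 proof
  fix v assume v: "v:Fd (m ## n ## p)"
  have v1: "fst v:Fd m" "!!c. c:spx (Fd m)==>fst (snd v c):Fd n" "!!c d. [|c:spx (Fd m); d:spx (Fd n)|]==>snd (snd v c) d:Fd p"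
  proof -
  have *: "fst v:Fd m" "snd v:spx (Fd m) \<rightarrow>\<^sub>E Fd (n ## p)" using v by(auto simp: Field_sharp[OF m dset_sharp[OF n p]])
  show "fst v:Fd m" by(rule *)
  fix c assume "c:spx (Fd m)"
  hence c: "snd v c:Fd n \<times> (spx (Fd n) \<rightarrow>\<^sub>E Fd p)" using PiE_mem[OF *(2)] by(simp add: Field_sharp[OF n p])
  thus "fst (snd v c):Fd n" by auto
  show "snd (snd v c) d:Fd p" if "d:spx (Fd n)" for d using c PiE_mem[OF _ that] by(auto simp: mem_Times_iff)
  qed
  let ?v = "(fst v, \<lambda>c\<in>spx (Fd m). fst (snd v c))"
  have ev: "\<forall>\<^sub>F x in sfil j. Th1 x:ptails m (tls n) ?v" using Th1 v1 unfolding adm_def flim_tfil by(simp add: Field_sharp[OF m n])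
  have "EX y. y:Fd p & (ALL x:cell_of (Fd j) c. (snd (snd v (supp (fst (Th1 x)))) (supp (snd (Th1 x))), y):p)" for c
  proof(cases "cell_of (Fd j) c = {}")
  case True
  thus ?thesis using dset_ne[OF p] by auto
  next
  case False
  then obtain Q where Q: "Q:pcells m n" "Th1 ` cell_of (Fd j) c <= Q" using pmapD[OF P1] cell_of(3) by metis
  then obtain rh rh' where rh: "rh:spx (Fd m)" "rh':spx (Fd n)" "Q = rl rh \<times> rl rh'" by(auto simp: pprod_def cells_def)
  let ?K = "(%(c, d). snd (snd v c) d) ` (spx rh \<times> spx rh')"
  have sub: "spx rh <= spx (Fd m)" "spx rh' <= spx (Fd n)" using rh by(auto simp: sx_def)
  have "finite ?K" using rh by(intro finite_imageI finite_cartesian_product fin_spx) (auto simp: sx_def)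
  moreover have "?K <= Fd p" using v1(3) sub by auto
  ultimately obtain y where y: "y:Fd p" "ALL x:?K. (x, y):p" by(rule bexE[OF dset_fin_ub[OF p]])
  have "supp (fst (Th1 x)):spx rh & supp (snd (Th1 x)):spx rh'" if "x:cell_of (Fd j) c" for x
  using subsetD[OF Q(2) imageI[OF that]] unfolding rh(3) by(auto simp: mem_Times_iff intro: supp_spx)
  thus ?thesis using y by(intro exI[of _ y]) force
  qed
  then obtain xi where xi: "!!c. xi c:Fd p" "!!c x. x:cell_of (Fd j) c==>(snd (snd v (supp (fst (Th1 x)))) (supp (snd (Th1 x))), xi c):p" by metis
  show "EX xi. (ALL c. xi c:Fd p) & (\<forall>\<^sub>F x in sfil j. ALL z:rl (p `` {xi (supp x)}). ?h (x, z):ptails m (ptails n (tls p)) v)"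
  proof(intro exI[of _ xi] conjI allI xi(1))
  show "\<forall>\<^sub>F x in sfil j. ALL z:rl (p `` {xi (supp x)}). ?h (x, z):ptails m (ptails n (tls p)) v" using ev fspace_sx[OF j, unfolded fspace_def]
  proof eventually_elim
  case (elim x)
  obtain s t where st: "Th1 x = (s, t)" by(metis surj_pair)
  have s: "s:tls m (fst v)" and t': "t:tls n ((\<lambda>c\<in>spx (Fd m). fst (snd v c)) (supp s))" using elim(1) by(auto simp: st ptails_def)
  have t: "t:tls n (fst (snd v (supp s)))" using t' supp_spx[OF tls_rl[OF s]] by simp
  have "x:cell_of (Fd j) (supp x)" using elim(2) by(intro cell_of(1)) simp
  from xi(2)[OF this] have "p `` {xi (supp x)} <= p `` {snd (snd v (supp s)) (supp t)}" using dset_trans[OF p] by(auto simp: st)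
  from rl_mono[OF this] show ?case using s t by(auto simp: st ptails_def tls_def)
  qed
  qed
 qed
 from filterlim_compose[OF this adm_sdp[OF j p Th2]]
 show "filterlim Ph (tail3 m n p) (sfil k)" by(simp add: Ph_def)
qed

text \<open>For each simplex \<open>c\<close> of \<open>m\<close> the tail prescribes an element of
  \<open>n ## p\<close>; an element beyond which \<open>Th3\<close> stays in the corresponding tail
  is chosen for each \<open>c\<close> separately, as \<open>sdp\<close> permits.\<close>

lemma right_tail: assumes k: "dset k" and Th3: "adm (n ## p) n p Th3" and Th4: "adm k m (n ## p) Th4"
 defines "Ph == %w. (fst (Th4 w), Th3 (snd (Th4 w)))" shows "pmap (cells (Fd k)) (cells3 m n p) Ph" "filterlim Ph (tail3 m n p) (sfil k)"
proof -
 note np = dset_sharp[OF n p]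
 have P3: "pmap (cells (Fd (n ## p))) (pcells n p) Th3" and P4: "pmap (cells (Fd k)) (pcells m (n ## p)) Th4" using Th3 Th4 by(simp_all add: adm_def)
 from pmap_comp[OF P4 pmap_prod[OF pmap_id P3]]
 show "pmap (cells (Fd k)) (cells3 m n p) Ph" by(simp add: Ph_def)
 have "filterlim (%w. (fst w, Th3 (snd w))) (tail3 m n p) (sdp (sfil m) supp (n ## p))" unfolding flim_tfil ev_sdp[OF np]
 proof
  fix v assume v: "v:Fd (m ## n ## p)"
  have "EX u. u:Fd (n ## p) & (c:spx (Fd m) --> (ALL q:rl ((n ## p) `` {u}). Th3 q:ptails n (tls p) (snd v c)))" for c
  proof(cases "c:spx (Fd m)")
  case True
  hence "snd v c:Fd (n ## p)" using v PiE_mem[OF _ True] by(auto simp: Field_sharp[OF m np])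
  thus ?thesis using Th3 unfolding adm_def flim_tfil ev_sfil[OF np] by blast
  qed (use dset_ne[OF np] in blast)
  then obtain xi where xi: "!!c. xi c:Fd (n ## p)" "!!c q. [|c:spx (Fd m); q:rl ((n ## p) `` {xi c})|]==>Th3 q:ptails n (tls p) (snd v c)" by metis
  have "(x, Th3 z):ptails m (ptails n (tls p)) v" if "x:rl (m `` {fst v})" "z:rl ((n ## p) `` {xi (supp x)})" for x z
  proof -
  have x: "x:tls m (fst v)" using that by(simp add: tls_def)
  show ?thesis using xi(2)[OF supp_spx[OF tls_rl[OF x]] that(2)] x unfolding ptails_def[of m] by simp
  qed
  moreover have "fst v:Fd m" using v by(auto simp: Field_sharp[OF m np])
  ultimately show "EX xi. (ALL c. xi c:Fd (n ## p)) & (\<forall>\<^sub>F x in sfil m. ALL z:rl ((n ## p) `` {xi (supp x)}).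
  (fst (x, z), Th3 (snd (x, z))):ptails m (ptails n (tls p)) v)" unfolding ev_sfil[OF m] using xi(1) by(intro exI[of _ xi]) auto
 qed
 from filterlim_compose[OF this adm_sdp[OF m np Th4]]
 show "filterlim Ph (tail3 m n p) (sfil k)" by(simp add: Ph_def)
qed

text \<open>\<open>cmp n p h g\<close> is not known to be continuous on \<open>B\<close>, so the
  continuous lift \<open>ka\<close> of its homomorphism stands in for it as outer factor. The left
  bracketing is literally a pullback of \<open>psi3\<close>, the right one only asymptotically, by
  \<open>lift_unif\<close>; \<open>wit_tail\<close> then compares the two pullbacks.\<close>

lemma cmp_assoc: fixes A::"('g, 'a) galg" and D::"('g, 'd) galg" assumes A: "gpre G A" and B: "calg G B" and C: "calg G C" and D: "calg G D"
  and f: "sasym G A B m f" and g: "scasym G B C n g" and h: "scasym G C D p h"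
 obtains ka kk where "scasym G B D (n ## p) ka" "shom G B D (n ## p) (cmp n p h g) ka" "wit (kk::((('i*('i set=>'j))*(('i*('i set=>'j)) set=>'l)) \<times>
  ('i*('i set=>('j*('j set=>'l))))*'i*('i set=>('j*('j set=>'l)))) rel) G A D
  ((m ## n) ## p) (cmp (m ## n) p h (cmp m n g f)) (m ## n ## p) (cmp m (n ## p) ka f)"
proof -
 note Bg = calg_gpre[OF B] and Dg = calg_gpre[OF D] and mn = dset_sharp[OF m n] and np = dset_sharp[OF n p]
 note dL = dset_sharp[OF mn p] and dR = dset_sharp[OF m np]
 note a1 = adm_Theta[OF m n some_Theta[OF m n]] and a2 = adm_Theta[OF mn p some_Theta[OF mn p]]
  and a3 = adm_Theta[OF n p some_Theta[OF n p]] and a4 = adm_Theta[OF m np some_Theta[OF m np]]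
 note hg = cmp_asym[OF Bg C D n p casym_asym[OF g] h]
 obtain ka where ka: "scasym G B D (n ## p) ka" "smor (n ## p) B D (cmp n p h g) = smor (n ## p) B D ka"
  by(rule Mor_clift[OF B D fspace_sx[OF np] mor_of_Mor[OF hg Bg Dg fspace_sx[OF np]]]) blast
 have eq: "aeq (sfil (n ## p)) D (ka b) (cmp n p h g b)" if "b:cA B" for b
  using ka(2) that mor_of_eq_iff[of G D "stop (n ## p)" "sfil (n ## p)" B ka "cmp n p h g", OF Dg fspace_sx[OF np] amorD(1)[OF casym_asym[OF ka(1)]] amorD(1)[OF hg]] by simp
 have kah: "shom G B D (n ## p) (cmp n p h g) ka"
  by(rule ahom_aeq[OF Bg Dg fspace_sx[OF np] hg casym_asym[OF ka(1)]]) (rule pre_cstar.aeq_sym[OF gpre_pre_cstar[OF Dg] eq])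
 let ?Th1 = "SOME Th. Th:Theta_maps m n" and ?Th2 = "SOME Th. Th:Theta_maps (m ## n) p"
  and ?Th3 = "SOME Th. Th:Theta_maps n p" and ?Th4 = "SOME Th. Th:Theta_maps m (n ## p)"
 let ?L = "%w. (fst (?Th1 (fst (?Th2 w))), snd (?Th1 (fst (?Th2 w))), snd (?Th2 w))" and ?R = "%w. (fst (?Th4 w), ?Th3 (snd (?Th4 w)))"
 note s3 = psi3_asym[OF A B C D f g h]
 obtain kk::"((('i*('i set=>'j))*(('i*('i set=>'j)) set=>'l)) \<times> ('i*('i set=>('j*('j set=>'l))))*'i*('i set=>('j*('j set=>'l)))) rel"
  where w: "wit kk G A D ((m ## n) ## p) (pb (stop ((m ## n) ## p)) ?L (psi3 m n p h g f)) (m ## n ## p) (pb (stop (m ## n ## p)) ?R (psi3 m n p h g f))"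
  using wit_tail[OF A Dg contr_sys3 dL dR left_tail[OF dL mn a1 a2] right_tail[OF dR a3 a4] s3] by blast
 have "pb (stop ((m ## n) ## p)) ?L (psi3 m n p h g f) = cmp (m ## n) p h (cmp m n g f)"
  unfolding cmp_def pb_def psi_def psi3_def using adm_in[OF a1] adm_in[OF a2] by(intro ext restrict_ext) (simp add: mem_Times_iff)
 note w = w[unfolded this]
 have cR: "cmap (stop (m ## n ## p)) (wtop (cells3 m n p)) ?R" unfolding rtop_weak by(rule pmap_cmap[OF right_tail(1)[OF dR a3 a4]])
 have "shom G A D (m ## n ## p) (pb (stop (m ## n ## p)) ?R (psi3 m n p h g f)) (cmp m (n ## p) ka f)"
 proof(rule ahom_sym[OF A Dg fspace_sx[OF dR]], rule ahom_aeq[OF A Dg fspace_sx[OF dR] cmp_asym[OF A B D m np f ka(1)]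
  amor_pb[OF s3 cR right_tail(2)[OF dR a3 a4] fspace_sx[OF dR]]])
  fix a assume a: "a:cA A"
  have l: "aeq (sdp (sfil m) supp (n ## p)) D (%w. ka (f a (fst w)) (snd w)) (%w. h (g (f a (fst w)) (fst (?Th3 (snd w)))) (snd (?Th3 (snd w))))"
  by(rule lift_unif[OF A B C D m n p np f g h a3 ka(1) _ a]) (rule eq[unfolded cmp_def])
  show "aeq (sfil (m ## n ## p)) D (cmp m (n ## p) ka f a) (pb (stop (m ## n ## p)) ?R (psi3 m n p h g f) a)"
  by(rule iffD1[OF aeq_cong, OF _ _ aeq_comp[OF l adm_sdp[OF m np a4]]];
  use fspace_sx[OF dR, unfolded fspace_def] in "eventually_elim")
  (use adm_in[OF a4] adm_in[OF a3] in "auto simp: cmp_def pb_def psi_def psi3_def mem_Times_iff")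
 qed
 from that[OF ka(1) kah wit_shom_right[OF A Dg dR w this]] show thesis .
qed

end

subsection \<open>Homomorphisms as constant lifts\<close>

definition cst::"'i rel=>('a=>'b)=>'a=>'i pt=>'b" where "cst k ph = (%a. \<lambda>z\<in>rl (Fd k). ph a)"

lemma aeq_ev: "[|gpre G B; \<forall>\<^sub>F x in F. u x = v x|]==>aeq F B u v" using aeq_cong[of u v F v v B] pre_cstar.aeq_refl[OF gpre_pre_cstar] by simp

lemma cst_asym: assumes A: "gpre G A" and B: "gpre G B" and k: "dset k" and ph: "ph:Mor G A B" shows "sasym G A B k (cst k ph)" unfolding amor_def
proof(intro conjI ballI)
 show "cst k ph a:cA (Cb (stop k) B)" if "a:cA A" for a using gpre.Cb_const[OF B Mor_closed[OF ph that], of "stop k"] by(simp add: cst_def)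
 fix q a b assume *: "q:opcs G" "a:cA A" "b:cA A"
 have "\<forall>\<^sub>F z in sfil k. cst k ph (opn A q a b) z = opn B q (cst k ph a z) (cst k ph b z)"
  using fspace_sx[OF k, unfolded fspace_def] by eventually_elim (simp add: cst_def Mor_opn[OF ph *])
 thus "aeq (sfil k) B (cst k ph (opn A q a b)) (%z. opn B q (cst k ph a z) (cst k ph b z))" by(rule aeq_ev[OF B])
qed

lemma cst_casym: assumes A: "calg G A" and B: "gpre G B" and k: "dset k" and ph: "ph:Mor G A B" shows "scasym G A B k (cst k ph)" unfolding camor_def
proof(intro conjI)
 interpret A: gpre G A by(rule calg_gpre[OF A])
 interpret B: gpre G B by(rule B)
 interpret E: gpre G "Cb (stop k) B" by(rule B.Cb_gpre)
 show s: "sasym G A B k (cst k ph)" by(rule cst_asym[OF A.gpre_axioms B k ph])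
 have "cdist (Cb (stop k) B) (cst k ph x) (cst k ph y) <= cdist A x y" if "x:cA A" "y:cA A" for x y
  by(subst B.cdist_Cb_le_iff[OF amorD(1)[OF s that(1)] amorD(1)[OF s that(2)] A.cdist_ge0]) (use Mor_cdist[OF A B ph that] in "simp add: cst_def")
 from cmap_contr[OF A.pre_cstar_axioms E.pre_cstar_axioms this amorD(1)[OF s], of "ntop A" "%x. x"]
 show "cmap (ntop A) (ntop (Cb (stop k) B)) (cst k ph)" by simp
 have "cnorm (Cb (stop k) B) (cst k ph a) <= cnorm A a" if "a:cA A" for a
  by(rule B.norm_Cb_leI[OF A.norm_nonneg[OF that]]) (use Mor_norm[OF A B ph that] in "simp add: cst_def")
 thus "EX K. ALL a:cA A. cnorm (Cb (stop k) B) (cst k ph a) <= cnorm A a + K" by(intro exI[of _ 0]) simp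
qed

lemma comp_const_simpl: "ph:Mor G A B==>compose (cA A) (const_simpl k B) ph = smor k A B (cst k ph)"
 unfolding compose_def mor_of_def by(rule restrict_ext) (simp add: const_simpl_def cst_def Mor_closed)

lemma cst_shom: assumes A: "gpre G A" and B: "gpre G B" and k: "dset k" and h: "(ph, ph'):homotopy G A B" shows "shom G A B k (cst k ph) (cst k ph')"
proof -
 note C = gpre.cyl_gpre[OF B]
 obtain Ph where ph: "ph:Mor G A B" "ph':Mor G A B" and Ph: "Ph:Mor G A (cyl B)"
  and e: "compose (cA A) (ev B 0) Ph = ph" "compose (cA A) (ev B 1) Ph = ph'" using h by(auto simp: homotopy_def homotopy_rel_def)
 have ev: "Ph a 0 = ph a" "Ph a 1 = ph' a" if "a:cA A" for a
  using e(1)[symmetric] e(2)[symmetric] that Mor_closed[OF Ph that] by(simp_all add: compose_def gpre.ev_eq[OF B])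
 show ?thesis
 proof(rule ahomI[OF cst_asym[OF A B k ph(1)] cst_asym[OF A B k ph(2)] cst_asym[OF A C k Ph]])
  fix a assume a: "a:cA A"
  show "aeq (sfil k) B (%p. cst k Ph a p 0) (cst k ph a)" "aeq (sfil k) B (%p. cst k Ph a p 1) (cst k ph' a)"
  by(rule aeq_ev[OF B]; use fspace_sx[OF k, unfolded fspace_def] in "eventually_elim, simp add: cst_def ev[OF a]")+
 qed
qed

lemma dset_single: "dset {(i, i)}" by(rule dset_setI) auto

lemma cst_wit: assumes A: "gpre G A" and B: "gpre G B" and k: "dset k" and h: "shom G A B k (cst k ph) (cst k ph')"
 shows "wit k G A B k (cst k ph) {(i, i)} (cst {(i, i)} ph')"
proof -
 obtain x where x: "x:Fd k" using dset_ne[OF k] by blast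
 have c: "cofinal k k (%x. x)" "cofinal k {(i, i)} (%_. i)" using x by(auto simp: cofinal_def Field_def)
 have spbc: "spb k al (cst m ph) = cst k ph" if "al:Fd k \<rightarrow> Fd m" for m::"'m rel" and al and ph::"'b=>'c"
 proof -
  have "aff al z:rl (Fd m)" if "z:rl (Fd k)" for z using that \<open>al:_\<close> by(intro aff_rl[OF that]) (auto dest: supp_sub)
  thus ?thesis by(auto simp: pb_def cst_def intro!: ext restrict_ext)
 qed
 have "spb k (%x. x) (cst k ph) = cst k ph" "spb k (%_. i) (cst {(i, i)} ph') = cst k ph'" by(rule spbc; use c in "simp add: cofinal_def")+
 thus ?thesis using k c h unfolding wit_def by metis
qed

text \<open>A product with an identity is the pullback of \<open>f\<close> along one component of
  the map into the product. This component tends to infinity in \<open>m\<close>, as the identity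
  map of the realization does, so the two pullbacks agree in the limit.\<close>

lemma unit_wit: fixes k::"'k rel" and m::"'i rel" assumes A: "gpre G A" and B: "gpre G B" and k: "dset k" and m: "dset m" and f: "sasym G A B m f"
  and Th: "pmap (cells (Fd k)) (cells (Fd m)) Th" "filterlim Th (sfil m) (sfil k)" and u: "sasym G A B k u" "!!a. a:cA A==>u a = pb (stop k) Th f a"
 shows "EX kk::('k*'i*'i) rel. wit kk G A B k u m f"
proof -
 have t: "filterlim Th (tfil m (tls m)) (sfil k)" "filterlim (%p. p) (tfil m (tls m)) (sfil m)"
  "amor G A B (wtop (cells (Fd m))) (tfil m (tls m)) f" using Th(2) f unfolding spx_filter_tail[of m] by(simp_all add: rtop_weak filterlim_ident)
 obtain kk::"('k*'i*'i) rel" where kk: "wit kk G A B k (pb (stop k) Th f) m (pb (stop m) (%p. p) f)"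
  using wit_tail[OF A B contr_sys_spx[OF m] k m Th(1) t(1) pmap_id t(2,3)] ..
 have R: "aeq F B v w" if "v = w" for F::"'z filter" and v w using that by(intro aeq_ev[OF B]) simp
 have "shom G A B m (pb (stop m) (%p. p) f) f" using amor_pb[OF f _ filterlim_ident fspace_sx[OF m]] amorD(1)[OF f]
  by(intro ahom_aeq[OF A B fspace_sx[OF m] _ f] R) (auto simp: pb_def cA_Cb intro: extensionalityI)
 from wit_shom_right[OF A B m kk this] have w: "wit kk G A B k (pb (stop k) Th f) m f" .
 have c: "cmap (stop k) (stop m) Th" unfolding rtop_weak by(rule pmap_cmap[OF Th(1)])
 have "shom G A B k (pb (stop k) Th f) u" by(rule ahom_aeq[OF A B fspace_sx[OF k] amor_pb[OF f c Th(2) fspace_sx[OF k]] u(1)]) (rule R, simp add: u(2))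
 from wit_sym[OF A B wit_shom_right[OF A B k wit_sym[OF A B w] this]] show ?thesis ..
qed

lemma adm_proj: assumes m: "dset m" and n: "dset n" and Th: "adm k m n Th"
 shows "pmap (cells (Fd k)) (cells (Fd m)) (%w. fst (Th w))" "filterlim (%w. fst (Th w)) (sfil m) (sfil k)"
  "pmap (cells (Fd k)) (cells (Fd n)) (%w. snd (Th w))" "filterlim (%w. snd (Th w)) (sfil n) (sfil k)"
proof -
 have P: "pmap (cells (Fd k)) (pcells m n) Th" and T: "filterlim Th (ptail m n) (sfil k)" using Th by(auto simp: adm_def)
 have "pmap (pcells m n) (cells (Fd m)) fst" "pmap (pcells m n) (cells (Fd n)) snd"
  unfolding pmap_def pprod_def by(force intro!: continuous_on_fst continuous_on_snd continuous_on_id)+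
 from pmap_comp[OF P this(1)] pmap_comp[OF P this(2)]
 show "pmap (cells (Fd k)) (cells (Fd m)) (%w. fst (Th w))" "pmap (cells (Fd k)) (cells (Fd n)) (%w. snd (Th w))" .
 have ev: "\<forall>\<^sub>F w in sfil k. Th w:ptails m (tls n) (x, \<lambda>sg\<in>spx (Fd m). y)" if "x:Fd m" "y:Fd n" for x y
  using T that unfolding flim_tfil by(simp add: Field_sharp[OF m n])
 obtain x0 y0 where xy: "x0:Fd m" "y0:Fd n" using dset_ne[OF m] dset_ne[OF n] by blast
 show "filterlim (%w. fst (Th w)) (sfil m) (sfil k)" unfolding spx_filter_tail[of m] flim_tfil
 proof
  fix x assume "x:Fd m"
  from ev[OF this xy(2)] show "\<forall>\<^sub>F w in sfil k. fst (Th w):tls m x" by eventually_elim (auto simp: ptails_def)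
 qed
 show "filterlim (%w. snd (Th w)) (sfil n) (sfil k)" unfolding spx_filter_tail[of n] flim_tfil
 proof
  fix y assume "y:Fd n"
  from ev[OF xy(1) this] show "\<forall>\<^sub>F w in sfil k. snd (Th w):tls n y"
  proof eventually_elim
  case (elim w)
  hence "fst (Th w):tls m x0" by(auto simp: ptails_def)
  from supp_spx[OF tls_rl[OF this]] elim show ?case by(auto simp: ptails_def)
  qed
 qed
qed

definition idm::"('g, 'a) galg=>'a=>'a" where "idm A = (\<lambda>x\<in>cA A. x)"

lemma idm_Mor: "gpre G A==>idm A:Mor G A A" by(auto simp: Mor_iff idm_def gpre.opn_closed)

lemma unit_right: fixes m::"'i rel" and i::'k assumes A: "calg G A" and B: "calg G B" and m: "dset m" and f: "scasym G A B m f"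
 shows "EX kk::(('k*('k set=>'i))*'i*'i) rel.
  wit kk G A B ({(i, i)} ## m) (cmp {(i, i)} m f (cst {(i, i)} (idm A))) m f"
proof -
 note d = dset_single[of i] and Ag = calg_gpre[OF A]
 note ad = adm_Theta[OF d m some_Theta[OF d m]]
 show ?thesis by(rule unit_wit[OF Ag calg_gpre[OF B] dset_sharp[OF d m] m casym_asym[OF f] adm_proj(3,4)[OF d m ad]
  cmp_asym[OF Ag A B d m cst_asym[OF Ag Ag d idm_Mor[OF Ag]] f]])
  (use adm_in[OF ad] in "auto simp: cmp_def pb_def psi_def cst_def idm_def mem_Times_iff intro!: restrict_ext")
qed

lemma unit_left: fixes m::"'i rel" and i::'k assumes A: "gpre G A" and B: "calg G B" and m: "dset m" and f: "sasym G A B m f"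
 shows "EX kk::(('i*('i set=>'k))*'i*'i) rel.
  wit kk G A B (m ## {(i, i)}) (cmp m {(i, i)} (cst {(i, i)} (idm B)) f) m f"
proof -
 note d = dset_single[of i] and Bg = calg_gpre[OF B]
 note ad = adm_Theta[OF m d some_Theta[OF m d]]
 have fv: "f a x:cA B" if "a:cA A" "x:rl (Fd m)" for a x using pre_cstar.Cb_val[OF gpre_pre_cstar[OF Bg] amorD(1)[OF f that(1)], of x] that(2) by simp
 show ?thesis by(rule unit_wit[OF A Bg dset_sharp[OF m d] m f adm_proj(1,2)[OF m d ad]
  cmp_asym[OF A B B m d f cst_casym[OF B Bg d idm_Mor[OF Bg]]]])
  (use adm_in[OF ad] fv in "auto simp: cmp_def pb_def psi_def cst_def idm_def mem_Times_iff intro!: restrict_ext")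
qed

lemma cmp_cst: assumes m: "dset m" and n: "dset n" and ph: "ph:Mor G A B" and a: "a:cA A"
 shows "cmp m n (cst n ps) (cst m ph) a = cst (m ## n) (compose (cA A) ps ph) a" using adm_in[OF adm_Theta[OF m n some_Theta[OF m n]]] a
 by(auto simp: cmp_def pb_def psi_def cst_def compose_def mem_Times_iff intro!: restrict_ext)

section \<open>The homotopy category\<close>

lemma alg_map_path: assumes B: "gpre G B" and C: "gpre G C" and ps: "alg_map G B C ps" shows "alg_map G (cyl B) (cyl C) (%u. \<lambda>t\<in>{0..1}. ps (u t))"
proof -
 interpret B: gpre G B by(rule B)
 interpret C: gpre G C by(rule C)
 interpret BI: gpre G "cyl B" by(rule B.cyl_gpre)
 have m: "(\<lambda>t\<in>{0..1}. ps (u t)):cA (cyl C)" if "u:cA (cyl B)" for u using alg_map_Cb[OF B C ps, of u "tos {0..1}"] that by(simp add: cyl_def)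
 have "cdist (cyl C) (\<lambda>t\<in>{0..1}. ps (u t)) (\<lambda>t\<in>{0..1}. ps (v t)) <= cdist (cyl B) u v" if uv: "u:cA (cyl B)" "v:cA (cyl B)" for u v
 proof(subst C.cdist_cyl_le_iff[OF m[OF uv(1)] m[OF uv(2)] BI.cdist_ge0], rule ballI)
  fix t::real assume t: "t:{0..1}"
  from order_trans[OF alg_mapD(2)[OF ps B.cyl_val[OF uv(1) t] B.cyl_val[OF uv(2) t]] B.cdist_cyl_val[OF uv t]]
  show "cdist C ((\<lambda>t\<in>{0..1}. ps (u t)) t) ((\<lambda>t\<in>{0..1}. ps (v t)) t) <= cdist (cyl B) u v" using t by simp
 qed
 with m show ?thesis unfolding alg_map_def by(auto simp: B.opn_cyl C.opn_cyl alg_mapD(3)[OF ps] intro!: restrict_ext)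
qed

lemma htpy_iff: assumes B: "gpre G B" shows "(ph, ph'):homotopy G A B <-> ph:Mor G A B & ph':Mor G A B &
  (EX Ph:Mor G A (cyl B). ALL a:cA A. Ph a 0 = ph a & Ph a 1 = ph' a)"
proof -
 have e: "compose (cA A) (ev B t) Ph = ph <-> (ALL a:cA A. Ph a t = ph a)" if "ph:Mor G A B" "Ph:Mor G A (cyl B)" for ph Ph t
 proof -
  have "compose (cA A) (ev B t) Ph = ph <-> (ALL a:cA A. compose (cA A) (ev B t) Ph a = ph a)"
  using that(1) by(auto simp: Mor_iff intro: extensionalityI[OF compose_extensional])
  thus ?thesis using Mor_closed[OF that(2)] by(simp add: compose_def gpre.ev_eq[OF B])
 qed
 show ?thesis by(cases "ph:Mor G A B & ph':Mor G A B") (auto simp: homotopy_def homotopy_rel_def e ball_conj_distrib cong: bex_cong)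
qed

text \<open>Unlike for lifts, the ends of homotopies match exactly here, and paths can simply be
  concatenated.\<close>

lemma equiv_htpy: assumes A: "gpre G A" and B: "gpre G B" shows "equiv (Mor G A B) (homotopy G A B)"
proof(rule equivI')
 interpret B: gpre G B by(rule B)
 note iff = htpy_iff[OF B, where A = A] and C = B.cyl_gpre
 show "homotopy G A B <= Mor G A B \<times> Mor G A B" by(auto simp: homotopy_def homotopy_rel_def)
 show "(ph, ph):homotopy G A B" if "ph:Mor G A B" for ph unfolding iff using that by(intro conjI bexI[OF _ alg_map_Mor[OF alg_map_const[OF B] that A]]) auto
 show "(ph', ph):homotopy G A B" if h: "(ph, ph'):homotopy G A B" for ph ph'
 proof -
  obtain Ph where Ph: "Ph:Mor G A (cyl B)" "ALL a:cA A. Ph a 0 = ph a & Ph a 1 = ph' a" using h iff by blast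
  have "alg_map G (cyl B) (cyl B) (%u. \<lambda>t\<in>{0..1}. u (1 - t))" by(rule alg_map_rpm[OF B]) (auto intro!: continuous_intros)
  from alg_map_Mor[OF this Ph(1) A] show ?thesis
  using h Ph(2) unfolding iff by(intro conjI bexI[of _ "\<lambda>a\<in>cA A. \<lambda>t\<in>{0..1}. Ph a (1 - t)"]) auto
 qed
 show "(ph, om):homotopy G A B" if h: "(ph, ph'):homotopy G A B" "(ph', om):homotopy G A B" for ph ph' om
 proof -
  obtain Ph Ps where Ph: "Ph:Mor G A (cyl B)" "ALL a:cA A. Ph a 0 = ph a & Ph a 1 = ph' a"
  and Ps: "Ps:Mor G A (cyl B)" "ALL a:cA A. Ps a 0 = ph' a & Ps a 1 = om a" using h iff by blast
  have cp: "B.cpath (Ph a) (Ps a):cA (cyl B)" "Ph a 1 = Ps a 0" if a: "a:cA A" for a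
  using B.cpath_cyl[OF Mor_closed[OF Ph(1) a] Mor_closed[OF Ps(1) a]] Ph(2) Ps(2) a by simp_all
  have "(\<lambda>a\<in>cA A. B.cpath (Ph a) (Ps a)):Mor G A (cyl B)" unfolding Mor_iff
  proof(intro conjI ballI)
  show "(\<lambda>a\<in>cA A. B.cpath (Ph a) (Ps a)):cA A \<rightarrow> cA (cyl B)" using cp by auto
  next
  fix q x y assume q: "q:opcs G" and xy: "x:cA A" "y:cA A"
  show "(\<lambda>a\<in>cA A. B.cpath (Ph a) (Ps a)) (opn A q x y)
  = opn (cyl B) q ((\<lambda>a\<in>cA A. B.cpath (Ph a) (Ps a)) x) ((\<lambda>a\<in>cA A. B.cpath (Ph a) (Ps a)) y)"
  using gpre.opn_closed[OF A q xy] xy Mor_opn[OF Ph(1) q xy] Mor_opn[OF Ps(1) q xy] by(simp add: B.opn_cpath)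
  qed simp
  thus ?thesis using h Ph(2) Ps(2) unfolding iff by(intro conjI bexI[of _ "\<lambda>a\<in>cA A. B.cpath (Ph a) (Ps a)"]) (auto simp: B.cpath_def)
 qed
qed

lemma htpy_comp: assumes A: "gpre G A" and B: "calg G B" and C: "calg G C" and h: "(ph, ph'):homotopy G A B" "(ps, ps'):homotopy G B C"
 shows "(compose (cA A) ps ph, compose (cA A) ps' ph'):homotopy G A C"
proof -
 note Bg = calg_gpre[OF B] and Cg = calg_gpre[OF C]
 obtain Ph where ph: "ph:Mor G A B" "ph':Mor G A B" and Ph: "Ph:Mor G A (cyl B)" "ALL a:cA A. Ph a 0 = ph a & Ph a 1 = ph' a"
  using h(1) htpy_iff[OF Bg] by blast
 obtain Ps where ps: "ps:Mor G B C" "ps':Mor G B C" and Ps: "Ps:Mor G B (cyl C)" "ALL a:cA B. Ps a 0 = ps a & Ps a 1 = ps' a"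
  using h(2) htpy_iff[OF Cg] by blast
 have "(compose (cA A) ps ph, compose (cA A) ps ph'):homotopy G A C" unfolding htpy_iff[OF Cg] using Ph(2) Mor_comp[OF ph(1) ps(1) A] Mor_comp[OF ph(2) ps(1) A]
  by(intro conjI bexI[OF _ alg_map_Mor[OF alg_map_path[OF Bg Cg Mor_alg_map[OF B Cg ps(1)]] Ph(1) A]]) (auto simp: compose_def)
 moreover have "(compose (cA A) ps ph', compose (cA A) ps' ph'):homotopy G A C" unfolding htpy_iff[OF Cg]
  using Ps(2) Mor_comp[OF ph(2) ps(1) A] Mor_comp[OF ph(2) ps(2) A]
  by(intro conjI bexI[OF _ Mor_comp[OF ph(2) Ps(1) A]]) (auto simp: compose_def Mor_closed[OF ph(2)])
 ultimately show ?thesis using transD[of "homotopy G A C"] equiv_htpy[OF A Cg] unfolding equiv_def by blast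
qed

lemma homotopy_composition: assumes A: "gpre G A" and B: "calg G B" and C: "calg G C" and ph: "ph:Mor G A B" and ps: "ps:Mor G B C"
 shows "composition (htpy_cat G) A B C (homotopy G B C `` {ps}) (homotopy G A B `` {ph}) = homotopy G A C `` {compose (cA A) ps ph}"
proof -
 note eB = equiv_htpy[OF A calg_gpre[OF B]] and eC = equiv_htpy[OF calg_gpre[OF B] calg_gpre[OF C]] and eA = equiv_htpy[OF A calg_gpre[OF C]]
 have eq: "homotopy G A C `` {compose (cA A) ps' ph'} = homotopy G A C `` {compose (cA A) ps ph}"
  if "ps':homotopy G B C `` {ps}" "ph':homotopy G A B `` {ph}" for ps' ph' using that htpy_comp[OF A B C] by(intro equiv_class_eq[OF eA, symmetric]) auto
 have ne: "homotopy G A B `` {ph} ~= {}" "homotopy G B C `` {ps} ~= {}" using equiv_class_self[OF eB ph] equiv_class_self[OF eC ps] by blast+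
 have "composition (htpy_cat G) A B C (homotopy G B C `` {ps}) (homotopy G A B `` {ph})
  = (UN ps':homotopy G B C `` {ps}. UN ph':homotopy G A B `` {ph}. homotopy G A C `` {compose (cA A) ps' ph'})" by(simp add: homotopy_category_def)
 also have "\<dots> = (UN ps':homotopy G B C `` {ps}. UN ph':homotopy G A B `` {ph}. homotopy G A C `` {compose (cA A) ps ph})" by(intro SUP_cong refl eq)
 finally show ?thesis using ne by simp
qed

lemma category_htpy: fixes G::"'g monoid" shows "category (htpy_cat G::(('g, 'a) galg, _) cat)"
proof
 note simps = homotopy_category_def
 have alg: "calg G A" "gpre G A" if "A:obj (htpy_cat G)" for A::"('g, 'a) galg" using that graded_calg calg_gpre by(auto simp: simps)
 have rep: "EX ph:Mor G A B. f = homotopy G A B `` {ph}" if "f:hom_set (htpy_cat G) A B" for A B::"('g, 'a) galg" and f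
  using that by(auto simp: simps quotient_def)
 have hom: "homotopy G A B `` {ph}:hom_set (htpy_cat G) A B" if "ph:Mor G A B" for A B::"('g, 'a) galg" and ph using that by(simp add: simps quotientI)
 have ident: "ident (htpy_cat G) A = homotopy G A A `` {idm A}" for A::"('g, 'a) galg" by(simp add: simps idm_def)
 note comp = homotopy_composition[OF alg(2) alg(1) alg(1)]
 fix A B C D::"('g, 'a) galg" and f g h
 assume A: "A:obj (htpy_cat G)"
 show "ident (htpy_cat G) A:hom_set (htpy_cat G) A A" unfolding ident by(rule hom[OF idm_Mor[OF alg(2)[OF A]]])
 assume B: "B:obj (htpy_cat G)" and "f:hom_set (htpy_cat G) A B"
 then obtain ph where ph: "ph:Mor G A B" "f = homotopy G A B `` {ph}" using rep by blast
 have "compose (cA A) ph (idm A) = ph" "compose (cA A) (idm B) ph = ph"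
  using ph(1) Mor_closed[OF ph(1)] by(auto simp: Mor_iff compose_def idm_def intro: extensionalityI)
 thus "composition (htpy_cat G) A A B f (ident (htpy_cat G) A) = f" "composition (htpy_cat G) A B B (ident (htpy_cat G) B) f = f"
  unfolding ident ph(2) comp[OF A A B idm_Mor[OF alg(2)[OF A]] ph(1)] comp[OF A B B ph(1) idm_Mor[OF alg(2)[OF B]]] by simp_all
 assume C: "C:obj (htpy_cat G)" and "g:hom_set (htpy_cat G) B C"
 then obtain ps where ps: "ps:Mor G B C" "g = homotopy G B C `` {ps}" using rep by blast
 note c = Mor_comp[OF ph(1) ps(1) alg(2)[OF A]]
 show "composition (htpy_cat G) A B C g f:hom_set (htpy_cat G) A C" unfolding ph(2) ps(2) comp[OF A B C ph(1) ps(1)] by(rule hom[OF c])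
 assume D: "D:obj (htpy_cat G)" and "h:hom_set (htpy_cat G) C D"
 then obtain om where om: "om:Mor G C D" "h = homotopy G C D `` {om}" using rep by blast
 have "compose (cA A) om (compose (cA A) ps ph) = compose (cA A) (compose (cA B) om ps) ph"
  using Mor_closed[OF ph(1)] by(auto simp: compose_def intro!: restrict_ext)
 thus "composition (htpy_cat G) A C D h (composition (htpy_cat G) A B C g f) = composition (htpy_cat G) A B D (composition (htpy_cat G) B C D h g) f"
  unfolding ph(2) ps(2) om(2) comp[OF A B C ph(1) ps(1)] comp[OF B C D ps(1) om(1)] comp[OF A C D c om(1)]
  comp[OF A B D ph(1) Mor_comp[OF ps(1) om(1) alg(2)[OF B]]] by simp
qed

section \<open>The simpltotic category\<close>

text \<open>Equality in the limit with witnesses of one fixed type \<open>'y\<close>, chosen so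
  large that it stays transitive across all index types that occur.\<close>

definition weq::"'y itself=>'g monoid=>('g, 'a) galg=>('g, 'b) galg =>'i rel=>('a=>'i pt=>'b)=>'j rel=>('a=>'j pt=>'b)=>bool" where
 "weq Y G A B m f n g <-> (EX k::'y rel. wit k G A B m f n g)"

text \<open>The element of the limit over \<open>'x\<close> represented by a germ whose index type
  may be larger, such as the one of a composition product.\<close>

definition cl::"'x itself=>'g monoid=>('g, 'a) galg=>('g, 'a) galg =>'i rel=>('a=>'i pt=>'a)=>('x, 'a) germ set" where
 "cl X G A B m f = {r:germs G A B. limit_eq G A B r (m, hcls G A B m f)}"

lemma small_trans: "[|small TYPE('i) S; small Y (UNIV::'i set)|]==>small Y S" unfolding small_def by(meson comp_inj_on inj_on_subset subset_UNIV)

lemma small_UNIV: "small TYPE('i) (S::'i set)" unfolding small_def by(rule exI[of _ "%x. x"]) simp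

lemma small_fst: "small TYPE('i) S==>small TYPE('i*'b) S" unfolding small_def by(elim exE, rule_tac x = "%x. (h x, undefined)" in exI) (simp add: inj_on_def)

lemma small_snd: "small TYPE('i) S==>small TYPE('b*'i) S" unfolding small_def by(elim exE, rule_tac x = "%x. (undefined, h x)" in exI) (simp add: inj_on_def)

lemma infin_fst: "infinite (UNIV::'i set)==>infinite (UNIV::('i*'b) set)"
 using finite_imageI[of "UNIV::('i*'b) set" fst] by(auto simp: fst_image_times simp flip: UNIV_Times_UNIV)

text \<open>The index types of a product and of the two bracketings of a triple product of directed
  sets over \<open>'x\<close>.\<close>

type_synonym 'x sh = "'x*('x set=>'x)"
type_synonym 'x shl = "'x sh*('x sh set=>'x)"
type_synonym 'x shr = "'x*('x set=>'x sh)"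

lemma weq_sym: "[|gpre G A; gpre G B; weq Y G A B m f n g|]==>weq Y G A B n g m f" unfolding weq_def using wit_sym by blast

lemma weq_sym_iff: "[|gpre G A; gpre G B|]==>weq Y G A B m f n g <-> weq Y G A B n g m f" by(rule iffI; rule weq_sym)

context
 fixes Y::"'y itself" and G::"'g monoid" and A B::"('g, 'a) galg" assumes inf: "infinite (UNIV::'y set)" and A: "gpre G A" and B: "gpre G B"
  and sa: "small Y (UNIV::'a set)" and sg: "small Y (UNIV::'g set)"
begin

lemma weqI: fixes m::"'i rel" and n::"'j rel" and k::"'k rel" assumes "small Y (UNIV::'i set)" "small Y (UNIV::'j set)" and w: "wit k G A B m f n g"
 shows "weq Y G A B m f n g" unfolding weq_def by(rule wit_small[OF inf A B small_sub[OF sa subset_UNIV] small_sub[OF sg subset_UNIV]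
  small_sub[OF assms(1) subset_UNIV] small_sub[OF assms(2) subset_UNIV] w])

lemma weq_trans: fixes m::"'i rel" and n::"'j rel" and p::"'l rel"
 assumes sm: "small Y (UNIV::'i set)" "small Y (UNIV::'l set)" and n: "dset n" and g: "sasym G A B n g" and w: "weq Y G A B m f n g" "weq Y G A B n g p h"
 shows "weq Y G A B m f p h"
proof -
 obtain k l::"'y rel" where kl: "wit k G A B m f n g" "wit l G A B n g p h" using w unfolding weq_def by blast
 show ?thesis by(rule weqI[OF sm wit_trans[OF A B n g kl]])
qed

lemma weq_shom: fixes m::"'i rel" assumes "small Y (UNIV::'i set)" and m: "dset m" and "shom G A B m f g"
 shows "weq Y G A B m f m g" by(rule weqI[OF assms(1) assms(1) wit_shom[OF A B m assms(3)]])

lemma weq_refl: fixes m::"'i rel" assumes "small Y (UNIV::'i set)" and m: "dset m" and "sasym G A B m f"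
 shows "weq Y G A B m f m f" by(rule weq_shom[OF assms(1) m ahom_refl[OF A B fspace_sx[OF m] assms(3)]])

text \<open>\<open>limit_eq\<close> takes its witnesses over \<open>'j\<close> and
  \<open>weq\<close> over \<open>'y\<close>; under the size assumptions \<open>wit_small\<close>
  converts them in both directions.\<close>

lemma limit_eq_weq: fixes m::"'i rel" and n::"'j rel" assumes sm: "small Y (UNIV::'i set)" "small Y (UNIV::'j set)"
  and j: "infinite (UNIV::'j set)" "small TYPE('j) (UNIV::'a set)" "small TYPE('j) (UNIV::'g set)" "small TYPE('j) (UNIV::'i set)"
  and m: "dset m" "sasym G A B m f" and n: "dset n" "sasym G A B n g" shows "limit_eq G A B (m, hcls G A B m f) (n, hcls G A B n g) <-> weq Y G A B m f n g"
proof -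
 have "limit_eq G A B (m, hcls G A B m f) (n, hcls G A B n g)" if w: "wit (k::'y rel) G A B m f n g" for k unfolding limit_eq_iff[OF A B m(1) n(1) m(2) n(2)]
  by(rule wit_small[OF j(1) A B small_sub[OF j(2) subset_UNIV] small_sub[OF j(3) subset_UNIV]
  small_sub[OF j(4) subset_UNIV] small_UNIV w])
 moreover have "weq Y G A B m f n g" if w: "wit (k::'j rel) G A B m f n g" for k by(rule weqI[OF sm w])
 ultimately show ?thesis unfolding weq_def using limit_eq_iff[OF A B m(1) n(1) m(2) n(2)] by blast
qed

end

lemma weq_cmp: fixes Y::"'y itself" and A B C::"('g, 'a) galg" and m::"'i rel" and n::"'j rel" and m'::"'i' rel" and n'::"'j' rel"
 assumes inf: "infinite (UNIV::'y set)" and A: "gpre G A" and B: "calg G B" and C: "calg G C" and sa: "small Y (UNIV::'a set)" and sg: "small Y (UNIV::'g set)"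
  and sm: "small Y (UNIV::('i*('i set=>'j)) set)" "small Y (UNIV::('i'*('i' set=>'j')) set)" and d: "dset m" "dset m'" "dset n" "dset n'"
  and f: "sasym G A B m f" "sasym G A B m' f'" and g: "scasym G B C n g" "scasym G B C n' g'" and w: "weq Y G A B m f m' f'" "weq Y G B C n g n' g'"
 shows "weq Y G A C (m ## n) (cmp m n g f) (m' ## n') (cmp m' n' g' f')"
proof -
 obtain k l::"'y rel" where kl: "wit k G A B m f m' f'" "wit l G B C n g n' g'" using w unfolding weq_def by blast
 show ?thesis by(rule exE[OF cmp_congr[OF A B C d f g kl]], rule weqI[OF inf A calg_gpre[OF C] sa sg sm])
qed

text \<open>The middle type is large enough for \<open>limit_eq\<close> to compare germs over
  \<open>'x\<close> with germs over it, and small enough for \<open>weq\<close> to be transitive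
  through it.\<close>

definition between::"'x itself=>'y itself=>'i itself=>bool" where "between X Y I <-> infinite (UNIV::'i set) & small I (UNIV::'x set) & small Y (UNIV::'i set)"

context
 fixes Y::"'y itself" and G::"'g monoid" and a0::"'a itself"
 assumes xa: "small TYPE('x) (UNIV::'a set)" and xg: "small TYPE('x) (UNIV::'g set)" and infy: "infinite (UNIV::'y set)"
  and bx: "between TYPE('x) Y TYPE('x)" and bs: "between TYPE('x) Y TYPE('x sh)" and yl: "small Y (UNIV::'x shl set)" and yr: "small Y (UNIV::'x shr set)"
begin

lemma yx: "small Y (UNIV::'x set)" and ys: "small Y (UNIV::'x sh set)" using bx bs by(simp_all add: between_def)
lemma ya: "small Y (UNIV::'a set)" and yg: "small Y (UNIV::'g set)" using small_trans[OF xa yx] small_trans[OF xg yx] by blast+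

lemma in_cl: fixes A B::"('g, 'a) galg" and l::"'x rel" and m::"'i rel" assumes b: "between TYPE('x) Y TYPE('i)"
  and A: "gpre G A" and B: "gpre G B" and l: "dset l" "sasym G A B l u" and m: "dset m" "sasym G A B m f"
 shows "(l, hcls G A B l u):cl TYPE('x) G A B m f <-> weq Y G A B l u m f"
proof -
 have i: "infinite (UNIV::'i set)" "small TYPE('i) (UNIV::'x set)" "small Y (UNIV::'i set)" using b by(simp_all add: between_def)
 have "(l, hcls G A B l u):germs G A B" using l by(auto simp: germs_iff[OF A B])
 with limit_eq_weq[OF infy A B ya yg yx i(3) i(1) small_trans[OF xa i(2)] small_trans[OF xg i(2)] i(2) l m]
 show ?thesis by(simp add: cl_def)
qed

lemma cl_eqI: fixes A B::"('g, 'a) galg" and m::"'i rel" and P::"('x, 'a) germ set"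
 assumes b: "between TYPE('x) Y TYPE('i)" and A: "gpre G A" and B: "gpre G B" and m: "dset m" "sasym G A B m f" and P: "P <= germs G A B"
  and eq: "!!l u. [|dset (l::'x rel); sasym G A B l u|]==>(l, hcls G A B l u):P <-> weq Y G A B l u m f" shows "P = cl TYPE('x) G A B m f"
proof -
 have "r:P <-> r:cl TYPE('x) G A B m f" for r
 proof(cases "r:germs G A B")
  case True
  then obtain l u where "dset l" "sasym G A B l u" "r = (l, hcls G A B l u)" unfolding germs_iff[OF A B] by blast
  thus ?thesis using eq in_cl[OF b A B _ _ m] by simp
 next
  case False
  thus ?thesis using P by(auto simp: cl_def)
 qed
 thus ?thesis by blast
qed

lemma cl_cong: fixes A B::"('g, 'a) galg" and m::"'i rel" and n::"'j rel"
 assumes b: "between TYPE('x) Y TYPE('i)" "between TYPE('x) Y TYPE('j)" and A: "gpre G A" and B: "gpre G B"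
  and m: "dset m" "sasym G A B m f" and n: "dset n" "sasym G A B n g" and w: "weq Y G A B m f n g" shows "cl TYPE('x) G A B m f = cl TYPE('x) G A B n g"
proof(rule cl_eqI[OF b(2) A B n])
 have i: "small Y (UNIV::'i set)" "small Y (UNIV::'j set)" using b by(simp_all add: between_def)
 fix l::"'x rel" and u assume l: "dset l" "sasym G A B l u"
 show "(l, hcls G A B l u):cl TYPE('x) G A B m f <-> weq Y G A B l u n g" unfolding in_cl[OF b(1) A B l m]
  using weq_trans[OF infy A B ya yg yx i(2) m _ w] weq_trans[OF infy A B ya yg yx i(1) n _ weq_sym[OF A B w]] by blast
qed (auto simp: cl_def)

text \<open>The germ is shrunk to the type \<open>'x\<close> by \<open>germ_small\<close>, after
  which its lift is replaced by a continuous one for the same homotopy class.\<close>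

lemma rep: fixes A B::"('g, 'a) galg" and m::"'i rel" assumes i: "small Y (UNIV::'i set)" and A: "calg G A" and B: "calg G B" and m: "dset m" "sasym G A B m f"
 obtains l::"'x rel" and u where "dset l" "scasym G A B l u" "weq Y G A B l u m f"
proof -
 note Ag = calg_gpre[OF A] and Bg = calg_gpre[OF B]
 have infx: "infinite (UNIV::'x set)" using bx by(simp add: between_def)
 obtain l::"'x rel" and u and k::"('i*'x) rel" where l: "dset l" "sasym G A B l u" "wit k G A B m f l u"
  using germ_small[OF infx Ag Bg small_sub[OF xa subset_UNIV] small_sub[OF xg subset_UNIV] m] by blast
 obtain u' where u': "scasym G A B l u'" "hcls G A B l u = hcls G A B l u'"
  using hcls_casym[OF Ag A B m(1) l(1), of "hcls G A B l u"] l(2) simpl_mor_iff[OF Ag Bg l(1)] by metis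
 from u'(2) have "shom G A B l u u'" unfolding hcls_eq_iff[OF Ag Bg l(1,2) casym_asym[OF u'(1)]] .
 from wit_shom_right[OF Ag Bg l(1,3) this] have "weq Y G A B m f l u'" by(rule weqI[OF infy Ag Bg ya yg i yx])
 thus thesis by(rule that[OF l(1) u'(1) weq_sym[OF Ag Bg]])
qed

lemma class_cl: fixes A B::"('g, 'a) galg" and m::"'x rel" assumes A: "gpre G A" and B: "gpre G B" and m: "dset m" "sasym G A B m f"
 shows "{(p, q). p:germs G A B & q:germs G A B & limit_eq G A B p q} `` {(m, hcls G A B m f)} = cl TYPE('x) G A B m f"
proof(rule cl_eqI[OF bx A B m])
 have g: "(l, hcls G A B l u):germs G A B" if "dset l" "sasym G A B l u" for l::"'x rel" and u using that by(auto simp: germs_iff[OF A B])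
 fix l::"'x rel" and u assume l: "dset l" "sasym G A B l u"
 show "(l, hcls G A B l u):{(p, q). p:germs G A B & q:germs G A B & limit_eq G A B p q} `` {(m, hcls G A B m f)}
  <-> weq Y G A B l u m f" using g[OF m] g[OF l] in_cl[OF bx A B m l] weq_sym_iff[OF A B, of Y l u m f] by(auto simp: cl_def)
qed auto

lemma cl_simpl_mor: fixes A B::"('g, 'a) galg" and m::"'i rel"
 assumes b: "between TYPE('x) Y TYPE('i)" and A: "calg G A" and B: "calg G B" and m: "dset m" "sasym G A B m f"
 shows "cl TYPE('x) G A B m f:simpltotic_mor G A B"
proof -
 note Ag = calg_gpre[OF A] and Bg = calg_gpre[OF B]
 have "small Y (UNIV::'i set)" using b by(simp add: between_def)
 from rep[OF this A B m] obtain l::"'x rel" and u where l: "dset l" "scasym G A B l u" "weq Y G A B l u m f" .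
 note lu = l(1) casym_asym[OF l(2)]
 have "(l, hcls G A B l u):germs G A B" using lu by(auto simp: germs_iff[OF Ag Bg])
 thus ?thesis unfolding cl_cong[OF bx b Ag Bg lu m l(3), symmetric] class_cl[OF Ag Bg lu, symmetric] simpltotic_mor_def by(rule quotientI)
qed

lemma simpl_morE: fixes A B::"('g, 'a) galg" and P::"('x, 'a) germ set" assumes A: "calg G A" and B: "calg G B" and P: "P:simpltotic_mor G A B"
 obtains m::"'x rel" and f where "dset m" "scasym G A B m f" "P = cl TYPE('x) G A B m f"
proof -
 note Ag = calg_gpre[OF A] and Bg = calg_gpre[OF B] and b = bx
 obtain p::"('x, 'a) germ" where p: "p:germs G A B" and P: "P = {(p, q). p:germs G A B & q:germs G A B & limit_eq G A B p q} `` {p}"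
  by(rule quotientE[OF P[unfolded simpltotic_mor_def]]) blast
 from p obtain m f where m: "dset m" "sasym G A B m f" and p': "p = (m, hcls G A B m f)" unfolding germs_iff[OF Ag Bg] by blast
 obtain l::"'x rel" and u where l: "dset l" "scasym G A B l u" "weq Y G A B l u m f" by(rule rep[OF yx A B m])
 show thesis using that[OF l(1,2)] cl_cong[OF b b Ag Bg l(1) casym_asym[OF l(2)] m l(3)] P unfolding p' class_cl[OF Ag Bg m] by simp
qed

text \<open>\<open>simpltotic_comp\<close> admits every pair of representatives over
  \<open>'x\<close>. By \<open>weq_cmp\<close> all their products agree in the limit, so one product
  determines the class.\<close>

lemma comp_cl: fixes A B C::"('g, 'a) galg" and m n::"'x rel" assumes A: "calg G A" and B: "calg G B" and C: "calg G C"
  and m: "dset m" and f: "sasym G A B m f" and n: "dset n" and g: "scasym G B C n g"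
 shows "scmp G A B C (cl TYPE('x) G B C n g) (cl TYPE('x) G A B m f) = cl TYPE('x) G A C (m ## n) (cmp m n g f)"
proof(rule cl_eqI[OF bs calg_gpre[OF A] calg_gpre[OF C] dset_sharp[OF m n] cmp_asym[OF calg_gpre[OF A] B C m n f g]])
 note Ag = calg_gpre[OF A] and Bg = calg_gpre[OF B] and Cg = calg_gpre[OF C] and b = bx
 note mn = dset_sharp[OF m n] cmp_asym[OF Ag B C m n f g] and g' = casym_asym[OF g]
 fix l::"'x rel" and u assume l: "dset l" "sasym G A C l u"
 have r: "(l, hcls G A C l u):germs G A C" using l by(auto simp: germs_iff[OF Ag Cg])
 have lim: "limit_eq G A C (l, hcls G A C l u) (m' ## n', hcls G A C (m' ## n') v) <-> weq Y G A C l u (m' ## n') v"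
  if "dset (m' ## n')" "sasym G A C (m' ## n') v" for m' n'::"'x rel" and v using in_cl[OF bs Ag Cg l that] r by(simp add: cl_def)
 show "(l, hcls G A C l u):scmp G A B C (cl TYPE('x) G B C n g) (cl TYPE('x) G A B m f) <-> weq Y G A C l u (m ## n) (cmp m n g f)"
 proof
  assume w: "weq Y G A C l u (m ## n) (cmp m n g f)"
  have "(n, hcls G B C n g):cl TYPE('x) G B C n g" unfolding in_cl[OF b Bg Cg n g' n g'] by(rule weq_refl[OF infy Bg Cg ya yg yx n g'])
  moreover have "(m, hcls G A B m f):cl TYPE('x) G A B m f" unfolding in_cl[OF b Ag Bg m f m f] by(rule weq_refl[OF infy Ag Bg ya yg yx m f])
  moreover have "limit_eq G A C (l, hcls G A C l u) (m ## n, simpl_comp G A B C m n (hcls G B C n g) (hcls G A B m f))"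
  unfolding simpl_comp_hcls[OF Ag B C m n f g] lim[OF mn] by(rule w)
  ultimately show "(l, hcls G A C l u):scmp G A B C (cl TYPE('x) G B C n g) (cl TYPE('x) G A B m f)" unfolding simpltotic_comp_def using r by blast
 next
  assume "(l, hcls G A C l u):scmp G A B C (cl TYPE('x) G B C n g) (cl TYPE('x) G A B m f)"
  then obtain n' d m' c where d: "(n', d):cl TYPE('x) G B C n g" and c: "(m', c):cl TYPE('x) G A B m f"
  and lm: "limit_eq G A C (l, hcls G A C l u) (m' ## n', simpl_comp G A B C m' n' d c)" unfolding simpltotic_comp_def by blast
  have "dset n'" "d:simpl_mor G B C n'" "dset m'" "c:simpl_mor G A B m'" using c d by(auto simp: cl_def germs_def)
  note n' = this(1) and m' = this(3)
  obtain g1 where g1: "scasym G B C n' g1" "d = hcls G B C n' g1" by(rule hcls_casym[OF Ag B C m' n' \<open>d:_\<close>])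
  obtain f1 where f1: "sasym G A B m' f1" "c = hcls G A B m' f1" using \<open>c:_\<close> simpl_mor_iff[OF Ag Bg m'] by blast
  have w: "weq Y G A B m' f1 m f" "weq Y G B C n' g1 n g"
  using c d in_cl[OF b Ag Bg m' f1(1) m f] in_cl[OF b Bg Cg n' casym_asym[OF g1(1)] n g'] f1(2) g1(2) by simp_all
  note mn' = dset_sharp[OF m' n'] cmp_asym[OF Ag B C m' n' f1(1) g1(1)]
  have "weq Y G A C l u (m' ## n') (cmp m' n' g1 f1)" using lm unfolding f1(2) g1(2) simpl_comp_hcls[OF Ag B C m' n' f1(1) g1(1)] lim[OF mn'] .
  thus "weq Y G A C l u (m ## n) (cmp m n g f)"
  by(rule weq_trans[OF infy Ag Cg ya yg yx ys mn' _ weq_cmp[OF infy Ag B C ya yg ys ys m' m n' n f1(1) f g1(1) g w]])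
 qed
qed (auto simp: simpltotic_comp_def)

text \<open>Lifts that are constant in the simplex variable stay so under pullback; hence neither
  the element of the one-point directed set nor the representative of the homotopy class
  matters.\<close>

lemma of_cl: fixes A B::"('g, 'a) galg" and i::'x assumes A: "calg G A" and B: "calg G B" and ph: "ph:Mor G A B"
 shows "simpltotic_of G A B (homotopy G A B `` {ph}) = cl TYPE('x) G A B {(i, i)} (cst {(i, i)} ph)"
proof(rule cl_eqI[OF bx calg_gpre[OF A] calg_gpre[OF B] dset_single cst_asym[OF calg_gpre[OF A] calg_gpre[OF B] dset_single ph]])
 note Ag = calg_gpre[OF A] and Bg = calg_gpre[OF B] and eh = equiv_htpy[OF calg_gpre[OF A] calg_gpre[OF B]]
 fix l::"'x rel" and u assume l: "dset l" "sasym G A B l u"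
 have r: "(l, hcls G A B l u):germs G A B" using l by(auto simp: germs_iff[OF Ag Bg])
 have lim: "limit_eq G A B (l, hcls G A B l u) ({(j, j)}, simpl_mor_class G A B {(j, j)} (compose (cA A) (const_simpl {(j, j)} B) ps))
  <-> weq Y G A B l u {(j, j)} (cst {(j, j)} ps)" if ps: "ps:Mor G A B" for ps and j::'x
  using in_cl[OF bx Ag Bg l dset_single[of j] cst_asym[OF Ag Bg dset_single[of j] ps]] r by(simp add: cl_def comp_const_simpl[OF ps] hcls_def)
 have "weq Y G A B {(j, j)} (cst {(j, j)} ps) {(i, i)} (cst {(i, i)} ph)" if h: "(ps, ph):homotopy G A B" for ps and j::'x
  by(rule weqI[OF infy Ag Bg ya yg yx yx cst_wit[OF Ag Bg dset_single cst_shom[OF Ag Bg dset_single h]]])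
 note tr = weq_trans[OF infy Ag Bg ya yg yx yx dset_single cst_asym[OF Ag Bg dset_single] _ this]
 have sym: "(ps, ph):homotopy G A B & ps:Mor G A B" if "ps:homotopy G A B `` {ph}" for ps
  using that htpy_iff[OF Bg] equivE[OF eh] by(metis Image_singleton_iff symE)
 show "(l, hcls G A B l u):simpltotic_of G A B (homotopy G A B `` {ph}) <-> weq Y G A B l u {(i, i)} (cst {(i, i)} ph)"
 proof
  assume "(l, hcls G A B l u):simpltotic_of G A B (homotopy G A B `` {ph})"
  then obtain ps and j::'x where ps: "ps:homotopy G A B `` {ph}" and
  *: "limit_eq G A B (l, hcls G A B l u) ({(j, j)}, simpl_mor_class G A B {(j, j)} (compose (cA A) (const_simpl {(j, j)} B) ps))"
  unfolding simpltotic_of_def by blast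
  from sym[OF ps] * show "weq Y G A B l u {(i, i)} (cst {(i, i)} ph)" using tr lim by blast
 next
  assume "weq Y G A B l u {(i, i)} (cst {(i, i)} ph)"
  thus "(l, hcls G A B l u):simpltotic_of G A B (homotopy G A B `` {ph})" unfolding simpltotic_of_def using r lim[OF ph] equiv_class_self[OF eh ph] by blast
 qed
qed (auto simp: simpltotic_of_def)

lemma comp_of: fixes A B C::"('g, 'a) galg" and i::'x assumes A: "calg G A" and B: "calg G B" and C: "calg G C" and ph: "ph:Mor G A B" and ps: "ps:Mor G B C"
 shows "scmp G A B C (cl TYPE('x) G B C {(i, i)} (cst {(i, i)} ps)) (cl TYPE('x) G A B {(i, i)} (cst {(i, i)} ph))
  = cl TYPE('x) G A C {(i, i)} (cst {(i, i)} (compose (cA A) ps ph))"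
proof -
 note Ag = calg_gpre[OF A] and Bg = calg_gpre[OF B] and Cg = calg_gpre[OF C] and d = dset_single[of i]
 note dd = dset_sharp[OF d d] and c = Mor_comp[OF ph ps Ag]
 note f = cst_asym[OF Ag Bg d ph] and g = cst_casym[OF B Cg d ps]
 note fg = cmp_asym[OF Ag B C d d f g] and cc = cst_asym[OF Ag Cg d c] and cs = cst_asym[OF Ag Cg dd c]
 have "shom G A C ({(i, i)} ## {(i, i)}) (cmp {(i, i)} {(i, i)} (cst {(i, i)} ps) (cst {(i, i)} ph)) (cst ({(i, i)} ## {(i, i)}) (compose (cA A) ps ph))"
  by(rule ahom_aeq[OF Ag Cg fspace_sx[OF dd] fg cs]) (simp add: cmp_cst[OF d d ph] aeq_ev[OF Cg])
 from weq_shom[OF infy Ag Cg ya yg ys dd this]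
 have "weq Y G A C ({(i, i)} ## {(i, i)}) (cmp {(i, i)} {(i, i)} (cst {(i, i)} ps) (cst {(i, i)} ph)) {(i, i)} (cst {(i, i)} (compose (cA A) ps ph))"
  by(rule weq_trans[OF infy Ag Cg ya yg ys yx dd cs _
  weqI[OF infy Ag Cg ya yg ys yx cst_wit[OF Ag Cg dd ahom_refl[OF Ag Cg fspace_sx[OF dd] cs]]]])
 thus ?thesis unfolding comp_cl[OF A B C d f d g] by(rule cl_cong[OF bs bx Ag Cg dd fg d cc])
qed

text \<open>The inner products live over a larger type and cannot be fed into \<open>comp_cl\<close>
  again. They are replaced by germs \<open>l\<close> and \<open>r\<close> over \<open>'x\<close>,
  and three comparisons over \<open>'y\<close> connect the two outer products through the triple
  products of \<open>cmp_assoc\<close>.\<close>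

lemma comp_assoc_cl: fixes A B C D::"('g, 'a) galg" and m n p::"'x rel" assumes A: "calg G A" and B: "calg G B" and C: "calg G C" and D: "calg G D"
  and m: "dset m" and n: "dset n" and p: "dset p" and f: "scasym G A B m f" and g: "scasym G B C n g" and h: "scasym G C D p h"
 shows "scmp G A C D (cl TYPE('x) G C D p h) (scmp G A B C (cl TYPE('x) G B C n g) (cl TYPE('x) G A B m f))
  = scmp G A B D (scmp G B C D (cl TYPE('x) G C D p h) (cl TYPE('x) G B C n g)) (cl TYPE('x) G A B m f)"
proof -
 note Ag = calg_gpre[OF A] and Bg = calg_gpre[OF B] and Cg = calg_gpre[OF C] and Dg = calg_gpre[OF D]
 note f' = casym_asym[OF f] and g' = casym_asym[OF g] and h' = casym_asym[OF h]
 note mn = dset_sharp[OF m n] and np = dset_sharp[OF n p]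
 note fg = cmp_asym[OF Ag B C m n f' g] and gh = cmp_asym[OF Bg C D n p g' h]
 obtain l::"'x rel" and u where l: "dset l" "scasym G A C l u" and wl: "weq Y G A C l u (m ## n) (cmp m n g f)" by(rule rep[OF ys A C mn fg])
 obtain r::"'x rel" and v where r: "dset r" "scasym G B D r v" and wr: "weq Y G B D r v (n ## p) (cmp n p h g)" by(rule rep[OF ys B D np gh])
 obtain ka and kk::"('x shl*'x shr*'x shr) rel" where ka: "scasym G B D (n ## p) ka" "shom G B D (n ## p) (cmp n p h g) ka"
  and kk: "wit kk G A D ((m ## n) ## p) (cmp (m ## n) p h (cmp m n g f)) (m ## n ## p) (cmp m (n ## p) ka f)" by(rule cmp_assoc[OF m n p Ag B C D f' g h])
 note u' = casym_asym[OF l(2)] and v' = casym_asym[OF r(2)]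
 note lp = dset_sharp[OF l(1) p] cmp_asym[OF Ag C D l(1) p u' h] and mr = dset_sharp[OF m r(1)] cmp_asym[OF Ag B D m r(1) f' r(2)]
 note L = dset_sharp[OF mn p] cmp_asym[OF Ag C D mn p fg h] and R = dset_sharp[OF m np] cmp_asym[OF Ag B D m np f' ka(1)]
 have w1: "weq Y G A D (l ## p) (cmp l p h u) ((m ## n) ## p) (cmp (m ## n) p h (cmp m n g f))"
  by(rule weq_cmp[OF infy Ag C D ya yg ys yl l(1) mn p p u' fg h h wl weq_refl[OF infy Cg Dg ya yg yx p h']])
 have w2: "weq Y G A D ((m ## n) ## p) (cmp (m ## n) p h (cmp m n g f)) (m ## n ## p) (cmp m (n ## p) ka f)" by(rule weqI[OF infy Ag Dg ya yg yl yr kk])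
 have "weq Y G B D r v (n ## p) ka" by(rule weq_trans[OF infy Bg Dg ya yg yx ys np gh wr weq_shom[OF infy Bg Dg ya yg ys np ka(2)]])
 hence w3: "weq Y G A D (m ## r) (cmp m r v f) (m ## n ## p) (cmp m (n ## p) ka f)"
  by(rule weq_cmp[OF infy Ag B D ya yg ys yr m m r(1) np f' f' r(2) ka(1) weq_refl[OF infy Ag Bg ya yg yx m f']])
 have w: "weq Y G A D (l ## p) (cmp l p h u) (m ## r) (cmp m r v f)"
  by(rule weq_trans[OF infy Ag Dg ya yg ys ys L w1 weq_trans[OF infy Ag Dg ya yg yl ys R w2 weq_sym[OF Ag Dg w3]]])
 show ?thesis unfolding comp_cl[OF A B C m f' n g] comp_cl[OF B C D n g' p h] cl_cong[OF bx bs Ag Cg l(1) u' mn fg wl, symmetric]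
  cl_cong[OF bx bs Bg Dg r(1) v' np gh wr, symmetric] comp_cl[OF A C D l(1) u' p h] comp_cl[OF A B D m f' r(1,2)] by(rule cl_cong[OF bs bs Ag Dg lp mr w])
qed

lemma ident_cl: fixes A B::"('g, 'a) galg" and m::"'x rel" and i::'x assumes A: "calg G A" and B: "calg G B" and m: "dset m" and f: "scasym G A B m f"
 shows "scmp G A A B (cl TYPE('x) G A B m f) (cl TYPE('x) G A A {(i, i)} (cst {(i, i)} (idm A))) = cl TYPE('x) G A B m f"
  and "scmp G A B B (cl TYPE('x) G B B {(i, i)} (cst {(i, i)} (idm B))) (cl TYPE('x) G A B m f) = cl TYPE('x) G A B m f"
proof -
 note Ag = calg_gpre[OF A] and Bg = calg_gpre[OF B] and d = dset_single[of i] and f' = casym_asym[OF f]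
 note iA = cst_asym[OF Ag Ag d idm_Mor[OF Ag]] and iB = cst_casym[OF B Bg d idm_Mor[OF Bg]]
 show "scmp G A A B (cl TYPE('x) G A B m f) (cl TYPE('x) G A A {(i, i)} (cst {(i, i)} (idm A))) = cl TYPE('x) G A B m f" unfolding comp_cl[OF A A B d iA m f]
  by(rule exE[OF unit_right[OF A B m f]], rule cl_cong[OF bs bx Ag Bg dset_sharp[OF d m] cmp_asym[OF Ag A B d m iA f] m f'
  weqI[OF infy Ag Bg ya yg ys yx]])
 show "scmp G A B B (cl TYPE('x) G B B {(i, i)} (cst {(i, i)} (idm B))) (cl TYPE('x) G A B m f) = cl TYPE('x) G A B m f" unfolding comp_cl[OF A B B m f' d iB]
  by(rule exE[OF unit_left[OF Ag B m f']], rule cl_cong[OF bs bx Ag Bg dset_sharp[OF m d] cmp_asym[OF Ag B B m d f' iB] m f'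
  weqI[OF infy Ag Bg ya yg ys yx]])
qed

lemma simpl_simps: "obj (simpltotic_category G) = {A. graded_G_cstar_algebra G A}" "hom_set (simpltotic_category G) = simpltotic_mor G"
 "composition (simpltotic_category G) = scmp G"
 "ident (simpltotic_category G) A = simpltotic_of G A A (homotopy G A A `` {idm A})" by(simp_all add: simpltotic_category_def idm_def)

lemma category_simpl: "category (simpltotic_category G::(('g, 'a) galg, ('x, 'a) germ set) cat)"
proof(unfold_locales, unfold simpl_simps)
 fix A B C D::"('g, 'a) galg" and P Q R::"('x, 'a) germ set" and i::'x
 assume "A:{A. graded_G_cstar_algebra G A}"
 hence A: "calg G A" using graded_calg by blast
 note Ag = calg_gpre[OF A]
 note iA = of_cl[OF A A idm_Mor[OF Ag], of i]
 show "simpltotic_of G A A (homotopy G A A `` {idm A}):(simpltotic_mor G A A::('x, 'a) germ set set)"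
  unfolding iA by(rule cl_simpl_mor[OF bx A A dset_single cst_asym[OF Ag Ag dset_single idm_Mor[OF Ag]]])
 assume "B:{A. graded_G_cstar_algebra G A}"
 hence B: "calg G B" using graded_calg by blast
 note iB = of_cl[OF B B idm_Mor[OF calg_gpre[OF B]], of i]
 assume "P:simpltotic_mor G A B"
 then obtain m::"'x rel" and f where f: "dset m" "scasym G A B m f" "P = cl TYPE('x) G A B m f" by(rule simpl_morE[OF A B])
 show "scmp G A A B P (simpltotic_of G A A (homotopy G A A `` {idm A})) = P"
  "scmp G A B B (simpltotic_of G B B (homotopy G B B `` {idm B})) P = P" unfolding iA iB f(3) by(rule ident_cl[OF A B f(1,2)])+
 assume "C:{A. graded_G_cstar_algebra G A}"
 hence C: "calg G C" using graded_calg by blast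
 assume "Q:simpltotic_mor G B C"
 then obtain n::"'x rel" and g where g: "dset n" "scasym G B C n g" "Q = cl TYPE('x) G B C n g" by(rule simpl_morE[OF B C])
 show "scmp G A B C Q P:simpltotic_mor G A C" unfolding f(3) g(3) comp_cl[OF A B C f(1) casym_asym[OF f(2)] g(1,2)]
  by(rule cl_simpl_mor[OF bs A C dset_sharp[OF f(1) g(1)] cmp_asym[OF Ag B C f(1) g(1) casym_asym[OF f(2)] g(2)]])
 assume "D:{A. graded_G_cstar_algebra G A}"
 hence D: "calg G D" using graded_calg by blast
 assume "R:simpltotic_mor G C D"
 then obtain p::"'x rel" and h where h: "dset p" "scasym G C D p h" "R = cl TYPE('x) G C D p h" by(rule simpl_morE[OF C D])
 show "scmp G A C D R (scmp G A B C Q P) = scmp G A B D (scmp G B C D R Q) P"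
  unfolding f(3) g(3) h(3) by(rule comp_assoc_cl[OF A B C D f(1) g(1) h(1) f(2) g(2) h(2)])
qed

lemma functor_simpl: "cat_functor (htpy_cat G) (simpltotic_category G::(('g, 'a) galg, ('x, 'a) germ set) cat) (%A. A) (simpltotic_of G)"
proof(intro cat_functor.intro category_htpy category_simpl cat_functor_axioms.intro)
 fix A B C::"('g, 'a) galg" and c d and i::'x
 assume A': "A:obj (htpy_cat G)"
 thus "A:obj (simpltotic_category G::(('g, 'a) galg, ('x, 'a) germ set) cat)" by(simp add: homotopy_category_def simpltotic_category_def)
 show "simpltotic_of G A A (ident (htpy_cat G) A) = ident (simpltotic_category G::(('g, 'a) galg, ('x, 'a) germ set) cat) A"
  by(simp add: homotopy_category_def simpltotic_category_def)
 from A' have A: "calg G A" using graded_calg by(auto simp: homotopy_category_def)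
 note Ag = calg_gpre[OF A]
 have rep: "EX ph:Mor G D E. c = homotopy G D E `` {ph}" if "c:hom_set (htpy_cat G) D E" for D E::"('g, 'a) galg" and c
  using that by(auto simp: homotopy_category_def quotient_def)
 assume "B:obj (htpy_cat G)"
 hence B: "calg G B" using graded_calg by(auto simp: homotopy_category_def)
 assume "c:hom_set (htpy_cat G) A B"
 then obtain ph where ph: "ph:Mor G A B" "c = homotopy G A B `` {ph}" using rep by blast
 show "simpltotic_of G A B c:hom_set (simpltotic_category G::(('g, 'a) galg, ('x, 'a) germ set) cat) A B" unfolding simpl_simps ph(2) of_cl[OF A B ph(1), of i]
  by(rule cl_simpl_mor[OF bx A B dset_single cst_asym[OF Ag calg_gpre[OF B] dset_single ph(1)]])
 assume "C:obj (htpy_cat G)"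
 hence C: "calg G C" using graded_calg by(auto simp: homotopy_category_def)
 assume "d:hom_set (htpy_cat G) B C"
 then obtain ps where ps: "ps:Mor G B C" "d = homotopy G B C `` {ps}" using rep by blast
 show "simpltotic_of G A C (composition (htpy_cat G) A B C d c)
  = composition (simpltotic_category G::(('g, 'a) galg, ('x, 'a) germ set) cat) A B C (simpltotic_of G B C d) (simpltotic_of G A B c)"
  unfolding ph(2) ps(2) homotopy_composition[OF Ag B C ph(1) ps(1)] simpl_simps of_cl[OF A B ph(1), of i]
  of_cl[OF B C ps(1), of i] comp_of[OF A B C ph(1) ps(1)] by(rule of_cl[OF A C Mor_comp[OF ph(1) ps(1) Ag]])
qed

end

theorem theorem5p10: fixes G :: "'g monoid" assumes "group G"
 shows "category (simpltotic_category G :: (('g, 'a) galg, (('g, 'a, 'j) index, 'a) germ set) cat) &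
  cat_functor (homotopy_category G) (simpltotic_category G :: (('g, 'a) galg, (('g, 'a, 'j) index, 'a) germ set) cat) (%A. A) (simpltotic_of G)"
proof -
 \<comment> \<open>The type \<open>?Y\<close> is chosen so that the index types of both bracketings
   of a triple product embed into it as factors.\<close>
 let ?X = "TYPE(('g, 'a, 'j) index)" and ?Y = "TYPE(('g, 'a, 'j) index shl*('g, 'a, 'j) index shr)"
 have inf: "infinite (UNIV::('g, 'a, 'j) index set)" by(rule infinite_super[OF subset_UNIV, of "range (%n. Inl (undefined, undefined, n))"])
  (auto intro!: range_inj_infinite injI)
 have "small ?X (UNIV::'a set)" unfolding small_def by(rule exI[of _ "%a. Inl (a, undefined, 0)"]) (simp add: inj_on_def)
 moreover have "small ?X (UNIV::'g set)" unfolding small_def by(rule exI[of _ "%g. Inl (undefined, g, 0)"]) (simp add: inj_on_def)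
 moreover have "infinite (UNIV::(('g, 'a, 'j) index shl*('g, 'a, 'j) index shr) set)" by(intro infin_fst inf)
 moreover have "between ?X ?Y ?X" unfolding between_def by(intro conjI inf small_fst small_UNIV)
 moreover have "between ?X ?Y TYPE(('g, 'a, 'j) index sh)" unfolding between_def by(intro conjI inf infin_fst small_fst small_UNIV)
 moreover have "small ?Y (UNIV::('g, 'a, 'j) index shl set)" by(intro small_fst small_UNIV)
 moreover have "small ?Y (UNIV::('g, 'a, 'j) index shr set)" by(intro small_snd small_UNIV)
 ultimately show ?thesis using category_simpl functor_simpl by blast
qed

end
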